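(* Let $F$ be a non-archimedean local field of characteristic zero, $\mathrm{H}=\mathrm{GL}_n\times\mathrm{GL}_n$ acting on $\mathfrak{X}=\mathfrak{gl}_n\times\mathfrak{gl}_n$ by $(h_1,h_2)\cdot(X,Y)=(h_1Xh_2^{-1},h_2Yh_1^{-1})$. Suppose $\phi\in C_c^\infty(\mathfrak{X}(F))$ satisfies $\phi(0)\neq0$. Then there exists an $\mathrm{H}$-regular elliptic $(X,Y)\in\mathfrak{X}(F)$ such that $\mathrm{Orb}^{\mathrm{H}}(\phi,(X,Y))\neq0$.
   Context: $(X,Y)\in\mathfrak{X}(F)$ is $\mathrm{H}$-regular semisimple if the fibre through it of the categorical quotient $\mathfrak{X}\to\mathfrak{X}/\!\!/\mathrm{H}$ consists of a single $\mathrm{H}(\overline F)$-orbit, and $\mathrm{H}$-regular elliptic if moreover its stabilizer $\mathrm{H}_{(X,Y)}$ is anisotropic modulo the diagonally embedded scalars $\{(z,z)\}$. $\mathrm{Orb}^{\mathrm{H}}(\phi,(X,Y))=\int_{\mathrm{H}_{(X,Y)}(F)\backslash\mathrm{H}(F)}\phi(h^{-1}\cdot(X,Y))\,dh$. *)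

theory Defs
  imports
    "HOL-Analysis.Analysis"
    "HOL-Algebra.Group_Action"
    "HOL-Algebra.Algebraic_Closure_Type"
begin

text \<open>
  The topology of the field is the metric topology of a nontrivial non-archimedean absolute
  value \<open>absval\<close>, which is not assumed to be normalized. Local compactness is equivalent to
  completeness together with discreteness of the value group and finiteness of the residue field.
\<close>

class nonarch_local_field_0 = field_char_0 + metric_space +
  fixes absval :: "'a \<Rightarrow> real"
  assumes dist_absval: "dist x y = absval (x - y)"
    and absval_mult: "absval (x * y) = absval x * absval y"
    and absval_add: "absval (x + y) \<le> max (absval x) (absval y)"
    and absval_nontrivial: "\<exists>x. x \<noteq> 0 \<and> absval x \<noteq> 1"
    and locally_compact: "\<exists>U K. open U \<and> x \<in> U \<and> U \<subseteq> K \<and> compact K"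

type_synonym ('k, 'n) mat2 = "('k^'n^'n) \<times> ('k^'n^'n)"

definition GLxGL :: "('k::field, 'n::finite) mat2 monoid" where
  "GLxGL = \<lparr>carrier = {h. invertible (fst h) \<and> invertible (snd h)},
          mult = (\<lambda>g h. (fst g ** fst h, snd g ** snd h)),
          one = (mat 1, mat 1)\<rparr>"

definition act :: "('k::field, 'n::finite) mat2 \<Rightarrow> ('k, 'n) mat2 \<Rightarrow> ('k, 'n) mat2" where
  "act h x = (fst h ** fst x ** matrix_inv (snd h), snd h ** snd x ** matrix_inv (fst h))"

lemma matrix_inv_props:
  fixes A :: "'k::field^'n^'n"
  assumes "invertible A"
  shows "A ** matrix_inv A = mat 1" "matrix_inv A ** A = mat 1" "invertible (matrix_inv A)"
proof -
  have *: "A ** matrix_inv A = mat 1 \<and> matrix_inv A ** A = mat 1"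
    using assms unfolding invertible_def matrix_inv_def by (rule someI_ex)
  then show "A ** matrix_inv A = mat 1" "matrix_inv A ** A = mat 1" by auto
  from * show "invertible (matrix_inv A)" unfolding invertible_def by blast
qed

lemma group_GLxGL: "group (GLxGL :: ('k::field, 'n::finite) mat2 monoid)"
proof (rule groupI)
  fix x :: "('k, 'n) mat2"
  assume "x \<in> carrier GLxGL"
  then show "\<exists>y\<in>carrier GLxGL. y \<otimes>\<^bsub>GLxGL\<^esub> x = \<one>\<^bsub>GLxGL\<^esub>"
    by (intro bexI[of _ "(matrix_inv (fst x), matrix_inv (snd x))"])
       (auto simp: GLxGL_def matrix_inv_props)
qed (auto simp: GLxGL_def invertible_mult matrix_mul_assoc invertible_def[of "mat 1"])

lemma matrix_inv_mult:
  fixes A B :: "'k::field^'n^'n"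
  assumes "invertible A" "invertible B"
  shows "matrix_inv (A ** B) = matrix_inv B ** matrix_inv A"
proof -
  have "invertible (A ** B)" using assms by (rule invertible_mult)
  then have 1: "matrix_inv (A ** B) ** (A ** B) = mat 1" by (rule matrix_inv_props)
  have "(A ** B) ** (matrix_inv B ** matrix_inv A) = A ** (B ** matrix_inv B) ** matrix_inv A"
    by (simp only: matrix_mul_assoc)
  also have "\<dots> = mat 1" using assms by (simp add: matrix_inv_props)
  finally have "matrix_inv (A ** B) ** ((A ** B) ** (matrix_inv B ** matrix_inv A))
      = matrix_inv (A ** B)" by simp
  moreover have "matrix_inv (A ** B) ** ((A ** B) ** C) = C" for C :: "'k^'n^'n"
    by (metis 1 matrix_mul_assoc matrix_mul_lid)
  ultimately show ?thesis by metis
qed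

lemma matrix_inv_mat_1: "matrix_inv (mat 1 :: 'k::field^'n^'n) = mat 1"
  using matrix_inv_props(1)[of "mat 1 :: 'k^'n^'n"] by (simp add: invertible_def)

lemma act_one: "act \<one>\<^bsub>GLxGL\<^esub> x = x"
  by (simp add: act_def GLxGL_def matrix_inv_mat_1)

lemma act_mult:
  assumes "g \<in> carrier GLxGL" "h \<in> carrier GLxGL"
  shows "act (g \<otimes>\<^bsub>GLxGL\<^esub> h) x = act g (act h x)"
  using assms by (simp add: act_def GLxGL_def matrix_inv_mult matrix_mul_assoc)

text \<open>
  The algebra over \<open>'a\<close> generated by a set of functions with values in the algebraic closure.
\<close>

inductive_set rat_algebra ::
  "('x \<Rightarrow> 'a::field alg_closure) set \<Rightarrow> ('x \<Rightarrow> 'a alg_closure) set"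
  for S :: "('x \<Rightarrow> 'a::field alg_closure) set"
where
  const: "(\<lambda>_. to_ac c) \<in> rat_algebra S"
| gen: "f \<in> S \<Longrightarrow> f \<in> rat_algebra S"
| add: "f \<in> rat_algebra S \<Longrightarrow> g \<in> rat_algebra S \<Longrightarrow> (\<lambda>x. f x + g x) \<in> rat_algebra S"
| mult: "f \<in> rat_algebra S \<Longrightarrow> g \<in> rat_algebra S \<Longrightarrow> (\<lambda>x. f x * g x) \<in> rat_algebra S"

definition coord_funs :: "(('k, 'n::finite) mat2 \<Rightarrow> 'k) set" where
  "coord_funs = {f. \<exists>i j. f = (\<lambda>x. fst x $ i $ j) \<or> f = (\<lambda>x. snd x $ i $ j)}"

text \<open>
  \<open>regular_funs_X\<close> and \<open>regular_funs_H\<close> are the coordinate rings over \<open>'a\<close> of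
  \<open>gl_n \<times> gl_n\<close> and of \<open>GL_n \<times> GL_n\<close>, as functions on points over the algebraic closure;
  the values of the latter outside the group are irrelevant.
\<close>

definition regular_funs_X :: "(('a::field alg_closure, 'n::finite) mat2 \<Rightarrow> 'a alg_closure) set" where
  "regular_funs_X = rat_algebra coord_funs"

definition regular_funs_H :: "(('a::field alg_closure, 'n::finite) mat2 \<Rightarrow> 'a alg_closure) set" where
  "regular_funs_H =
     rat_algebra (coord_funs \<union> {\<lambda>h. inverse (det (fst h)), \<lambda>h. inverse (det (snd h))})"

definition invariant_funs :: "(('a::field alg_closure, 'n::finite) mat2 \<Rightarrow> 'a alg_closure) set" where
  "invariant_funs = {f \<in> regular_funs_X. \<forall>h\<in>carrier GLxGL. \<forall>x. f (act h x) = f x}"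

definition base_change :: "('a::field, 'n::finite) mat2 \<Rightarrow> ('a alg_closure, 'n) mat2" where
  "base_change x = (map_matrix to_ac (fst x), map_matrix to_ac (snd x))"

text \<open>
  The categorical quotient is the spectrum of the ring of invariants, so two geometric points
  have the same image in it iff all invariants agree on them.
\<close>

definition quotient_fibre :: "('a::field, 'n::finite) mat2 \<Rightarrow> ('a alg_closure, 'n) mat2 set" where
  "quotient_fibre x = {y. \<forall>f\<in>invariant_funs. f y = f (base_change x)}"

definition H_regular_semisimple :: "('a::field, 'n::finite) mat2 \<Rightarrow> bool" where
  "H_regular_semisimple x \<longleftrightarrow> (\<exists>y. quotient_fibre x = Group_Action.orbit GLxGL act y)"

definition geom_stabilizer :: "('a::field, 'n::finite) mat2 \<Rightarrow> ('a alg_closure, 'n) mat2 set" where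
  "geom_stabilizer x = stabilizer GLxGL act (base_change x)"

text \<open>
  The stabilizer of an \<open>H\<close>-regular semisimple element is a torus, and a torus is anisotropic if it
  has no nontrivial rational character. The rational characters of the quotient by the scalars
  are the rational characters of the stabilizer which are trivial on the scalars. In
  characteristic 0 the stabilizer is reduced, so its regular functions over \<open>'a\<close> are the
  restrictions of those of \<open>GL_n \<times> GL_n\<close> to its geometric points.
\<close>

definition rational_character ::
  "('a::field, 'n::finite) mat2 \<Rightarrow> (('a alg_closure, 'n) mat2 \<Rightarrow> 'a alg_closure) \<Rightarrow> bool" where
  "rational_character x \<psi> \<longleftrightarrow>
     \<psi> \<in> regular_funs_H \<and>
     (\<forall>h\<in>geom_stabilizer x. \<psi> h \<noteq> 0) \<and>
     (\<forall>g\<in>geom_stabilizer x. \<forall>h\<in>geom_stabilizer x. \<psi> (g \<otimes>\<^bsub>GLxGL\<^esub> h) = \<psi> g * \<psi> h)"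

definition stabilizer_anisotropic_mod_scalars :: "('a::field, 'n::finite) mat2 \<Rightarrow> bool" where
  "stabilizer_anisotropic_mod_scalars x \<longleftrightarrow>
     (\<forall>\<psi>. rational_character x \<psi> \<and> (\<forall>z. z \<noteq> 0 \<longrightarrow> \<psi> (mat z, mat z) = 1)
        \<longrightarrow> (\<forall>h\<in>geom_stabilizer x. \<psi> h = 1))"

definition H_regular_elliptic :: "('a::field, 'n::finite) mat2 \<Rightarrow> bool" where
  "H_regular_elliptic x \<longleftrightarrow> H_regular_semisimple x \<and> stabilizer_anisotropic_mod_scalars x"

text \<open>
  The space of cosets \<open>T h\<close> with the quotient topology: for a set \<open>U\<close> of cosets, \<open>\<Union>U\<close> is its
  preimage in the group.
\<close>

definition coset_topology ::
  "('a::{field,topological_space}, 'n::finite) mat2 set \<Rightarrow> ('a, 'n) mat2 set topology" where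
  "coset_topology T = topology (\<lambda>U. U \<subseteq> rcosets\<^bsub>GLxGL\<^esub> T \<and>
     openin (top_of_set (carrier GLxGL)) (\<Union>U))"

lemma openin_coset_topology:
  assumes "subgroup T (GLxGL :: ('a::{field,topological_space}, 'n::finite) mat2 monoid)"
  shows "openin (coset_topology T) U \<longleftrightarrow>
    U \<subseteq> rcosets\<^bsub>GLxGL\<^esub> T \<and> openin (top_of_set (carrier GLxGL)) (\<Union>U)"
proof -
  interpret group "GLxGL :: ('a, 'n) mat2 monoid" by (rule group_GLxGL)
  have Int: "\<Union>(U \<inter> V) = \<Union>U \<inter> \<Union>V" if "U \<subseteq> rcosets\<^bsub>GLxGL\<^esub> T" "V \<subseteq> rcosets\<^bsub>GLxGL\<^esub> T" for U V
  proof -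
    have "C = D" if "C \<in> U" "D \<in> V" "y \<in> C" "y \<in> D" for C D y
      using that \<open>U \<subseteq> _\<close> \<open>V \<subseteq> _\<close> rcos_disjoint[OF assms]
      unfolding pairwise_def disjnt_def by (meson disjoint_iff subsetD)
    then show ?thesis by blast
  qed
  have UN: "\<Union>(\<Union>\<K>) = (\<Union>U\<in>\<K>. \<Union>U)" for \<K> :: "('a, 'n) mat2 set set set" by blast
  have "istopology (\<lambda>U. U \<subseteq> rcosets\<^bsub>GLxGL\<^esub> T \<and> openin (top_of_set (carrier GLxGL)) (\<Union>U))"
    unfolding istopology_def
  proof (intro conjI allI impI)
    fix U V
    assume U: "U \<subseteq> rcosets\<^bsub>GLxGL\<^esub> T \<and> openin (top_of_set (carrier GLxGL)) (\<Union>U)"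
      and V: "V \<subseteq> rcosets\<^bsub>GLxGL\<^esub> T \<and> openin (top_of_set (carrier GLxGL)) (\<Union>V)"
    then show "U \<inter> V \<subseteq> rcosets\<^bsub>GLxGL\<^esub> T" by blast
    have "openin (top_of_set (carrier GLxGL)) (\<Union>U \<inter> \<Union>V)" using U V by (intro openin_Int) auto
    then show "openin (top_of_set (carrier GLxGL)) (\<Union>(U \<inter> V))" using Int U V by metis
  next
    fix \<K> :: "('a, 'n) mat2 set set set"
    assume K: "\<forall>U\<in>\<K>. U \<subseteq> rcosets\<^bsub>GLxGL\<^esub> T \<and> openin (top_of_set (carrier GLxGL)) (\<Union>U)"
    then show "\<Union>\<K> \<subseteq> rcosets\<^bsub>GLxGL\<^esub> T" by blast
    have "openin (top_of_set (carrier GLxGL)) (\<Union>U\<in>\<K>. \<Union>U)" using K by (intro openin_Union) blast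
    then show "openin (top_of_set (carrier GLxGL)) (\<Union>(\<Union>\<K>))" by (simp only: UN)
  qed
  then show ?thesis unfolding coset_topology_def by (simp add: topology_inverse')
qed

text \<open>
  A nonzero right-invariant Radon measure on the space of cosets \<open>T h\<close>. Over a local field this
  space is locally compact and second countable, so a Borel measure that is finite on compact
  sets is Radon.
\<close>

definition invariant_coset_measure ::
  "('a::{field,topological_space}, 'n::finite) mat2 set \<Rightarrow> ('a, 'n) mat2 set measure \<Rightarrow> bool" where
  "invariant_coset_measure T \<mu> \<longleftrightarrow>
     space \<mu> = rcosets\<^bsub>GLxGL\<^esub> T \<and>
     sets \<mu> = sigma_sets (rcosets\<^bsub>GLxGL\<^esub> T) {U. openin (coset_topology T) U} \<and>
     (\<forall>K. compactin (coset_topology T) K \<longrightarrow> emeasure \<mu> K < \<infinity>) \<and>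
     (\<forall>g\<in>carrier GLxGL. \<forall>A\<in>sets \<mu>. emeasure \<mu> ((\<lambda>C. C #>\<^bsub>GLxGL\<^esub> g) ` A) = emeasure \<mu> A) \<and>
     emeasure \<mu> (space \<mu>) \<noteq> 0"

text \<open>
  \<open>orb_stab_fun GLxGL act C x\<close> is the common value of \<open>h\<^sup>-\<^sup>1 \<cdot> x\<close> for \<open>h\<close> in the coset \<open>C\<close> of the
  stabilizer of \<open>x\<close>.
\<close>

definition Orb ::
  "('a::field, 'n::finite) mat2 set measure \<Rightarrow> (('a, 'n) mat2 \<Rightarrow> complex) \<Rightarrow> ('a, 'n) mat2 \<Rightarrow> complex" where
  "Orb \<mu> \<phi> x = (LINT C|\<mu>. \<phi> (orb_stab_fun GLxGL act C x))"

lemma orb_stab_fun_GLxGL: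
  fixes x h :: "('a::field, 'n::finite) mat2"
  assumes "h \<in> carrier GLxGL"
  shows "orb_stab_fun GLxGL act (stabilizer GLxGL act x #>\<^bsub>GLxGL\<^esub> h) x = act (inv\<^bsub>GLxGL\<^esub> h) x"
proof -
  interpret group "GLxGL :: ('a, 'n) mat2 monoid" by (rule group_GLxGL)
  let ?C = "stabilizer GLxGL act x #>\<^bsub>GLxGL\<^esub> h"
  have "h \<in> ?C"
    using assms by (auto simp: r_coset_def stabilizer_def act_one intro!: bexI[of _ "\<one>\<^bsub>GLxGL\<^esub>"])
  then have "(SOME k. k \<in> ?C) \<in> ?C" by (rule someI)
  then obtain t where t: "t \<in> carrier GLxGL" "act t x = x" "(SOME k. k \<in> ?C) = t \<otimes>\<^bsub>GLxGL\<^esub> h"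
    by (auto simp: r_coset_def stabilizer_def)
  have "act (inv\<^bsub>GLxGL\<^esub> t) x = act (inv\<^bsub>GLxGL\<^esub> t) (act t x)" by (simp add: t)
  also have "\<dots> = act (inv\<^bsub>GLxGL\<^esub> t \<otimes>\<^bsub>GLxGL\<^esub> t) x"
    by (rule act_mult[symmetric]) (use t(1) in simp_all)
  also have "\<dots> = x" using t(1) by (simp add: act_one)
  finally show ?thesis
    using assms t by (simp add: orb_stab_fun_def inv_mult_group act_mult)
qed

text \<open>
  Over a non-archimedean field, smooth means locally constant.
\<close>

definition Cc_infinity :: "('x::topological_space \<Rightarrow> complex) set" where
  "Cc_infinity = {\<phi>. (\<forall>x. \<exists>U. open U \<and> x \<in> U \<and> (\<forall>y\<in>U. \<phi> y = \<phi> x)) \<and>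
     compact (closure {x. \<phi> x \<noteq> 0})}"

end

theory Submission
  imports Defs "HOL-Computational_Algebra.Polynomial_Factorial" "HOL-Algebra.Sylow"
begin

text \<open>
  Let \<open>\<Pi>\<close> be the companion matrix of \<open>X\<^sup>n - \<pi>\<close>, where \<open>\<pi>\<close> is a uniformizer, and consider the elliptic elements
  \<open>x\<^sub>k = (\<pi>\<^sup>k \<Pi>, 1)\<close>. They all have the same stabilizer \<open>T\<close>, the centralizer of \<open>\<Pi>\<close> embedded diagonally. With
  \<open>K = GL_n(O) \<times> GL_n(O)\<close>, and after averaging \<open>\<phi>\<close> over \<open>K\<close>, the orbital integral of \<open>x\<^sub>k\<close> is, up to a common factor,
  the finite sum over \<open>T h K\<close> of \<open>wt(h) \<phi>(h\<^sup>-\<^sup>1 x\<^sub>k)\<close>, where the weight \<open>wt(h)\<close> is the index of \<open>T \<inter> K \<inter> h K h\<^sup>-\<^sup>1\<close> in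
  \<open>T \<inter> K\<close>, a power of the residue characteristic \<open>p\<close>. A \<open>\<rat>\<close>-linear functional on the values reduces the
  claim to integer-valued \<open>\<phi>\<close>, so that the sums may be compared modulo a high power of \<open>p\<close>.

  Modulo \<open>p\<^sup>v\<^sup>+\<^sup>1\<close> only the double cosets with \<open>wt(h) \<le> p\<^sup>v\<close> matter. On these, \<open>h\<^sup>-\<^sup>1 x\<^sub>k\<close> has a small first component when
  \<open>n k + d\<close> is large and a small second component when \<open>- d\<close> is large, where \<open>d = val det h\<^sub>2 - val det h\<^sub>1\<close>.
  Multiplying \<open>h\<^sub>2\<close> by \<open>\<Pi>\<^sup>n\<close> preserves weights and, where the second component is negligible, carries the terms of
  \<open>x\<^bsub>k+1\<^esub>\<close> to those of \<open>x\<^sub>k\<close>. For large \<open>k\<close> the difference of the two sums therefore consists of \<open>n\<close> levels of \<open>d\<close>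
  on which \<open>h\<^sup>-\<^sup>1 x\<^bsub>k+1\<^esub>\<close> is negligible: it is \<open>n \<phi>(0) W\<close>, where \<open>W\<close> is the total weight of one level.
  Only the trivial double coset has weight 1 on level 0, so \<open>W \<equiv> 1\<close> modulo \<open>p\<close>. If all orbital integrals vanished,
  \<open>n \<phi>(0)\<close> would be divisible by every power of \<open>p\<close>.
\<close>

no_notation fps_nth (infixl \<open>$\<close> 75)
hide_const (open) Module.smult UnivPoly.monom UnivPoly.coeff Divisibility.prime Divisibility.irreducible Polynomials.degree

section \<open>Absolute values and valuations\<close>

lemma absval_nonneg [simp]: "0 \<le> absval x" for x :: "'a::nonarch_local_field_0"
  using dist_absval[of x 0] zero_le_dist[of x 0] by simp

lemma absval_eq_0_iff [simp]: "absval x = 0 \<longleftrightarrow> x = 0" for x :: "'a::nonarch_local_field_0"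
  using dist_absval[of x 0] by (metis diff_zero dist_eq_0_iff)

lemma absval_0 [simp]: "absval (0 :: 'a::nonarch_local_field_0) = 0"
  by simp

lemma absval_pos_iff [simp]: "0 < absval x \<longleftrightarrow> x \<noteq> 0" for x :: "'a::nonarch_local_field_0"
  using absval_nonneg[of x] absval_eq_0_iff[of x] by linarith

lemma absval_le_0_iff [simp]: "absval x \<le> 0 \<longleftrightarrow> x = 0" for x :: "'a::nonarch_local_field_0"
  using absval_pos_iff[of x] by (simp add: linorder_not_less [symmetric] del: absval_pos_iff)

lemma absval_1 [simp]: "absval (1 :: 'a::nonarch_local_field_0) = 1"
  using absval_mult[of 1 "1::'a"] absval_eq_0_iff[of "1::'a"] by simp

lemma absval_minus [simp]: "absval (- x) = absval x" for x :: "'a::nonarch_local_field_0"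
  using dist_absval[of x 0] dist_absval[of 0 x] by (simp add: dist_commute)

lemma absval_diff: "absval (x - y) \<le> max (absval x) (absval y)" for x y :: "'a::nonarch_local_field_0"
  using absval_add[of x "- y"] by simp

lemma absval_eq_if_diff_less:
  fixes x y :: "'a::nonarch_local_field_0"
  assumes "absval (x - y) < absval x"
  shows "absval y = absval x"
  using assms absval_add[of "x - y" y] absval_diff[of x "x - y"] by auto

lemma absval_power: "absval (x ^ n) = absval x ^ n" for x :: "'a::nonarch_local_field_0"
  by (induction n) (simp_all add: absval_mult)

lemma absval_inverse: "absval (inverse x) = inverse (absval x)" for x :: "'a::nonarch_local_field_0"
proof (cases "x = 0")
  case False
  then have "absval x * absval (inverse x) = 1" by (simp add: absval_mult [symmetric])
  then show ?thesis by (metis inverse_unique)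
qed simp

lemma absval_divide: "absval (x / y) = absval x / absval y" for x y :: "'a::nonarch_local_field_0"
  by (simp add: divide_inverse absval_mult absval_inverse)

lemma absval_power_int: "absval (x powi k) = absval x powi k" for x :: "'a::nonarch_local_field_0"
  by (simp add: power_int_def absval_power absval_inverse)

lemma absval_sum_le:
  fixes f :: "'i \<Rightarrow> 'a::nonarch_local_field_0"
  assumes "0 \<le> r" "\<And>i. i \<in> S \<Longrightarrow> absval (f i) \<le> r"
  shows "absval (sum f S) \<le> r"
  using assms
proof (induction S rule: infinite_finite_induct)
  case (insert x F)
  then have "absval (f x) \<le> r" "absval (sum f F) \<le> r" by auto
  then show ?case using insert.hyps absval_add[of "f x" "sum f F"] by auto
qed simp_all

lemma absval_prod: "absval (\<Prod>i\<in>S. f i) = (\<Prod>i\<in>S. absval (f i))" for f :: "'i \<Rightarrow> 'a::nonarch_local_field_0"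
  by (induction S rule: infinite_finite_induct) (simp_all add: absval_mult)

lemma absval_of_nat_le_1: "absval (of_nat k :: 'a::nonarch_local_field_0) \<le> 1"
  by (induction k) (simp_all add: order_trans[OF absval_add])

instance nonarch_local_field_0 \<subseteq> topological_monoid_add
proof
  fix a b :: 'a
  have "((\<lambda>x. max (dist (fst x) a) (dist (snd x) b)) \<longlongrightarrow> max (dist a a) (dist b b)) (nhds a \<times>\<^sub>F nhds b)"
    by (intro tendsto_max tendsto_dist tendsto_const filterlim_fst filterlim_snd)
  then have "((\<lambda>x. max (dist (fst x) a) (dist (snd x) b)) \<longlongrightarrow> 0) (nhds a \<times>\<^sub>F nhds b)" by simp
  then have "((\<lambda>x. dist (fst x + snd x) (a + b)) \<longlongrightarrow> 0) (nhds a \<times>\<^sub>F nhds b)"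
  proof (rule tendsto_0_le[where K = 1], intro always_eventually allI)
    fix x :: "'a \<times> 'a"
    have "dist (fst x + snd x) (a + b) \<le> max (dist (fst x) a) (dist (snd x) b)"
      using absval_add[of "fst x - a" "snd x - b"] by (simp add: dist_absval add_diff_add)
    then show "norm (dist (fst x + snd x) (a + b)) \<le> norm (max (dist (fst x) a) (dist (snd x) b)) * 1" by simp
  qed
  then show "((\<lambda>x. fst x + snd x) \<longlongrightarrow> a + b) (nhds a \<times>\<^sub>F nhds b)" by (rule tendsto_dist_iff [THEN iffD2])
qed

instance nonarch_local_field_0 \<subseteq> topological_comm_monoid_add ..

instance nonarch_local_field_0 \<subseteq> topological_semigroup_mult
proof
  fix a b :: 'a
  let ?g = "\<lambda>x. max (dist (fst x) a * max (dist (snd x) b) (absval b)) (absval a * dist (snd x) b)"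
  have "(?g \<longlongrightarrow> max (dist a a * max (dist b b) (absval b)) (absval a * dist b b)) (nhds a \<times>\<^sub>F nhds b)"
    by (intro tendsto_max tendsto_mult tendsto_dist tendsto_const filterlim_fst filterlim_snd)
  then have "(?g \<longlongrightarrow> 0) (nhds a \<times>\<^sub>F nhds b)" by simp
  then have "((\<lambda>x. dist (fst x * snd x) (a * b)) \<longlongrightarrow> 0) (nhds a \<times>\<^sub>F nhds b)"
  proof (rule tendsto_0_le[where K = 1], intro always_eventually allI)
    fix x :: "'a \<times> 'a"
    have "fst x * snd x - a * b = (fst x - a) * snd x + a * (snd x - b)" by (simp add: algebra_simps)
    then have "dist (fst x * snd x) (a * b) \<le>
        max (dist (fst x) a * absval (snd x)) (absval a * dist (snd x) b)"
      using absval_add[of "(fst x - a) * snd x" "a * (snd x - b)"] by (simp add: dist_absval absval_mult)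
    moreover have "absval (snd x) \<le> max (dist (snd x) b) (absval b)"
      using absval_add[of "snd x - b" b] by (simp add: dist_absval)
    then have "dist (fst x) a * absval (snd x) \<le> dist (fst x) a * max (dist (snd x) b) (absval b)"
      by (intro mult_left_mono) simp_all
    ultimately show "norm (dist (fst x * snd x) (a * b)) \<le> norm (?g x) * 1" by simp
  qed
  then show "((\<lambda>x. fst x * snd x) \<longlongrightarrow> a * b) (nhds a \<times>\<^sub>F nhds b)" by (rule tendsto_dist_iff [THEN iffD2])
qed

lemma exists_absval_less:
  assumes "0 < e"
  shows "\<exists>y :: 'a::nonarch_local_field_0. y \<noteq> 0 \<and> absval y < e"
proof -
  obtain x :: 'a where x: "x \<noteq> 0" "absval x \<noteq> 1" using absval_nontrivial by blast
  define y where "y = (if absval x < 1 then x else inverse x)"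
  have y: "y \<noteq> 0" "absval y < 1" using x by (auto simp: y_def absval_inverse inverse_less_1_iff)
  obtain n where "absval y ^ n < e" using real_arch_pow_inv[OF assms y(2)] by blast
  then show ?thesis using y by (intro exI[of _ "y ^ n"]) (simp add: absval_power)
qed

lemma compact_absval_le: "compact {x :: 'a::nonarch_local_field_0. absval x \<le> R}"
proof -
  obtain U K where UK: "open U" "(0::'a) \<in> U" "U \<subseteq> K" "compact K" using locally_compact[of "0 :: 'a"] by blast
  then obtain e where e: "0 < e" "ball 0 e \<subseteq> U" by (meson openE)
  let ?R = "max R 1"
  obtain y :: 'a where y: "y \<noteq> 0" "absval y < e / ?R"
    using exists_absval_less[of "e / ?R"] e by auto
  have "x \<in> (\<lambda>z. z * inverse y) ` K" if "absval x \<le> R" for x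
  proof -
    have "absval (x * y) \<le> ?R * absval y" using that by (simp add: absval_mult mult_right_mono)
    also have "\<dots> < e" using y by (simp add: field_simps)
    finally have "x * y \<in> K" using e UK by (auto simp: dist_absval)
    moreover have "x = x * y * inverse y" using y by simp
    ultimately show ?thesis by blast
  qed
  then have "{x. absval x \<le> R} \<subseteq> (\<lambda>z. z * inverse y) ` K" by blast
  moreover have "compact ((\<lambda>z. z * inverse y) ` K)"
    using UK(4) by (intro compact_continuous_image continuous_on_mult' continuous_on_id continuous_on_const)
  moreover have "{x :: 'a. absval x \<le> R} = cball 0 R" by (auto simp: dist_absval)
  then have "closed {x :: 'a. absval x \<le> R}" by simp
  ultimately show ?thesis using compact_Int_closed by (metis inf.absorb_iff2)
qed

instance nonarch_local_field_0 \<subseteq> heine_borel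
proof
  fix f :: "nat \<Rightarrow> 'a" assume "bounded (range f)"
  then obtain R where "\<forall>x\<in>range f. dist 0 x \<le> R" by (auto simp: bounded_any_center[of _ 0])
  then have range: "\<forall>n. f n \<in> {x. absval x \<le> R}" by (simp add: dist_absval)
  have "seq_compact {x :: 'a. absval x \<le> R}"
    using compact_absval_le compact_eq_seq_compact_metric by blast
  then show "\<exists>l r. strict_mono (r::nat\<Rightarrow>nat) \<and> ((f \<circ> r) \<longlonglongrightarrow> l)"
    using range by (rule seq_compactE) blast
qed

definition uniformizer :: "'a::nonarch_local_field_0" (\<open>\<pi>\<close>) where
  "\<pi> = (SOME w. w \<noteq> 0 \<and> absval w < 1 \<and> (\<forall>x :: 'a. absval x < 1 \<longrightarrow> absval x \<le> absval w))"

lemma uniformizer: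
  shows uniformizer_nonzero [simp]: "(\<pi> :: 'a::nonarch_local_field_0) \<noteq> 0"
    and absval_uniformizer_less_1 [simp]: "absval (\<pi> :: 'a) < 1"
    and absval_le_uniformizer: "absval (x :: 'a) < 1 \<Longrightarrow> absval x \<le> absval (\<pi> :: 'a)"
proof -
  let ?M = "{x :: 'a. absval x \<le> 1} - {x. 1 \<le> absval x}"
  have "open {x :: 'a. 1 \<le> absval x}"
    unfolding open_dist
  proof (intro ballI exI[of _ 1] conjI allI impI)
    fix x y :: 'a assume "x \<in> {x. 1 \<le> absval x}" "dist y x < 1"
    then have "absval (x - y) < absval x" "1 \<le> absval x" by (auto simp: dist_commute dist_absval)
    then show "y \<in> {x. 1 \<le> absval x}" using absval_eq_if_diff_less[of x y] by simp
  qed simp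
  then have compact: "compact ?M" by (intro compact_diff compact_absval_le)
  obtain y :: 'a where y: "y \<noteq> 0" "absval y < 1" using exists_absval_less[of 1] by auto
  then have "y \<in> ?M" by simp
  then have "?M \<noteq> {}" by blast
  moreover have "continuous_on ?M (dist 0)" by (intro continuous_intros)
  ultimately obtain w where w: "w \<in> ?M" "\<And>x. x \<in> ?M \<Longrightarrow> dist 0 x \<le> dist 0 w"
    using continuous_attains_sup[OF compact] by blast
  then have "w \<noteq> 0" using y w(2)[OF \<open>y \<in> ?M\<close>] by auto
  moreover have "absval w < 1" using w(1) by simp
  moreover have "absval x \<le> absval w" if "absval x < 1" for x :: 'a
    using w(2)[of x] that by (simp add: dist_absval)
  ultimately have "w \<noteq> 0 \<and> absval w < 1 \<and> (\<forall>x :: 'a. absval x < 1 \<longrightarrow> absval x \<le> absval w)" by blast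
  from someI[of "\<lambda>w. w \<noteq> 0 \<and> absval w < 1 \<and> (\<forall>x :: 'a. absval x < 1 \<longrightarrow> absval x \<le> absval w)", OF this]
  show "(\<pi> :: 'a) \<noteq> 0" "absval (\<pi> :: 'a) < 1" "absval (x :: 'a) < 1 \<Longrightarrow> absval x \<le> absval (\<pi> :: 'a)"
    unfolding uniformizer_def by blast+
qed

text \<open>The value at \<open>0\<close> is junk.\<close>

definition val :: "'a::nonarch_local_field_0 \<Rightarrow> int" where
  "val x = \<lfloor>log (absval (\<pi> :: 'a)) (absval x)\<rfloor>"

lemma absval_eq_powi_val:
  fixes x :: "'a::nonarch_local_field_0"
  assumes "x \<noteq> 0"
  shows "absval x = absval (\<pi> :: 'a) powi val x"
proof -
  let ?r = "absval (\<pi> :: 'a)" and ?l = "log (absval (\<pi> :: 'a)) (absval x)"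
  have r: "0 < ?r" "?r < 1" by simp_all
  have x: "absval x = ?r powr ?l"
    using assms r powr_log_cancel[of ?r "absval x"] by (metis absval_pos_iff less_irrefl)
  have powi: "?r powi k = ?r powr real_of_int k" for k
    using r by (simp add: powr_real_of_int')
  have "real_of_int (val x) \<le> ?l" "?l < real_of_int (val x + 1)" unfolding val_def by linarith+
  then have "?r powr real_of_int (val x + 1) < ?r powr ?l" "?r powr ?l \<le> ?r powr real_of_int (val x)"
    using r by (simp_all add: powr_less_mono' powr_mono' less_imp_le)
  then have bounds: "?r * ?r powi val x < absval x" "absval x \<le> ?r powi val x"
    unfolding x [symmetric] powi [symmetric] by (simp_all add: power_int_add mult.commute)
  define y where "y = x / \<pi> powi val x"
  have "0 < ?r powi val x" using r by simp
  then have "?r < absval y" "absval y \<le> 1"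
    using bounds by (simp_all add: y_def absval_divide absval_power_int pos_less_divide_eq)
  then have "absval y = 1" using absval_le_uniformizer[of y] by linarith
  then show ?thesis by (simp add: y_def absval_divide absval_power_int)
qed

lemma absval_uniformizer_powi_less_iff:
  "absval (\<pi> :: 'a::nonarch_local_field_0) powi k < absval (\<pi> :: 'a) powi l \<longleftrightarrow> l < k"
proof (cases k l rule: linorder_cases)
  case less
  then show ?thesis using power_int_strict_decreasing[of k l "absval (\<pi> :: 'a)"] by simp
next
  case greater
  then show ?thesis using power_int_strict_decreasing[of l k "absval (\<pi> :: 'a)"] by simp
qed simp

lemma absval_uniformizer_powi_le_iff:
  "absval (\<pi> :: 'a::nonarch_local_field_0) powi k \<le> absval (\<pi> :: 'a) powi l \<longleftrightarrow> l \<le> k"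
  unfolding linorder_not_less [symmetric] absval_uniformizer_powi_less_iff ..

lemma val_eqI:
  fixes x :: "'a::nonarch_local_field_0"
  assumes "x \<noteq> 0" "absval x = absval (\<pi> :: 'a) powi k"
  shows "val x = k"
proof -
  have "absval (\<pi> :: 'a) powi val x = absval (\<pi> :: 'a) powi k"
    unfolding absval_eq_powi_val[OF assms(1), symmetric] by (rule assms(2))
  then show ?thesis
    using absval_uniformizer_powi_less_iff[of "val x" k, where 'a = 'a]
      absval_uniformizer_powi_less_iff[of k "val x", where 'a = 'a] by simp
qed

lemma val_mult: "x \<noteq> 0 \<Longrightarrow> y \<noteq> 0 \<Longrightarrow> val (x * y) = val x + val y" for x y :: "'a::nonarch_local_field_0"
  using absval_eq_powi_val[of x] absval_eq_powi_val[of y]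
  by (intro val_eqI) (simp_all add: absval_mult power_int_add)

lemma val_eq_0: "absval x = 1 \<Longrightarrow> val x = 0" for x :: "'a::nonarch_local_field_0"
  by (rule val_eqI) auto

lemma exists_residue_prime: "\<exists>p. prime p \<and> absval (of_nat p :: 'a::nonarch_local_field_0) < 1"
proof (rule ccontr)
  assume none: "\<not> ?thesis"
  have unit: "absval (of_nat k :: 'a) = 1" if "k \<noteq> 0" for k
    using that
  proof (induction k rule: prime_divisors_induct)
    case (factor p k)
    then have "prime p" by blast
    have "\<not> absval (of_nat p :: 'a) < 1" using none \<open>prime p\<close> by blast
    then have "absval (of_nat p :: 'a) = 1" using absval_of_nat_le_1[of p, where 'a = 'a] by linarith
    then show ?case using factor by (simp add: absval_mult)
  qed auto
  have "seq_compact {x :: 'a. absval x \<le> 1}"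
    using compact_absval_le compact_eq_seq_compact_metric by blast
  then obtain S where S: "finite S" "{x :: 'a. absval x \<le> 1} \<subseteq> (\<Union>y\<in>S. ball y 1)"
    using seq_compact_imp_totally_bounded[of "{x :: 'a. absval x \<le> 1}"] zero_less_one by blast
  then have "\<forall>k. \<exists>y. y \<in> S \<and> (of_nat k :: 'a) \<in> ball y 1" using absval_of_nat_le_1 by blast
  then obtain f where f: "\<And>k. f k \<in> S \<and> (of_nat k :: 'a) \<in> ball (f k) 1" by metis
  have "\<not> inj f" using S(1) f by (metis finite_imageD finite_subset image_subsetI infinite_UNIV_nat)
  then obtain k l where kl: "k < l" "f k = f l" by (metis injI linorder_neqE_nat)
  have "absval (of_nat (l - k) :: 'a) = absval ((f k - of_nat k) - (f l - of_nat l))"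
    using kl by (simp add: of_nat_diff)
  also have "\<dots> < 1"
    using f[of k] f[of l] absval_diff[of "f k - of_nat k" "f l - of_nat l"]
    by (auto simp: dist_absval le_max_iff_disj)
  finally show False using unit[of "l - k"] kl by simp
qed

section \<open>Integral invertible matrices\<close>

lemma matrix_diff_ldistrib: "A ** (B - C) = A ** B - A ** C" for A :: "'k::ring_1^'n^'m"
  by (simp add: matrix_matrix_mult_def vec_eq_iff right_diff_distrib sum_subtractf)

lemma matrix_diff_rdistrib: "(A - B) ** C = A ** C - B ** C" for A :: "'k::ring_1^'n^'m"
  by (simp add: matrix_matrix_mult_def vec_eq_iff left_diff_distrib sum_subtractf)

lemma matrix_add_rdistrib: "(A + B) ** C = A ** C + B ** C" for A :: "'k::semiring_1^'n^'m"
  by (simp add: matrix_matrix_mult_def vec_eq_iff distrib_right sum.distrib)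

lemma mat_mult_nth [simp]: "(mat c ** A) $ i $ j = c * A $ i $ j" for A :: "'k::semiring_1^'n^'m"
  by (simp add: matrix_matrix_mult_def mat_def if_distrib [of "\<lambda>x. x * _"] cong: if_cong)

lemma mult_mat_nth [simp]: "(A ** mat c) $ i $ j = A $ i $ j * c" for A :: "'k::semiring_1^'n^'m"
  by (simp add: matrix_matrix_mult_def mat_def if_distrib [of "\<lambda>x. _ * x"] cong: if_cong)

lemma mat_mult_commute: "mat c ** A = A ** mat c" for A :: "'k::comm_semiring_1^'n^'n"
  by (simp add: vec_eq_iff mult.commute)

lemma mat_mult_mat: "mat a ** mat b = (mat (a * b) :: 'k::semiring_1^'n^'n)"
  unfolding vec_eq_iff mat_mult_nth by (simp add: mat_def)

lemma mat_add: "mat (a + b) = (mat a + mat b :: 'k::semiring_1^'n^'n)"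
  by (simp add: mat_def vec_eq_iff)

lemma mat_mult_vec: "mat c *v v = c *s v" for v :: "'k::semiring_1^'n"
  by (simp add: vec_eq_iff matrix_vector_mult_def mat_def if_distrib [of "\<lambda>x. x * _"] cong: if_cong)

lemma det_mat: "det (mat c :: 'k::comm_ring_1^'n^'n) = c ^ CARD('n)"
  by (subst det_diagonal) (auto simp: mat_def)

lemma invertible_mat: "c \<noteq> 0 \<Longrightarrow> invertible (mat c :: 'k::field^'n^'n)"
  unfolding invertible_def by (rule exI[of _ "mat (inverse c)"]) (simp add: mat_mult_mat)

lemma matrix_inv_unique_right:
  fixes A B :: "'k::field^'n^'n"
  assumes "A ** B = mat 1"
  shows "invertible A" "invertible B" "matrix_inv A = B" "matrix_inv B = A"
proof -
  have BA: "B ** A = mat 1" using assms by (rule matrix_left_right_inverse1)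
  show invertible: "invertible A" "invertible B" using assms BA unfolding invertible_def by blast+
  show "matrix_inv A = B"
    by (metis BA invertible(1) matrix_inv_props(1) matrix_mul_assoc matrix_mul_lid matrix_mul_rid)
  show "matrix_inv B = A"
    by (metis assms invertible(2) matrix_inv_props(1) matrix_mul_assoc matrix_mul_lid matrix_mul_rid)
qed

lemma matrix_inv_matrix_inv: "invertible A \<Longrightarrow> matrix_inv (matrix_inv A) = A" for A :: "'k::field^'n^'n"
  by (metis matrix_inv_props(1) matrix_inv_unique_right(4))

lemma invertible_transpose: "invertible A \<Longrightarrow> invertible (transpose A)" for A :: "'k::field^'n^'n"
  by (metis invertible_def matrix_transpose_mul transpose_mat)

lemma matrix_inv_transpose:
  fixes A :: "'k::field^'n^'n"
  assumes "invertible A"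
  shows "matrix_inv (transpose A) = transpose (matrix_inv A)"
  by (rule matrix_inv_unique_right)
    (simp add: matrix_transpose_mul [symmetric] matrix_inv_props assms)

lemma det_matrix_inv:
  fixes A :: "'k::field^'n^'n"
  assumes "invertible A"
  shows "det A * det (matrix_inv A) = 1"
  using assms by (simp add: det_mul [symmetric] matrix_inv_props)

lemma matrix_inv_cancel:
  fixes A :: "'k::field^'n^'n" and B :: "'k^'m^'n"
  assumes "invertible A"
  shows "matrix_inv A ** (A ** B) = B" "A ** (matrix_inv A ** B) = B"
  using assms by (simp_all add: matrix_mul_assoc matrix_inv_props)

lemma invertible_iff_mult_vec_eq_0:
  fixes A :: "'k::field^'n^'n"
  shows "invertible A \<longleftrightarrow> (\<forall>v. A *v v = 0 \<longrightarrow> v = 0)"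
proof -
  have "inj ((*v) A) \<longleftrightarrow> (\<forall>v. A *v v = 0 \<longrightarrow> v = 0)"
    by (metis (no_types, opaque_lifting) eq_iff_diff_eq_0 inj_def matrix_vector_mult_0_right
        matrix_vector_mult_diff_distrib)
  then show ?thesis by (simp add: invertible_left_inverse matrix_left_invertible_injective)
qed

lemma mult_axis_nth: "(A *v axis j 1) $ i = A $ i $ j" for A :: "'k::semiring_1^'n^'m"
  by (simp add: matrix_vector_mult_def axis_def if_distrib [of "\<lambda>x. _ * x"] cong: if_cong)

lemma matrix_eqI_axis:
  fixes A B :: "'k::semiring_1^'n^'m"
  assumes "\<And>j. A *v axis j 1 = B *v axis j 1"
  shows "A = B"
  using assms by (metis mult_axis_nth vec_eq_iff)

lemma continuous_on_matrix_mult: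
  fixes f :: "'x::topological_space \<Rightarrow> 'k::{semiring_1, topological_comm_monoid_add,
      topological_semigroup_mult}^'n^'m"
    and g :: "'x \<Rightarrow> 'k^'l^'n"
  assumes "continuous_on S f" "continuous_on S g"
  shows "continuous_on S (\<lambda>x. f x ** g x)"
  unfolding matrix_matrix_mult_def
  using assms
  by (intro continuous_on_vec_lambda continuous_on_sum continuous_on_mult') (auto intro!: continuous_intros)

lemma finite_ex_max_image:
  fixes f :: "'i \<Rightarrow> 'b::linorder"
  assumes "finite S" "S \<noteq> {}"
  shows "\<exists>i\<in>S. \<forall>j\<in>S. f j \<le> f i"
proof -
  have "Max (f ` S) \<in> f ` S" using assms by (intro Max_in) auto
  then show ?thesis using assms(1) by (metis (no_types, lifting) Max_ge finite_imageI imageE image_eqI)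
qed

definition entries_le :: "real \<Rightarrow> 'a::nonarch_local_field_0^'n^'m \<Rightarrow> bool" where
  "entries_le r A \<longleftrightarrow> (\<forall>i j. absval (A $ i $ j) \<le> r)"

lemma entries_le_mono: "entries_le r A \<Longrightarrow> r \<le> s \<Longrightarrow> entries_le s A"
  unfolding entries_le_def by (meson order_trans)

lemma entries_le_nonneg: "entries_le r A \<Longrightarrow> 0 \<le> r"
  unfolding entries_le_def by (meson absval_nonneg order_trans)

lemma entries_le_mult:
  assumes "entries_le r A" "entries_le s B"
  shows "entries_le (r * s) (A ** B)"
  unfolding entries_le_def matrix_matrix_mult_def
  using assms entries_le_nonneg[OF assms(1)] entries_le_nonneg[OF assms(2)]
  by (auto intro!: absval_sum_le mult_mono simp: entries_le_def absval_mult)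

lemma entries_le_mult_le: "entries_le r A \<Longrightarrow> entries_le s B \<Longrightarrow> r * s \<le> t \<Longrightarrow> entries_le t (A ** B)"
  using entries_le_mult entries_le_mono by blast

lemma entries_le_add: "entries_le r A \<Longrightarrow> entries_le r B \<Longrightarrow> entries_le r (A + B)"
  unfolding entries_le_def by (simp add: order_trans[OF absval_add])

lemma entries_le_minus: "entries_le r A \<Longrightarrow> entries_le r (- A)"
  unfolding entries_le_def by simp

lemma entries_le_diff: "entries_le r A \<Longrightarrow> entries_le r B \<Longrightarrow> entries_le r (A - B)"
  using entries_le_add[of r A "- B"] entries_le_minus[of r B] by simp

lemma entries_le_mat: "absval c \<le> r \<Longrightarrow> entries_le r (mat c)"
  unfolding entries_le_def mat_def using order_trans[OF absval_nonneg[of c], of r] by simp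

lemma entries_le_transpose: "entries_le r A \<Longrightarrow> entries_le r (transpose A)"
  unfolding entries_le_def transpose_def by simp

lemma entries_le_dist: "entries_le (dist A B) (A - B)"
  unfolding entries_le_def
proof (intro allI)
  fix i j
  have "dist (A $ i $ j) (B $ i $ j) \<le> dist A B" by (meson dist_vec_nth_le order_trans)
  then show "absval ((A - B) $ i $ j) \<le> dist A B" by (simp add: dist_absval)
qed

lemma dist_le_if_entries_le:
  fixes A B :: "'a::nonarch_local_field_0^'n^'m"
  assumes "entries_le r (A - B)"
  shows "dist A B \<le> real CARD('m) * (real CARD('n) * r)"
proof -
  have dist_le_sum: "dist x y \<le> (\<Sum>i\<in>UNIV. dist (x $ i) (y $ i))" for x y :: "'k::metric_space^'l"
    unfolding dist_vec_def by (rule L2_set_le_sum) auto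
  have "dist (A $ i) (B $ i) \<le> real CARD('n) * r" for i
    by (rule order_trans[OF dist_le_sum], rule sum_bounded_above)
      (use assms in \<open>auto simp: entries_le_def dist_absval\<close>)
  then have "(\<Sum>i\<in>UNIV. dist (A $ i) (B $ i)) \<le> real CARD('m) * (real CARD('n) * r)"
    by (intro sum_bounded_above) simp
  then show ?thesis using dist_le_sum[of A B] by simp
qed

lemma exists_max_entry: "\<exists>i j. entries_le (absval (A $ i $ j)) A"
  using finite_ex_max_image[of UNIV "\<lambda>(i, j). absval (A $ i $ j)"] by (auto simp: entries_le_def)

lemma exists_entries_le: "\<exists>r\<ge>1. entries_le r A"
proof -
  obtain i j where "entries_le (absval (A $ i $ j)) A" using exists_max_entry by blast
  then show ?thesis by (intro exI[of _ "max 1 (absval (A $ i $ j))"]) (auto intro: entries_le_mono)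
qed

lemma compact_entries_le: "compact {A :: 'a::nonarch_local_field_0^'n^'m. entries_le r A}"
proof -
  have "dist 0 A \<le> real CARD('m) * (real CARD('n) * r)" if "entries_le r A" for A :: "'a^'n^'m"
    using dist_le_if_entries_le[of r 0 A] that by (simp add: entries_le_minus)
  then have "bounded {A :: 'a^'n^'m. entries_le r A}" unfolding bounded_def by blast
  moreover have "entries_le r A \<longleftrightarrow> (\<forall>i j. dist (A $ i $ j) 0 \<le> r)" for A :: "'a^'n^'m"
    by (simp add: entries_le_def dist_absval)
  then have "closed {A :: 'a^'n^'m. entries_le r A}"
    by (simp only:) (intro closed_Collect_all closed_Collect_le continuous_intros)
  ultimately show ?thesis by (simp add: compact_eq_bounded_closed)
qed

definition GL_O :: "('a::nonarch_local_field_0^'n^'n) set" where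
  "GL_O = {A. invertible A \<and> entries_le 1 A \<and> entries_le 1 (matrix_inv A)}"

lemma GL_O_I: "A ** B = mat 1 \<Longrightarrow> entries_le 1 A \<Longrightarrow> entries_le 1 B \<Longrightarrow> A \<in> GL_O"
  unfolding GL_O_def using matrix_inv_unique_right[of A B] by simp

lemma GL_O_D: "A \<in> GL_O \<Longrightarrow> invertible A" "A \<in> GL_O \<Longrightarrow> entries_le 1 A"
    "A \<in> GL_O \<Longrightarrow> entries_le 1 (matrix_inv A)"
  by (simp_all add: GL_O_def)

lemma GL_O_one [simp]: "mat 1 \<in> GL_O"
  by (rule GL_O_I[of _ "mat 1"]) (auto intro: entries_le_mat)

lemma GL_O_mult: "A \<in> GL_O \<Longrightarrow> B \<in> GL_O \<Longrightarrow> A ** B \<in> GL_O"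
  unfolding GL_O_def by (auto simp: invertible_mult matrix_inv_mult intro: entries_le_mult_le)

lemma GL_O_inv: "A \<in> GL_O \<Longrightarrow> matrix_inv A \<in> GL_O"
  unfolding GL_O_def by (auto simp: matrix_inv_props matrix_inv_matrix_inv)

lemma GL_O_transpose: "A \<in> GL_O \<Longrightarrow> transpose A \<in> GL_O"
  unfolding GL_O_def by (auto simp: invertible_transpose matrix_inv_transpose entries_le_transpose)

lemma GL_O_mat:
  assumes "absval c = 1"
  shows "mat c \<in> GL_O"
proof (rule GL_O_I)
  have "c \<noteq> 0" using assms by auto
  then show "mat c ** mat (inverse c) = mat 1" by (simp add: mat_mult_mat)
qed (use assms in \<open>auto intro!: entries_le_mat simp: absval_inverse\<close>)

lemma invertible_if_near_one:
  fixes A :: "'a::nonarch_local_field_0^'n^'n"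
  assumes "entries_le r (A - mat 1)" "r < 1"
  shows "invertible A"
  unfolding invertible_iff_mult_vec_eq_0
proof (intro allI impI)
  define Y where "Y = A - mat 1"
  have Y: "entries_le r Y" using assms(1) by (simp add: Y_def)
  fix v assume v: "A *v v = 0"
  obtain i where i: "\<And>j. absval (v $ j) \<le> absval (v $ i)"
    using finite_ex_max_image[of UNIV "\<lambda>j. absval (v $ j)"] by auto
  have "v + Y *v v = 0" using v by (simp add: Y_def matrix_vector_mult_diff_rdistrib)
  then have "v = - (Y *v v)" by (simp add: eq_neg_iff_add_eq_0)
  then have "absval (v $ i) = absval ((Y *v v) $ i)" by (metis absval_minus vector_uminus_component)
  also have "\<dots> \<le> r * absval (v $ i)"
    unfolding matrix_vector_mult_def using Y i entries_le_nonneg[OF Y]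
    by (auto simp: absval_mult entries_le_def intro!: absval_sum_le mult_mono)
  finally have "absval (v $ i) * (1 - r) \<le> 0" by (simp add: algebra_simps)
  then have "absval (v $ i) \<le> 0" using assms(2) by (simp add: mult_le_0_iff)
  then show "v = 0" using i by (metis absval_eq_0_iff absval_nonneg order_antisym order_trans vec_eq_iff
      zero_index)
qed

lemma GL_O_if_near_one:
  fixes A :: "'a::nonarch_local_field_0^'n^'n"
  assumes "entries_le r (A - mat 1)" "r < 1"
  shows "A \<in> GL_O" "entries_le r (matrix_inv A - mat 1)"
proof -
  define Y where "Y = A - mat 1"
  have Y: "entries_le r Y" "A = mat 1 + Y" using assms(1) by (simp_all add: Y_def)
  have invertible: "invertible A" using assms by (rule invertible_if_near_one)
  define Z where "Z = matrix_inv A"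
  have "A ** Z = mat 1" unfolding Z_def using invertible by (rule matrix_inv_props)
  then have Z: "Z = mat 1 - Y ** Z" by (simp add: Y(2) matrix_add_rdistrib eq_diff_eq)
  obtain i j where ij: "entries_le (absval (Z $ i $ j)) Z" using exists_max_entry by blast
  have YZ: "entries_le (r * absval (Z $ i $ j)) (Y ** Z)" using Y(1) ij by (rule entries_le_mult)
  have "absval (Z $ i $ j) \<le> max 1 (r * absval (Z $ i $ j))"
  proof -
    have "absval ((mat 1 :: 'a^'n^'n) $ i $ j) \<le> 1" "absval ((Y ** Z) $ i $ j) \<le> r * absval (Z $ i $ j)"
      using YZ by (auto simp: mat_def entries_le_def)
    then show ?thesis by (subst (1) Z, simp only: vector_minus_component)
        (meson absval_diff max.mono order_trans)
  qed
  moreover have "r * absval (Z $ i $ j) < absval (Z $ i $ j)" if "1 < absval (Z $ i $ j)"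
    using mult_strict_right_mono[OF assms(2) less_trans[OF zero_less_one that]] by simp
  ultimately have "absval (Z $ i $ j) \<le> 1" by linarith
  then have Z1: "entries_le 1 Z" using ij by (rule entries_le_mono [rotated])
  have "entries_le 1 A"
    unfolding Y(2) using Y(1) assms(2) by (intro entries_le_add entries_le_mat) (auto intro: entries_le_mono)
  then show "A \<in> GL_O" using invertible Z1 unfolding GL_O_def Z_def by blast
  have "entries_le r (Y ** Z)" using Y(1) Z1 by (rule entries_le_mult_le) simp
  moreover have "Z - mat 1 = - (Y ** Z)" using Z by (metis add_diff_cancel_left' diff_conv_add_uminus)
  ultimately show "entries_le r (matrix_inv A - mat 1)" by (simp add: Z_def entries_le_minus)
qed

lemma GL_O_if_dist_less_1:
  assumes "A \<in> GL_O" "dist A B < 1"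
  shows "B \<in> GL_O"
proof -
  have "entries_le (1 * dist B A) (matrix_inv A ** (B - A))"
    using assms(1) by (intro entries_le_mult entries_le_dist GL_O_D)
  moreover have "matrix_inv A ** (B - A) = matrix_inv A ** B - mat 1"
    using assms(1) by (simp add: matrix_diff_ldistrib matrix_inv_props GL_O_D)
  ultimately have "matrix_inv A ** B \<in> GL_O"
    using assms(2) by (intro GL_O_if_near_one(1)[of "dist B A"]) (simp_all add: dist_commute)
  then have "A ** (matrix_inv A ** B) \<in> GL_O" using assms(1) GL_O_mult by blast
  then show ?thesis using assms(1) by (simp add: matrix_inv_cancel GL_O_D)
qed

lemma open_GL_O: "open (GL_O :: ('a::nonarch_local_field_0^'n^'n) set)"
  unfolding open_dist using GL_O_if_dist_less_1 by (metis dist_commute zero_less_one)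

lemma compact_GL_O: "compact (GL_O :: ('a::nonarch_local_field_0^'n^'n) set)"
proof -
  have "A \<in> GL_O" if "A \<in> closure GL_O" for A :: "'a^'n^'n"
    using that GL_O_if_dist_less_1 by (meson closure_approachable zero_less_one)
  then have "closed (GL_O :: ('a^'n^'n) set)" unfolding closure_subset_eq [symmetric] by blast
  then have "compact ({A :: 'a^'n^'n. entries_le 1 A} \<inter> GL_O)"
    by (intro compact_Int_closed compact_entries_le)
  moreover have "{A :: 'a^'n^'n. entries_le 1 A} \<inter> GL_O = GL_O" by (auto simp: GL_O_def)
  ultimately show ?thesis by simp
qed

lemma finite_GL_O_cosets:
  "\<exists>S. finite S \<and> (\<forall>h :: 'a::nonarch_local_field_0^'n^'n.
    invertible h \<longrightarrow> entries_le r h \<longrightarrow> entries_le r (matrix_inv h) \<longrightarrow>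
      (\<exists>g\<in>S. invertible g \<and> matrix_inv g ** h \<in> GL_O))"
proof -
  define e where "e = inverse (2 * max r 1)"
  have e: "0 < e" "r * e < 1" by (auto simp: e_def max_def field_simps)
  let ?X = "{h :: 'a^'n^'n. invertible h \<and> entries_le r h \<and> entries_le r (matrix_inv h)}"
  have "seq_compact {h :: 'a^'n^'n. entries_le r h}"
    using compact_entries_le compact_eq_seq_compact_metric by blast
  then obtain N where N: "finite N" "{h :: 'a^'n^'n. entries_le r h} \<subseteq> (\<Union>B\<in>N. ball B e)"
    using seq_compact_imp_totally_bounded[of "{h :: 'a^'n^'n. entries_le r h}"] e(1) by blast
  then have "\<exists>B\<in>N. dist B h < e" if "h \<in> ?X" for h using that by (auto simp: subset_iff)
  then obtain c where c: "\<And>h. h \<in> ?X \<Longrightarrow> c h \<in> N \<and> dist (c h) h < e" by metis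
  then have "finite (c ` ?X)" using N(1) by (auto intro: finite_subset)
  then obtain S where S: "S \<subseteq> ?X" "finite S" "c ` ?X = c ` S"
    using finite_subset_image[of "c ` ?X" c ?X] by blast
  have near: "entries_le e (h - c h)" if "h \<in> ?X" for h
    using entries_le_dist[of h "c h"] c[OF that] by (auto simp: dist_commute intro: entries_le_mono)
  show ?thesis
  proof (intro exI[of _ S] conjI S(2) allI impI)
    fix h :: "'a^'n^'n" assume "invertible h" "entries_le r h" "entries_le r (matrix_inv h)"
    then have h: "h \<in> ?X" by blast
    then have "c h \<in> c ` S" unfolding S(3) [symmetric] by (rule imageI)
    then obtain g where g: "g \<in> S" "c h = c g" by blast
    then have gX: "g \<in> ?X" using S(1) by blast
    have "entries_le e ((h - c h) - (g - c g))" using near[OF h] near[OF gX] by (rule entries_le_diff)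
    then have "entries_le (r * e) (matrix_inv g ** (h - g))"
      using gX g(2) by (intro entries_le_mult) simp_all
    moreover have "matrix_inv g ** (h - g) = matrix_inv g ** h - mat 1"
      using gX by (simp add: matrix_diff_ldistrib matrix_inv_props)
    ultimately have "matrix_inv g ** h \<in> GL_O" using e(2) by (metis GL_O_if_near_one(1))
    then show "\<exists>g\<in>S. invertible g \<and> matrix_inv g ** h \<in> GL_O" using g(1) gX by blast
  qed
qed

lemma countable_GL_O_cosets:
  "\<exists>S. countable S \<and> (\<forall>h :: 'a::nonarch_local_field_0^'n^'n.
    invertible h \<longrightarrow> (\<exists>g\<in>S. invertible g \<and> matrix_inv g ** h \<in> GL_O))"
proof -
  have "\<forall>N :: nat. \<exists>S. finite S \<and> (\<forall>h :: 'a^'n^'n.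
    invertible h \<longrightarrow> entries_le N h \<longrightarrow> entries_le N (matrix_inv h) \<longrightarrow>
      (\<exists>g\<in>S. invertible g \<and> matrix_inv g ** h \<in> GL_O))"
    using finite_GL_O_cosets by blast
  from choice[OF this] obtain S where S: "\<And>N :: nat. finite (S N)" "\<And>N h. invertible h \<Longrightarrow>
      entries_le N h \<Longrightarrow> entries_le N (matrix_inv h) \<Longrightarrow>
      \<exists>g\<in>S N. invertible g \<and> matrix_inv g ** (h :: 'a^'n^'n) \<in> GL_O"
    by blast
  show ?thesis
  proof (intro exI[of _ "\<Union>N. S N"] conjI allI impI)
    show "countable (\<Union>N. S N)" using S(1) by (auto intro: countable_finite)
    fix h :: "'a^'n^'n" assume h: "invertible h"
    obtain r s where "entries_le r h" "entries_le s (matrix_inv h)" using exists_entries_le by metis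
    moreover obtain N :: nat where "max r s \<le> real N" using real_arch_simple by blast
    ultimately have "entries_le N h" "entries_le N (matrix_inv h)" by (auto intro: entries_le_mono)
    then show "\<exists>g\<in>\<Union>N. S N. invertible g \<and> matrix_inv g ** h \<in> GL_O" using S(2)[OF h] by blast
  qed
qed

lemma absval_det_le:
  fixes A :: "'a::nonarch_local_field_0^'n^'n"
  assumes "entries_le r A"
  shows "absval (det A) \<le> r ^ CARD('n)"
proof -
  have "(\<Prod>i\<in>UNIV. absval (A $ i $ p i)) \<le> (\<Prod>i\<in>(UNIV :: 'n set). r)" for p
    using assms by (intro prod_mono) (auto simp: entries_le_def)
  moreover have "absval (of_int (sign p) :: 'a) = 1" for p :: "'n \<Rightarrow> 'n" by (simp add: sign_def)
  ultimately show ?thesis unfolding det_def using entries_le_nonneg[OF assms]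
    by (intro absval_sum_le) (auto simp: absval_mult absval_prod)
qed

lemma absval_det_GL_O:
  assumes "A \<in> GL_O"
  shows "absval (det A) = 1"
proof -
  have le: "absval (det A) \<le> 1" "absval (det (matrix_inv A)) \<le> 1"
    using absval_det_le[OF GL_O_D(2)[OF assms]] absval_det_le[OF GL_O_D(3)[OF assms]] by simp_all
  have "absval (det A) * absval (det (matrix_inv A)) = 1"
    using det_matrix_inv[OF GL_O_D(1)[OF assms]] by (metis absval_1 absval_mult)
  then have "1 \<le> absval (det A)" using le by (metis absval_nonneg mult_left_le)
  then show ?thesis using le(1) by (rule antisym[rotated])
qed

lemma GL_O_unipotent:
  assumes "entries_le 1 N" "N ** N = 0"
  shows "mat 1 + N \<in> GL_O"
proof (rule GL_O_I)
  show "(mat 1 + N) ** (mat 1 - N) = mat 1"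
    using assms by (simp add: matrix_add_rdistrib matrix_diff_ldistrib)
qed (use assms in \<open>simp_all add: entries_le_add entries_le_diff entries_le_mat\<close>)

lemma GL_O_swap_columns:
  fixes a b :: "'n::finite"
  shows "\<exists>P\<in>GL_O. \<forall>(A :: 'a::nonarch_local_field_0^'n^'n) i j. (A ** P) $ i $ j =
      A $ i $ Transposition.transpose a b j"
proof -
  let ?P = "(\<chi> i j. of_bool (i = Transposition.transpose a b j)) :: 'a^'n^'n"
  have mult: "(A ** ?P) $ i $ j = A $ i $ Transposition.transpose a b j" for A :: "'a^'n^'n" and i j
    by (simp add: matrix_matrix_mult_def of_bool_def if_distrib [of "\<lambda>x. _ * x"] cong: if_cong)
  moreover have "?P \<in> GL_O"
  proof (rule GL_O_I)
    show "?P ** ?P = mat 1" by (simp add: vec_eq_iff mult) (simp add: mat_def)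
  qed (auto simp: entries_le_def)
  ultimately show ?thesis by blast
qed

text \<open>If the pivot vanishes, so does the whole block outside \<open>S\<close>; the quotients are then \<open>x / 0 = 0\<close>.\<close>

lemma GL_O_clear_pivot:
  fixes A :: "'a::nonarch_local_field_0^'n^'n"
  assumes zero: "\<And>i j. i \<in> S \<or> j \<in> S \<Longrightarrow> i \<noteq> j \<Longrightarrow> A $ i $ j = 0"
    and a: "a \<notin> S" and pivot: "\<And>i j. i \<notin> S \<Longrightarrow> j \<notin> S \<Longrightarrow> absval (A $ i $ j) \<le> absval (A $ a $ a)"
  shows "\<exists>k\<in>GL_O. \<exists>l\<in>GL_O. \<forall>i j. i \<in> insert a S \<or> j \<in> insert a S \<longrightarrow> i \<noteq> j \<longrightarrow> (k ** A ** l) $ i $ j = 0"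
proof -
  define L where "L = (\<chi> i j. if j = a \<and> i \<noteq> a then - A $ i $ a / A $ a $ a else 0 :: 'a^'n^'n)"
  define M where "M = (\<chi> i j. if i = a \<and> j \<noteq> a then - A $ a $ j / A $ a $ a else 0 :: 'a^'n^'n)"
  have le: "absval (A $ i $ j) \<le> absval (A $ a $ a)" if "i = a \<or> j = a" for i j
  proof (cases "i \<in> S \<or> j \<in> S")
    case True
    then have "i \<noteq> j" using that a by blast
    then show ?thesis using zero[OF True] by simp
  qed (use pivot in blast)
  then have "absval (A $ i $ j / A $ a $ a) \<le> 1" if "i = a \<or> j = a" for i j
    using that by (cases "A $ a $ a = 0") (simp_all add: absval_divide divide_le_eq_1)
  then have GL_O: "mat 1 + L \<in> GL_O" "mat 1 + M \<in> GL_O"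
    by (auto intro!: GL_O_unipotent sum.neutral
        simp: L_def M_def entries_le_def matrix_matrix_mult_def vec_eq_iff absval_divide)
  have L: "(L ** A) $ i $ j = (if i = a then 0 else - A $ i $ a / A $ a $ a * A $ a $ j)" for i j
    by (simp add: L_def matrix_matrix_mult_def if_distrib [of "\<lambda>x. x * _"] cong: if_cong)
  have M: "(Z ** M) $ i $ j = (if j = a then 0 else - Z $ i $ a * A $ a $ j / A $ a $ a)" for Z i j
    by (simp add: M_def matrix_matrix_mult_def if_distrib [of "\<lambda>x. _ * x"] cong: if_cong)
  have "((mat 1 + L) ** A ** (mat 1 + M)) $ i $ j = 0"
    if ij: "i \<in> insert a S \<or> j \<in> insert a S" "i \<noteq> j" for i j
  proof -
    have "((mat 1 + L) ** A ** (mat 1 + M)) $ i $ j = A $ i $ j + (L ** A) $ i $ j +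
      (if j = a then 0 else - (A $ i $ a + (L ** A) $ i $ a) * A $ a $ j / A $ a $ a)"
    by (simp add: matrix_add_rdistrib matrix_add_ldistrib M left_diff_distrib diff_divide_distrib)
    moreover have "A $ i $ j = 0" if "i = a \<or> j = a" "A $ a $ a = 0" using le[OF that(1)] that(2) by simp
    ultimately show ?thesis using ij zero[of i j] zero[of i a] zero[of a j] a by (auto simp: L)
  qed
  then show ?thesis using GL_O by blast
qed

theorem GL_O_cartan_decomposition:
  fixes A :: "'a::nonarch_local_field_0^'n^'n"
  shows "\<exists>k\<in>GL_O. \<exists>l\<in>GL_O. \<forall>i j. i \<noteq> j \<longrightarrow> (k ** A ** l) $ i $ j = 0"
proof -
  have "\<exists>k\<in>GL_O. \<exists>l\<in>GL_O. \<forall>i j. i \<noteq> j \<longrightarrow> (k ** A ** l) $ i $ j = 0"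
    if "\<And>i j. i \<in> S \<or> j \<in> S \<Longrightarrow> i \<noteq> j \<Longrightarrow> A $ i $ j = 0" for S and A :: "'a^'n^'n"
    using that
  proof (induction "card (- S)" arbitrary: S A)
    case 0
    then have "S = UNIV" by auto
    then show ?case using 0 by (intro bexI[of _ "mat 1"]) auto
  next
    case (Suc m)
    then have "- S \<noteq> {}" by (metis card.empty nat.distinct(1))
    then obtain a b where ab: "a \<notin> S" "b \<notin> S" "\<And>i j. i \<notin> S \<Longrightarrow> j \<notin> S \<Longrightarrow> absval (A $ i $ j) \<le> absval (A $ a $ b)"
      using finite_ex_max_image[of "(- S) \<times> (- S)" "\<lambda>(i, j). absval (A $ i $ j)"] by auto
    obtain P where P: "P \<in> GL_O" "\<And>(A :: 'a^'n^'n) i j. (A ** P) $ i $ j =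
        A $ i $ Transposition.transpose a b j"
      using GL_O_swap_columns[of a b] by blast
    have "\<exists>k\<in>GL_O. \<exists>l\<in>GL_O. \<forall>i j. i \<in> insert a S \<or> j \<in> insert a S \<longrightarrow> i \<noteq> j \<longrightarrow> (k ** (A ** P) ** l) $ i $ j = 0"
    proof (rule GL_O_clear_pivot)
      show "a \<notin> S" by (rule ab(1))
      show "(A ** P) $ i $ j = 0" if "i \<in> S \<or> j \<in> S" "i \<noteq> j" for i j
        using that Suc.prems ab(1,2) unfolding P(2) Transposition.transpose_def by metis
      show "absval ((A ** P) $ i $ j) \<le> absval ((A ** P) $ a $ a)" if "i \<notin> S" "j \<notin> S" for i j
        using that ab unfolding P(2) Transposition.transpose_def by metis
    qed
    then obtain k l where kl: "k \<in> GL_O" "l \<in> GL_O"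
      "\<And>i j. i \<in> insert a S \<or> j \<in> insert a S \<Longrightarrow> i \<noteq> j \<Longrightarrow> (k ** (A ** P) ** l) $ i $ j = 0" by blast
    moreover have "m = card (- insert a S)" using Suc.hyps(2) ab(1) by (simp add: Compl_insert)
    ultimately obtain k' l' where kl': "k' \<in> GL_O" "l' \<in> GL_O"
      "\<forall>i j. i \<noteq> j \<longrightarrow> (k' ** (k ** (A ** P) ** l) ** l') $ i $ j = 0"
      using Suc.hyps(1)[of "insert a S" "k ** (A ** P) ** l"] by blast
    have "k' ** (k ** (A ** P) ** l) ** l' = (k' ** k) ** A ** (P ** l ** l')"
      by (simp only: matrix_mul_assoc)
    then show ?case using kl kl' P(1) by (metis GL_O_mult)
  qed
  from this[of "{}"] show ?thesis by simp
qed

section \<open>Powers of a companion matrix\<close>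

definition pos :: "'n::finite \<Rightarrow> int" where
  "pos i = int (to_nat_on UNIV i)"

definition at_pos :: "int \<Rightarrow> 'n::finite" where
  "at_pos k = from_nat_into UNIV (nat (k mod int CARD('n)))"

lemma pos_nonneg [simp]: "0 \<le> pos i"
  by (simp add: pos_def)

lemma pos_less: "pos (i :: 'n::finite) < int CARD('n)"
  using to_nat_on_finite[of "UNIV :: 'n set"] bij_betwE unfolding pos_def by fastforce

lemma at_pos_pos [simp]: "at_pos (pos i) = (i :: 'n::finite)"
  using pos_less[of i] by (simp add: at_pos_def) (simp add: pos_def countable_finite)

lemma pos_at_pos: "pos (at_pos k :: 'n::finite) = k mod int CARD('n)"
proof -
  have "nat (k mod int CARD('n)) \<in> to_nat_on (UNIV :: 'n set) ` UNIV"
    using to_nat_on_finite[of "UNIV :: 'n set"] by (auto simp: bij_betw_def nat_less_iff)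
  then show ?thesis unfolding pos_def at_pos_def by simp
qed

lemma at_pos_mod: "k mod int CARD('n) = l mod int CARD('n) \<Longrightarrow> at_pos k = (at_pos l :: 'n::finite)"
  by (simp add: at_pos_def)

lemma pos_at_pos_less: "k < CARD('n) \<Longrightarrow> pos (at_pos (int k) :: 'n::finite) = int k"
  by (simp add: pos_at_pos)

text \<open>
  \<open>cyclic_mat c v\<close> is the \<open>v\<close>-th power of the companion matrix of \<open>X\<^sup>n - c\<close>: it maps \<open>e\<^sub>j\<close> to
  \<open>e\<^bsub>j+v\<^esub>\<close>, where the basis is extended to integer indices by \<open>e\<^bsub>j+n\<^esub> = c e\<^sub>j\<close>.
\<close>

definition cyclic_mat :: "'k::field \<Rightarrow> int \<Rightarrow> 'k^'n^'n" where
  "cyclic_mat c v = (\<chi> i j. if i = at_pos (pos j + v) then c powi ((pos j + v) div int CARD('n)) else 0)"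

lemma cyclic_mat_axis:
  "(cyclic_mat c v :: 'k::field^'n^'n) *v axis (at_pos k) 1 =
    c powi ((k mod int CARD('n) + v) div int CARD('n)) *s axis (at_pos (k + v)) 1"
proof -
  have "(at_pos (k mod int CARD('n) + v) :: 'n) = at_pos (k + v)" by (rule at_pos_mod) (simp add: mod_simps)
  then show ?thesis unfolding vec_eq_iff mult_axis_nth by (auto simp: cyclic_mat_def pos_at_pos axis_def)
qed

lemma cyclic_mat_add:
  assumes "c \<noteq> 0"
  shows "cyclic_mat c (u + v) = cyclic_mat c u ** (cyclic_mat c v :: 'k::field^'n^'n)"
proof (rule matrix_eqI_axis)
  fix j :: 'n
  let ?n = "int CARD('n)" and ?m = "pos j + v"
  have "(?m + u) div ?n = ((?m mod ?n + u) + ?m div ?n * ?n) div ?n" by simp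
  also have "\<dots> = ?m div ?n + (?m mod ?n + u) div ?n" by (rule div_mult_self1) simp
  finally have "(?m + u) div ?n = ?m div ?n + (?m mod ?n + u) div ?n" .
  then have "c powi ((pos j + (u + v)) div ?n) = c powi (?m div ?n) * c powi ((?m mod ?n + u) div ?n)"
    using assms by (simp add: power_int_add add_ac)
  then show "cyclic_mat c (u + v) *v axis j 1 = (cyclic_mat c u ** (cyclic_mat c v :: 'k^'n^'n)) *v axis j 1"
    using cyclic_mat_axis[of c _ "pos j", where 'n = 'n] cyclic_mat_axis[of c u ?m, where 'n = 'n]
      pos_less[of j]
    by (simp add: matrix_vector_mul_assoc [symmetric] vector_scalar_commute vector_smult_assoc add_ac)
qed

lemma cyclic_mat_CARD_mult: "cyclic_mat c (int CARD('n) * m) = (mat (c powi m) :: 'k::field^'n^'n)"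
proof -
  have "at_pos (pos j + int CARD('n) * m) = j" "(pos j + int CARD('n) * m) div int CARD('n) = m" for j :: 'n
    using at_pos_mod[of "pos j + int CARD('n) * m" "pos j", where 'n = 'n] pos_less[of j] by simp_all
  then show ?thesis by (simp add: cyclic_mat_def mat_def vec_eq_iff)
qed

lemma cyclic_mat_0 [simp]: "cyclic_mat c 0 = (mat 1 :: 'k::field^'n^'n)"
  using cyclic_mat_CARD_mult[of c 0, where 'n = 'n] by simp

lemma invertible_cyclic_mat: "c \<noteq> 0 \<Longrightarrow> invertible (cyclic_mat c v :: 'k::field^'n^'n)"
  and matrix_inv_cyclic_mat: "c \<noteq> 0 \<Longrightarrow> matrix_inv (cyclic_mat c v :: 'k::field^'n^'n) = cyclic_mat c (- v)"
  using matrix_inv_unique_right[of "cyclic_mat c v" "cyclic_mat c (- v) :: 'k^'n^'n"]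
    cyclic_mat_add[of c v "- v", where 'n = 'n] by simp_all

lemma cyclic_mat_cancel:
  fixes A :: "'k::field^'m^'n"
  assumes "c \<noteq> 0"
  shows "cyclic_mat c v ** (cyclic_mat c (- v) ** A) = A" "cyclic_mat c (- v) ** (cyclic_mat c v ** A) = A"
  using matrix_inv_cancel[OF invertible_cyclic_mat[OF assms, of v, where 'n = 'n], of A]
  by (simp_all add: matrix_inv_cyclic_mat[OF assms])

lemma det_cyclic_mat_nat_mult:
  assumes "c \<noteq> 0"
  shows "det (cyclic_mat c (int m * v) :: 'k::field^'n^'n) = det (cyclic_mat c v :: 'k^'n^'n) ^ m"
  by (induction m) (simp_all add: cyclic_mat_add[OF assms] det_mul distrib_right)

lemma det_cyclic_mat_power_CARD:
  assumes "c \<noteq> 0"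
  shows "det (cyclic_mat c v :: 'k::field^'n^'n) ^ CARD('n) = (c powi v) ^ CARD('n)"
  using det_cyclic_mat_nat_mult[OF assms, of "CARD('n)" v, where 'n = 'n]
  by (simp add: cyclic_mat_CARD_mult det_mat)

text \<open>The value of a polynomial at a square matrix; \<open>poly\<close> does not apply since \<open>*\<close> on vectors is componentwise.\<close>

definition matrix_poly :: "'k::comm_ring_1^'n^'n \<Rightarrow> 'k poly \<Rightarrow> 'k^'n^'n" where
  "matrix_poly M f = fold_coeffs (\<lambda>a B. mat a + M ** B) f 0"

lemma matrix_poly_0 [simp]: "matrix_poly M 0 = 0"
  by (simp add: matrix_poly_def)

lemma matrix_poly_pCons [simp]: "matrix_poly M (pCons a f) = mat a + M ** matrix_poly M f"
  by (cases "a = 0 \<and> f = 0") (auto simp: matrix_poly_def)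

lemma matrix_poly_1 [simp]: "matrix_poly M 1 = mat 1"
  by (simp add: one_pCons)

lemma matrix_poly_add: "matrix_poly M (f + g) = matrix_poly M f + matrix_poly M g"
  by (induction f g rule: poly_induct2) (simp_all add: mat_add matrix_add_ldistrib)

lemma matrix_poly_diff: "matrix_poly M (f - g) = matrix_poly M f - matrix_poly M g"
  using matrix_poly_add[of M "f - g" g] by (simp add: eq_diff_eq)

lemma matrix_poly_sum: "matrix_poly M (sum f S) = (\<Sum>i\<in>S. matrix_poly M (f i))"
  by (induction S rule: infinite_finite_induct) (simp_all add: matrix_poly_add)

lemma matrix_poly_smult: "matrix_poly M (smult a f) = mat a ** matrix_poly M f"
proof (induction f)
  case (pCons b f)
  have "mat a ** (M ** matrix_poly M f) = M ** (mat a ** matrix_poly M f)"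
    by (metis mat_mult_commute matrix_mul_assoc)
  then show ?case by (simp add: matrix_add_ldistrib mat_mult_mat pCons.IH)
qed simp

lemma matrix_poly_mult: "matrix_poly M (f * g) = matrix_poly M f ** matrix_poly M g"
  by (induction f) (simp_all add: matrix_poly_add matrix_poly_smult matrix_add_rdistrib matrix_mul_assoc)

lemma matrix_poly_monom_cyclic_mat:
  assumes "c \<noteq> 0"
  shows "matrix_poly (cyclic_mat c 1) (monom a k) = mat a ** (cyclic_mat c (int k) :: 'k::field^'n^'n)"
proof (induction k)
  case (Suc k)
  have "matrix_poly (cyclic_mat c 1) (monom a (Suc k)) =
      cyclic_mat c 1 ** (mat a ** (cyclic_mat c (int k) :: 'k^'n^'n))"
    by (simp add: monom_Suc Suc.IH)
  also have "\<dots> = mat a ** (cyclic_mat c 1 ** cyclic_mat c (int k))"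
    by (metis mat_mult_commute matrix_mul_assoc)
  finally show ?case using cyclic_mat_add[OF assms, of 1 "int k", where 'n = 'n] by simp
qed (simp add: monom_0)

lemma matrix_poly_cyclic_mat:
  assumes "c \<noteq> 0" "degree f < m"
  shows "matrix_poly (cyclic_mat c 1) f =
      (\<Sum>k<m. mat (coeff f k) ** (cyclic_mat c (int k) :: 'k::field^'n^'n))"
proof -
  have "f = (\<Sum>k\<le>m - 1. monom (coeff f k) k)"
    using assms(2) by (intro poly_as_sum_of_monoms' [symmetric]) simp
  also have "{..m - 1} = {..<m}" using assms(2) by auto
  finally have "matrix_poly (cyclic_mat c 1) f =
      matrix_poly (cyclic_mat c 1 :: 'k^'n^'n) (\<Sum>k<m. monom (coeff f k) k)"
    by simp
  then show ?thesis by (simp add: matrix_poly_sum matrix_poly_monom_cyclic_mat[OF assms(1)])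
qed

abbreviation base_axis :: "'k::field^'n" where
  "base_axis \<equiv> axis (at_pos 0) 1"

lemma cyclic_mat_base_axis:
  assumes "k < CARD('n)"
  shows "(cyclic_mat c (int k) :: 'k::field^'n^'n) *v base_axis = axis (at_pos (int k)) 1"
  using cyclic_mat_axis[of c "int k" 0, where 'n = 'n] assms by simp

lemma sum_matrix_vector_mult: "(\<Sum>i\<in>S. A i) *v x = (\<Sum>i\<in>S. A i *v x)" for x :: "'k::semiring_1^'n"
  by (induction S rule: infinite_finite_induct) (simp_all add: matrix_vector_mult_add_rdistrib)

lemma matrix_poly_cyclic_mat_base_axis:
  assumes "c \<noteq> 0" "degree f < CARD('n)"
  shows "(matrix_poly (cyclic_mat c 1 :: 'k::field^'n^'n) f *v base_axis) $ i = coeff f (nat (pos i))"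
proof -
  have "(matrix_poly (cyclic_mat c 1) f *v base_axis) =
      (\<Sum>k<CARD('n). (mat (coeff f k) ** cyclic_mat c (int k)) *v (base_axis :: 'k^'n))"
    unfolding matrix_poly_cyclic_mat[OF assms] by (rule sum_matrix_vector_mult)
  also have "\<dots> = (\<Sum>k<CARD('n). coeff f k *s (axis (at_pos (int k)) 1 :: 'k^'n))"
    by (intro sum.cong refl)
      (simp add: matrix_vector_mul_assoc [symmetric] cyclic_mat_base_axis mat_mult_vec)
  also have "\<dots> $ i = (\<Sum>k<CARD('n). if k = nat (pos i) then coeff f k else 0)"
  proof -
    have "i = at_pos (int k) \<longleftrightarrow> k = nat (pos i)" if "k < CARD('n)" for k
      using pos_at_pos_less[OF that] by (metis at_pos_pos nat_int int_nat_eq pos_nonneg)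
    then show ?thesis
      unfolding sum_component vector_smult_component by (intro sum.cong) (auto simp: axis_def)
  qed
  finally show ?thesis using pos_less[of i] by (simp add: nat_less_iff)
qed

lemma degree_if_matrix_poly_cyclic_mat_eq_0:
  assumes "c \<noteq> 0" "f \<noteq> 0" "matrix_poly (cyclic_mat c 1 :: 'k::field^'n^'n) f = 0"
  shows "CARD('n) \<le> degree f"
proof (rule ccontr)
  assume "\<not> CARD('n) \<le> degree f"
  then have f: "degree f < CARD('n)" by simp
  have "coeff f k = 0" for k
  proof (cases "k < CARD('n)")
    case True
    then show ?thesis
      using matrix_poly_cyclic_mat_base_axis[OF assms(1) f, of "at_pos (int k)"] assms(3)
      by (simp add: pos_at_pos_less)
  qed (use f in \<open>simp add: coeff_eq_0\<close>)
  then show False using assms(2) by (simp add: poly_eq_iff)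
qed

definition cyclic_centralizer :: "'k::field \<Rightarrow> ('k^'n^'n) set" where
  "cyclic_centralizer c = {A. A ** cyclic_mat c 1 = cyclic_mat c 1 ** A}"

lemma matrix_inv_commute:
  fixes A B :: "'k::field^'n^'n"
  assumes "invertible B" "A ** B = B ** A"
  shows "A ** matrix_inv B = matrix_inv B ** A"
proof -
  have "matrix_inv B ** (B ** A) ** matrix_inv B = matrix_inv B ** (A ** B) ** matrix_inv B"
    by (simp only: assms(2))
  then have "matrix_inv B ** B ** A ** matrix_inv B = matrix_inv B ** A ** (B ** matrix_inv B)"
    by (simp only: matrix_mul_assoc)
  then show ?thesis using assms(1) by (simp add: matrix_inv_props)
qed

lemma matrix_poly_in_cyclic_centralizer [simp]: "matrix_poly (cyclic_mat c 1) f \<in> cyclic_centralizer c"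
proof -
  have "matrix_poly (cyclic_mat c 1) f ** matrix_poly (cyclic_mat c 1) [:0, 1:] =
      matrix_poly (cyclic_mat c 1) [:0, 1:] ** matrix_poly (cyclic_mat c 1) f"
    by (metis matrix_poly_mult mult.commute)
  then show ?thesis by (simp add: cyclic_centralizer_def)
qed

lemma cyclic_mat_commute:
  assumes "A \<in> cyclic_centralizer c" "c \<noteq> 0"
  shows "A ** cyclic_mat c v = cyclic_mat c v ** A"
proof -
  have nat: "A ** cyclic_mat c (int k) = cyclic_mat c (int k) ** A" for k
  proof (induction k)
    case (Suc k)
    then show ?case
      using assms cyclic_mat_add[OF assms(2), of 1 "int k", where 'n = 'b]
      by (simp add: cyclic_centralizer_def matrix_mul_assoc) (metis matrix_mul_assoc)
  qed simp
  show ?thesis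
  proof (cases v)
    case (nonneg k)
    then show ?thesis using nat by simp
  next
    case (neg k)
    then show ?thesis
      using matrix_inv_commute[OF invertible_cyclic_mat[OF assms(2)] nat[of "Suc k"]]
        matrix_inv_cyclic_mat[OF assms(2), of "int (Suc k)", where 'n = 'b] by simp
  qed
qed

lemma cyclic_centralizer_eqI:
  fixes A B :: "'k::field^'n^'n"
  assumes "A \<in> cyclic_centralizer c" "B \<in> cyclic_centralizer c" "c \<noteq> 0" "A *v base_axis = B *v base_axis"
  shows "A = B"
proof (rule matrix_eqI_axis)
  fix j :: 'n
  have "axis j 1 = cyclic_mat c (pos j) *v (base_axis :: 'k^'n)"
    using cyclic_mat_base_axis[of "nat (pos j)", where 'n = 'n and c = c] pos_less[of j]
    by (simp add: nat_less_iff)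
  then show "A *v axis j 1 = B *v axis j 1"
    using cyclic_mat_commute[OF assms(1,3), of "pos j"] cyclic_mat_commute[OF assms(2,3), of "pos j"] assms(4)
    by (metis matrix_vector_mul_assoc)
qed

lemma exists_matrix_poly_base_axis:
  fixes x :: "'k::field^'n"
  assumes "c \<noteq> 0"
  obtains f where "degree f < CARD('n)" "matrix_poly (cyclic_mat c 1 :: 'k^'n^'n) f *v base_axis = x"
proof
  let ?f = "\<Sum>k<CARD('n). monom (x $ at_pos (int k)) k"
  have coeff: "coeff ?f k = (if k < CARD('n) then x $ at_pos (int k) else 0)" for k
    by (simp add: coeff_sum)
  then show "degree ?f < CARD('n)"
    by (metis (no_types, lifting) coeff_0 leading_coeff_neq_0 degree_0 zero_less_card_finite)
  then have "(matrix_poly (cyclic_mat c 1 :: 'k^'n^'n) ?f *v base_axis) $ i = x $ i" for i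
    using pos_less[of i] by (subst matrix_poly_cyclic_mat_base_axis[OF assms]) (simp_all add: coeff
      nat_less_iff)
  then show "matrix_poly (cyclic_mat c 1 :: 'k^'n^'n) ?f *v base_axis = x" by (simp add: vec_eq_iff)
qed

lemma cyclic_centralizer_matrix_poly:
  fixes A :: "'k::field^'n^'n"
  assumes "A \<in> cyclic_centralizer c" "c \<noteq> 0"
  obtains f where "degree f < CARD('n)" "A = matrix_poly (cyclic_mat c 1) f"
proof -
  obtain f where "degree f < CARD('n)" "matrix_poly (cyclic_mat c 1 :: 'k^'n^'n) f *v base_axis =
      A *v base_axis"
    using assms(2) by (rule exists_matrix_poly_base_axis)
  then show ?thesis
    using that cyclic_centralizer_eqI[OF assms(1) matrix_poly_in_cyclic_centralizer assms(2)] by metis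
qed

lemma cyclic_centralizer_commute:
  fixes A B :: "'k::field^'n^'n"
  assumes "A \<in> cyclic_centralizer c" "B \<in> cyclic_centralizer c" "c \<noteq> 0"
  shows "A ** B = B ** A"
  using cyclic_centralizer_matrix_poly[OF assms(1,3)] cyclic_centralizer_matrix_poly[OF assms(2,3)]
  by (metis matrix_poly_mult mult.commute)

lemma cyclic_centralizer_mult:
  assumes "A \<in> cyclic_centralizer c" "B \<in> cyclic_centralizer c"
  shows "A ** B \<in> cyclic_centralizer c"
  using assms unfolding cyclic_centralizer_def
  by (simp add: matrix_mul_assoc [symmetric]) (simp add: matrix_mul_assoc)

lemma cyclic_centralizer_matrix_inv:
  fixes A :: "'k::field^'n^'n"
  shows "A \<in> cyclic_centralizer c \<Longrightarrow> invertible A \<Longrightarrow> matrix_inv A \<in> cyclic_centralizer c"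
  unfolding cyclic_centralizer_def using matrix_inv_commute[of A "cyclic_mat c 1"] by simp

lemma mat_in_cyclic_centralizer [simp]: "mat a \<in> cyclic_centralizer c"
  by (simp add: cyclic_centralizer_def mat_mult_commute)

lemma cyclic_mat_in_cyclic_centralizer [simp]:
  assumes "c \<noteq> 0"
  shows "(cyclic_mat c v :: 'k::field^'n^'n) \<in> cyclic_centralizer c"
  using cyclic_mat_add[OF assms, of v 1, where 'n = 'n] cyclic_mat_add[OF assms, of 1 v, where 'n = 'n]
  by (simp add: cyclic_centralizer_def add.commute)

section \<open>The norm of the totally ramified extension\<close>

abbreviation Pi_power :: "int \<Rightarrow> 'a::nonarch_local_field_0^'n^'n" where
  "Pi_power \<equiv> cyclic_mat \<pi>"

lemma power_int_nat_mult_add: "x \<noteq> 0 \<Longrightarrow> x powi (int n * q + r) = (x powi q) ^ n * x powi r"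
  for x :: "'k::field"
  by (simp add: power_int_add power_int_mult mult.commute[of "int n"])

text \<open>
  Identifying \<open>F\<^sup>n\<close> with \<open>E = F[X] / (X\<^sup>n - \<pi>)\<close>, this is the \<open>n\<close>-th power of the absolute value of \<open>E\<close>; the
  centralizer of the companion matrix is \<open>E\<close> acting on itself.
\<close>

definition cyclic_norm :: "'a::nonarch_local_field_0^'n \<Rightarrow> real" where
  "cyclic_norm x = Max (range (\<lambda>i. absval (x $ i) ^ CARD('n) * absval (\<pi> :: 'a) powi pos i))"

lemma cyclic_norm_ge:
  fixes x :: "'a::nonarch_local_field_0^'n"
  shows "absval (x $ i) ^ CARD('n) * absval (\<pi> :: 'a) powi pos i \<le> cyclic_norm x"
  unfolding cyclic_norm_def by (intro Max_ge) auto

lemma cyclic_norm_le_iff: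
  fixes x :: "'a::nonarch_local_field_0^'n"
  shows "cyclic_norm x \<le> r \<longleftrightarrow> (\<forall>i. absval (x $ i) ^ CARD('n) * absval (\<pi> :: 'a) powi pos i \<le> r)"
  unfolding cyclic_norm_def by (subst Max_le_iff) auto

lemma cyclic_norm_attained:
  fixes x :: "'a::nonarch_local_field_0^'n"
  obtains i where "cyclic_norm x = absval (x $ i) ^ CARD('n) * absval (\<pi> :: 'a) powi pos i"
proof -
  have "cyclic_norm x \<in> range (\<lambda>i. absval (x $ i) ^ CARD('n) * absval (\<pi> :: 'a) powi pos i)"
    unfolding cyclic_norm_def by (intro Max_in) auto
  then show ?thesis using that by blast
qed

lemma cyclic_norm_nonneg [simp]: "0 \<le> cyclic_norm x"
  by (rule order_trans[OF _ cyclic_norm_ge]) simp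

lemma cyclic_norm_eq_0_iff [simp]: "cyclic_norm x = 0 \<longleftrightarrow> x = 0"
  for x :: "'a::nonarch_local_field_0^'n"
proof
  assume "cyclic_norm x = 0"
  then have "absval (x $ i) ^ CARD('n) * absval (\<pi> :: 'a) powi pos i = 0" for i
    using cyclic_norm_ge[of x i] by (intro antisym) simp_all
  then show "x = 0" by (simp add: vec_eq_iff)
qed (simp add: cyclic_norm_def power_0_left)

lemma cyclic_norm_0 [simp]: "cyclic_norm 0 = 0"
  by simp

lemma cyclic_norm_pos_iff [simp]: "0 < cyclic_norm x \<longleftrightarrow> x \<noteq> 0"
  by (simp add: order.strict_iff_order)

lemma cyclic_norm_scaled:
  fixes x y :: "'a::nonarch_local_field_0^'n"
  assumes "surj \<sigma>" "0 \<le> r" "\<And>i. absval (y $ \<sigma> i) ^ CARD('n) * absval (\<pi> :: 'a) powi pos (\<sigma> i) =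
    r * (absval (x $ i) ^ CARD('n) * absval (\<pi> :: 'a) powi pos i)"
  shows "cyclic_norm y = r * cyclic_norm x"
proof (rule antisym)
  show "cyclic_norm y \<le> r * cyclic_norm x"
    unfolding cyclic_norm_le_iff
  proof
    fix j
    obtain i where "j = \<sigma> i" using assms(1) by blast
    then show "absval (y $ j) ^ CARD('n) * absval (\<pi> :: 'a) powi pos j \<le> r * cyclic_norm x"
      using assms(2,3) by (simp add: mult_left_mono cyclic_norm_ge)
  qed
  obtain i where "cyclic_norm x = absval (x $ i) ^ CARD('n) * absval (\<pi> :: 'a) powi pos i"
    by (rule cyclic_norm_attained)
  then show "r * cyclic_norm x \<le> cyclic_norm y" using cyclic_norm_ge[of y "\<sigma> i"] assms(3) by metis
qed

lemma cyclic_norm_smult: "cyclic_norm (a *s x) = absval a ^ CARD('n) * cyclic_norm x"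
  for x :: "'a::nonarch_local_field_0^'n"
  by (rule cyclic_norm_scaled[of id]) (simp_all add: absval_mult power_mult_distrib)

lemma cyclic_norm_Pi_power: "cyclic_norm (Pi_power v *v x) = absval (\<pi> :: 'a) powi v * cyclic_norm x"
  for x :: "'a::nonarch_local_field_0^'n"
proof (rule cyclic_norm_scaled)
  let ?\<sigma> = "\<lambda>i :: 'n. at_pos (pos i + v) :: 'n" and ?n = "int CARD('n)"
  have inverse: "at_pos (pos (?\<sigma> i) - v) = i" for i
    using at_pos_mod[of "pos (?\<sigma> i) - v" "pos i", where 'n = 'n] by (simp add: pos_at_pos mod_simps)
  then show "surj ?\<sigma>"
    by (intro surjI[of _ "\<lambda>i. at_pos (pos i - v)"])
      (metis at_pos_mod at_pos_pos diff_add_cancel mod_add_left_eq pos_at_pos)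
  fix i :: 'n
  have "?\<sigma> i = ?\<sigma> k \<longleftrightarrow> k = i" for k using inverse by metis
  then have nth: "(Pi_power v *v x) $ ?\<sigma> i = \<pi> powi ((pos i + v) div ?n) * x $ i"
    by (simp add: matrix_vector_mult_def cyclic_mat_def if_distrib [of "\<lambda>z. z * _"] cong: if_cong)
  have "absval ((Pi_power v *v x) $ ?\<sigma> i) ^ CARD('n) * absval (\<pi> :: 'a) powi pos (?\<sigma> i) =
      (absval (\<pi> :: 'a) powi ((pos i + v) div ?n)) ^ CARD('n) * absval (\<pi> :: 'a) powi ((pos i + v) mod ?n) *
      absval (x $ i) ^ CARD('n)"
    unfolding nth by (simp add: absval_mult absval_power_int power_mult_distrib pos_at_pos)
  also have "(absval (\<pi> :: 'a) powi ((pos i + v) div ?n)) ^ CARD('n)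
      * absval (\<pi> :: 'a) powi ((pos i + v) mod ?n) =
      absval (\<pi> :: 'a) powi (v + pos i)"
    by (simp flip: power_int_nat_mult_add add: add.commute)
  finally show "absval ((Pi_power v *v x) $ ?\<sigma> i) ^ CARD('n) * absval (\<pi> :: 'a) powi pos (?\<sigma> i) =
      absval (\<pi> :: 'a) powi v * (absval (x $ i) ^ CARD('n) * absval (\<pi> :: 'a) powi pos i)"
    by (simp add: power_int_add)
qed simp

lemma cyclic_norm_add: "cyclic_norm (x + y) \<le> max (cyclic_norm x) (cyclic_norm y)"
  for x y :: "'a::nonarch_local_field_0^'n"
  unfolding cyclic_norm_le_iff
proof
  fix i
  have "absval ((x + y) $ i) \<le> absval (x $ i) \<or> absval ((x + y) $ i) \<le> absval (y $ i)"
    using absval_add[of "x $ i" "y $ i"] by auto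
  then have "absval ((x + y) $ i) ^ CARD('n) * absval (\<pi> :: 'a) powi pos i \<le>
      absval (x $ i) ^ CARD('n) * absval (\<pi> :: 'a) powi pos i
      \<or> absval ((x + y) $ i) ^ CARD('n) * absval (\<pi> :: 'a) powi pos i \<le>
          absval (y $ i) ^ CARD('n) * absval (\<pi> :: 'a) powi pos i"
    by (auto intro: mult_right_mono power_mono)
  then show "absval ((x + y) $ i) ^ CARD('n) * absval (\<pi> :: 'a) powi pos i \<le>
      max (cyclic_norm x) (cyclic_norm y)"
    using cyclic_norm_ge[of x i] cyclic_norm_ge[of y i] by linarith
qed

lemma cyclic_norm_minus [simp]: "cyclic_norm (- x) = cyclic_norm x"
  by (simp add: cyclic_norm_def)

lemma cyclic_norm_add_eq:
  assumes "cyclic_norm y < cyclic_norm x"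
  shows "cyclic_norm (x + y) = cyclic_norm x"
  using cyclic_norm_add[of x y] cyclic_norm_add[of "x + y" "- y"] assms by auto

lemma cyclic_norm_sum_le:
  assumes "0 \<le> r" "\<And>i. i \<in> S \<Longrightarrow> cyclic_norm (f i) \<le> r"
  shows "cyclic_norm (sum f S) \<le> r"
  using assms
proof (induction S rule: infinite_finite_induct)
  case (insert x F)
  then have "cyclic_norm (f x) \<le> r" "cyclic_norm (sum f F) \<le> r" by auto
  then show ?case using insert.hyps cyclic_norm_add[of "f x" "sum f F"] by auto
qed simp_all

lemma cyclic_norm_le_1_iff: "cyclic_norm x \<le> 1 \<longleftrightarrow> (\<forall>i. absval (x $ i) \<le> 1)"
  for x :: "'a::nonarch_local_field_0^'n"
proof -
  have "absval (x $ i) ^ CARD('n) * absval (\<pi> :: 'a) powi pos i \<le> 1 \<longleftrightarrow> absval (x $ i) \<le> 1" for i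
  proof (cases "x $ i = 0")
    case False
    have "absval (x $ i) ^ CARD('n) * absval (\<pi> :: 'a) powi pos i =
        absval (\<pi> :: 'a) powi (int CARD('n) * val (x $ i) + pos i)"
      by (simp add: absval_eq_powi_val[OF False] power_int_nat_mult_add)
    also have "\<dots> \<le> absval (\<pi> :: 'a) powi 0 \<longleftrightarrow> 0 \<le> int CARD('n) * val (x $ i) + pos i"
      by (rule absval_uniformizer_powi_le_iff)
    also have "\<dots> \<longleftrightarrow> 0 \<le> val (x $ i)"
    proof
      assume "0 \<le> int CARD('n) * val (x $ i) + pos i"
      then have "0 < int CARD('n) * (val (x $ i) + 1)" using pos_less[of i] by (simp add: distrib_left)
      then show "0 \<le> val (x $ i)" by (simp add: zero_less_mult_iff)
    qed simp
    also have "\<dots> \<longleftrightarrow> absval (x $ i) \<le> absval (\<pi> :: 'a) powi 0"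
      unfolding absval_eq_powi_val[OF False] absval_uniformizer_powi_le_iff ..
    finally show ?thesis by simp
  qed (simp add: power_0_left)
  then show ?thesis by (simp add: cyclic_norm_le_iff)
qed

lemma cyclic_norm_eq_powi:
  fixes x :: "'a::nonarch_local_field_0^'n"
  assumes "x \<noteq> 0"
  obtains i where "cyclic_norm x = absval (\<pi> :: 'a) powi (int CARD('n) * val (x $ i) + pos i)" "x $ i \<noteq> 0"
proof -
  obtain i where i: "cyclic_norm x = absval (x $ i) ^ CARD('n) * absval (\<pi> :: 'a) powi pos i"
    by (rule cyclic_norm_attained)
  then have "x $ i \<noteq> 0" using assms cyclic_norm_eq_0_iff[of x] by auto
  then show ?thesis
    using that[of i] i absval_eq_powi_val[OF \<open>x $ i \<noteq> 0\<close>] by (simp add: power_int_nat_mult_add)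
qed

lemma absval_base_coordinate_eq_1:
  fixes x :: "'a::nonarch_local_field_0^'n"
  assumes "cyclic_norm x = 1"
  shows "absval (x $ at_pos 0) = 1"
proof -
  have "x \<noteq> 0" using assms by auto
  then obtain i where i: "cyclic_norm x = absval (\<pi> :: 'a) powi (int CARD('n) * val (x $ i) + pos i)"
      "x $ i \<noteq> 0"
    by (rule cyclic_norm_eq_powi)
  then have "int CARD('n) * val (x $ i) + pos i = 0"
    using assms absval_uniformizer_powi_less_iff[of _ 0, where 'a = 'a] absval_uniformizer_powi_less_iff[of 0,
      where 'a = 'a]
    by (metis less_irrefl linorder_neqE_linordered_idom power_int_0_right)
  then have "int CARD('n) dvd pos i" by (metis add.commute add_eq_0_iff dvd_minus_iff dvd_triv_left
      minus_mult_right)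
  then have "pos i = 0" using pos_less[of i] by (metis order_le_less pos_nonneg zdvd_not_zless)
  then have "i = at_pos 0" "val (x $ i) = 0" using \<open>int CARD('n) * val (x $ i) + pos i = 0\<close>
    by (metis at_pos_pos, simp)
  then show ?thesis using absval_eq_powi_val[OF i(2)] by simp
qed

lemma cyclic_norm_axis: "cyclic_norm (axis j 1 :: 'a::nonarch_local_field_0^'n) = absval (\<pi> :: 'a) powi pos j"
proof (rule antisym)
  show "cyclic_norm (axis j 1 :: 'a^'n) \<le> absval (\<pi> :: 'a) powi pos j"
    unfolding cyclic_norm_le_iff by (auto simp: axis_def power_0_left)
  show "absval (\<pi> :: 'a) powi pos j \<le> cyclic_norm (axis j 1 :: 'a^'n)"
    using cyclic_norm_ge[of "axis j 1 :: 'a^'n" j] by (simp add: axis_def)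
qed

definition centralizer_norm :: "'a::nonarch_local_field_0^'n^'n \<Rightarrow> real" where
  "centralizer_norm A = cyclic_norm (A *v base_axis)"

lemma centralizer_norm_nonneg [simp]: "0 \<le> centralizer_norm A"
  by (simp add: centralizer_norm_def)

lemma centralizer_norm_Pi_power: "centralizer_norm (Pi_power v :: 'a::nonarch_local_field_0^'n^'n) =
    absval (\<pi> :: 'a) powi v"
  by (simp add: centralizer_norm_def cyclic_norm_Pi_power cyclic_norm_axis pos_at_pos)

lemma centralizer_norm_mat: "centralizer_norm (mat a :: 'a::nonarch_local_field_0^'n^'n) =
    absval a ^ CARD('n)"
  unfolding centralizer_norm_def mat_mult_vec cyclic_norm_smult by (simp add: cyclic_norm_axis pos_at_pos)

lemma cyclic_norm_mult_unit:
  fixes A :: "'a::nonarch_local_field_0^'n^'n"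
  assumes "A \<in> cyclic_centralizer \<pi>" "centralizer_norm A = 1"
  shows "cyclic_norm (A *v x) = cyclic_norm x"
proof (cases "x = 0")
  case False
  let ?w = "absval (\<pi> :: 'a)"
  obtain f where f: "degree f < CARD('n)" "A = matrix_poly (Pi_power 1) f"
    using assms(1) by (rule cyclic_centralizer_matrix_poly) simp
  define summand where "summand k = coeff f k *s (Pi_power (int k) *v x)" for k
  have coeff: "(A *v base_axis) $ i = coeff f (nat (pos i))" for i
    unfolding f(2) using f(1) by (rule matrix_poly_cyclic_mat_base_axis[rotated]) simp
  have "absval ((A *v base_axis) $ at_pos (int k)) \<le> 1" for k
    using assms(2) cyclic_norm_le_1_iff[of "A *v base_axis"] by (simp add: centralizer_norm_def)
  then have coeff_le: "absval (coeff f k) \<le> 1" if "k < CARD('n)" for k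
    unfolding coeff using that by (metis nat_int pos_at_pos_less)
  have "absval (coeff f 0) = 1"
    using absval_base_coordinate_eq_1[of "A *v base_axis"] assms(2) coeff[of "at_pos 0"]
    by (simp add: centralizer_norm_def pos_at_pos)
  then have first: "cyclic_norm (summand 0) = cyclic_norm x" by (simp add: summand_def cyclic_norm_smult)
  have "cyclic_norm (summand k) \<le> ?w * cyclic_norm x" if "k \<in> {..<CARD('n)} - {0}" for k
  proof -
    have "?w powi int k \<le> ?w powi 1" using that by (intro absval_uniformizer_powi_le_iff[THEN iffD2]) auto
    moreover have "absval (coeff f k) ^ CARD('n) \<le> 1" using coeff_le that by (intro power_le_one) auto
    ultimately have "absval (coeff f k) ^ CARD('n) * ?w powi int k \<le> 1 * ?w powi 1" by (intro mult_mono) auto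
    then show ?thesis
      by (simp add: summand_def cyclic_norm_smult cyclic_norm_Pi_power mult.assoc [symmetric] mult_right_mono)
  qed
  then have "cyclic_norm (sum summand ({..<CARD('n)} - {0})) \<le> ?w * cyclic_norm x"
    by (intro cyclic_norm_sum_le) auto
  also have "\<dots> < cyclic_norm (summand 0)"
    unfolding first using False mult_strict_right_mono[OF absval_uniformizer_less_1, of "cyclic_norm x"]
    by simp
  finally have "cyclic_norm (summand 0 + sum summand ({..<CARD('n)} - {0})) = cyclic_norm (summand 0)"
    by (rule cyclic_norm_add_eq)
  moreover have "A *v x = sum summand {..<CARD('n)}"
    unfolding f(2) using f(1)
    by (simp add: matrix_poly_cyclic_mat sum_matrix_vector_mult summand_def
      matrix_vector_mul_assoc [symmetric] mat_mult_vec)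
  then have "A *v x = summand 0 + sum summand ({..<CARD('n)} - {0})"
    by (simp add: sum.remove)
  ultimately show ?thesis by (simp add: first)
qed simp

lemma centralizer_norm_eq_powi:
  fixes A :: "'a::nonarch_local_field_0^'n^'n"
  assumes "A \<in> cyclic_centralizer \<pi>" "A \<noteq> 0"
  obtains v where "centralizer_norm A = absval (\<pi> :: 'a) powi v"
proof -
  have "A *v base_axis \<noteq> 0"
    using cyclic_centralizer_eqI[of A \<pi> 0] assms mat_in_cyclic_centralizer[of 0 "\<pi> :: 'a", where 'b = 'n]
    by auto
  then show ?thesis using that cyclic_norm_eq_powi unfolding centralizer_norm_def by metis
qed

lemma cyclic_norm_mult:
  fixes A :: "'a::nonarch_local_field_0^'n^'n"
  assumes "A \<in> cyclic_centralizer \<pi>"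
  shows "cyclic_norm (A *v x) = centralizer_norm A * cyclic_norm x"
proof (cases "A = 0")
  case False
  then obtain v where v: "centralizer_norm A = absval (\<pi> :: 'a) powi v"
    using centralizer_norm_eq_powi[OF assms] by blast
  define U where "U = Pi_power (- v) ** A"
  have "U \<in> cyclic_centralizer \<pi>" unfolding U_def using assms by (intro cyclic_centralizer_mult) simp_all
  moreover have "centralizer_norm U = 1"
    using v by (simp add: U_def centralizer_norm_def matrix_vector_mul_assoc [symmetric] cyclic_norm_Pi_power
      power_int_minus)
  ultimately have "cyclic_norm (U *v x) = cyclic_norm x" by (rule cyclic_norm_mult_unit)
  moreover have "A = Pi_power v ** U" by (simp add: U_def cyclic_mat_cancel)
  ultimately show ?thesis
    by (metis v cyclic_norm_Pi_power matrix_vector_mul_assoc)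
qed (simp add: centralizer_norm_def)

lemma centralizer_norm_mult:
  assumes "A \<in> cyclic_centralizer \<pi>"
  shows "centralizer_norm (A ** B) = centralizer_norm A * centralizer_norm B"
  unfolding centralizer_norm_def [of "A ** B"] centralizer_norm_def [of B] matrix_vector_mul_assoc [symmetric]
  by (rule cyclic_norm_mult[OF assms])

lemma entries_le_1_iff_centralizer_norm:
  fixes A :: "'a::nonarch_local_field_0^'n^'n"
  assumes "A \<in> cyclic_centralizer \<pi>"
  shows "entries_le 1 A \<longleftrightarrow> centralizer_norm A \<le> 1"
proof
  assume "entries_le 1 A"
  then show "centralizer_norm A \<le> 1"
    unfolding centralizer_norm_def cyclic_norm_le_1_iff mult_axis_nth by (simp add: entries_le_def)
next
  assume A: "centralizer_norm A \<le> 1"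
  have "cyclic_norm (A *v axis j 1) \<le> 1" for j
  proof -
    have "absval (\<pi> :: 'a) powi pos j \<le> absval (\<pi> :: 'a) powi 0"
      unfolding absval_uniformizer_powi_le_iff by simp
    then show ?thesis
      using A by (simp add: cyclic_norm_mult[OF assms] cyclic_norm_axis mult_le_one)
  qed
  then show "entries_le 1 A"
    unfolding cyclic_norm_le_1_iff mult_axis_nth entries_le_def by blast
qed

lemma GL_O_iff_centralizer_norm:
  fixes A :: "'a::nonarch_local_field_0^'n^'n"
  assumes "A \<in> cyclic_centralizer \<pi>"
  shows "A \<in> GL_O \<longleftrightarrow> centralizer_norm A = 1"
proof -
  have inverse: "centralizer_norm A * centralizer_norm (matrix_inv A) = 1"
      "matrix_inv A \<in> cyclic_centralizer \<pi>"
    if "invertible A"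
    using that assms centralizer_norm_mult[OF assms, of "matrix_inv A"] centralizer_norm_mat[of "1 :: 'a",
      where 'n = 'n]
    by (simp_all add: matrix_inv_props cyclic_centralizer_matrix_inv)
  show ?thesis
  proof
    assume A: "A \<in> GL_O"
    then have "centralizer_norm A \<le> 1" "centralizer_norm (matrix_inv A) \<le> 1"
      using entries_le_1_iff_centralizer_norm[OF assms] entries_le_1_iff_centralizer_norm[OF inverse(2)]
      by (simp_all add: GL_O_D)
    then show "centralizer_norm A = 1"
      using inverse(1)[OF GL_O_D(1)[OF A]] mult_left_le[of "centralizer_norm (matrix_inv A)"
        "centralizer_norm A"] by simp
  next
    assume norm: "centralizer_norm A = 1"
    then have "x = 0" if "A *v x = 0" for x
      using cyclic_norm_mult[OF assms, of x] that by simp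
    then have "invertible A" unfolding invertible_iff_mult_vec_eq_0 by blast
    then show "A \<in> GL_O"
      using norm inverse entries_le_1_iff_centralizer_norm[OF assms]
        entries_le_1_iff_centralizer_norm[OF inverse(2)] by (simp add: GL_O_def)
  qed
qed

lemma entries_le_if_centralizer_norm_le:
  fixes A :: "'a::nonarch_local_field_0^'n^'n"
  assumes "A \<in> cyclic_centralizer \<pi>" "centralizer_norm A \<le> absval (\<pi> :: 'a) powi (int CARD('n) * q)"
  shows "entries_le (absval (\<pi> :: 'a) powi q) A"
proof -
  let ?w = "absval (\<pi> :: 'a)" and ?B = "mat (\<pi> powi (- q)) ** A"
  have "centralizer_norm ?B = (?w powi (- q)) ^ CARD('n) * centralizer_norm A"
    by (simp add: centralizer_norm_mult centralizer_norm_mat absval_power_int)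
  also have "\<dots> \<le> (?w powi (- q)) ^ CARD('n) * ?w powi (int CARD('n) * q)"
    using assms(2) by (intro mult_left_mono) simp_all
  also have "\<dots> = 1" by (simp flip: power_int_nat_mult_add)
  finally have "entries_le 1 ?B"
    using assms(1) by (simp add: entries_le_1_iff_centralizer_norm cyclic_centralizer_mult)
  then have "entries_le (?w powi q * 1) (mat (\<pi> powi q) ** ?B)"
    by (intro entries_le_mult entries_le_mat) (simp_all add: absval_power_int)
  moreover have "mat (\<pi> powi q) ** ?B = A"
    by (simp add: matrix_mul_assoc mat_mult_mat power_int_minus)
  ultimately show ?thesis by simp
qed

lemma entries_le_Pi_power:
  "int CARD('n) * q \<le> v \<Longrightarrow> entries_le (absval (\<pi> :: 'a) powi q)
      (Pi_power v :: 'a::nonarch_local_field_0^'n^'n)"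
  by (intro entries_le_if_centralizer_norm_le) (simp_all add: centralizer_norm_Pi_power
    absval_uniformizer_powi_le_iff)

lemma val_det_Pi_power: "val (det (Pi_power v :: 'a::nonarch_local_field_0^'n^'n)) = v"
proof (rule val_eqI)
  show "det (Pi_power v :: 'a^'n^'n) \<noteq> 0"
    using invertible_cyclic_mat[of "\<pi> :: 'a" v, where 'n = 'n] by (simp add: invertible_det_nz)
  have "absval (det (Pi_power v :: 'a^'n^'n)) ^ CARD('n) = (absval (\<pi> :: 'a) powi v) ^ CARD('n)"
    using det_cyclic_mat_power_CARD[of "\<pi> :: 'a" v, where 'n = 'n]
    by (simp flip: absval_power absval_power_int)
  then show "absval (det (Pi_power v :: 'a^'n^'n)) = absval (\<pi> :: 'a) powi v"
    by (simp add: power_eq_iff_eq_base)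
qed

lemma absval_det_cyclic_centralizer:
  fixes A :: "'a::nonarch_local_field_0^'n^'n"
  assumes "A \<in> cyclic_centralizer \<pi>"
  shows "absval (det A) = centralizer_norm A"
proof (cases "A = 0")
  case False
  then obtain v where v: "centralizer_norm A = absval (\<pi> :: 'a) powi v"
    using centralizer_norm_eq_powi[OF assms] by blast
  define U where "U = Pi_power (- v) ** A"
  have "U \<in> cyclic_centralizer \<pi>" unfolding U_def using assms by (intro cyclic_centralizer_mult) simp_all
  moreover have "centralizer_norm U = 1"
    using v by (simp add: U_def centralizer_norm_mult centralizer_norm_Pi_power power_int_minus)
  ultimately have "absval (det U) = 1" using GL_O_iff_centralizer_norm absval_det_GL_O by blast
  moreover have "det A = det (Pi_power v :: 'a^'n^'n) * det U"
    by (simp add: U_def cyclic_mat_cancel flip: det_mul)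
  moreover have "det (Pi_power v :: 'a^'n^'n) \<noteq> 0"
    using invertible_cyclic_mat[of "\<pi> :: 'a" v, where 'n = 'n] by (simp add: invertible_det_nz)
  then have "absval (det (Pi_power v :: 'a^'n^'n)) = absval (\<pi> :: 'a) powi v"
    using absval_eq_powi_val val_det_Pi_power by metis
  ultimately show ?thesis by (simp add: absval_mult v)
qed (use det_mat[of "0 :: 'a", where 'n = 'n] in \<open>simp add: centralizer_norm_def power_0_left\<close>)

lemma conj_Pi_power_mult:
  fixes h :: "'a::nonarch_local_field_0^'n^'n"
  assumes "invertible h" "A \<in> cyclic_centralizer \<pi>"
  shows "matrix_inv (Pi_power v ** h) ** A ** (Pi_power v ** h) = matrix_inv h ** A ** h"
proof -
  have "Pi_power (- v) ** A ** Pi_power v = (A :: 'a^'n^'n)"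
    unfolding matrix_mul_assoc [symmetric] cyclic_mat_commute[OF assms(2) uniformizer_nonzero]
    by (simp add: cyclic_mat_cancel)
  then have "matrix_inv h ** (Pi_power (- v) ** A ** Pi_power v) ** h = matrix_inv h ** A ** h" by simp
  then show ?thesis
    using assms(1) by (simp add: matrix_inv_mult invertible_cyclic_mat matrix_inv_cyclic_mat matrix_mul_assoc)
qed

text \<open>
  A column \<open>g e\<^sub>b\<close> of norm \<open>1\<close> equals \<open>V e\<^sub>0\<close> for some \<open>V \<in> GL\<^sub>n(O)\<close> commuting with the companion matrix
  \<open>\<Pi>\<close>, so that the columns of \<open>g\<^sup>-\<^sup>1 V\<close> are those of the conjugates \<open>g\<^sup>-\<^sup>1 \<Pi>\<^sup>k g\<close> with index \<open>b\<close>.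
\<close>

lemma entries_le_matrix_inv_if_conj_Pi_power:
  fixes g :: "'a::nonarch_local_field_0^'n^'n"
  assumes g: "invertible g" and b: "cyclic_norm (g *v axis b 1) = 1"
    and conj: "\<And>k. k < CARD('n) \<Longrightarrow> entries_le r (matrix_inv g ** Pi_power (int k) ** g)"
  shows "entries_le r (matrix_inv g)"
proof -
  obtain f where f: "matrix_poly (Pi_power 1 :: 'a^'n^'n) f *v base_axis = g *v axis b 1"
    by (rule exists_matrix_poly_base_axis[OF uniformizer_nonzero])
  define V where "V = matrix_poly (Pi_power 1 :: 'a^'n^'n) f"
  have VZ: "V \<in> cyclic_centralizer \<pi>" by (simp add: V_def)
  then have V: "V \<in> GL_O" using b f by (simp add: GL_O_iff_centralizer_norm centralizer_norm_def V_def)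
  have "entries_le r (matrix_inv g ** V)"
    unfolding entries_le_def
  proof (intro allI)
    fix i k :: 'n
    define j where "j = nat (pos k)"
    have j: "j < CARD('n)" "axis k 1 = Pi_power (int j) *v (base_axis :: 'a^'n)"
      using cyclic_mat_base_axis[of j, where 'n = 'n and c = "\<pi> :: 'a"] pos_less[of k]
      by (simp_all add: j_def nat_less_iff)
    have "(matrix_inv g ** V) *v axis k 1 = (matrix_inv g ** Pi_power (int j)) *v (V *v base_axis)"
      unfolding j(2) matrix_vector_mul_assoc matrix_mul_assoc [symmetric]
        cyclic_mat_commute[OF VZ uniformizer_nonzero] ..
    also have "\<dots> = (matrix_inv g ** Pi_power (int j) ** g) *v axis b 1"
      unfolding V_def f by (simp only: matrix_vector_mul_assoc matrix_mul_assoc)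
    finally have "(matrix_inv g ** V) $ i $ k = (matrix_inv g ** Pi_power (int j) ** g) $ i $ b"
      unfolding mult_axis_nth [symmetric] by simp
    then show "absval ((matrix_inv g ** V) $ i $ k) \<le> r" using conj[OF j(1)] by (simp add: entries_le_def)
  qed
  then have "entries_le (r * 1) (matrix_inv g ** V ** matrix_inv V)"
    using GL_O_D(3)[OF V] by (rule entries_le_mult)
  then show ?thesis
    using GL_O_D(1)[OF V] by (simp add: matrix_mul_assoc [symmetric] matrix_inv_props)
qed

lemma exists_integral_Pi_power_mult:
  fixes h :: "'a::nonarch_local_field_0^'n^'n"
  assumes h: "invertible h" and conj: "\<And>k. k < CARD('n) \<Longrightarrow>
      entries_le r (matrix_inv h ** Pi_power (int k) ** h)"
  obtains v where "entries_le 1 (Pi_power v ** h)" "entries_le r (matrix_inv (Pi_power v ** h))"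
proof -
  obtain b where b: "\<And>j. cyclic_norm (h *v axis j 1) \<le> cyclic_norm (h *v axis b 1)"
    using finite_ex_max_image[of UNIV "\<lambda>j. cyclic_norm (h *v axis j 1)"] by auto
  have "h *v axis b 1 \<noteq> 0" using h unfolding invertible_iff_mult_vec_eq_0
    by (metis axis_eq_0_iff zero_neq_one)
  then obtain u where u: "cyclic_norm (h *v axis b 1) = absval (\<pi> :: 'a) powi u"
    using cyclic_norm_eq_powi by metis
  define g where "g = Pi_power (- u) ** h"
  have g: "invertible g" unfolding g_def using h by (intro invertible_mult invertible_cyclic_mat) simp_all
  have norm: "cyclic_norm (g *v axis j 1) = absval (\<pi> :: 'a) powi (- u) * cyclic_norm (h *v axis j 1)" for j
    by (simp add: g_def matrix_vector_mul_assoc [symmetric] cyclic_norm_Pi_power)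
  then have b1: "cyclic_norm (g *v axis b 1) = 1" by (simp add: u power_int_minus)
  moreover have "cyclic_norm (g *v axis j 1) \<le> cyclic_norm (g *v axis b 1)" for j
    unfolding norm using b by (intro mult_left_mono) simp_all
  ultimately have "entries_le 1 g"
    by (simp add: entries_le_def cyclic_norm_le_1_iff mult_axis_nth)
  moreover have "entries_le r (matrix_inv g)"
    using g b1 conj unfolding g_def
    by (intro entries_le_matrix_inv_if_conj_Pi_power) (simp_all add: conj_Pi_power_mult[OF h])
  ultimately show ?thesis using that unfolding g_def by blast
qed

lemma irreducible_monom_minus_uniformizer:
  "irreducible (monom 1 CARD('n::finite) - [:\<pi> :: 'a::nonarch_local_field_0:])"
proof (rule Factorial_Ring.irreducibleI)
  let ?p = "monom 1 CARD('n) - [:\<pi> :: 'a:]" and ?M = "Pi_power 1 :: 'a^'n^'n"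
  have "degree (monom (1 :: 'a) CARD('n) + - [:\<pi>:]) = CARD('n)"
    by (subst degree_add_eq_left) (simp_all add: degree_monom_eq)
  then have deg: "degree ?p = CARD('n)" by (simp only: diff_conv_add_uminus)
  then show nonzero: "?p \<noteq> 0" by auto
  show "\<not> ?p dvd 1"
    using is_unit_iff_degree[OF nonzero] deg by simp
  fix f g assume fg: "?p = f * g"
  then have nz: "f \<noteq> 0" "g \<noteq> 0" using nonzero by auto
  have "matrix_poly ?M ?p = 0"
    using cyclic_mat_CARD_mult[of "\<pi> :: 'a" 1, where 'n = 'n]
    by (simp add: matrix_poly_diff matrix_poly_monom_cyclic_mat)
  then have "centralizer_norm (matrix_poly ?M f) * centralizer_norm (matrix_poly ?M g) = 0"
    unfolding fg matrix_poly_mult centralizer_norm_mult[OF matrix_poly_in_cyclic_centralizer, symmetric]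
    by (simp add: centralizer_norm_def)
  then have "matrix_poly ?M f = 0 \<or> matrix_poly ?M g = 0"
    using centralizer_norm_eq_powi[OF matrix_poly_in_cyclic_centralizer]
    by (metis mult_eq_0_iff power_int_eq_0_iff uniformizer_nonzero absval_eq_0_iff)
  then have "CARD('n) \<le> degree f \<or> CARD('n) \<le> degree g"
    using degree_if_matrix_poly_cyclic_mat_eq_0[OF uniformizer_nonzero] nz by blast
  moreover have "degree f + degree g = CARD('n)" using degree_mult_eq[OF nz] fg deg by simp
  ultimately show "f dvd 1 \<or> g dvd 1" using nz by (auto simp: is_unit_iff_degree)
qed

lemma centralizer_norm_add: "centralizer_norm (A + B) \<le> max (centralizer_norm A) (centralizer_norm B)"
  using cyclic_norm_add[of "A *v base_axis" "B *v base_axis"]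
  by (simp add: centralizer_norm_def matrix_vector_mult_add_rdistrib)

lemma centralizer_norm_matrix_poly_power_minus_1:
  fixes f :: "'a::nonarch_local_field_0 poly"
  assumes "centralizer_norm (matrix_poly (Pi_power 1 :: 'a^'n^'n) (f - 1)) \<le> r" "r \<le> 1"
  shows "centralizer_norm (matrix_poly (Pi_power 1 :: 'a^'n^'n) (f ^ k - 1)) \<le> r"
proof (induction k)
  case 0
  show ?case using assms(1) by (simp add: centralizer_norm_def order_trans[OF cyclic_norm_nonneg])
next
  case (Suc k)
  let ?N = "\<lambda>f. centralizer_norm (matrix_poly (Pi_power 1 :: 'a^'n^'n) f)"
  have mult: "?N (g * h) = ?N g * ?N h" for g h by (simp add: matrix_poly_mult centralizer_norm_mult)
  have add: "?N (g + h) \<le> max (?N g) (?N h)" for g h unfolding matrix_poly_add by (rule centralizer_norm_add)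
  have "?N f \<le> 1"
    using add[of "f - 1" 1] assms centralizer_norm_mat[of "1 :: 'a", where 'n = 'n] by auto
  then have "?N (f * (f ^ k - 1)) \<le> r" unfolding mult using Suc.IH mult_mono[of "?N f" 1 "?N (f ^ k - 1)" r]
    by simp
  moreover have eq: "f ^ Suc k - 1 = f * (f ^ k - 1) + (f - 1)" by (simp add: algebra_simps)
  ultimately show ?case unfolding eq using assms(1) by (intro order_trans[OF add]) simp
qed

text \<open>\<open>f\<^sup>p - 1 = (f - 1)(1 + f + \<dots> + f\<^bsup>p-1\<^esup>)\<close>, and the second factor is close to \<open>p\<close>, hence to \<open>0\<close>.\<close>

lemma centralizer_norm_matrix_poly_power_prime:
  fixes f :: "'a::nonarch_local_field_0 poly"
  assumes p: "absval (of_nat p :: 'a) < 1"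
    and f: "centralizer_norm (matrix_poly (Pi_power 1 :: 'a^'n^'n) (f - 1)) \<le> absval (\<pi> :: 'a) ^ Suc i"
  shows "centralizer_norm (matrix_poly (Pi_power 1 :: 'a^'n^'n) (f ^ p - 1)) \<le> absval (\<pi> :: 'a) ^ Suc (Suc i)"
proof -
  let ?N = "\<lambda>f. centralizer_norm (matrix_poly (Pi_power 1 :: 'a^'n^'n) f)" and ?w = "absval (\<pi> :: 'a)"
  have mult: "?N (g * h) = ?N g * ?N h" for g h by (simp add: matrix_poly_mult centralizer_norm_mult)
  have add: "?N (g + h) \<le> max (?N g) (?N h)" for g h unfolding matrix_poly_add by (rule centralizer_norm_add)
  have "?w ^ Suc i \<le> ?w" using power_decreasing[of 1 "Suc i" ?w] by (simp add: less_imp_le)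
  then have near: "?N (f - 1) \<le> ?w" using f by linarith
  have powers: "?N (f ^ j - 1) \<le> ?w" for j
    using near by (rule centralizer_norm_matrix_poly_power_minus_1) (simp add: less_imp_le)
  have "?N (of_nat p) = absval (of_nat p :: 'a) ^ CARD('n)"
    by (simp add: of_nat_poly centralizer_norm_mat)
  also have "\<dots> \<le> absval (of_nat p :: 'a)"
    using p power_decreasing[of 1 "CARD('n)" "absval (of_nat p :: 'a)"] by (simp add: Suc_le_eq)
  finally have p_small: "?N (of_nat p) \<le> ?w" using absval_le_uniformizer[OF p] by linarith
  have "?N (of_nat k + (\<Sum>j<k. f ^ j - 1)) \<le> max (?N (of_nat k)) ?w" for k
  proof -
    have "?N (\<Sum>j<k. f ^ j - 1) \<le> ?w"
      unfolding matrix_poly_sum centralizer_norm_def sum_matrix_vector_mult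
      by (rule cyclic_norm_sum_le) (use powers in \<open>simp_all add: centralizer_norm_def\<close>)
    then show ?thesis using add[of "of_nat k" "\<Sum>j<k. f ^ j - 1"] by linarith
  qed
  from this[of p] have "?N (\<Sum>j<p. f ^ j) \<le> ?w" using p_small by (simp add: sum_subtractf)
  then have "?N (f - 1) * ?N (\<Sum>j<p. f ^ j) \<le> ?w ^ Suc i * ?w" using f by (intro mult_mono) simp_all
  then show ?thesis unfolding mult [symmetric] by (simp add: power_diff_1_eq mult.commute)
qed

lemma centralizer_norm_matrix_poly_prime_power:
  fixes f :: "'a::nonarch_local_field_0 poly"
  assumes p: "absval (of_nat p :: 'a) < 1"
    and f: "centralizer_norm (matrix_poly (Pi_power 1 :: 'a^'n^'n) (f - 1)) \<le> absval (\<pi> :: 'a)"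
  shows "centralizer_norm (matrix_poly (Pi_power 1 :: 'a^'n^'n) (f ^ (p ^ s) - 1)) \<le> absval (\<pi> :: 'a) ^ Suc s"
proof (induction s)
  case (Suc s)
  then have "centralizer_norm (matrix_poly (Pi_power 1 :: 'a^'n^'n) ((f ^ (p ^ s)) ^ p - 1)) \<le>
      absval (\<pi> :: 'a) ^ Suc (Suc s)"
    by (rule centralizer_norm_matrix_poly_power_prime[OF p])
  then show ?case by (simp add: power_mult [symmetric] mult.commute)
qed (use f in simp)

lemma exists_scalar_near_cyclic_norm_1:
  fixes x :: "'a::nonarch_local_field_0^'n"
  assumes x: "cyclic_norm x = 1"
  obtains a where "absval a = 1" "cyclic_norm (x - a *s base_axis) \<le> absval (\<pi> :: 'a)"
proof
  let ?w = "absval (\<pi> :: 'a)" and ?a = "x $ at_pos 0"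
  show "absval ?a = 1" using absval_base_coordinate_eq_1 x by blast
  have "absval ((x - ?a *s base_axis) $ i) ^ CARD('n) * ?w powi pos i \<le> ?w" for i
  proof (cases "i = at_pos 0")
    case False
    then have "1 \<le> pos i" using at_pos_pos[of i] pos_nonneg[of i]
      by (metis int_one_le_iff_zero_less order_le_less)
    then have "?w powi pos i \<le> ?w powi 1" by (simp only: absval_uniformizer_powi_le_iff)
    moreover have "absval (x $ i) ^ CARD('n) \<le> 1"
      using x cyclic_norm_le_1_iff[of x] by (intro power_le_one) simp_all
    ultimately have "absval (x $ i) ^ CARD('n) * ?w powi pos i \<le> 1 * ?w powi 1" by (intro mult_mono) simp_all
    then show ?thesis using False by (simp add: axis_def)
  qed (simp add: axis_def power_0_left)
  then show "cyclic_norm (x - ?a *s base_axis) \<le> ?w" unfolding cyclic_norm_le_iff by blast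
qed

lemma GL_O_centralizer_power_near_scalar:
  fixes f :: "'a::nonarch_local_field_0 poly"
  assumes p: "absval (of_nat p :: 'a) < 1" and f: "matrix_poly (Pi_power 1 :: 'a^'n^'n) f \<in> GL_O"
    and r: "0 < r"
  obtains s a where "absval a = 1" "entries_le r (matrix_poly (Pi_power 1 :: 'a^'n^'n) (f ^ (p ^ s)) - mat a)"
proof -
  let ?M = "Pi_power 1 :: 'a^'n^'n" and ?w = "absval (\<pi> :: 'a)"
  let ?N = "\<lambda>f. centralizer_norm (matrix_poly ?M f)"
  have smult: "?N (smult c g) = ?N g" if "absval c = 1" for c g
    using that by (simp add: matrix_poly_smult centralizer_norm_mult centralizer_norm_mat)
  have "cyclic_norm (matrix_poly ?M f *v base_axis) = 1"
    using f by (simp add: GL_O_iff_centralizer_norm centralizer_norm_def)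
  then obtain a where a: "absval a = 1" "?N (f - [:a:]) \<le> ?w"
    by (rule exists_scalar_near_cyclic_norm_1)
      (simp add: centralizer_norm_def matrix_poly_diff matrix_vector_mult_diff_rdistrib mat_mult_vec)
  then have nz: "a \<noteq> 0" by auto
  define g where "g = smult (inverse a) f"
  have "g - 1 = smult (inverse a) (f - [:a:])" using nz by (simp add: g_def smult_diff_right one_pCons)
  then have "?N (g - 1) \<le> ?w" using a by (simp only: smult absval_inverse inverse_1)
  then have powers: "?N (g ^ (p ^ s) - 1) \<le> ?w ^ Suc s" for s
    by (rule centralizer_norm_matrix_poly_prime_power[OF p])
  obtain q where q: "?w ^ q < r" using real_arch_pow_inv[OF r, of ?w] by auto
  define s where "s = CARD('n) * q"
  have b: "absval (a ^ (p ^ s)) = 1" by (simp add: absval_power a)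
  have "f = smult a g" using nz by (simp add: g_def)
  then have "f ^ (p ^ s) - [:a ^ (p ^ s):] = smult (a ^ (p ^ s)) (g ^ (p ^ s) - 1)"
    by (simp add: smult_power [symmetric] smult_diff_right one_pCons)
  then have "?N (f ^ (p ^ s) - [:a ^ (p ^ s):]) = ?N (g ^ (p ^ s) - 1)" by (simp only: smult b)
  also have "\<dots> \<le> ?w ^ Suc s" by (rule powers)
  also have "\<dots> \<le> ?w ^ s" by (intro power_decreasing) (simp_all add: less_imp_le)
  finally have "entries_le (?w powi int q) (matrix_poly ?M (f ^ (p ^ s) - [:a ^ (p ^ s):]))"
    by (intro entries_le_if_centralizer_norm_le) (simp_all add: s_def flip: of_nat_mult)
  then have "entries_le r (matrix_poly ?M (f ^ (p ^ s)) - mat (a ^ (p ^ s)))"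
    using q by (auto simp: matrix_poly_diff intro: entries_le_mono)
  then show ?thesis using that b by blast
qed

section \<open>Regular semisimplicity\<close>

lemma det_eq_0_iff_eigenvector:
  fixes A :: "'k::field^'n^'n"
  shows "det (mat z - A) = 0 \<longleftrightarrow> (\<exists>v. v \<noteq> 0 \<and> A *v v = z *s v)"
proof -
  have "(mat z - A) *v v = 0 \<longleftrightarrow> A *v v = z *s v" for v
    by (auto simp: matrix_vector_mult_diff_rdistrib mat_mult_vec)
  then show ?thesis
    using invertible_det_nz[of "mat z - A"] invertible_iff_mult_vec_eq_0[of "mat z - A"] by blast
qed

lemma eigenvectors_independent:
  fixes A :: "'k::field^'n^'n"
  assumes "finite J" "inj_on l J" "\<And>j. j \<in> J \<Longrightarrow> u j \<noteq> 0 \<and> A *v u j = l j *s u j"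
    "(\<Sum>j\<in>J. x j *s u j) = 0" "j \<in> J"
  shows "x j = 0"
  using assms
proof (induction J arbitrary: x j rule: finite_induct)
  case (insert k J)
  have lin: "A *v (\<Sum>j\<in>S. y j *s u j) = (\<Sum>j\<in>S. y j *s (A *v u j))" for S and y :: "_ \<Rightarrow> 'k"
    by (induction S rule: infinite_finite_induct)
      (simp_all add: matrix_vector_right_distrib vector_scalar_commute)
  have "0 = A *v (\<Sum>j\<in>insert k J. x j *s u j)" using insert.prems(3) by simp
  also have "\<dots> = (\<Sum>j\<in>insert k J. (x j * l j) *s u j)"
    unfolding lin by (rule sum.cong) (use insert.prems(2) in \<open>auto simp: vector_smult_assoc\<close>)
  finally have "(\<Sum>j\<in>insert k J. (x j * l j) *s u j) = 0" by simp
  moreover have "(\<Sum>j\<in>insert k J. (x j * l k) *s u j) = l k *s (\<Sum>j\<in>insert k J. x j *s u j)"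
    by (simp add: vec_eq_iff sum_distrib_left mult_ac)
  ultimately have "(\<Sum>j\<in>insert k J. (x j * (l j - l k)) *s u j) = 0"
    using insert.prems(3) by (simp add: right_diff_distrib vector_sub_rdistrib sum_subtractf)
  then have comb: "(\<Sum>j\<in>J. (x j * (l j - l k)) *s u j) = 0" using insert.hyps by simp
  have rest: "x i = 0" if "i \<in> J" for i
  proof -
    have "x i * (l i - l k) = 0"
      using insert.IH[OF _ _ comb that] insert.prems(1,2) by (auto simp: inj_on_insert)
    moreover have "l i \<noteq> l k"
      using insert.prems(1) insert.hyps(2) that by (metis inj_on_contraD insertI1 insertI2)
    ultimately show ?thesis by simp
  qed
  then have "x k *s u k = 0" using insert.prems(3) insert.hyps by (simp add: sum.neutral)
  then have "x k = 0" using insert.prems(2)[of k] by (simp add: vector_mul_eq_0)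
  then show ?case using rest insert.prems(4) by auto
qed simp

lemma exists_diagonalization:
  fixes A :: "'k::field^'n^'n" and l :: "'n \<Rightarrow> 'k"
  assumes "inj l" "\<And>j. det (mat (l j) - A) = 0"
  obtains P where "invertible P" "A ** P = P ** (\<chi> i j. if i = j then l i else 0)"
proof -
  obtain u where u: "u j \<noteq> 0 \<and> A *v u j = l j *s u j" for j
    using assms(2) unfolding det_eq_0_iff_eigenvector by metis
  define P where "P = (\<chi> i j. u j $ i)"
  have "P *v x = (\<Sum>j\<in>UNIV. x $ j *s u j)" for x
    by (simp add: P_def vec_eq_iff matrix_vector_mult_def mult.commute)
  then have "x $ j = 0" if "P *v x = 0" for x j
    using that by (intro eigenvectors_independent[of UNIV l u A "\<lambda>j. x $ j"]) (use u assms(1) in simp_all)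
  then have "invertible P" unfolding invertible_iff_mult_vec_eq_0 by (simp add: vec_eq_iff)
  moreover have "A ** P = P ** (\<chi> i j. if i = j then l i else 0)"
  proof -
    have "(A ** P) $ i $ j = (A *v u j) $ i" for i j
      by (simp add: P_def matrix_matrix_mult_def matrix_vector_mult_def)
    then show ?thesis using u
      by (simp add: vec_eq_iff) (simp add: P_def matrix_matrix_mult_def if_distrib [of "\<lambda>x. _ * x"]
        mult.commute cong: if_cong)
  qed
  ultimately show ?thesis using that by blast
qed

lemma similar_if_common_eigenvalues:
  fixes A B :: "'k::field^'n^'n" and l :: "'n \<Rightarrow> 'k"
  assumes "inj l" "\<And>j. det (mat (l j) - A) = 0" "\<And>j. det (mat (l j) - B) = 0"
  obtains g where "invertible g" "B ** g = g ** A"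
proof -
  let ?D = "\<chi> i j. if i = j then l i else 0"
  obtain P where P: "invertible P" "A ** P = P ** ?D" using assms(1,2) by (rule exists_diagonalization)
  obtain Q where Q: "invertible Q" "B ** Q = Q ** ?D" using assms(1,3) by (rule exists_diagonalization)
  have "B ** (Q ** matrix_inv P) = Q ** ?D ** matrix_inv P" by (simp only: Q(2) matrix_mul_assoc)
  also have "\<dots> = Q ** matrix_inv P ** (A ** P) ** matrix_inv P"
    unfolding P(2) using P(1) by (simp add: matrix_mul_assoc) (simp add: matrix_mul_assoc [symmetric]
      matrix_inv_props)
  also have "\<dots> = Q ** matrix_inv P ** A" using P(1)
    by (simp add: matrix_mul_assoc [symmetric] matrix_inv_props)
  finally show ?thesis using that P(1) Q(1) by (meson invertible_mult matrix_inv_props(3))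
qed

definition charpoly :: "'k::field^'n^'n \<Rightarrow> 'k poly" where
  "charpoly A = det (\<chi> i j. (if i = j then [:0, 1:] else 0) - [:A $ i $ j:])"

lemma poly_charpoly: "poly (charpoly A) z = det (mat z - A)"
proof -
  have "poly (of_int k) z = of_int k" for k :: int by (simp add: of_int_poly)
  then show ?thesis unfolding charpoly_def det_def
    by (simp add: poly_sum poly_prod mat_def if_distrib [of "\<lambda>p. poly p z"] cong: if_cong)
qed

lemma poly_eq_if_infinite:
  fixes f g :: "'k::field poly"
  assumes "infinite S" "\<And>z. z \<in> S \<Longrightarrow> poly f z = poly g z"
  shows "f = g"
proof (rule ccontr)
  assume "f \<noteq> g"
  then have "finite {z. poly (f - g) z = 0}" by (intro poly_roots_finite) simp
  moreover have "S \<subseteq> {z. poly (f - g) z = 0}" using assms(2) by auto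
  ultimately show False using assms(1) finite_subset by blast
qed

lemma rat_algebra_sum:
  fixes S :: "('x \<Rightarrow> 'a::field alg_closure) set"
  shows "(\<And>i. i \<in> I \<Longrightarrow> f i \<in> rat_algebra S) \<Longrightarrow> (\<lambda>x. \<Sum>i\<in>I. f i x) \<in> rat_algebra S"
proof (induction I rule: infinite_finite_induct)
  case (insert i I)
  then show ?case using rat_algebra.add[of "f i" S "\<lambda>x. \<Sum>i\<in>I. f i x"] by simp
qed (use rat_algebra.const[of 0 S] in simp_all)

lemma rat_algebra_prod:
  fixes S :: "('x \<Rightarrow> 'a::field alg_closure) set"
  shows "(\<And>i. i \<in> I \<Longrightarrow> f i \<in> rat_algebra S) \<Longrightarrow> (\<lambda>x. \<Prod>i\<in>I. f i x) \<in> rat_algebra S"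
proof (induction I rule: infinite_finite_induct)
  case (insert i I)
  then show ?case using rat_algebra.mult[of "f i" S "\<lambda>x. \<Prod>i\<in>I. f i x"] by simp
qed (use rat_algebra.const[of 1 S] in simp_all)

lemma rat_algebra_det:
  fixes S :: "('x \<Rightarrow> 'a::field alg_closure) set"
  assumes "\<And>i j. (\<lambda>x. E x $ i $ j) \<in> rat_algebra S"
  shows "(\<lambda>x. det (E x)) \<in> rat_algebra S"
proof -
  have "(\<lambda>x. \<Sum>p | p permutes UNIV. to_ac (of_int (sign p)) * (\<Prod>i\<in>UNIV. E x $ i $ p i)) \<in> rat_algebra S"
    by (intro rat_algebra_sum rat_algebra.mult rat_algebra.const rat_algebra_prod assms)
  then show ?thesis by (simp add: det_def)
qed

lemma act_fst_mult_snd: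
  assumes "h \<in> carrier GLxGL"
  shows "fst (act h y) ** snd (act h y) = fst h ** (fst y ** snd y) ** matrix_inv (fst h)"
proof -
  have "fst (act h y) ** snd (act h y) =
      fst h ** fst y ** (matrix_inv (snd h) ** snd h) ** snd y ** matrix_inv (fst h)"
    by (simp add: act_def matrix_mul_assoc)
  moreover have "fst h ** fst y ** (matrix_inv (snd h) ** snd h) = fst h ** fst y"
    using assms by (simp add: GLxGL_def matrix_inv_props)
  ultimately show ?thesis by (simp add: matrix_mul_assoc)
qed

lemma det_mat_minus_conj:
  fixes A g :: "'k::field^'n^'n"
  assumes "invertible g"
  shows "det (mat z - g ** A ** matrix_inv g) = det (mat z - A)"
proof -
  have "g ** mat z ** matrix_inv g = mat z"
    unfolding mat_mult_commute[of z g, symmetric] using assms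
    by (simp add: matrix_mul_assoc [symmetric] matrix_inv_props)
  then have "mat z - g ** A ** matrix_inv g = g ** (mat z - A) ** matrix_inv g"
    by (simp add: matrix_diff_ldistrib matrix_diff_rdistrib)
  then show ?thesis using assms by (simp add: det_mul det_matrix_inv invertible_det_nz)
qed

lemma det_mat_minus_in_invariant_funs:
  "(\<lambda>y :: ('a::field alg_closure, 'n::finite) mat2. det (mat (to_ac l) - fst y ** snd y)) \<in> invariant_funs"
proof -
  let ?X = "coord_funs :: (('a alg_closure, 'n) mat2 \<Rightarrow> 'a alg_closure) set"
  have coord: "(\<lambda>y. fst y $ i $ j) \<in> rat_algebra ?X" "(\<lambda>y. snd y $ i $ j) \<in> rat_algebra ?X" for i j
    by (auto intro!: rat_algebra.gen simp: coord_funs_def)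
  have "(\<lambda>y. (mat (to_ac l) - fst y ** snd y) $ i $ j) \<in> rat_algebra ?X" for i j
  proof -
    have "(\<lambda>y. to_ac (if i = j then l else 0) + to_ac (- 1) * (\<Sum>k\<in>UNIV. fst y $ i $ k * snd y $ k $ j))
        \<in> rat_algebra ?X"
      by (intro rat_algebra.add rat_algebra.mult rat_algebra.const rat_algebra_sum coord)
    then show ?thesis by (simp add: mat_def matrix_matrix_mult_def if_distrib [of to_ac] cong: if_cong)
  qed
  then have "(\<lambda>y :: ('a alg_closure, 'n) mat2. det (mat (to_ac l) - fst y ** snd y)) \<in> regular_funs_X"
    unfolding regular_funs_X_def by (rule rat_algebra_det)
  then show ?thesis
    by (simp add: invariant_funs_def act_fst_mult_snd) (simp add: GLxGL_def det_mat_minus_conj)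
qed

lemma det_mat_minus_eq_on_quotient_fibre:
  fixes x :: "('a::field_char_0, 'n::finite) mat2"
  assumes "y \<in> quotient_fibre x"
  shows "det (mat z - fst y ** snd y) = det (mat z - fst (base_change x) ** snd (base_change x))"
proof -
  have "det (mat (to_ac l) - fst y ** snd y) =
      det (mat (to_ac l) - fst (base_change x) ** snd (base_change x))" for l
    using assms det_mat_minus_in_invariant_funs[of l, where ?'n = 'n] by (force simp: quotient_fibre_def)
  moreover have "infinite (range (to_ac :: 'a \<Rightarrow> _))"
    using inj_to_ac infinite_UNIV_char_0 by (blast dest: finite_imageD)
  ultimately have "charpoly (fst y ** snd y) = charpoly (fst (base_change x) ** snd (base_change x))"
    by (intro poly_eq_if_infinite[of "range to_ac"]) (auto simp: poly_charpoly)
  then show ?thesis by (metis poly_charpoly)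
qed

lemma orbit_subset_quotient_fibre: "Group_Action.orbit GLxGL act (base_change x) \<subseteq> quotient_fibre x"
  unfolding Group_Action.orbit_def quotient_fibre_def invariant_funs_def by blast

lemma det_map_matrix_to_ac: "det (map_matrix to_ac A) = to_ac (det A)"
  by (simp add: det_def to_ac_sum to_ac_prod)

lemma in_orbit_mat_1:
  fixes A B C g :: "'k::field^'n^'n"
  assumes "invertible g" "invertible C" "B ** C ** g = g ** A"
  shows "(B, C) \<in> Group_Action.orbit GLxGL act (A, mat 1)"
proof -
  have "g ** A ** matrix_inv (C ** g) = B ** (C ** (g ** matrix_inv g) ** matrix_inv C)"
    unfolding assms(3) [symmetric] using assms(1,2) by (simp add: matrix_inv_mult matrix_mul_assoc)
  then have "act (g, C ** g) (A, mat 1) = (B, C)"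
    using assms(1,2) by (simp add: act_def matrix_inv_props matrix_mul_assoc [symmetric])
  moreover have "(g, C ** g) \<in> carrier GLxGL" using assms(1,2) by (simp add: GLxGL_def invertible_mult)
  ultimately show ?thesis unfolding Group_Action.orbit_def by force
qed

lemma H_regular_semisimple_if_distinct_eigenvalues:
  fixes A :: "'a::field_char_0^'n^'n" and l :: "'n \<Rightarrow> 'a alg_closure"
  assumes A: "invertible A" and l: "inj l" "\<And>j. det (mat (l j) - map_matrix to_ac A) = 0"
  shows "H_regular_semisimple (A, mat 1)"
proof -
  let ?A = "map_matrix to_ac A"
  have bc: "base_change (A, mat 1) = (?A, mat 1)" by (simp add: base_change_def vec_eq_iff mat_def)
  have "y \<in> Group_Action.orbit GLxGL act (?A, mat 1)" if y: "y \<in> quotient_fibre (A, mat 1)" for y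
  proof -
    have "det (mat z - fst y ** snd y) = det (mat z - ?A)" for z
      using det_mat_minus_eq_on_quotient_fibre[OF y] by (simp add: bc)
    then obtain g where g: "invertible g" "fst y ** snd y ** g = g ** ?A"
      using similar_if_common_eigenvalues[OF l, of "fst y ** snd y"] l(2) by auto
    have "det (fst y ** snd y) * det g = det g * to_ac (det A)"
      using arg_cong[OF g(2), of det] by (simp add: det_mul det_map_matrix_to_ac)
    then have "invertible (snd y)" using A g(1) by (auto simp: invertible_det_nz det_mul)
    then show ?thesis using in_orbit_mat_1[OF g(1) _ g(2)] by simp
  qed
  then show ?thesis
    unfolding H_regular_semisimple_def using orbit_subset_quotient_fibre[of "(A, mat 1)"] unfolding bc
    by blast
qed

lemma card_roots_if_rsquarefree:
  fixes f :: "'k::alg_closed_field poly"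
  assumes "rsquarefree f"
  shows "card {z. poly f z = 0} = degree f"
proof -
  have f: "f \<noteq> 0" using assms by (simp add: rsquarefree_def)
  then obtain A where A: "size A = degree f" "f = smult (Polynomial.lead_coeff f) (\<Prod>x\<in>#A. [:- x, 1:])"
    using alg_closed_imp_factorization by blast
  have nz: "(\<Prod>x\<in>#B. [:- x, 1 :: 'k:]) \<noteq> 0" for B by (induction B) (simp_all del: mult_pCons_left)
  have "proots (\<Prod>x\<in>#B. [:- x, 1 :: 'k:]) = B" for B
  proof (induction B)
    case (add x B)
    then show ?case
      using proots_mult[of "[:- x, 1:]" "\<Prod>x\<in>#B. [:- x, 1:]"] nz by (simp del: mult_pCons_left)
  qed simp
  then have "proots f = A" using f by (subst A(2)) simp
  moreover have "proots f = mset_set {z. poly f z = 0}"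
    using f assms poly_roots_finite[OF f]
    by (intro multiset_eqI) (auto simp: count_mset_set' order_root rsquarefree_root_order)
  ultimately have "size (mset_set {z. poly f z = 0}) = degree f" using A(1) by simp
  then show ?thesis by simp
qed

lemma card_nth_roots_alg_closed:
  fixes c :: "'k::{alg_closed_field, field_char_0}"
  assumes "c \<noteq> 0" "0 < n"
  shows "card {z. z ^ n = c} = n"
proof -
  let ?f = "monom 1 n + [:- c:]"
  have "rsquarefree ?f"
    using assms by (auto simp: rsquarefree_roots pderiv_add pderiv_monom pderiv_pCons poly_monom power_0_left)
  then have "card {z. poly ?f z = 0} = degree ?f" by (rule card_roots_if_rsquarefree)
  also have "degree ?f = n" using assms(2) by (subst degree_add_eq_left) (simp_all add: degree_monom_eq)
  finally show ?thesis by (simp add: poly_monom)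
qed

lemma map_matrix_cyclic_mat:
  "map_matrix to_ac (cyclic_mat c v :: 'a::field^'n^'n) = cyclic_mat (to_ac c) v"
  by (simp add: cyclic_mat_def vec_eq_iff power_int_def)

lemma matrix_poly_linear: "matrix_poly M [:- z, 1:] = M - mat z"
  using matrix_poly_diff[of M "[:0, 1:]" "[:z:]"] by simp

lemma det_mat_minus_cyclic_mat_eq_0_iff:
  fixes c :: "'k::field"
  assumes c: "c \<noteq> 0"
  shows "det (mat z - cyclic_mat c 1 :: 'k^'n^'n) = 0 \<longleftrightarrow> z ^ CARD('n) = c"
proof
  let ?M = "cyclic_mat c 1 :: 'k^'n^'n"
  assume "det (mat z - ?M) = 0"
  then obtain v where v: "v \<noteq> 0" "?M *v v = z *s v" unfolding det_eq_0_iff_eigenvector by blast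
  have "cyclic_mat c (int k) *v v = z ^ k *s v" for k
  proof (induction k)
    case (Suc k)
    have "(cyclic_mat c (int (Suc k)) :: 'k^'n^'n) = cyclic_mat c (int k) ** ?M"
      using cyclic_mat_add[OF c, of "int k" 1, where 'n = 'n] by (simp add: add.commute)
    then show ?case
      by (simp add: matrix_vector_mul_assoc [symmetric] v(2) vector_scalar_commute Suc.IH vector_smult_assoc)
  qed simp
  from this[of "CARD('n)"] show "z ^ CARD('n) = c"
    using cyclic_mat_CARD_mult[of c 1, where 'n = 'n] v(1) by (simp add: mat_mult_vec)
next
  let ?M = "cyclic_mat c 1 :: 'k^'n^'n" and ?f = "monom 1 CARD('n) - [:c:]"
  assume z: "z ^ CARD('n) = c"
  then have "poly ?f z = 0" by (simp add: poly_monom)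
  then obtain q where q: "?f = [:- z, 1:] * q" unfolding poly_eq_0_iff_dvd by blast
  have "degree (monom (1 :: 'k) CARD('n) + - [:c:]) = CARD('n)"
    by (subst degree_add_eq_left) (simp_all add: degree_monom_eq)
  then have deg: "degree ?f = CARD('n)" by (simp only: diff_conv_add_uminus)
  then have "q \<noteq> 0" unfolding q by auto
  then have "degree q < CARD('n)" using deg unfolding q by (simp add: degree_mult_eq del: mult_pCons_left)
  then have nz: "matrix_poly ?M q \<noteq> 0"
    using degree_if_matrix_poly_cyclic_mat_eq_0[OF c \<open>q \<noteq> 0\<close>, where 'n = 'n] by auto
  have "matrix_poly ?M ?f = 0"
    using cyclic_mat_CARD_mult[of c 1, where 'n = 'n]
    by (simp add: matrix_poly_diff matrix_poly_monom_cyclic_mat[OF c])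
  then have "matrix_poly ?M [:- z, 1:] ** matrix_poly ?M q = 0" unfolding q matrix_poly_mult .
  then have "(mat z - ?M) ** matrix_poly ?M q = 0"
    by (simp add: matrix_poly_linear matrix_diff_rdistrib del: matrix_poly_pCons)
  then have "\<not> invertible (mat z - ?M)" using nz matrix_inv_cancel(1)[of "mat z - ?M" "matrix_poly ?M q"]
    by auto
  then show "det (mat z - ?M) = 0" by (simp add: invertible_det_nz)
qed

lemma H_regular_semisimple_cyclic_mat:
  fixes s c :: "'a::field_char_0"
  assumes s: "s \<noteq> 0" and c: "c \<noteq> 0"
  shows "H_regular_semisimple (mat s ** cyclic_mat c 1 :: 'a^'n^'n, mat 1)"
proof -
  let ?Z = "{z. z ^ CARD('n) = to_ac c}" and ?M = "cyclic_mat (to_ac c) 1 :: 'a alg_closure^'n^'n"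
  have "card ?Z = CARD('n)" using c by (intro card_nth_roots_alg_closed) auto
  then obtain b :: "'n \<Rightarrow> 'a alg_closure" where b: "bij_betw b UNIV ?Z"
    by (metis card_ge_0_finite finite finite_same_card_bij zero_less_card_finite)
  have "map_matrix to_ac (mat s ** cyclic_mat c 1 :: 'a^'n^'n) = mat (to_ac s) ** ?M"
    unfolding map_matrix_cyclic_mat [symmetric] by (simp add: vec_eq_iff)
  moreover have "det (mat (to_ac s * b j) - mat (to_ac s) ** ?M) = 0" for j
  proof -
    have "mat (to_ac s * b j) - mat (to_ac s) ** ?M = mat (to_ac s) ** (mat (b j) - ?M)"
      by (simp add: matrix_diff_ldistrib mat_mult_mat)
    moreover have "b j ^ CARD('n) = to_ac c" using b by (auto simp: bij_betw_def)
    ultimately show ?thesis using det_mat_minus_cyclic_mat_eq_0_iff[of "to_ac c", where 'n = 'n] c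
      by (simp add: det_mul)
  qed
  moreover have "inj (\<lambda>j. to_ac s * b j)" using b s by (auto simp: inj_def bij_betw_def)
  ultimately show ?thesis
    using s c by (intro H_regular_semisimple_if_distinct_eigenvalues[of _ "\<lambda>j. to_ac s * b j"])
      (simp_all add: invertible_mult invertible_mat invertible_cyclic_mat)
qed

section \<open>Anisotropy of the stabilizer\<close>

lemma stabilizer_mat_1:
  fixes A :: "'k::field^'n^'n"
  shows "stabilizer GLxGL act (A, mat 1) = {(e, e) | e. invertible e \<and> e ** A = A ** e}"
proof -
  have "act (a, b) (A, mat 1) = (A, mat 1) \<longleftrightarrow> a = b \<and> a ** A = A ** a" if inv: "invertible a" "invertible b"
      for a b
  proof -
    have right: "C ** matrix_inv d = D \<longleftrightarrow> C = D ** d" if "invertible d" for C D d :: "'k^'n^'n"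
      using that by (metis matrix_inv_props(1,2) matrix_mul_assoc matrix_mul_rid)
    show ?thesis using inv by (auto simp: act_def right)
  qed
  then show ?thesis by (auto simp: stabilizer_def GLxGL_def)
qed

definition ac_poly :: "'a::field poly \<Rightarrow> 'a alg_closure \<Rightarrow> 'a alg_closure" where
  "ac_poly f = poly (map_poly to_ac f)"

lemma ac_poly_0 [simp]: "ac_poly 0 z = 0"
  by (simp add: ac_poly_def)

lemma ac_poly_pCons [simp]: "ac_poly (pCons a f) z = to_ac a + z * ac_poly f z"
  by (simp add: ac_poly_def map_poly_pCons)

lemma ac_poly_1 [simp]: "ac_poly 1 z = 1"
  by (simp add: one_pCons)

lemma ac_poly_add [simp]: "ac_poly (f + g) z = ac_poly f z + ac_poly g z"
  by (induction f g rule: poly_induct2) (simp_all add: algebra_simps)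

lemma ac_poly_diff [simp]: "ac_poly (f - g) z = ac_poly f z - ac_poly g z"
  using ac_poly_add[of "f - g" g z] by (simp add: eq_diff_eq)

lemma ac_poly_smult [simp]: "ac_poly (smult a f) z = to_ac a * ac_poly f z"
  by (induction f) (simp_all add: algebra_simps)

lemma ac_poly_mult [simp]: "ac_poly (f * g) z = ac_poly f z * ac_poly g z"
  by (induction f) (simp_all add: algebra_simps)

lemma ac_poly_power [simp]: "ac_poly (f ^ k) z = ac_poly f z ^ k"
  by (induction k) simp_all

lemma ac_poly_monom: "ac_poly (monom a k) z = to_ac a * z ^ k"
  by (induction k) (simp_all add: monom_0 monom_Suc)

lemma infinite_ac_poly_neq_0:
  fixes p :: "'a::field_char_0 poly"
  assumes "p \<noteq> 0"
  shows "infinite {z. ac_poly p z \<noteq> 0}"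
proof -
  have "map_poly to_ac p \<noteq> 0" using assms by (simp add: map_poly_eq_0_iff)
  then have "finite {z. ac_poly p z = 0}" unfolding ac_poly_def by (rule poly_roots_finite)
  then show ?thesis
    using infinite_UNIV_char_0[where 'a = "'a alg_closure"] by (simp add: Collect_neg_eq Compl_eq_Diff_UNIV)
qed

lemma exists_ac_poly_root:
  assumes "degree f \<noteq> 0"
  obtains z where "ac_poly f z = 0"
proof -
  have "degree (map_poly to_ac f) \<noteq> 0" using assms by (simp add: degree_map_poly)
  then have "\<exists>z. poly (map_poly to_ac f) z = 0" by (intro alg_closed_imp_poly_has_root) simp
  then show ?thesis using that unfolding ac_poly_def by blast
qed

text \<open>A nonzero polynomial of minimal degree vanishing at \<open>z\<close> divides every polynomial vanishing at \<open>z\<close>.\<close>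

lemma irreducible_dvd_if_common_root:
  fixes p f :: "'a::field poly"
  assumes p: "irreducible p" and root: "ac_poly p z = 0" "ac_poly f z = 0"
  shows "p dvd f"
proof -
  have "p \<noteq> 0" using p by auto
  then obtain q where q: "q \<noteq> 0" "ac_poly q z = 0"
    and min: "\<And>g. g \<noteq> 0 \<Longrightarrow> ac_poly g z = 0 \<Longrightarrow> degree q \<le> degree g"
    using ex_has_least_nat[of "\<lambda>g. g \<noteq> 0 \<and> ac_poly g z = 0" p degree] root(1) by blast
  have dvd: "q dvd g" if "ac_poly g z = 0" for g
  proof -
    have "ac_poly (g mod q) z = 0"
      using that q(2) ac_poly_add[of "g div q * q" "g mod q" z] by simp
    then have "g mod q = 0" using min[of "g mod q"] degree_mod_less[OF q(1), of g] by fastforce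
    then show ?thesis by (simp add: dvd_eq_mod_eq_0)
  qed
  obtain w where w: "p = q * w" using dvd[OF root(1)] by (elim dvdE)
  have "\<not> q dvd 1"
  proof
    assume "q dvd 1"
    then obtain g where "1 = q * g" by (elim dvdE)
    then have "ac_poly 1 z = ac_poly q z * ac_poly g z" by (metis ac_poly_mult)
    then show False using q(2) by simp
  qed
  then have w1: "w dvd 1" using Factorial_Ring.irreducibleD[OF p w] by blast
  then have "p dvd q" using w1 unfolding w by (simp add: mult_unit_dvd_iff)
  then show ?thesis using dvd[OF root(2)] by (rule dvd_trans)
qed

definition localized_funs :: "'a::field poly \<Rightarrow> ('a alg_closure \<Rightarrow> 'a alg_closure) set" where
  "localized_funs p = rat_algebra {\<lambda>z. z, \<lambda>z. inverse (ac_poly p z)}"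

lemma ac_poly_in_localized_funs: "(\<lambda>z. ac_poly f z) \<in> localized_funs p"
  unfolding localized_funs_def
proof (induction f)
  case 0
  show ?case using rat_algebra.const[of 0] by simp
next
  case (pCons a f)
  then show ?case
    unfolding ac_poly_pCons by (intro rat_algebra.add rat_algebra.mult rat_algebra.const)
      (auto intro: rat_algebra.gen)
qed

lemma localized_funs_powi: "(\<lambda>z. ac_poly p z powi k) \<in> localized_funs p"
proof -
  have power: "(\<lambda>z. f z ^ j) \<in> localized_funs p" if "f \<in> localized_funs p" for f j
    using rat_algebra_prod[of "{..<j}" "\<lambda>_. f"] that unfolding localized_funs_def by simp
  have "(\<lambda>z. inverse (ac_poly p z)) \<in> localized_funs p"
    unfolding localized_funs_def by (rule rat_algebra.gen) simp
  then show ?thesis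
    using power[of "ac_poly p"] power[of "\<lambda>z. inverse (ac_poly p z)"] ac_poly_in_localized_funs[of p p]
    by (cases "0 \<le> k") (simp_all add: power_int_def)
qed

lemma localized_funs_fraction:
  assumes "f \<in> localized_funs p"
  shows "\<exists>F r. \<forall>z. ac_poly p z \<noteq> 0 \<longrightarrow> f z * ac_poly p z ^ r = ac_poly F z"
  using assms unfolding localized_funs_def
proof (induction rule: rat_algebra.induct)
  case (const c)
  show ?case by (intro exI[of _ "[:c:]"] exI[of _ 0]) simp
next
  case (gen f)
  then consider "f = (\<lambda>z. z)" | "f = (\<lambda>z. inverse (ac_poly p z))" by blast
  then show ?case
  proof cases
    case 1
    then show ?thesis by (intro exI[of _ "[:0, 1:]"] exI[of _ 0]) simp
  next
    case 2
    then show ?thesis by (intro exI[of _ 1]) simp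
  qed
next
  case (add f g)
  then obtain F r G s where
    "\<And>z. ac_poly p z \<noteq> 0 \<Longrightarrow> f z * ac_poly p z ^ r = ac_poly F z"
    "\<And>z. ac_poly p z \<noteq> 0 \<Longrightarrow> g z * ac_poly p z ^ s = ac_poly G z" by blast
  then have "(f z + g z) * ac_poly p z ^ (r + s) = ac_poly (F * p ^ s + G * p ^ r) z" if "ac_poly p z \<noteq> 0"
      for z
    using that by (simp add: power_add distrib_right flip: mult.assoc)
  then show ?case by blast
next
  case (mult f g)
  then obtain F r G s where
    F: "\<And>z. ac_poly p z \<noteq> 0 \<Longrightarrow> f z * ac_poly p z ^ r = ac_poly F z" and
    G: "\<And>z. ac_poly p z \<noteq> 0 \<Longrightarrow> g z * ac_poly p z ^ s = ac_poly G z" by blast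
  have "f z * g z * ac_poly p z ^ (r + s) = ac_poly (F * G) z" if "ac_poly p z \<noteq> 0" for z
    unfolding ac_poly_mult F[OF that, symmetric] G[OF that, symmetric] by (simp add: power_add mult_ac)
  then show ?case by blast
qed

lemma smult_power_if_roots_subset:
  fixes p f :: "'a::field poly"
  assumes p: "irreducible p" and "f \<noteq> 0" "\<And>z. ac_poly f z = 0 \<Longrightarrow> ac_poly p z = 0"
  shows "\<exists>a k. f = smult a (p ^ k)"
proof -
  have p0: "p \<noteq> 0" using p by auto
  show ?thesis using assms(2,3)
  proof (induction "degree f" arbitrary: f rule: less_induct)
    case less
    show ?case
    proof (cases "degree f = 0")
      case True
      then obtain a where "f = [:a:]" by (rule degree_eq_zeroE)
      then show ?thesis by (intro exI[of _ a] exI[of _ 0]) simp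
    next
      case False
      then obtain z where "ac_poly f z = 0" by (rule exists_ac_poly_root)
      then have "p dvd f" using irreducible_dvd_if_common_root[OF p] less.prems(2) by blast
      then obtain g where g: "f = p * g" by (elim dvdE)
      have "degree p \<noteq> 0"
        using p p0 is_unit_iff_degree[of p] irreducible_not_unit by blast
      then have "degree g < degree f" using less.prems(1) unfolding g by (simp add: degree_mult_eq)
      then obtain a k where "g = smult a (p ^ k)" using less.hyps[of g] less.prems unfolding g by auto
      then show ?thesis unfolding g by (intro exI[of _ a] exI[of _ "Suc k"]) simp
    qed
  qed
qed

lemma localized_funs_nonvanishing:
  fixes p :: "'a::field_char_0 poly"
  assumes p: "irreducible p" and f: "f \<in> localized_funs p"
    and nonvanishing: "\<And>z. ac_poly p z \<noteq> 0 \<Longrightarrow> f z \<noteq> 0"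
  obtains a m where "a \<noteq> 0" "\<And>z. ac_poly p z \<noteq> 0 \<Longrightarrow> f z = to_ac a * ac_poly p z powi m"
proof -
  obtain F r where F: "\<And>z. ac_poly p z \<noteq> 0 \<Longrightarrow> f z * ac_poly p z ^ r = ac_poly F z"
    using localized_funs_fraction[OF f] by blast
  have nz: "ac_poly F z \<noteq> 0" if "ac_poly p z \<noteq> 0" for z
    using that nonvanishing[OF that] by (simp flip: F[OF that])
  have "p \<noteq> 0" using p by auto
  then have "F \<noteq> 0"
    using nz not_finite_existsD[OF infinite_ac_poly_neq_0[of p]] by auto
  then obtain a k where a: "F = smult a (p ^ k)" using smult_power_if_roots_subset[OF p] nz by metis
  have "f z = to_ac a * ac_poly p z powi (int k - int r)" if z: "ac_poly p z \<noteq> 0" for z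
    using F[OF z] z by (simp add: a power_int_diff field_simps)
  moreover have "a \<noteq> 0" using \<open>F \<noteq> 0\<close> a by auto
  ultimately show ?thesis using that by blast
qed

lemma localized_funs_pullback:
  assumes E: "\<And>i j. (\<lambda>z. E z $ i $ j) \<in> localized_funs p"
    and d: "d \<in> localized_funs p" "\<And>z. z \<in> S \<Longrightarrow> d z = inverse (det (E z))"
    and f: "f \<in> regular_funs_H"
  shows "\<exists>g\<in>localized_funs p. \<forall>z\<in>S. f (E z, E z) = g z"
  using f unfolding regular_funs_H_def
proof (induction rule: rat_algebra.induct)
  case (const c)
  show ?case unfolding localized_funs_def using rat_algebra.const by (intro bexI[of _ "\<lambda>_. to_ac c"]) auto
next
  case (gen f)
  then consider i j where "\<And>z. f (E z, E z) = E z $ i $ j" | "\<And>z. f (E z, E z) = inverse (det (E z))"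
    by (auto simp: coord_funs_def)
  then show ?case
  proof cases
    case (1 i j)
    then show ?thesis by (intro bexI[of _ "\<lambda>z. E z $ i $ j"]) (simp_all add: E)
  next
    case 2
    then show ?thesis using d by (intro bexI[of _ d]) simp_all
  qed
next
  case (add f f')
  then obtain g g' where "g \<in> localized_funs p" "g' \<in> localized_funs p"
    "\<forall>z\<in>S. f (E z, E z) = g z" "\<forall>z\<in>S. f' (E z, E z) = g' z" by blast
  then show ?case
    unfolding localized_funs_def by (intro bexI[of _ "\<lambda>z. g z + g' z"] rat_algebra.add) auto
next
  case (mult f f')
  then obtain g g' where "g \<in> localized_funs p" "g' \<in> localized_funs p"
    "\<forall>z\<in>S. f (E z, E z) = g z" "\<forall>z\<in>S. f' (E z, E z) = g' z" by blast
  then show ?case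
    unfolding localized_funs_def by (intro bexI[of _ "\<lambda>z. g z * g' z"] rat_algebra.mult) auto
qed

lemma two_powi_eq_1_iff: "(2 :: 'k::field_char_0) powi k = 1 \<longleftrightarrow> k = 0"
proof
  assume k: "(2 :: 'k) powi k = 1"
  obtain j where j: "k = int j \<or> k = - int j" by (cases k rule: int_cases2) auto
  then have "(2 :: 'k) ^ j = 1" using k by (auto simp: power_int_minus)
  then have "of_nat (2 ^ j) = (of_nat 1 :: 'k)" by simp
  then have "(2 :: nat) ^ j = 1" by (simp only: of_nat_eq_iff)
  then show "k = 0" using j by auto
qed simp

locale cyclic_centralizer_character =
  fixes c :: "'k::{alg_closed_field, field_char_0}" and t :: "'k^'n^'n \<Rightarrow> 'k" and a :: 'k and m :: int
  assumes nonzero: "c \<noteq> 0"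
    and mult: "\<lbrakk>A \<in> cyclic_centralizer c; B \<in> cyclic_centralizer c; invertible A; invertible B\<rbrakk> \<Longrightarrow> t (A ** B) =
        t A * t B"
    and scalar: "z \<noteq> 0 \<Longrightarrow> t (mat z) = 1"
    and linear: "z ^ CARD('n) \<noteq> c \<Longrightarrow> t (mat z - cyclic_mat c 1) = a * (z ^ CARD('n) - c) powi m"
begin

abbreviation value_at :: "'k poly \<Rightarrow> 'k^'n^'n" where
  "value_at \<equiv> matrix_poly (cyclic_mat c 1)"

lemma t_linear:
  assumes "invertible (value_at [:- z, 1:])"
  shows "t (value_at [:- z, 1:]) = a * (z ^ CARD('n) - c) powi m"
proof -
  let ?E = "mat z - cyclic_mat c 1 :: 'k^'n^'n"
  have eq: "?E = mat (- 1) ** value_at [:- z, 1:]"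
    by (simp add: matrix_poly_linear vec_eq_iff del: matrix_poly_pCons)
  then have "t ?E = t (value_at [:- z, 1:])"
    using mult[of "mat (- 1)" "value_at [:- z, 1:]"] assms scalar[of "- 1"]
    by (simp add: invertible_mat del: matrix_poly_pCons)
  moreover have "invertible ?E" unfolding eq using assms by (intro invertible_mult invertible_mat) simp_all
  then have "z ^ CARD('n) \<noteq> c" using det_mat_minus_cyclic_mat_eq_0_iff[OF nonzero] invertible_det_nz by blast
  ultimately show ?thesis using linear by simp
qed

lemma t_prod_linear:
  assumes "invertible (value_at (\<Prod>x\<in>#A. [:- x, 1:]))"
  shows "t (value_at (\<Prod>x\<in>#A. [:- x, 1:])) = (\<Prod>x\<in>#A. a * (x ^ CARD('n) - c) powi m)"
  using assms
proof (induction A)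
  case empty
  show ?case using scalar[of 1] by simp
next
  case (add x A)
  have eq: "value_at (\<Prod>x\<in>#add_mset x A. [:- x, 1:]) = value_at [:- x, 1:] ** value_at (\<Prod>x\<in>#A. [:- x, 1:])"
    by (simp add: matrix_poly_mult del: matrix_poly_pCons mult_pCons_left)
  have "invertible (value_at [:- x, 1:])" "invertible (value_at (\<Prod>x\<in>#A. [:- x, 1:]))"
    using add.prems unfolding eq by (auto simp: invertible_det_nz det_mul)
  then show ?case unfolding eq using add.IH by (simp add: mult t_linear del: matrix_poly_pCons)
qed

lemma t_value_at:
  assumes f: "f \<noteq> 0" "invertible (value_at f)"
  obtains A where "size A = degree f" "\<And>x. x \<in># A \<Longrightarrow> poly f x = 0"
    "t (value_at f) = (\<Prod>x\<in>#A. a * (x ^ CARD('n) - c) powi m)"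
proof -
  let ?l = "Polynomial.lead_coeff f"
  obtain A where A: "size A = degree f" "f = smult ?l (\<Prod>x\<in>#A. [:- x, 1:])"
    using alg_closed_imp_factorization[OF f(1)] by blast
  have eq: "value_at f = mat ?l ** value_at (\<Prod>x\<in>#A. [:- x, 1:])" by (subst A(2)) (rule matrix_poly_smult)
  then have inv: "invertible (value_at (\<Prod>x\<in>#A. [:- x, 1:]))"
    using f(2) by (auto simp: invertible_det_nz det_mul)
  have "t (value_at f) = t (value_at (\<Prod>x\<in>#A. [:- x, 1:]))"
    unfolding eq using inv f(1) scalar[of ?l] by (simp add: mult invertible_mat)
  moreover have "poly f x = 0" if "x \<in># A" for x
    using that by (subst A(2)) (auto simp: poly_prod_mset prod_mset_zero_iff)
  ultimately show ?thesis using that A(1) t_prod_linear[OF inv] by simp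
qed

lemma degree_monom_minus_const: "degree (monom 1 CARD('n) - [:d :: 'k:]) = CARD('n)"
proof -
  have "degree (monom 1 CARD('n) + [:- d :: 'k:]) = CARD('n)"
    by (subst degree_add_eq_left) (simp_all add: degree_monom_eq)
  then show ?thesis by (simp add: diff_conv_add_uminus)
qed

text \<open>\<open>\<Pi>\<^sup>n - (c + d)\<close> is the scalar \<open>- d\<close>, and \<open>x\<^sup>n - c = d\<close> at the roots \<open>x\<close> of \<open>X\<^sup>n - (c + d)\<close>.\<close>

lemma power_CARD_mult_powi:
  assumes d: "d \<noteq> 0"
  shows "a ^ CARD('n) * d powi (m * int CARD('n)) = 1"
proof -
  let ?f = "monom 1 CARD('n) - [:c + d:]"
  have val_f: "value_at ?f = mat (- d)"
    using cyclic_mat_CARD_mult[of c 1, where 'n = 'n] mat_add[of "c + d" "- d", where 'n = 'n]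
    by (simp add: matrix_poly_diff matrix_poly_monom_cyclic_mat[OF nonzero])
  then have inv: "invertible (value_at ?f)" using d by (simp add: invertible_mat)
  have "?f \<noteq> 0" using degree_monom_minus_const[of "c + d"] by auto
  then obtain A where A: "size A = degree ?f" "\<And>x. x \<in># A \<Longrightarrow> poly ?f x = 0"
    "t (value_at ?f) = (\<Prod>x\<in>#A. a * (x ^ CARD('n) - c) powi m)" using inv by (rule t_value_at) blast
  have "x ^ CARD('n) - c = d" if "x \<in># A" for x using A(2)[OF that] by (simp add: poly_monom)
  then have "t (value_at ?f) = (\<Prod>x\<in>#A. a * d powi m)" unfolding A(3) by (simp cong: image_mset_cong)
  then show ?thesis
    using scalar[of "- d"] d degree_monom_minus_const[of "c + d"] unfolding val_f
    by (simp add: A(1) power_mult_distrib power_int_mult power_int_power)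
qed

lemma power_CARD_eq_1: "a ^ CARD('n) = 1"
  using power_CARD_mult_powi[of 1] by simp

lemma exponent_eq_0: "m = 0"
  using power_CARD_mult_powi[of 2] by (simp add: power_CARD_eq_1 two_powi_eq_1_iff)

lemma t_value_at_eq_power:
  assumes "f \<noteq> 0" "invertible (value_at f)"
  shows "t (value_at f) = a ^ degree f"
proof -
  obtain A where "size A = degree f" "t (value_at f) = (\<Prod>x\<in>#A. a * (x ^ CARD('n) - c) powi m)"
    using t_value_at[OF assms] by blast
  then show ?thesis by (simp add: exponent_eq_0)
qed

text \<open>\<open>X\<close> and \<open>X\<^sup>n + X - c\<close> have the same value \<open>\<Pi>\<close>, but degrees \<open>1\<close> and \<open>n\<close>.\<close>

lemma base_eq_1: "a = 1"
proof (cases "CARD('n) = 1")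
  case False
  let ?f = "[:0, 1:] :: 'k poly" and ?g = "monom 1 CARD('n) + [:- c, 1:]"
  have "1 < CARD('n)" using False by (metis less_one linorder_neqE_nat zero_less_card_finite less_irrefl)
  then have deg: "degree ?g = CARD('n)" by (subst degree_add_eq_left) (simp_all add: degree_monom_eq)
  then have "?g \<noteq> 0" by auto
  have inv: "invertible (value_at ?f)" using nonzero by (simp add: invertible_cyclic_mat)
  have eq: "value_at ?g = value_at ?f"
    using cyclic_mat_CARD_mult[of c 1, where 'n = 'n] mat_add[of c "- c", where 'n = 'n]
    by (simp add: matrix_poly_add matrix_poly_monom_cyclic_mat[OF nonzero] flip: add.assoc)
  have "a ^ 1 = t (value_at ?f)" using t_value_at_eq_power[of ?f] inv by simp
  also have "\<dots> = a ^ CARD('n)" using t_value_at_eq_power[OF \<open>?g \<noteq> 0\<close>] inv unfolding eq deg by simp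
  finally show ?thesis by (simp add: power_CARD_eq_1)
qed (use power_CARD_eq_1 in simp)

theorem character_trivial:
  assumes "A \<in> cyclic_centralizer c" "invertible A"
  shows "t A = 1"
proof -
  obtain f where f: "A = value_at f" using cyclic_centralizer_matrix_poly[OF assms(1) nonzero] by metis
  have "f \<noteq> 0" using assms(2) f det_mat[of "0 :: 'k", where 'n = 'n] by (auto simp: invertible_det_nz)
  then show ?thesis using t_value_at_eq_power assms(2) by (simp add: f base_eq_1)
qed

end

lemma base_change_cyclic_mat:
  "base_change (mat s ** cyclic_mat c 1 :: 'a::field^'n^'n, mat 1) =
      (mat (to_ac s) ** cyclic_mat (to_ac c) 1, mat 1)"
  unfolding map_matrix_cyclic_mat [symmetric] by (simp add: base_change_def vec_eq_iff) (simp add: mat_def)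

lemma stabilizer_cyclic_mat:
  fixes s c :: "'k::field"
  assumes "s \<noteq> 0"
  shows "stabilizer GLxGL act (mat s ** cyclic_mat c 1 :: 'k^'n^'n, mat 1) =
    {(e, e) | e. invertible e \<and> e \<in> cyclic_centralizer c}"
proof -
  have "e ** (mat s ** cyclic_mat c 1) = mat s ** cyclic_mat c 1 ** e \<longleftrightarrow> e \<in> cyclic_centralizer c"
      for e :: "'k^'n^'n"
    using assms by (simp add: cyclic_centralizer_def matrix_mul_assoc flip: mat_mult_commute)
      (simp add: vec_eq_iff flip: matrix_mul_assoc)
  then show ?thesis unfolding stabilizer_mat_1 by blast
qed

lemma inverse_det_mat_minus_cyclic_mat_in_localized_funs:
  fixes c :: "'a::field_char_0"
  assumes irr: "irreducible (monom 1 CARD('n::finite) - [:c:])" and c: "c \<noteq> 0"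
  defines "p \<equiv> monom 1 CARD('n) - [:c:]" and "E \<equiv> \<lambda>z. mat z - cyclic_mat (to_ac c) 1 :: 'a alg_closure^'n^'n"
  shows "(\<lambda>z. E z $ i $ j) \<in> localized_funs p"
    and "\<exists>d\<in>localized_funs p. \<forall>z. ac_poly p z \<noteq> 0 \<longrightarrow> d z = inverse (det (E z))"
proof -
  show entry: "(\<lambda>z. E z $ i $ j) \<in> localized_funs p" for i j
  proof -
    have "(\<lambda>z. ac_poly (if i = j then [:0, 1:] else 0) z + to_ac (- (cyclic_mat c 1 :: 'a^'n^'n) $ i $ j))
        \<in> localized_funs p"
      using ac_poly_in_localized_funs unfolding localized_funs_def
      by (intro rat_algebra.add rat_algebra.const)
    moreover have "E z $ i $ j =
        ac_poly (if i = j then [:0, 1:] else 0) z + to_ac (- (cyclic_mat c 1 :: 'a^'n^'n) $ i $ j)" for z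
      unfolding E_def map_matrix_cyclic_mat [symmetric] by (simp add: mat_def)
    ultimately show ?thesis by simp
  qed
  have "(\<lambda>z. det (E z)) \<in> localized_funs p"
    using entry unfolding localized_funs_def by (rule rat_algebra_det)
  moreover have "det (E z) \<noteq> 0" if "ac_poly p z \<noteq> 0" for z
    using that c det_mat_minus_cyclic_mat_eq_0_iff[of "to_ac c" z, where 'n = 'n]
    by (simp add: E_def p_def ac_poly_monom)
  ultimately obtain a m where a: "\<And>z. ac_poly p z \<noteq> 0 \<Longrightarrow> det (E z) = to_ac a * ac_poly p z powi m"
    using localized_funs_nonvanishing[OF irr[folded p_def]] by metis
  have "(\<lambda>z. to_ac (inverse a) * ac_poly p z powi (- m)) \<in> localized_funs p"
    using localized_funs_powi unfolding localized_funs_def by (intro rat_algebra.mult rat_algebra.const)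
  then show "\<exists>d\<in>localized_funs p. \<forall>z. ac_poly p z \<noteq> 0 \<longrightarrow> d z = inverse (det (E z))"
    by (rule bexI[rotated]) (simp add: a power_int_minus)
qed

theorem stabilizer_anisotropic_cyclic_mat:
  fixes s c :: "'a::field_char_0"
  assumes s: "s \<noteq> 0" and c: "c \<noteq> 0" and irr: "irreducible (monom 1 CARD('n::finite) - [:c:])"
  shows "stabilizer_anisotropic_mod_scalars (mat s ** cyclic_mat c 1 :: 'a^'n^'n, mat 1)"
  unfolding stabilizer_anisotropic_mod_scalars_def
proof (intro allI impI ballI)
  let ?x = "(mat s ** cyclic_mat c 1 :: 'a^'n^'n, mat 1)" and ?p = "monom 1 CARD('n) - [:c:]"
  let ?E = "\<lambda>z. mat z - cyclic_mat (to_ac c) 1 :: 'a alg_closure^'n^'n"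
  fix \<psi> h
  assume \<psi>: "rational_character ?x \<psi> \<and> (\<forall>z. z \<noteq> 0 \<longrightarrow> \<psi> (mat z, mat z) = 1)" and h: "h \<in> geom_stabilizer ?x"
  have stab: "geom_stabilizer ?x = {(e, e) | e. invertible e \<and> e \<in> cyclic_centralizer (to_ac c)}"
    using s by (simp add: geom_stabilizer_def base_change_cyclic_mat stabilizer_cyclic_mat)
  have E: "?E z \<in> cyclic_centralizer (to_ac c)" "invertible (?E z)" if "ac_poly ?p z \<noteq> 0" for z
    using that c det_mat_minus_cyclic_mat_eq_0_iff[of "to_ac c" z, where 'n = 'n]
    by (simp_all add: ac_poly_monom invertible_det_nz cyclic_centralizer_def matrix_diff_ldistrib
      matrix_diff_rdistrib mat_mult_commute)
  obtain d where "d \<in> localized_funs ?p" "\<And>z. ac_poly ?p z \<noteq> 0 \<Longrightarrow> d z = inverse (det (?E z))"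
    using inverse_det_mat_minus_cyclic_mat_in_localized_funs(2)[OF irr c] by blast
  then obtain g where g: "g \<in> localized_funs ?p" "\<And>z. ac_poly ?p z \<noteq> 0 \<Longrightarrow> \<psi> (?E z, ?E z) = g z"
    using localized_funs_pullback[OF inverse_det_mat_minus_cyclic_mat_in_localized_funs(1)[OF irr c],
      of d "{z. ac_poly ?p z \<noteq> 0}" \<psi>] \<psi>
    unfolding rational_character_def by auto
  have "g z \<noteq> 0" if "ac_poly ?p z \<noteq> 0" for z
    using E[OF that] \<psi> g(2)[OF that] unfolding rational_character_def stab by auto
  then obtain a m where am: "\<And>z. ac_poly ?p z \<noteq> 0 \<Longrightarrow> g z = to_ac a * ac_poly ?p z powi m"
    using localized_funs_nonvanishing[OF irr g(1)] by metis
  interpret cyclic_centralizer_character "to_ac c" "\<lambda>e. \<psi> (e, e)" "to_ac a" m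
  proof
    fix A B :: "'a alg_closure^'n^'n"
    assume "A \<in> cyclic_centralizer (to_ac c)" "B \<in> cyclic_centralizer (to_ac c)" "invertible A" "invertible B"
    then have "\<psi> ((A, A) \<otimes>\<^bsub>GLxGL\<^esub> (B, B)) = \<psi> (A, A) * \<psi> (B, B)"
      using \<psi> unfolding rational_character_def stab by blast
    then show "\<psi> (A ** B, A ** B) = \<psi> (A, A) * \<psi> (B, B)" by (simp add: GLxGL_def)
  next
    fix z assume "z ^ CARD('n) \<noteq> to_ac c"
    then show "\<psi> (?E z, ?E z) = to_ac a * (z ^ CARD('n) - to_ac c) powi m"
      using g(2)[of z] am[of z] by (simp add: ac_poly_monom)
  qed (use c \<psi> in simp_all)
  show "\<psi> h = 1" using h character_trivial unfolding stab by blast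
qed

section \<open>Relative indices of subgroups\<close>

lemma card_image_cong_iff:
  assumes "\<And>x y. x \<in> S \<Longrightarrow> y \<in> S \<Longrightarrow> f x = f y \<longleftrightarrow> g x = g y"
  shows "card (f ` S) = card (g ` S)"
proof -
  define h where "h a = g (SOME x. x \<in> S \<and> f x = a)" for a
  have h: "h (f x) = g x" if "x \<in> S" for x
  proof -
    have "(SOME y. y \<in> S \<and> f y = f x) \<in> S \<and> f (SOME y. y \<in> S \<and> f y = f x) = f x"
      using that by (intro someI[of "\<lambda>y. y \<in> S \<and> f y = f x" x]) simp
    then show ?thesis using assms that unfolding h_def by blast
  qed
  have "inj_on h (f ` S)" using h assms by (auto simp: inj_on_def)
  moreover have "h ` f ` S = g ` S" using h by (auto simp: image_image cong: image_cong)
  ultimately show ?thesis by (metis card_image)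
qed

context group
begin

lemma rcos_eq_iff:
  assumes "subgroup N G" "x \<in> carrier G" "y \<in> carrier G"
  shows "N #> x = N #> y \<longleftrightarrow> x \<otimes> inv y \<in> N"
  using rcos_self[OF assms(2,1)] repr_independence[OF _ assms(3,1), of x]
    subgroup.rcos_module[OF assms(1) group_axioms assms(3,2)] by blast

text \<open>For subgroups \<open>S\<close> and \<open>N\<close> this is the index of \<open>S \<inter> N\<close> in \<open>S\<close>.\<close>

definition rel_index :: "'a set \<Rightarrow> 'a set \<Rightarrow> nat" where
  "rel_index S N = card ((\<lambda>s. N #> s) ` S)"

lemma rel_index_cong:
  assumes "subgroup S G" "subgroup N G" "subgroup N' G" "S \<inter> N = S \<inter> N'"
  shows "rel_index S N = rel_index S N'"
  unfolding rel_index_def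
proof (rule card_image_cong_iff)
  fix x y assume xy: "x \<in> S" "y \<in> S"
  then have "x \<otimes> inv y \<in> S" using assms(1) by (simp add: subgroup.m_closed subgroup.m_inv_closed)
  then have "x \<otimes> inv y \<in> N \<longleftrightarrow> x \<otimes> inv y \<in> N'" using assms(4) by auto
  moreover have "x \<in> carrier G" "y \<in> carrier G" using xy subgroup.mem_carrier[OF assms(1)] by auto
  ultimately show "N #> x = N #> y \<longleftrightarrow> N' #> x = N' #> y"
    by (simp only: rcos_eq_iff[OF assms(2)] rcos_eq_iff[OF assms(3)])
qed

lemma rel_index_eq_1:
  assumes "subgroup S G" "subgroup N G" "S \<subseteq> N"
  shows "rel_index S N = 1"
proof -
  have "N #> s = N" if "s \<in> S" for s
    using that assms subgroup.mem_carrier[OF assms(2)] by (intro coset_join2) auto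
  moreover have "S \<noteq> {}" using assms(1) subgroup.one_closed by blast
  ultimately have "(\<lambda>s. N #> s) ` S = {N}" by auto
  then show ?thesis by (simp add: rel_index_def)
qed

lemma rel_index_pigeonhole:
  assumes N: "subgroup N G" and fin: "finite ((\<lambda>s. N #> s) ` S)" and S: "S \<subseteq> carrier G"
    and u: "\<And>a. u a \<in> S" and index: "rel_index S N \<le> m"
  obtains a b :: nat where "a < b" "b \<le> m" "u a \<otimes> inv u b \<in> N"
proof -
  have "\<not> inj_on (\<lambda>a. N #> u a) {..m}"
  proof
    assume "inj_on (\<lambda>a. N #> u a) {..m}"
    then have "Suc m = card ((\<lambda>a. N #> u a) ` {..m})" by (simp add: card_image)
    also have "\<dots> \<le> rel_index S N"
      unfolding rel_index_def using fin u by (intro card_mono) auto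
    finally show False using index by simp
  qed
  then obtain a b where "a < b" "b \<le> m" "N #> u a = N #> u b"
    using linorder_inj_onI'[of "{..m}" "\<lambda>a. N #> u a"] by auto
  then show ?thesis using that[of a b] rcos_eq_iff[OF N] S u by blast
qed

lemma rel_index_image:
  assumes f: "f \<in> hom G G" "inj_on f (carrier G)"
    and S: "S \<subseteq> carrier G" and N: "subgroup N G" "subgroup (f ` N) G"
  shows "rel_index (f ` S) (f ` N) = rel_index S N"
  unfolding rel_index_def image_image
proof (rule card_image_cong_iff)
  interpret f: group_hom G G f by unfold_locales (rule f(1))
  fix x y assume "x \<in> S" "y \<in> S"
  then have xy: "x \<in> carrier G" "y \<in> carrier G" using S by auto
  then have "f x \<otimes> inv (f y) = f (x \<otimes> inv y)" by simp
  moreover have "f (x \<otimes> inv y) \<in> f ` N \<longleftrightarrow> x \<otimes> inv y \<in> N"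
    using f(2) xy subgroup.subset[OF N(1)] by (intro inj_on_image_mem_iff) auto
  ultimately show "f ` N #> f x = f ` N #> f y \<longleftrightarrow> N #> x = N #> y"
    using xy by (simp add: rcos_eq_iff N)
qed

definition conj_set :: "'a \<Rightarrow> 'a set \<Rightarrow> 'a set" where
  "conj_set g S = (\<lambda>x. g \<otimes> x \<otimes> inv g) ` S"

lemma conj_hom:
  assumes "g \<in> carrier G"
  shows "(\<lambda>x. g \<otimes> x \<otimes> inv g) \<in> hom G G" "inj_on (\<lambda>x. g \<otimes> x \<otimes> inv g) (carrier G)"
proof -
  have "g \<otimes> (x \<otimes> y) \<otimes> inv g = (g \<otimes> x \<otimes> inv g) \<otimes> (g \<otimes> y \<otimes> inv g)"
    if "x \<in> carrier G" "y \<in> carrier G" for x y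
  proof -
    have "(g \<otimes> x \<otimes> inv g) \<otimes> (g \<otimes> y \<otimes> inv g) = g \<otimes> x \<otimes> (inv g \<otimes> g) \<otimes> y \<otimes> inv g"
      using assms that by (simp only: m_assoc inv_closed m_closed)
    then show ?thesis using assms that by (simp add: m_assoc)
  qed
  then show "(\<lambda>x. g \<otimes> x \<otimes> inv g) \<in> hom G G" using assms by (auto intro!: homI)
  show "inj_on (\<lambda>x. g \<otimes> x \<otimes> inv g) (carrier G)" using assms by (auto intro!: inj_onI)
qed

lemma subgroup_conj_set:
  assumes "g \<in> carrier G" "subgroup S G"
  shows "subgroup (conj_set g S) G"
proof -
  interpret group_hom G G "\<lambda>x. g \<otimes> x \<otimes> inv g" by unfold_locales (rule conj_hom[OF assms(1)])
  show ?thesis unfolding conj_set_def using assms(2) by (rule subgroup_img_is_subgroup)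
qed

lemma mem_conj_set_iff:
  assumes "g \<in> carrier G" "S \<subseteq> carrier G" "x \<in> carrier G"
  shows "x \<in> conj_set g S \<longleftrightarrow> inv g \<otimes> x \<otimes> g \<in> S"
proof -
  have "x = g \<otimes> (inv g \<otimes> x \<otimes> g) \<otimes> inv g"
    using assms by (simp add: m_assoc [symmetric]) (simp add: m_assoc)
  moreover have "inv g \<otimes> (g \<otimes> s \<otimes> inv g) \<otimes> g = s" if "s \<in> carrier G" for s
    using assms(1) that by (simp add: m_assoc [symmetric]) (simp add: m_assoc)
  ultimately show ?thesis using assms(2) unfolding conj_set_def by auto
qed

lemma conj_set_mult:
  assumes "g \<in> carrier G" "h \<in> carrier G" "S \<subseteq> carrier G"
  shows "conj_set (g \<otimes> h) S = conj_set g (conj_set h S)"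
  using assms unfolding conj_set_def image_image
  by (intro image_cong) (auto simp: inv_mult_group m_assoc)

lemma conj_set_subgroup:
  assumes "subgroup S G" "g \<in> S"
  shows "conj_set g S = S"
proof -
  have c: "g \<in> carrier G" "S \<subseteq> carrier G" using assms subgroup.subset by auto
  have "inv g \<otimes> x \<otimes> g \<in> S \<longleftrightarrow> x \<in> S" if "x \<in> carrier G" for x
  proof
    assume "inv g \<otimes> x \<otimes> g \<in> S"
    then have "g \<otimes> (inv g \<otimes> x \<otimes> g) \<otimes> inv g \<in> S"
      using assms by (simp add: subgroup.m_closed subgroup.m_inv_closed)
    moreover have "g \<otimes> (inv g \<otimes> x \<otimes> g) \<otimes> inv g = x"
      using c that by (simp add: m_assoc [symmetric]) (simp add: m_assoc)
    ultimately show "x \<in> S" by simp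
  qed (use assms in \<open>simp add: subgroup.m_closed subgroup.m_inv_closed\<close>)
  then show ?thesis
    using mem_conj_set_iff[OF c] c subgroup.subset[OF subgroup_conj_set[OF c(1) assms(1)]] by blast
qed

lemma rel_index_conj_set:
  assumes "g \<in> carrier G" "subgroup S G" "subgroup N G"
  shows "rel_index (conj_set g S) (conj_set g N) = rel_index S N"
  using rel_index_image[OF conj_hom[OF assms(1)] subgroup.subset[OF assms(2)] assms(3)]
    subgroup_conj_set[OF assms(1,3)]
  unfolding conj_set_def by blast

lemma rel_index_conj_set_commute:
  assumes K: "subgroup K G" and h: "h = k \<otimes> d \<otimes> l" "k \<in> K" "d \<in> carrier G" "l \<in> K"
    and \<theta>: "\<theta> \<in> hom G G" "inj_on \<theta> (carrier G)" "\<theta> ` K = K" "\<theta> d = inv d"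
  shows "rel_index K (conj_set h K) = rel_index (conj_set h K) K"
proof -
  interpret \<theta>: group_hom G G \<theta> by unfold_locales (rule \<theta>(1))
  have Kc: "K \<subseteq> carrier G" using K by (rule subgroup.subset)
  then have c: "k \<in> carrier G" "l \<in> carrier G" "h \<in> carrier G" using h by auto
  have conj: "subgroup (conj_set g K) G" if "g \<in> carrier G" for g using that K by (rule subgroup_conj_set)
  have biinv: "rel_index K (conj_set (a \<otimes> g \<otimes> b) K) = rel_index K (conj_set g K)"
    if "a \<in> K" "b \<in> K" "g \<in> carrier G" for a b g
  proof -
    have ab: "a \<in> carrier G" "b \<in> carrier G" using that Kc by auto
    have "conj_set (a \<otimes> g \<otimes> b) K = conj_set a (conj_set g (conj_set b K))"
      using ab that Kc subgroup.subset[OF conj[OF ab(2)]] by (simp add: conj_set_mult)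
    then have "conj_set (a \<otimes> g \<otimes> b) K = conj_set a (conj_set g K)" using that
      by (simp add: conj_set_subgroup[OF K])
    then show ?thesis
      using rel_index_conj_set[OF ab(1) K conj[OF that(3)]] that by (simp add: conj_set_subgroup[OF K])
  qed
  have "\<theta> ` conj_set d K = conj_set (inv d) (\<theta> ` K)"
    using h(3) Kc by (auto simp: conj_set_def image_image \<theta>(4) subsetD intro!: image_cong)
  then have \<theta>_conj: "\<theta> ` conj_set d K = conj_set (inv d) K" by (simp only: \<theta>(3))
  have "rel_index (\<theta> ` K) (\<theta> ` conj_set d K) = rel_index K (conj_set d K)"
    using \<theta>(1,2) Kc conj h(3) by (intro rel_index_image) (simp_all add: \<theta>_conj)
  then have "rel_index K (conj_set d K) = rel_index K (conj_set (inv d) K)" by (simp only: \<theta>(3) \<theta>_conj)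
  also have "\<dots> = rel_index K (conj_set (inv l \<otimes> inv d \<otimes> inv k) K)"
    using h K by (intro biinv [symmetric]) (simp_all add: subgroup.m_inv_closed)
  also have "inv l \<otimes> inv d \<otimes> inv k = inv h" using h(1,3) c by (simp add: inv_mult_group m_assoc)
  also have "rel_index K (conj_set (inv h) K) = rel_index (conj_set h K) (conj_set h (conj_set (inv h) K))"
    using c(3) K conj by (intro rel_index_conj_set [symmetric]) simp_all
  also have "conj_set h (conj_set (inv h) K) = K"
    using c(3) Kc by (simp add: conj_set_mult [symmetric] conj_set_subgroup[OF K subgroup.one_closed[OF K]])
  finally show ?thesis using biinv[OF h(2,4,3)] by (simp add: h(1))
qed

theorem exists_ord_eq_prime:
  assumes fin: "finite (carrier G)" and q: "prime q" "q dvd order G"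
  obtains x where "x \<in> carrier G" "ord x = q"
proof -
  obtain m where "order G = q ^ 1 * m" using q(2) by auto
  then obtain H where H: "subgroup H G" "card H = q"
    using sylow_thm[OF q(1) group_axioms _ fin, of 1 m] by auto
  have "\<not> H \<subseteq> {\<one>}"
    using card_mono[of "{\<one>}" H] H(2) prime_gt_1_nat[OF q(1)] by auto
  then obtain x where x: "x \<in> H" "x \<noteq> \<one>" by blast
  then have xG: "x \<in> carrier G" using subgroup.mem_carrier[OF H(1)] by blast
  interpret H: group "G\<lparr>carrier := H\<rparr>" using H(1) by (rule subgroup.subgroup_is_group) (rule group_axioms)
  have "x [^]\<^bsub>G\<lparr>carrier := H\<rparr>\<^esub> order (G\<lparr>carrier := H\<rparr>) = \<one>\<^bsub>G\<lparr>carrier := H\<rparr>\<^esub>"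
    using x(1) by (intro H.pow_order_eq_1) simp
  then have "x [^] q = \<one>" using H(2) by (simp add: order_def nat_pow_consistent [symmetric])
  then have "ord x dvd q" using pow_eq_id[OF xG] by simp
  moreover have "ord x \<noteq> 1" using x(2) xG pow_eq_id[OF xG, of 1] by auto
  ultimately show ?thesis using that xG q(1) by (metis prime_nat_iff)
qed

lemma order_prime_power:
  assumes fin: "finite (carrier G)" and p: "prime (p :: nat)"
    and pow: "\<And>x. x \<in> carrier G \<Longrightarrow> \<exists>s :: nat. x [^] (p ^ s) = \<one>"
  shows "\<exists>k. order G = p ^ k"
proof -
  have only: "q = p" if q: "prime q" "q dvd order G" for q
  proof -
    obtain x where x: "x \<in> carrier G" "ord x = q" using exists_ord_eq_prime[OF fin q] by blast
    obtain s where "x [^] (p ^ s) = \<one>" using pow[OF x(1)] by blast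
    then have "q dvd p ^ s" using pow_eq_id[OF x(1)] x(2) by simp
    then show ?thesis using p q(1) prime_dvd_power primes_dvd_imp_eq by blast
  qed
  have "0 < order G" using fin by (simp add: order_gt_0_iff_finite)
  then obtain m where m: "order G = p ^ multiplicity p (order G) * m" "\<not> p dvd m"
    using multiplicity_decompose'[of "order G" p] p by (metis not_prime_unit less_irrefl)
  have "m = 1"
  proof (rule ccontr)
    assume "m \<noteq> 1"
    then obtain q where q: "prime q" "q dvd m" using prime_factor_nat by blast
    then have "q dvd order G" by (subst m(1)) simp
    then show False using only[OF q(1)] q(2) m(2) by simp
  qed
  then show ?thesis using m(1) by auto
qed

lemma rel_index_prime_power:
  assumes C: "subgroup C G" and comm: "\<And>x y. x \<in> C \<Longrightarrow> y \<in> C \<Longrightarrow> x \<otimes> y = y \<otimes> x"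
    and N: "subgroup N G" and fin: "finite ((\<lambda>x. N #> x) ` C)"
    and p: "prime (p :: nat)" "\<And>x. x \<in> C \<Longrightarrow> \<exists>s :: nat. x [^] (p ^ s) \<in> N"
  shows "\<exists>k. rel_index C N = p ^ k"
proof -
  let ?C = "G\<lparr>carrier := C\<rparr>" and ?N = "N \<inter> C"
  interpret C: group ?C using C by (rule subgroup.subgroup_is_group) (rule group_axioms)
  have NG: "subgroup ?N G" using N C by (rule subgroups_Inter_pair)
  interpret C: comm_group ?C by (rule C.group_comm_groupI) (use comm in simp)
  have norm: "normal ?N ?C" using NG C by (intro C.subgroup_imp_normal subgroup_incl) auto
  interpret N: normal ?N ?C by (rule norm)
  let ?Q = "?C Mod ?N"
  interpret Q: group ?Q by (rule N.factorgroup_is_group)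
  have coset: "?N #>\<^bsub>?C\<^esub> x = ?N #> x" for x by (simp add: r_coset_def)
  have carr: "carrier ?Q = (\<lambda>x. ?N #> x) ` C" by (auto simp: FactGroup_def RCOSETS_def coset)
  have index: "rel_index C N = rel_index C ?N" using C N NG by (intro rel_index_cong) auto
  have "rel_index C N \<noteq> 0" using fin subgroup.one_closed[OF C] by (auto simp: rel_index_def)
  then have "rel_index C ?N \<noteq> 0" using index by simp
  then have "finite (carrier ?Q)" unfolding carr rel_index_def by (simp add: card_eq_0_iff)
  moreover have "\<exists>s :: nat. y [^]\<^bsub>?Q\<^esub> (p ^ s) = \<one>\<^bsub>?Q\<^esub>" if y: "y \<in> carrier ?Q" for y
  proof -
    obtain x where x: "x \<in> C" "y = ?N #> x" using y carr by auto
    have pow: "x [^] (k :: nat) \<in> C" for k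
      using x(1) C by (induction k) (auto simp: subgroup.one_closed subgroup.m_closed)
    have powQ: "y [^]\<^bsub>?Q\<^esub> (k :: nat) = ?N #> (x [^] k)" for k
    proof (induction k)
      case 0
      show ?case using NG by (simp add: FactGroup_def coset_mult_one subgroup.subset)
    next
      case (Suc k)
      have "(?N #> (x [^] k)) <#>\<^bsub>?C\<^esub> (?N #> x) = ?N #> (x [^] k \<otimes> x)"
        using N.rcos_sum[of "x [^] k" x] pow x(1) by (simp add: coset)
      then show ?case using Suc by (simp add: x(2) FactGroup_def)
    qed
    obtain s :: nat where "x [^] (p ^ s) \<in> N" using p(2)[OF x(1)] by blast
    then have "?N #> (x [^] (p ^ s)) = ?N" using NG pow
      by (intro coset_join2) (auto simp: subgroup.mem_carrier)
    then show ?thesis using powQ[of "p ^ s"] by (auto simp: FactGroup_def)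
  qed
  ultimately have "\<exists>k. order ?Q = p ^ k" using Q.order_prime_power[OF _ p(1)] by blast
  then show ?thesis unfolding index by (simp add: order_def carr rel_index_def)
qed

end

section \<open>Double cosets and invariant measures on coset spaces\<close>

locale double_cosets = group G + T: subgroup T G + K: subgroup K G for G (structure) and T K
begin

definition dcoset :: "'a \<Rightarrow> 'a set" where
  "dcoset h = {t \<otimes> h \<otimes> k | t k. t \<in> T \<and> k \<in> K}"

definition dcosets :: "'a set set" where
  "dcosets = dcoset ` carrier G"

lemma dcosetI: "t \<in> T \<Longrightarrow> k \<in> K \<Longrightarrow> t \<otimes> h \<otimes> k \<in> dcoset h"
  unfolding dcoset_def by blast

lemma T_carrier [simp]: "t \<in> T \<Longrightarrow> t \<in> carrier G" and K_carrier [simp]: "k \<in> K \<Longrightarrow> k \<in> carrier G"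
  by (rule T.mem_carrier, assumption) (rule K.mem_carrier)

lemma dcoset_subset_carrier: "h \<in> carrier G \<Longrightarrow> dcoset h \<subseteq> carrier G"
  by (auto simp: dcoset_def)

lemma dcoset_self: "h \<in> carrier G \<Longrightarrow> h \<in> dcoset h"
  using dcosetI[OF T.one_closed K.one_closed, of h] by simp

lemma dcoset_subset:
  assumes "h \<in> carrier G" "g \<in> dcoset h"
  shows "dcoset g \<subseteq> dcoset h"
proof
  fix x assume "x \<in> dcoset g"
  then obtain t k t' k' where tk: "t \<in> T" "k \<in> K" "x = t \<otimes> g \<otimes> k" "t' \<in> T" "k' \<in> K" "g = t' \<otimes> h \<otimes> k'"
    using assms(2) by (auto simp: dcoset_def)
  then have "x = (t \<otimes> t') \<otimes> h \<otimes> (k' \<otimes> k)" using assms(1) by (simp add: m_assoc)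
  then show "x \<in> dcoset h" using tk unfolding dcoset_def by blast
qed

lemma dcoset_eqI:
  assumes "h \<in> carrier G" "g \<in> dcoset h"
  shows "dcoset g = dcoset h"
proof -
  obtain t k where tk: "t \<in> T" "k \<in> K" "g = t \<otimes> h \<otimes> k" using assms(2) by (auto simp: dcoset_def)
  then have "inv t \<otimes> g \<otimes> inv k = (inv t \<otimes> t) \<otimes> h \<otimes> (k \<otimes> inv k)"
    using assms(1) by (simp only: m_assoc inv_closed m_closed T_carrier K_carrier)
  then have "h = inv t \<otimes> g \<otimes> inv k" using assms(1) tk by simp
  then have "h \<in> dcoset g" using tk unfolding dcoset_def by blast
  moreover have "g \<in> carrier G" using assms dcoset_subset_carrier by blast
  ultimately show ?thesis using dcoset_subset assms by blast
qed

definition lift :: "('a \<Rightarrow> 'c) \<Rightarrow> 'a set \<Rightarrow> 'c" where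
  "lift \<Phi> D = \<Phi> (SOME h. h \<in> D)"

definition biinvariant :: "('a \<Rightarrow> 'c) \<Rightarrow> bool" where
  "biinvariant \<Phi> \<longleftrightarrow> (\<forall>h\<in>carrier G. \<forall>t\<in>T. \<forall>k\<in>K. \<Phi> (t \<otimes> h \<otimes> k) = \<Phi> h)"

lemma lift_eq:
  assumes "biinvariant \<Phi>" "h \<in> carrier G" "g \<in> dcoset h"
  shows "lift \<Phi> (dcoset h) = \<Phi> g"
proof -
  have "\<Phi> x = \<Phi> h" if "x \<in> dcoset h" for x
    using that assms(1,2) by (auto simp: biinvariant_def dcoset_def)
  moreover have "(SOME x. x \<in> dcoset h) \<in> dcoset h" using assms(3) by (rule someI)
  ultimately show ?thesis using assms(3) by (simp add: lift_def)
qed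

lemma lift_dcoset: "biinvariant \<Phi> \<Longrightarrow> h \<in> carrier G \<Longrightarrow> lift \<Phi> (dcoset h) = \<Phi> h"
  by (rule lift_eq[OF _ _ dcoset_self])

lemma biinvariant_dcoset_translate:
  assumes z: "z \<in> carrier G" "\<And>t. t \<in> T \<Longrightarrow> z \<otimes> t = t \<otimes> z"
  shows "biinvariant (\<lambda>h. dcoset (z \<otimes> h))"
  unfolding biinvariant_def
proof (intro ballI)
  fix h t k assume h: "h \<in> carrier G" and t: "t \<in> T" and k: "k \<in> K"
  have "z \<otimes> (t \<otimes> h \<otimes> k) = z \<otimes> t \<otimes> h \<otimes> k" using z(1) h t k by (simp add: m_assoc)
  also have "\<dots> = t \<otimes> (z \<otimes> h) \<otimes> k" unfolding z(2)[OF t] using z(1) h t k by (simp add: m_assoc)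
  finally show "dcoset (z \<otimes> (t \<otimes> h \<otimes> k)) = dcoset (z \<otimes> h)"
    using dcoset_eqI[OF _ dcosetI[OF t k]] z(1) h by simp
qed

definition weight :: "'a \<Rightarrow> nat" where
  "weight h = rel_index (T \<inter> K) (conj_set h K)"

lemma weight_one: "weight \<one> = 1"
  unfolding weight_def
  by (intro rel_index_eq_1 subgroups_Inter_pair T.subgroup_axioms K.subgroup_axioms)
    (simp_all add: conj_set_subgroup K.subgroup_axioms)

lemma weight_mult:
  assumes z: "z \<in> carrier G" "\<And>t. t \<in> T \<Longrightarrow> z \<otimes> t = t \<otimes> z" and h: "h \<in> carrier G" and k: "k \<in> K"
  shows "weight (z \<otimes> h \<otimes> k) = weight h"
  unfolding weight_def
proof (rule rel_index_cong)
  show "subgroup (T \<inter> K) G" by (intro subgroups_Inter_pair T.subgroup_axioms K.subgroup_axioms)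
  show "subgroup (conj_set (z \<otimes> h \<otimes> k) K) G" "subgroup (conj_set h K) G"
    using z h k by (simp_all add: subgroup_conj_set K.subgroup_axioms)
  then have sub: "conj_set h K \<subseteq> carrier G" by (intro subgroup.subset)
  have "conj_set (z \<otimes> h \<otimes> k) K = conj_set (z \<otimes> h) (conj_set k K)"
    using z h k K.subset by (intro conj_set_mult) auto
  also have "\<dots> = conj_set z (conj_set h K)"
    using z h k K.subset by (simp add: conj_set_subgroup[OF K.subgroup_axioms] conj_set_mult)
  finally have eq: "conj_set (z \<otimes> h \<otimes> k) K = conj_set z (conj_set h K)" .
  have "t \<in> conj_set z (conj_set h K) \<longleftrightarrow> t \<in> conj_set h K" if t: "t \<in> T" for t
  proof -
    have "inv z \<otimes> t \<otimes> z = inv z \<otimes> (z \<otimes> t)" using z(1) t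
      by (simp only: z(2)[OF t] m_assoc inv_closed T_carrier)
    also have "\<dots> = t" using z(1) t by (simp add: m_assoc [symmetric])
    finally show ?thesis using mem_conj_set_iff[OF z(1) sub, of t] t by simp
  qed
  then show "T \<inter> K \<inter> conj_set (z \<otimes> h \<otimes> k) K = T \<inter> K \<inter> conj_set h K" unfolding eq by blast
qed

end

lemma integral_finite_partition:
  fixes f :: "'c \<Rightarrow> 'b::{banach, second_countable_topology}"
  assumes fin: "finite \<E>" and disj: "disjoint \<E>"
    and meas: "\<And>E. E \<in> \<E> \<Longrightarrow> E \<in> sets \<mu>" "\<And>E. E \<in> \<E> \<Longrightarrow> emeasure \<mu> E < \<infinity>"
    and const: "\<And>E C. E \<in> \<E> \<Longrightarrow> C \<in> E \<Longrightarrow> f C = c E"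
    and zero: "\<And>C. C \<in> space \<mu> \<Longrightarrow> C \<notin> \<Union>\<E> \<Longrightarrow> f C = 0"
  shows "(LINT C|\<mu>. f C) = (\<Sum>E\<in>\<E>. measure \<mu> E *\<^sub>R c E)"
proof -
  have "f C = (\<Sum>E\<in>\<E>. indicator E C *\<^sub>R c E)" if C: "C \<in> space \<mu>" for C
  proof (cases "C \<in> \<Union>\<E>")
    case True
    then obtain E where E: "E \<in> \<E>" "C \<in> E" by blast
    then have "(\<Sum>E\<in>\<E>. indicator E C *\<^sub>R c E) = (\<Sum>E'\<in>\<E>. if E' = E then c E else 0)"
      using disj by (intro sum.cong) (auto simp: indicator_def disjoint_def)
    then show ?thesis using E fin const by simp
  next
    case False
    then show ?thesis using zero[OF C] by (auto intro!: sum.neutral [symmetric])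
  qed
  then have "(LINT C|\<mu>. f C) = (LINT C|\<mu>. (\<Sum>E\<in>\<E>. indicator E C *\<^sub>R c E))"
    by (rule Bochner_Integration.integral_cong[OF refl])
  then show ?thesis using meas by (simp add: Bochner_Integration.integral_sum)
qed

locale invariant_measure_on_cosets = double_cosets G T K for G (structure) and T K +
  fixes \<mu> :: "'a set measure"
  assumes space_cosets: "space \<mu> = rcosets T"
    and measurable_translate: "g \<in> carrier G \<Longrightarrow> (\<lambda>C. C #> g) \<in> \<mu> \<rightarrow>\<^sub>M \<mu>"
    and emeasure_translate: "g \<in> carrier G \<Longrightarrow> A \<in> sets \<mu> \<Longrightarrow> emeasure \<mu> ((\<lambda>C. C #> g) ` A) = emeasure \<mu> A"
begin

definition cosets_of :: "'a set \<Rightarrow> 'a set set" where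
  "cosets_of Y = (\<lambda>y. T #> y) ` Y"

lemma translate_cosets_of:
  assumes "g \<in> carrier G" "Y \<subseteq> carrier G"
  shows "(\<lambda>C. C #> g) ` cosets_of Y = cosets_of (Y #> g)"
proof -
  have "Y #> g = (\<lambda>y. y \<otimes> g) ` Y" by (auto simp: r_coset_def)
  moreover have "T #> y #> g = T #> (y \<otimes> g)" if "y \<in> Y" for y
    using that assms T.subset by (intro coset_mult_assoc) auto
  ultimately show ?thesis by (simp add: cosets_of_def image_image)
qed

lemma translate_translate:
  assumes "C \<in> space \<mu>" "g \<in> carrier G" "h \<in> carrier G"
  shows "C #> g #> h = C #> (g \<otimes> h)"
proof -
  have "C \<subseteq> carrier G" using assms(1) T.rcosets_carrier[OF is_group] unfolding space_cosets by blast
  then show ?thesis using assms by (simp add: coset_mult_assoc)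
qed

lemma translate_in_space: "C \<in> space \<mu> \<Longrightarrow> g \<in> carrier G \<Longrightarrow> C #> g \<in> space \<mu>"
  unfolding space_cosets by (auto simp: RCOSETS_def coset_mult_assoc T.subset)

lemma translate_one: "C \<in> space \<mu> \<Longrightarrow> C #> \<one> = C"
  unfolding space_cosets by (auto simp: RCOSETS_def coset_mult_assoc T.subset)

lemma vimage_translate:
  assumes "g \<in> carrier G" "A \<subseteq> space \<mu>"
  shows "(\<lambda>C. C #> g) -` A \<inter> space \<mu> = (\<lambda>C. C #> inv g) ` A"
proof -
  have cancel: "C #> inv g #> g = C" "C #> g #> inv g = C" if "C \<in> space \<mu>" for C
    using that assms(1) by (simp_all add: translate_translate translate_one)
  show ?thesis
  proof (intro equalityI subsetI)
    fix C assume "C \<in> (\<lambda>C. C #> g) -` A \<inter> space \<mu>"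
    then have "C #> g \<in> A" "C = C #> g #> inv g" using cancel by simp_all
    then show "C \<in> (\<lambda>C. C #> inv g) ` A" by (rule rev_image_eqI)
  next
    fix C assume "C \<in> (\<lambda>C. C #> inv g) ` A"
    then obtain D where D: "D \<in> A" "C = D #> inv g" by (rule imageE)
    then have "D \<in> space \<mu>" using assms(2) by blast
    then show "C \<in> (\<lambda>C. C #> g) -` A \<inter> space \<mu>"
      using D cancel(1) translate_in_space[OF _ inv_closed[OF assms(1)]] by simp
  qed
qed

lemma sets_translate:
  assumes "g \<in> carrier G" "A \<in> sets \<mu>"
  shows "(\<lambda>C. C #> g) ` A \<in> sets \<mu>"
  using measurable_sets[OF measurable_translate[OF inv_closed[OF assms(1)]] assms(2)]
    vimage_translate[OF inv_closed[OF assms(1)] sets.sets_into_space[OF assms(2)]] assms(1)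
  by (simp only: inv_inv)

lemma distr_translate:
  assumes "g \<in> carrier G"
  shows "distr \<mu> \<mu> (\<lambda>C. C #> g) = \<mu>"
proof (rule measure_eqI)
  fix A assume "A \<in> sets (distr \<mu> \<mu> (\<lambda>C. C #> g))"
  then have A: "A \<in> sets \<mu>" by simp
  then show "emeasure (distr \<mu> \<mu> (\<lambda>C. C #> g)) A = emeasure \<mu> A"
    using assms vimage_translate[OF assms sets.sets_into_space[OF A]]
    by (simp add: emeasure_distr measurable_translate emeasure_translate)
qed simp

lemma integral_translate:
  fixes f :: "'a set \<Rightarrow> 'c::{banach, second_countable_topology}"
  assumes "g \<in> carrier G" "f \<in> borel_measurable \<mu>"
  shows "(LINT C|\<mu>. f (C #> g)) = (LINT C|\<mu>. f C)"
  using integral_distr[OF measurable_translate[OF assms(1)] assms(2)] distr_translate[OF assms(1)] by simp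

lemma coset_in_cosets_of_iff:
  assumes "Y \<subseteq> carrier G" "g \<in> carrier G"
  shows "T #> g \<in> cosets_of Y \<longleftrightarrow> (\<exists>t\<in>T. t \<otimes> g \<in> Y)"
proof -
  have "T #> g = T #> y \<longleftrightarrow> y \<in> T #> g" if "y \<in> Y" for y
    using that assms rcos_self[of y T] repr_independence[of y T g] T.subgroup_axioms by auto
  then have "T #> g \<in> cosets_of Y \<longleftrightarrow> (\<exists>y\<in>Y. y \<in> T #> g)" unfolding cosets_of_def by blast
  then show ?thesis by (auto simp: r_coset_def)
qed

lemma coset_in_cosets_of_rcoset_iff:
  assumes S: "subgroup S G" and N: "subgroup N G" "N \<subseteq> S" and s: "s \<in> S" and x: "x \<in> S"
  shows "T #> s \<in> cosets_of (N #> x) \<longleftrightarrow> N #> x \<in> (\<lambda>t. N #> (t \<otimes> s)) ` (T \<inter> S)"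
proof -
  have Sc: "y \<in> carrier G" if "y \<in> S" for y using that S subgroup.mem_carrier by metis
  have "N #> x = N #> (t \<otimes> s) \<longleftrightarrow> t \<otimes> s \<in> N #> x" if "t \<in> S" for t
    using rcos_self[OF Sc[OF subgroup.m_closed[OF S that s]] N(1)] repr_independence[OF _ Sc[OF x] N(1)] by blast
  moreover have "t \<in> S" if t: "t \<in> T" "t \<otimes> s \<in> N #> x" for t
  proof -
    have "N #> x \<subseteq> S" using N(2) x S by (auto simp: r_coset_def subgroup.m_closed)
    then have "t \<otimes> s \<otimes> inv s \<in> S"
      using t by (intro subgroup.m_closed[OF S _ subgroup.m_inv_closed[OF S s]]) auto
    then show ?thesis using t s Sc[OF s] by (simp add: m_assoc)
  qed
  moreover have "T #> s \<in> cosets_of (N #> x) \<longleftrightarrow> (\<exists>t\<in>T. t \<otimes> s \<in> N #> x)"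
    using Sc[OF x] N(1) by (intro coset_in_cosets_of_iff Sc[OF s]) (simp add: r_coset_subset_G subgroup.subset)
  ultimately show ?thesis by blast
qed

lemma card_rcosets_meeting:
  assumes S: "subgroup S G" and N: "subgroup N G" "N \<subseteq> S" and s: "s \<in> S"
  shows "card {b \<in> (\<lambda>x. N #> x) ` S. T #> s \<in> cosets_of b} = rel_index (T \<inter> S) N"
proof -
  have Sc: "y \<in> carrier G" if "y \<in> S" for y using that S subgroup.mem_carrier by metis
  have sub: "(\<lambda>t. N #> (t \<otimes> s)) ` (T \<inter> S) \<subseteq> (\<lambda>x. N #> x) ` S"
    using subgroup.m_closed[OF S _ s] by auto
  have iff: "T #> s \<in> cosets_of b \<longleftrightarrow> b \<in> (\<lambda>t. N #> (t \<otimes> s)) ` (T \<inter> S)" if "b \<in> (\<lambda>x. N #> x) ` S" for b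
    using that coset_in_cosets_of_rcoset_iff[OF S N s] by (elim imageE) (simp only:)
  have "{b \<in> (\<lambda>x. N #> x) ` S. T #> s \<in> cosets_of b} = {b \<in> (\<lambda>x. N #> x) ` S. b \<in> (\<lambda>t. N #> (t \<otimes> s)) ` (T \<inter> S)}"
    using iff by (simp cong: conj_cong)
  also have "\<dots> = (\<lambda>t. N #> (t \<otimes> s)) ` (T \<inter> S)"
    using sub by (simp only: Int_def [symmetric] Collect_mem_eq Int_absorb1)
  finally have "{b \<in> (\<lambda>x. N #> x) ` S. T #> s \<in> cosets_of b} = (\<lambda>t. N #> (t \<otimes> s)) ` (T \<inter> S)" .
  moreover have "card ((\<lambda>t. N #> (t \<otimes> s)) ` (T \<inter> S)) = card ((\<lambda>t. N #> t) ` (T \<inter> S))"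
  proof (rule card_image_cong_iff)
    fix t u assume "t \<in> T \<inter> S" "u \<in> T \<inter> S"
    then have c: "t \<in> carrier G" "u \<in> carrier G" by auto
    have "t \<otimes> s \<otimes> inv (u \<otimes> s) = t \<otimes> (s \<otimes> inv s) \<otimes> inv u"
      using c Sc[OF s] by (simp only: inv_mult_group m_assoc m_closed inv_closed)
    then have "t \<otimes> s \<otimes> inv (u \<otimes> s) = t \<otimes> inv u" using c Sc[OF s] by simp
    then show "N #> (t \<otimes> s) = N #> (u \<otimes> s) \<longleftrightarrow> N #> t = N #> u"
      using c Sc[OF s] by (simp add: rcos_eq_iff[OF N(1)])
  qed
  ultimately show ?thesis by (simp add: rel_index_def)
qed

lemma Union_rcosets_subgroup:
  assumes S: "subgroup S G" and N: "subgroup N G" "N \<subseteq> S"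
  shows "\<Union>((\<lambda>x. N #> x) ` S) = S"
proof -
  have "x \<in> N #> x" if "x \<in> S" for x using that S N(1) by (simp add: rcos_self subgroup.mem_carrier)
  moreover have "N #> x \<subseteq> S" if "x \<in> S" for x using that N(2) S by (auto simp: r_coset_def subgroup.m_closed)
  ultimately show ?thesis by blast
qed

lemma sum_indicator_cosets_of:
  assumes S: "subgroup S G" and N: "subgroup N G" "N \<subseteq> S" and fin: "finite ((\<lambda>x. N #> x) ` S)"
  shows "(\<Sum>b\<in>(\<lambda>x. N #> x) ` S. indicator (cosets_of b) C) =
    (of_nat (rel_index (T \<inter> S) N) * indicator (cosets_of S) C :: ennreal)"
proof -
  let ?B = "(\<lambda>x. N #> x) ` S"
  have "(\<Sum>b\<in>?B. indicator (cosets_of b) C :: ennreal) = of_nat (card {b \<in> ?B. C \<in> cosets_of b})"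
    using sum.inter_filter[OF fin, of "\<lambda>_. 1 :: ennreal" "\<lambda>b. C \<in> cosets_of b"]
    by (simp add: indicator_def of_bool_def)
  moreover have "card {b \<in> ?B. C \<in> cosets_of b} = (if C \<in> cosets_of S then rel_index (T \<inter> S) N else 0)"
  proof (cases "C \<in> cosets_of S")
    case True
    then obtain s where "s \<in> S" "C = T #> s" by (auto simp: cosets_of_def)
    then show ?thesis using True card_rcosets_meeting[OF S N] by simp
  next
    case False
    then have "{b \<in> ?B. C \<in> cosets_of b} = {}"
      using Union_rcosets_subgroup[OF S N] unfolding cosets_of_def by blast
    then show ?thesis using False by (simp only: card.empty if_False)
  qed
  ultimately show ?thesis by (simp add: indicator_def)
qed

lemma emeasure_rel_index:
  assumes S: "subgroup S G" and N: "subgroup N G" "N \<subseteq> S" and fin: "finite ((\<lambda>x. N #> x) ` S)"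
    and meas: "cosets_of N \<in> sets \<mu>"
  shows "cosets_of S \<in> sets \<mu>"
    and "of_nat (rel_index S N) * emeasure \<mu> (cosets_of N) =
        of_nat (rel_index (T \<inter> S) N) * emeasure \<mu> (cosets_of S)"
proof -
  let ?B = "(\<lambda>x. N #> x) ` S"
  have b: "cosets_of b \<in> sets \<mu> \<and> emeasure \<mu> (cosets_of b) = emeasure \<mu> (cosets_of N)" if "b \<in> ?B" for b
  proof -
    from that obtain x where x: "x \<in> S" "b = N #> x" by (rule imageE)
    then have "cosets_of b = (\<lambda>C. C #> x) ` cosets_of N"
      using N(1) S by (simp add: translate_cosets_of subgroup.subset subgroup.mem_carrier)
    then show ?thesis
      using x(1) S meas sets_translate emeasure_translate by (simp add: subgroup.mem_carrier)
  qed
  have "cosets_of S = (\<Union>b\<in>?B. cosets_of b)"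
    unfolding cosets_of_def by (subst (1) Union_rcosets_subgroup[OF S N, symmetric]) blast
  then show S_sets: "cosets_of S \<in> sets \<mu>" using fin b by (simp only: sets.finite_UN)
  have "of_nat (rel_index S N) * emeasure \<mu> (cosets_of N) = (\<Sum>b\<in>?B. emeasure \<mu> (cosets_of b))"
    using b by (simp add: rel_index_def)
  also have "\<dots> = (\<Sum>b\<in>?B. \<integral>\<^sup>+ C. indicator (cosets_of b) C \<partial>\<mu>)"
    using b by (intro sum.cong) simp_all
  also have "\<dots> = (\<integral>\<^sup>+ C. (\<Sum>b\<in>?B. indicator (cosets_of b) C) \<partial>\<mu>)"
    using b by (intro nn_integral_sum [symmetric] borel_measurable_indicator) blast
  also have "\<dots> = of_nat (rel_index (T \<inter> S) N) * emeasure \<mu> (cosets_of S)"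
    unfolding sum_indicator_cosets_of[OF S N fin] using S_sets by (simp add: nn_integral_cmult)
  finally show "of_nat (rel_index S N) * emeasure \<mu> (cosets_of N) =
      of_nat (rel_index (T \<inter> S) N) * emeasure \<mu> (cosets_of S)" .
qed

lemma cosets_of_dcoset:
  assumes h: "h \<in> carrier G"
  shows "cosets_of (dcoset h) = (\<lambda>C. C #> h) ` cosets_of (conj_set h K)"
proof -
  have eq: "T #> (t \<otimes> h \<otimes> k) = T #> (h \<otimes> k \<otimes> inv h) #> h" if "t \<in> T" "k \<in> K" for t k
  proof -
    have "T #> (t \<otimes> h \<otimes> k) = T #> t #> (h \<otimes> k)" using that h T.subset by (simp add: coset_mult_assoc m_assoc)
    also have "T #> t = T" using that by (simp add: coset_join2 T.subgroup_axioms)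
    also have "T #> (h \<otimes> k) = T #> (h \<otimes> k \<otimes> inv h) #> h"
      using that h T.subset by (simp add: coset_mult_assoc m_assoc)
    finally show ?thesis .
  qed
  have "cosets_of (dcoset h) = (\<lambda>k. T #> (h \<otimes> k \<otimes> inv h) #> h) ` K"
  proof (intro equalityI subsetI)
    fix C assume "C \<in> cosets_of (dcoset h)"
    then show "C \<in> (\<lambda>k. T #> (h \<otimes> k \<otimes> inv h) #> h) ` K"
      using eq by (auto simp: cosets_of_def dcoset_def)
  next
    fix C assume "C \<in> (\<lambda>k. T #> (h \<otimes> k \<otimes> inv h) #> h) ` K"
    then obtain k where "k \<in> K" "C = T #> (\<one> \<otimes> h \<otimes> k)" using eq[OF T.one_closed] by auto
    then show "C \<in> cosets_of (dcoset h)" using T.one_closed unfolding cosets_of_def dcoset_def by blast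
  qed
  then show ?thesis by (simp add: cosets_of_def conj_set_def image_image)
qed

theorem emeasure_dcoset:
  assumes h: "h \<in> carrier G" and meas: "cosets_of (K \<inter> conj_set h K) \<in> sets \<mu>"
    and fin: "finite ((\<lambda>x. (K \<inter> conj_set h K) #> x) ` K)"
    and unimodular: "rel_index K (conj_set h K) = rel_index (conj_set h K) K"
    and TK: "T \<inter> conj_set h K \<subseteq> K"
  shows "cosets_of (dcoset h) \<in> sets \<mu>"
    and "emeasure \<mu> (cosets_of (dcoset h)) = of_nat (weight h) * emeasure \<mu> (cosets_of K)"
proof -
  let ?Kh = "conj_set h K" and ?N = "K \<inter> conj_set h K"
  note K = K.subgroup_axioms and Kh = subgroup_conj_set[OF h K.subgroup_axioms]
  have N: "subgroup ?N G" and TK': "subgroup (T \<inter> K) G" "subgroup (T \<inter> ?Kh) G"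
    by (intro subgroups_Inter_pair K Kh T.subgroup_axioms)+
  have index: "rel_index K ?N = rel_index K ?Kh" "rel_index ?Kh ?N = rel_index ?Kh K"
    "rel_index (T \<inter> K) ?N = weight h"
    unfolding weight_def by (auto intro!: rel_index_cong N K Kh TK')
  have index': "rel_index (T \<inter> ?Kh) ?N = 1" using TK by (intro rel_index_eq_1 TK' N) auto
  have "K \<noteq> {}" using K.one_closed by blast
  then have "rel_index K ?N \<noteq> 0" using fin by (simp add: rel_index_def)
  then have "rel_index ?Kh ?N \<noteq> 0" using index unimodular by simp
  then have fin': "finite ((\<lambda>x. ?N #> x) ` ?Kh)" unfolding rel_index_def by (simp add: card_eq_0_iff)
  note measK = emeasure_rel_index[OF K N _ fin meas] and measKh = emeasure_rel_index[OF Kh N _ fin' meas]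
  have "cosets_of ?Kh \<in> sets \<mu>" using measKh by blast
  then show "cosets_of (dcoset h) \<in> sets \<mu>" using h by (simp add: cosets_of_dcoset sets_translate)
  have "emeasure \<mu> (cosets_of (dcoset h)) = emeasure \<mu> (cosets_of ?Kh)"
    using h measKh(1) by (simp add: cosets_of_dcoset emeasure_translate)
  then show "emeasure \<mu> (cosets_of (dcoset h)) = of_nat (weight h) * emeasure \<mu> (cosets_of K)"
    using measK(2) measKh(2) index index' unimodular by simp
qed

lemma coset_mem_cosets_of_dcoset_iff:
  assumes "h \<in> carrier G" "g \<in> carrier G"
  shows "T #> g \<in> cosets_of (dcoset h) \<longleftrightarrow> g \<in> dcoset h"
proof -
  have "t \<otimes> g \<in> dcoset h \<longleftrightarrow> g \<in> dcoset h" if t: "t \<in> T" for t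
  proof -
    have "t \<otimes> g \<otimes> \<one> \<in> dcoset g" using t K.one_closed by (rule dcosetI)
    then have "dcoset (t \<otimes> g) = dcoset g" using t assms(2) by (intro dcoset_eqI) simp_all
    moreover have "t \<otimes> g \<in> dcoset (t \<otimes> g)" "g \<in> dcoset g" using t assms(2) by (simp_all add: dcoset_self)
    ultimately show ?thesis using dcoset_eqI[OF assms(1)] by auto
  qed
  then have "(\<exists>t\<in>T. t \<otimes> g \<in> dcoset h) \<longleftrightarrow> g \<in> dcoset h" using T.one_closed by (metis (no_types, lifting))
  then show ?thesis using coset_in_cosets_of_iff[OF dcoset_subset_carrier assms(2)] assms(1) by simp
qed

lemma dcosets_eqI:
  assumes D: "D \<in> dcosets" "D' \<in> dcosets" and C: "C \<in> cosets_of D" "C \<in> cosets_of D'"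
  shows "D = D'"
proof -
  obtain h h' where h: "h \<in> carrier G" "D = dcoset h" "h' \<in> carrier G" "D' = dcoset h'"
    using D by (auto simp: dcosets_def)
  obtain g where g: "g \<in> dcoset h" "C = T #> g" using C(1) h(2) by (auto simp: cosets_of_def)
  then have "g \<in> dcoset h'"
    using C(2) h coset_mem_cosets_of_dcoset_iff[OF h(3), of g] dcoset_subset_carrier[OF h(1)] by auto
  then show ?thesis using dcoset_eqI[OF h(1) g(1)] dcoset_eqI[OF h(3)] h by simp
qed

lemma inj_on_cosets_of: "inj_on cosets_of dcosets"
proof (rule inj_onI)
  fix D D' assume D: "D \<in> dcosets" "D' \<in> dcosets" "cosets_of D = cosets_of D'"
  then obtain h where "h \<in> carrier G" "D = dcoset h" by (auto simp: dcosets_def)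
  then have "T #> h \<in> cosets_of D" by (simp add: cosets_of_def dcoset_self)
  then show "D = D'" using dcosets_eqI[OF D(1,2)] D(3) by simp
qed

theorem integral_biinvariant:
  fixes f :: "'a set \<Rightarrow> 'c::{banach, second_countable_topology}"
  assumes f: "\<And>h. h \<in> carrier G \<Longrightarrow> f (T #> h) = \<Phi> h" and \<Phi>: "biinvariant \<Phi>"
    and supp: "finite {D \<in> dcosets. lift \<Phi> D \<noteq> 0}"
    and meas: "\<And>h. h \<in> carrier G \<Longrightarrow> cosets_of (dcoset h) \<in> sets \<mu>"
      "\<And>h. h \<in> carrier G \<Longrightarrow> emeasure \<mu> (cosets_of (dcoset h)) < \<infinity>"
  shows "(LINT C|\<mu>. f C) = (\<Sum>D | D \<in> dcosets \<and> lift \<Phi> D \<noteq> 0. measure \<mu> (cosets_of D) *\<^sub>R lift \<Phi> D)"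
proof -
  let ?\<D> = "{D \<in> dcosets. lift \<Phi> D \<noteq> 0}"
  have lift: "f C = lift \<Phi> D" if DC: "D \<in> dcosets" "C \<in> cosets_of D" for C D
  proof -
    obtain h where h: "h \<in> carrier G" "D = dcoset h" using DC(1) by (auto simp: dcosets_def)
    obtain g where "g \<in> dcoset h" "C = T #> g" using DC(2) h(2) by (auto simp: cosets_of_def)
    then show ?thesis using h f lift_eq[OF \<Phi> h(1)] dcoset_subset_carrier[OF h(1)] by auto
  qed
  have "(LINT C|\<mu>. f C) = (\<Sum>E\<in>cosets_of ` ?\<D>. measure \<mu> E *\<^sub>R lift \<Phi> (inv_into dcosets cosets_of E))"
  proof (rule integral_finite_partition)
    show "finite (cosets_of ` ?\<D>)" using supp by simp
    show "disjoint (cosets_of ` ?\<D>)" using dcosets_eqI unfolding disjoint_def by blast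
    show "E \<in> sets \<mu>" "emeasure \<mu> E < \<infinity>" if "E \<in> cosets_of ` ?\<D>" for E
      using that meas by (auto simp: dcosets_def)
    show "f C = lift \<Phi> (inv_into dcosets cosets_of E)" if "E \<in> cosets_of ` ?\<D>" "C \<in> E" for E C
      using that lift by (auto simp: inv_into_f_f inj_on_cosets_of)
    show "f C = 0" if C: "C \<in> space \<mu>" "C \<notin> \<Union>(cosets_of ` ?\<D>)" for C
    proof -
      obtain g where g: "g \<in> carrier G" "C = T #> g" using C(1) by (auto simp: space_cosets RCOSETS_def)
      then have "dcoset g \<in> dcosets" "C \<in> cosets_of (dcoset g)"
        using dcoset_self by (auto simp: dcosets_def cosets_of_def)
      then show ?thesis using lift[of "dcoset g" C] C(2) by auto
    qed
  qed
  also have "\<dots> = (\<Sum>D\<in>?\<D>. measure \<mu> (cosets_of D) *\<^sub>R lift \<Phi> D)"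
    using inj_on_cosets_of by (subst sum.reindex) (auto simp: inv_into_f_f intro: inj_on_subset
      intro!: sum.cong)
  finally show ?thesis .
qed

end

section \<open>The maximal compact subgroup\<close>

global_interpretation GLxGL: group "GLxGL :: ('k::field, 'n::finite) mat2 monoid"
  by (rule group_GLxGL)

lemma carrier_GLxGL_iff: "h \<in> carrier GLxGL \<longleftrightarrow> invertible (fst h) \<and> invertible (snd h)"
  by (simp add: GLxGL_def)

lemma mult_GLxGL: "g \<otimes>\<^bsub>GLxGL\<^esub> h = (fst g ** fst h, snd g ** snd h)"
  by (simp add: GLxGL_def)

lemma one_GLxGL: "\<one>\<^bsub>GLxGL\<^esub> = (mat 1, mat 1)"
  by (simp add: GLxGL_def)

lemma inv_GLxGL:
  assumes "h \<in> carrier GLxGL"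
  shows "inv\<^bsub>GLxGL\<^esub> h = (matrix_inv (fst h), matrix_inv (snd h))"
  using assms by (intro GLxGL.inv_equality) (auto simp: GLxGL_def matrix_inv_props)

definition GLxGL_O :: "('a::nonarch_local_field_0, 'n::finite) mat2 set" where
  "GLxGL_O = GL_O \<times> GL_O"

lemma GLxGL_O_carrier: "k \<in> GLxGL_O \<Longrightarrow> k \<in> carrier GLxGL"
  by (auto simp: GLxGL_O_def carrier_GLxGL_iff GL_O_D)

lemma subgroup_GLxGL_O: "subgroup GLxGL_O (GLxGL :: ('a::nonarch_local_field_0, 'n::finite) mat2 monoid)"
proof (rule GLxGL.subgroupI)
  fix g h :: "('a, 'n) mat2" assume g: "g \<in> GLxGL_O" and "h \<in> GLxGL_O"
  then show "g \<otimes>\<^bsub>GLxGL\<^esub> h \<in> GLxGL_O" by (auto simp: GLxGL_O_def mult_GLxGL GL_O_mult)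
  show "inv\<^bsub>GLxGL\<^esub> g \<in> GLxGL_O"
    using g by (auto simp: inv_GLxGL[OF GLxGL_O_carrier[OF g]] GLxGL_O_def GL_O_inv)
next
  have "(mat 1, mat 1) \<in> (GLxGL_O :: ('a, 'n) mat2 set)" by (simp add: GLxGL_O_def)
  then show "GLxGL_O \<noteq> ({} :: ('a, 'n) mat2 set)" by blast
qed (auto simp: GLxGL_O_carrier)

lemma open_GLxGL_O: "open (GLxGL_O :: ('a::nonarch_local_field_0, 'n::finite) mat2 set)"
  unfolding GLxGL_O_def by (intro open_Times open_GL_O)

lemma compact_GLxGL_O: "compact (GLxGL_O :: ('a::nonarch_local_field_0, 'n::finite) mat2 set)"
  unfolding GLxGL_O_def by (intro compact_Times compact_GL_O)

lemma open_GLxGL_sandwich: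
  fixes g h :: "('a::nonarch_local_field_0, 'n::finite) mat2"
  assumes "open Y"
  shows "open {x. g \<otimes>\<^bsub>GLxGL\<^esub> x \<otimes>\<^bsub>GLxGL\<^esub> h \<in> Y}"
proof -
  have "continuous_on UNIV (\<lambda>x :: ('a, 'n) mat2. (fst g ** fst x ** fst h, snd g ** snd x ** snd h))"
    by (intro continuous_on_Pair continuous_on_matrix_mult continuous_on_const continuous_on_fst
      continuous_on_snd continuous_on_id)
  then have "open ((\<lambda>x :: ('a, 'n) mat2. (fst g ** fst x ** fst h, snd g ** snd x ** snd h)) -` Y)"
    using assms by (rule open_vimage[rotated])
  then show ?thesis by (simp add: mult_GLxGL vimage_def)
qed

lemma open_carrier_GLxGL: "open (carrier GLxGL :: ('a::nonarch_local_field_0, 'n::finite) mat2 set)"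
proof -
  have "\<exists>U. open U \<and> h \<in> U \<and> U \<subseteq> carrier GLxGL" if h: "h \<in> carrier GLxGL" for h :: "('a, 'n) mat2"
  proof (intro exI conjI subsetI)
    let ?U = "{x. inv\<^bsub>GLxGL\<^esub> h \<otimes>\<^bsub>GLxGL\<^esub> x \<otimes>\<^bsub>GLxGL\<^esub> \<one>\<^bsub>GLxGL\<^esub> \<in> GLxGL_O}"
    show "open ?U" using open_GLxGL_O by (rule open_GLxGL_sandwich)
    show "h \<in> ?U" using h subgroup.one_closed[OF subgroup_GLxGL_O] by simp
    fix x assume "x \<in> ?U"
    then have "inv\<^bsub>GLxGL\<^esub> h \<otimes>\<^bsub>GLxGL\<^esub> x \<in> carrier GLxGL"
      using GLxGL_O_carrier by (auto simp: mult_GLxGL one_GLxGL)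
    then show "x \<in> carrier GLxGL"
      using h by (auto simp: inv_GLxGL mult_GLxGL carrier_GLxGL_iff invertible_det_nz det_mul)
  qed
  then show ?thesis by (subst open_subopen) blast
qed

lemma open_GLxGL_sandwich_Int_carrier:
  fixes g h :: "('a::nonarch_local_field_0, 'n::finite) mat2"
  shows "open Y \<Longrightarrow> open ({x. g \<otimes>\<^bsub>GLxGL\<^esub> x \<otimes>\<^bsub>GLxGL\<^esub> h \<in> Y} \<inter> carrier GLxGL)"
  by (intro open_Int open_GLxGL_sandwich open_carrier_GLxGL)

lemma open_rcoset:
  fixes N :: "('a::nonarch_local_field_0, 'n::finite) mat2 set"
  assumes N: "open N" "N \<subseteq> carrier GLxGL" and g: "g \<in> carrier GLxGL"
  shows "open (N #>\<^bsub>GLxGL\<^esub> g)"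
proof -
  have "N #>\<^bsub>GLxGL\<^esub> g = {x. \<one>\<^bsub>GLxGL\<^esub> \<otimes>\<^bsub>GLxGL\<^esub> x \<otimes>\<^bsub>GLxGL\<^esub> inv\<^bsub>GLxGL\<^esub> g \<in> N} \<inter> carrier GLxGL"
  proof (intro equalityI subsetI IntI CollectI)
    fix x assume "x \<in> N #>\<^bsub>GLxGL\<^esub> g"
    then obtain n where n: "n \<in> N" "x = n \<otimes>\<^bsub>GLxGL\<^esub> g" by (auto simp: r_coset_def)
    then have "n \<in> carrier GLxGL" using N(2) by blast
    then show "\<one>\<^bsub>GLxGL\<^esub> \<otimes>\<^bsub>GLxGL\<^esub> x \<otimes>\<^bsub>GLxGL\<^esub> inv\<^bsub>GLxGL\<^esub> g \<in> N" "x \<in> carrier GLxGL"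
      using n g by (simp_all add: GLxGL.m_assoc)
  next
    fix x assume x: "x \<in> {x. \<one>\<^bsub>GLxGL\<^esub> \<otimes>\<^bsub>GLxGL\<^esub> x \<otimes>\<^bsub>GLxGL\<^esub> inv\<^bsub>GLxGL\<^esub> g \<in> N} \<inter> carrier GLxGL"
    then have "x = x \<otimes>\<^bsub>GLxGL\<^esub> inv\<^bsub>GLxGL\<^esub> g \<otimes>\<^bsub>GLxGL\<^esub> g" using g by (simp add: GLxGL.m_assoc)
    then show "x \<in> N #>\<^bsub>GLxGL\<^esub> g" using x by (auto simp: r_coset_def)
  qed
  then show ?thesis using N(1) by (simp only: open_GLxGL_sandwich_Int_carrier)
qed

lemma open_conj_set:
  fixes N :: "('a::nonarch_local_field_0, 'n::finite) mat2 set"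
  assumes N: "open N" "N \<subseteq> carrier GLxGL" and h: "h \<in> carrier GLxGL"
  shows "open (GLxGL.conj_set h N)"
proof -
  have "GLxGL.conj_set h N \<subseteq> carrier GLxGL" using N(2) h by (auto simp: GLxGL.conj_set_def)
  then have "GLxGL.conj_set h N = {x. inv\<^bsub>GLxGL\<^esub> h \<otimes>\<^bsub>GLxGL\<^esub> x \<otimes>\<^bsub>GLxGL\<^esub> h \<in> N} \<inter> carrier GLxGL"
    using GLxGL.mem_conj_set_iff[OF h N(2)] by auto
  then show ?thesis using N(1) by (simp only: open_GLxGL_sandwich_Int_carrier)
qed

lemma finite_rcosets_compact:
  fixes N :: "('a::nonarch_local_field_0, 'n::finite) mat2 set"
  assumes N: "open N" "subgroup N GLxGL" and C: "compact C" "C \<subseteq> carrier GLxGL"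
  shows "finite ((\<lambda>x. N #>\<^bsub>GLxGL\<^esub> x) ` C)"
proof -
  have cover: "C \<subseteq> (\<Union>x\<in>C. N #>\<^bsub>GLxGL\<^esub> x)" using C(2) GLxGL.rcos_self[OF _ N(2)] by blast
  obtain F where F: "F \<subseteq> C" "finite F" "C \<subseteq> (\<Union>x\<in>F. N #>\<^bsub>GLxGL\<^esub> x)"
    by (rule compactE_image[OF C(1) _ cover])
      (use open_rcoset[OF N(1) subgroup.subset[OF N(2)]] C(2) in auto)
  have "N #>\<^bsub>GLxGL\<^esub> y \<in> (\<lambda>x. N #>\<^bsub>GLxGL\<^esub> x) ` F" if y: "y \<in> C" for y
  proof -
    obtain x where x: "x \<in> F" "y \<in> N #>\<^bsub>GLxGL\<^esub> x" using F(3) y by blast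
    then have "N #>\<^bsub>GLxGL\<^esub> x = N #>\<^bsub>GLxGL\<^esub> y"
      using F(1) C(2) N(2) by (intro GLxGL.repr_independence) auto
    then show ?thesis using x(1) by blast
  qed
  then have "(\<lambda>x. N #>\<^bsub>GLxGL\<^esub> x) ` C \<subseteq> (\<lambda>x. N #>\<^bsub>GLxGL\<^esub> x) ` F" by (rule image_subsetI)
  then show ?thesis using F(2) by (metis finite_imageI finite_subset)
qed

definition contragredient :: "('a::field, 'n::finite) mat2 \<Rightarrow> ('a, 'n) mat2" where
  "contragredient h = (transpose (matrix_inv (fst h)), transpose (matrix_inv (snd h)))"

lemma contragredient_contragredient: "h \<in> carrier GLxGL \<Longrightarrow> contragredient (contragredient h) = h"
  by (cases h) (simp add: contragredient_def carrier_GLxGL_iff matrix_inv_transpose matrix_inv_props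
    matrix_inv_matrix_inv)

lemma contragredient_hom: "contragredient \<in> hom GLxGL GLxGL"
  by (auto intro!: homI simp: contragredient_def carrier_GLxGL_iff mult_GLxGL matrix_inv_mult
    matrix_transpose_mul
      invertible_transpose matrix_inv_props)

lemma contragredient_GLxGL_O: "contragredient ` GLxGL_O = GLxGL_O"
proof -
  have c: "contragredient k \<in> GLxGL_O" if "k \<in> GLxGL_O" for k :: "('a, 'b) mat2"
    using that by (auto simp: contragredient_def GLxGL_O_def GL_O_transpose GL_O_inv)
  have "k \<in> contragredient ` GLxGL_O" if "k \<in> GLxGL_O" for k :: "('a, 'b) mat2"
    using contragredient_contragredient[OF GLxGL_O_carrier[OF that]] c[OF that] by (metis image_eqI)
  then show ?thesis using c by blast
qed

lemma GLxGL_unimodular: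
  fixes h :: "('a::nonarch_local_field_0, 'n::finite) mat2"
  assumes h: "h \<in> carrier GLxGL"
  shows "GLxGL.rel_index GLxGL_O (GLxGL.conj_set h GLxGL_O) =
      GLxGL.rel_index (GLxGL.conj_set h GLxGL_O) GLxGL_O"
proof -
  obtain k1 l1 where 1: "k1 \<in> GL_O" "l1 \<in> GL_O" "\<forall>i j. i \<noteq> j \<longrightarrow> (k1 ** fst h ** l1) $ i $ j = 0"
    using GL_O_cartan_decomposition[of "fst h"] by (elim bexE)
  obtain k2 l2 where 2: "k2 \<in> GL_O" "l2 \<in> GL_O" "\<forall>i j. i \<noteq> j \<longrightarrow> (k2 ** snd h ** l2) $ i $ j = 0"
    using GL_O_cartan_decomposition[of "snd h"] by (elim bexE)
  let ?k = "(k1, k2)" and ?l = "(l1, l2)"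
  define d where "d = ?k \<otimes>\<^bsub>GLxGL\<^esub> h \<otimes>\<^bsub>GLxGL\<^esub> ?l"
  have kl: "?k \<in> GLxGL_O" "?l \<in> GLxGL_O" using 1 2 by (auto simp: GLxGL_O_def)
  then have c: "?k \<in> carrier GLxGL" "?l \<in> carrier GLxGL" by (auto dest: GLxGL_O_carrier)
  then have d: "d \<in> carrier GLxGL" using h unfolding d_def by simp
  show ?thesis
  proof (rule GLxGL.rel_index_conj_set_commute[OF subgroup_GLxGL_O _ _ d])
    show "inv\<^bsub>GLxGL\<^esub> ?k \<in> GLxGL_O" "inv\<^bsub>GLxGL\<^esub> ?l \<in> GLxGL_O"
      using kl subgroup.m_inv_closed[OF subgroup_GLxGL_O] by auto
    have "inv\<^bsub>GLxGL\<^esub> ?k \<otimes>\<^bsub>GLxGL\<^esub> d \<otimes>\<^bsub>GLxGL\<^esub> inv\<^bsub>GLxGL\<^esub> ?l =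
        (inv\<^bsub>GLxGL\<^esub> ?k \<otimes>\<^bsub>GLxGL\<^esub> ?k) \<otimes>\<^bsub>GLxGL\<^esub> h \<otimes>\<^bsub>GLxGL\<^esub> (?l \<otimes>\<^bsub>GLxGL\<^esub> inv\<^bsub>GLxGL\<^esub> ?l)"
      unfolding d_def using c h by (simp only: GLxGL.m_assoc GLxGL.m_closed GLxGL.inv_closed)
    then show "h = inv\<^bsub>GLxGL\<^esub> ?k \<otimes>\<^bsub>GLxGL\<^esub> d \<otimes>\<^bsub>GLxGL\<^esub> inv\<^bsub>GLxGL\<^esub> ?l" using c h by simp
    show "contragredient \<in> hom GLxGL GLxGL" by (rule contragredient_hom)
    show "inj_on contragredient (carrier GLxGL)"
      by (rule inj_on_inverseI) (rule contragredient_contragredient)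
    show "contragredient ` GLxGL_O = GLxGL_O" by (rule contragredient_GLxGL_O)
    have "transpose (fst d) = fst d" "transpose (snd d) = snd d"
      using 1(3) 2(3) by (auto simp: d_def mult_GLxGL vec_eq_iff Finite_Cartesian_Product.transpose_def)
        metis+
    then show "contragredient d = inv\<^bsub>GLxGL\<^esub> d"
      using d by (simp add: inv_GLxGL contragredient_def carrier_GLxGL_iff flip: matrix_inv_transpose)
  qed
qed

section \<open>Invariant measures on coset spaces of the group\<close>

locale GLxGL_coset_measure =
  fixes T :: "('a::nonarch_local_field_0, 'n::finite) mat2 set" and \<mu>
  assumes subgroup_T: "subgroup T GLxGL" and invariant_coset_measure: "invariant_coset_measure T \<mu>"
begin

lemma openin_coset_topology_iff: "openin (coset_topology T) U \<longleftrightarrow> U \<subseteq> rcosets\<^bsub>GLxGL\<^esub> T \<and> open (\<Union>U)"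
proof -
  have "\<Union>U \<subseteq> carrier GLxGL" if "U \<subseteq> rcosets\<^bsub>GLxGL\<^esub> T"
    using Union_mono[OF that] GLxGL.rcosets_part_G[OF subgroup_T] by simp
  then show ?thesis
    using openin_coset_topology[OF subgroup_T, of U] openin_open_eq[OF open_carrier_GLxGL, of "\<Union>U"] by auto
qed

lemma mem_Union_iff:
  assumes "U \<subseteq> rcosets\<^bsub>GLxGL\<^esub> T" "x \<in> carrier GLxGL"
  shows "x \<in> \<Union>U \<longleftrightarrow> T #>\<^bsub>GLxGL\<^esub> x \<in> U"
proof
  assume "x \<in> \<Union>U"
  then obtain C where C: "C \<in> U" "x \<in> C" by blast
  then obtain g where g: "g \<in> carrier GLxGL" "C = T #>\<^bsub>GLxGL\<^esub> g" using assms(1) by (auto simp: RCOSETS_def)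
  then have "C = T #>\<^bsub>GLxGL\<^esub> x" using C(2) GLxGL.repr_independence[OF _ g(1) subgroup_T] by simp
  then show "T #>\<^bsub>GLxGL\<^esub> x \<in> U" using C(1) by simp
qed (use GLxGL.rcos_self[OF assms(2) subgroup_T] in blast)

lemma space_eq: "space \<mu> = rcosets\<^bsub>GLxGL\<^esub> T"
  and sets_eq: "sets \<mu> = sigma_sets (rcosets\<^bsub>GLxGL\<^esub> T) {U. openin (coset_topology T) U}"
  and emeasure_compact: "compactin (coset_topology T) C \<Longrightarrow> emeasure \<mu> C < \<infinity>"
  and emeasure_image: "g \<in> carrier GLxGL \<Longrightarrow> A \<in> sets \<mu> \<Longrightarrow> emeasure \<mu> ((\<lambda>C. C #>\<^bsub>GLxGL\<^esub> g) ` A) = emeasure \<mu> A"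
  and emeasure_space: "emeasure \<mu> (space \<mu>) \<noteq> 0"
  using invariant_coset_measure unfolding invariant_coset_measure_def by auto

lemma translate_measurable:
  assumes g: "g \<in> carrier GLxGL"
  shows "(\<lambda>C. C #>\<^bsub>GLxGL\<^esub> g) \<in> \<mu> \<rightarrow>\<^sub>M \<mu>"
proof (rule measurable_sigma_sets[OF sets_eq])
  have translate: "T #>\<^bsub>GLxGL\<^esub> x #>\<^bsub>GLxGL\<^esub> g = T #>\<^bsub>GLxGL\<^esub> (x \<otimes>\<^bsub>GLxGL\<^esub> g)" if "x \<in> carrier GLxGL" for x
    using that g by (simp add: GLxGL.coset_mult_assoc subgroup.subset[OF subgroup_T])
  show "{U. openin (coset_topology T) U} \<subseteq> Pow (rcosets\<^bsub>GLxGL\<^esub> T)" by (auto simp: openin_coset_topology_iff)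
  show "(\<lambda>C. C #>\<^bsub>GLxGL\<^esub> g) \<in> space \<mu> \<rightarrow> rcosets\<^bsub>GLxGL\<^esub> T"
    using g unfolding space_eq by (auto simp: RCOSETS_def translate)
  fix U assume "U \<in> {U. openin (coset_topology T) U}"
  then have U: "U \<subseteq> rcosets\<^bsub>GLxGL\<^esub> T" "open (\<Union>U)" by (auto simp: openin_coset_topology_iff)
  let ?V = "(\<lambda>C. C #>\<^bsub>GLxGL\<^esub> g) -` U \<inter> space \<mu>"
  have V: "?V \<subseteq> rcosets\<^bsub>GLxGL\<^esub> T" unfolding space_eq by blast
  have "x \<in> \<Union>?V \<longleftrightarrow> x \<in> {x. \<one>\<^bsub>GLxGL\<^esub> \<otimes>\<^bsub>GLxGL\<^esub> x \<otimes>\<^bsub>GLxGL\<^esub> g \<in> \<Union>U} \<inter> carrier GLxGL" for x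
  proof (cases "x \<in> carrier GLxGL")
    case True
    then have "T #>\<^bsub>GLxGL\<^esub> x \<in> space \<mu>" unfolding space_eq by (auto simp: RCOSETS_def)
    then show ?thesis
      using True g mem_Union_iff[OF V True] mem_Union_iff[OF U(1), of "x \<otimes>\<^bsub>GLxGL\<^esub> g"] by (simp add: translate)
  next
    case False
    then show ?thesis using Union_mono[OF V] GLxGL.rcosets_part_G[OF subgroup_T] by auto
  qed
  then have "\<Union>?V = {x. \<one>\<^bsub>GLxGL\<^esub> \<otimes>\<^bsub>GLxGL\<^esub> x \<otimes>\<^bsub>GLxGL\<^esub> g \<in> \<Union>U} \<inter> carrier GLxGL" by (rule Set.set_eqI)
  then have "open (\<Union>?V)" using U(2) by (simp only: open_GLxGL_sandwich_Int_carrier)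
  then have "openin (coset_topology T) ?V" using V by (simp add: openin_coset_topology_iff)
  then show "?V \<in> sets \<mu>" unfolding sets_eq by (intro sigma_sets.Basic) simp
qed

sublocale double_cosets GLxGL T GLxGL_O
  by (intro double_cosets.intro GLxGL.group_axioms subgroup_T subgroup_GLxGL_O)

sublocale invariant_measure_on_cosets GLxGL T GLxGL_O \<mu>
  by unfold_locales (auto simp: space_eq translate_measurable emeasure_image)

lemma openin_cosets_of:
  assumes "open Y" "Y \<subseteq> carrier GLxGL"
  shows "openin (coset_topology T) (cosets_of Y)"
proof -
  have sub: "cosets_of Y \<subseteq> rcosets\<^bsub>GLxGL\<^esub> T" using assms(2) by (auto simp: cosets_of_def RCOSETS_def)
  have "x \<in> \<Union>(cosets_of Y) \<longleftrightarrow>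
      x \<in> (\<Union>t\<in>T. {x. t \<otimes>\<^bsub>GLxGL\<^esub> x \<otimes>\<^bsub>GLxGL\<^esub> \<one>\<^bsub>GLxGL\<^esub> \<in> Y} \<inter> carrier GLxGL)" for x
  proof (cases "x \<in> carrier GLxGL")
    case True
    then have "x \<in> \<Union>(cosets_of Y) \<longleftrightarrow> (\<exists>t\<in>T. t \<otimes>\<^bsub>GLxGL\<^esub> x \<in> Y)"
      using mem_Union_iff[OF sub True] coset_in_cosets_of_iff[OF assms(2) True] by simp
    then show ?thesis using True by auto
  next
    case False
    then show ?thesis using Union_mono[OF sub] GLxGL.rcosets_part_G[OF subgroup_T] by auto
  qed
  then have "\<Union>(cosets_of Y) = (\<Union>t\<in>T. {x. t \<otimes>\<^bsub>GLxGL\<^esub> x \<otimes>\<^bsub>GLxGL\<^esub> \<one>\<^bsub>GLxGL\<^esub> \<in> Y} \<inter> carrier GLxGL)"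
    by (rule Set.set_eqI)
  then have "open (\<Union>(cosets_of Y))"
    using assms(1) by (simp only:) (intro open_UN ballI open_GLxGL_sandwich_Int_carrier)
  then show ?thesis using sub by (simp add: openin_coset_topology_iff)
qed

lemma cosets_of_open_in_sets:
  assumes "open Y" "Y \<subseteq> carrier GLxGL"
  shows "cosets_of Y \<in> sets \<mu>"
  unfolding sets_eq using openin_cosets_of[OF assms] by (intro sigma_sets.Basic) simp

lemma emeasure_cosets_of_GLxGL_O_finite: "emeasure \<mu> (cosets_of GLxGL_O) < \<infinity>"
proof -
  have "continuous_map (top_of_set (carrier GLxGL)) (coset_topology T) (\<lambda>x. T #>\<^bsub>GLxGL\<^esub> x)"
    unfolding continuous_map
  proof (intro conjI allI impI)
    have "openin (coset_topology T) (rcosets\<^bsub>GLxGL\<^esub> T)"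
      using open_carrier_GLxGL GLxGL.rcosets_part_G[OF subgroup_T] by (simp add: openin_coset_topology_iff)
    then have "rcosets\<^bsub>GLxGL\<^esub> T \<subseteq> topspace (coset_topology T)" by (rule openin_subset)
    then show "(\<lambda>x. T #>\<^bsub>GLxGL\<^esub> x) ` topspace (top_of_set (carrier GLxGL)) \<subseteq> topspace (coset_topology T)"
      by (auto simp: RCOSETS_def)
    fix U assume "openin (coset_topology T) U"
    then have U: "U \<subseteq> rcosets\<^bsub>GLxGL\<^esub> T" "open (\<Union>U)" by (auto simp: openin_coset_topology_iff)
    have "\<Union>U \<subseteq> carrier GLxGL" using U(1) GLxGL.rcosets_part_G[OF subgroup_T] by (metis Union_mono)
    then have "{x \<in> carrier GLxGL. T #>\<^bsub>GLxGL\<^esub> x \<in> U} = \<Union>U"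
      using mem_Union_iff[OF U(1)] by (simp cong: conj_cong flip: mem_Union_iff[OF U(1)]) blast
    then show "openin (top_of_set (carrier GLxGL)) {x \<in> topspace (top_of_set (carrier GLxGL)). T #>\<^bsub>GLxGL\<^esub> x
        \<in> U}"
      using U(2) by (auto intro: open_openin_trans[OF open_carrier_GLxGL])
  qed
  moreover have "compactin (top_of_set (carrier GLxGL)) (GLxGL_O :: ('a, 'n) mat2 set)"
    using GLxGL_O_carrier compact_GLxGL_O by (auto simp: compactin_subtopology)
  ultimately have "compactin (coset_topology T) (cosets_of GLxGL_O)" unfolding cosets_of_def
    by (rule image_compactin[rotated])
  then show ?thesis by (rule emeasure_compact)
qed

end

section \<open>Schwartz--Bruhat functions\<close>

definition pair_entries_le :: "real \<Rightarrow> ('a::nonarch_local_field_0, 'n::finite) mat2 \<Rightarrow> bool" where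
  "pair_entries_le r y \<longleftrightarrow> entries_le r (fst y) \<and> entries_le r (snd y)"

lemma pair_entries_le_mono: "pair_entries_le r y \<Longrightarrow> r \<le> s \<Longrightarrow> pair_entries_le s y"
  by (auto simp: pair_entries_le_def intro: entries_le_mono)

lemma pair_entries_le_dist: "pair_entries_le (dist y z) (y - z)"
  using dist_fst_le[of y z] dist_snd_le[of y z]
  by (auto simp: pair_entries_le_def intro: entries_le_mono[OF entries_le_dist])

lemma dist_le_if_pair_entries_le:
  fixes y z :: "('a::nonarch_local_field_0, 'n::finite) mat2"
  assumes "pair_entries_le r (y - z)"
  shows "dist y z \<le> 2 * (real CARD('n) * (real CARD('n) * r))"
proof -
  have "dist y z \<le> dist (fst y) (fst z) + dist (snd y) (snd z)"
    using sqrt_sum_squares_le_sum[of "dist (fst y) (fst z)" "dist (snd y) (snd z)"]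
    by (simp add: dist_prod_def)
  moreover have "dist (fst y) (fst z) \<le> real CARD('n) * (real CARD('n) * r)"
    "dist (snd y) (snd z) \<le> real CARD('n) * (real CARD('n) * r)"
    using assms by (auto simp: pair_entries_le_def intro!: dist_le_if_entries_le)
  ultimately show ?thesis by linarith
qed

lemma compact_pair_entries_le:
    "compact {y :: ('a::nonarch_local_field_0, 'n::finite) mat2. pair_entries_le r y}"
proof -
  have "{y :: ('a, 'n) mat2. pair_entries_le r y} = {A. entries_le r A} \<times> {A. entries_le r A}"
    by (auto simp: pair_entries_le_def)
  then show ?thesis by (simp add: compact_Times compact_entries_le)
qed

lemma act_diff: "act h (y - z) = act h y - act h z" for y z :: "('k::field, 'n::finite) mat2"
  by (simp add: act_def matrix_diff_ldistrib matrix_diff_rdistrib)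

lemma act_0: "act h (0, 0) = (0, 0 :: 'k::field^'n^'n)"
  using act_diff[of h "(0, 0)" "(0, 0)"] by (simp add: zero_prod_def)

lemma act_inv_act: "h \<in> carrier GLxGL \<Longrightarrow> act (inv\<^bsub>GLxGL\<^esub> h) (act h y) = y"
  using act_mult[of "inv\<^bsub>GLxGL\<^esub> h" h y] by (simp add: act_one)

lemma pair_entries_le_act:
  assumes "k \<in> GLxGL_O" "pair_entries_le r y"
  shows "pair_entries_le r (act k y)"
proof -
  have "entries_le r (A ** B ** C)" if "entries_le 1 A" "entries_le r B" "entries_le 1 C"
      for A B C :: "'a^'b^'b"
    using entries_le_mult[OF entries_le_mult[OF that(1,2)] that(3)] by simp
  then show ?thesis
    using assms by (auto simp: pair_entries_le_def act_def GLxGL_O_def GL_O_D)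
qed

definition schwartz_bruhat :: "real \<Rightarrow> real \<Rightarrow> (('a::nonarch_local_field_0, 'n::finite) mat2 \<Rightarrow> 'c::zero) \<Rightarrow> bool"
    where
  "schwartz_bruhat \<rho> R \<phi> \<longleftrightarrow>
    (\<forall>y z. pair_entries_le \<rho> (y - z) \<longrightarrow> \<phi> y = \<phi> z) \<and> (\<forall>y. \<phi> y \<noteq> 0 \<longrightarrow> pair_entries_le R y)"

lemma schwartz_bruhatI:
  assumes "\<And>y z. pair_entries_le \<rho> (y - z) \<Longrightarrow> \<phi> y = \<phi> z" "\<And>y. \<phi> y \<noteq> 0 \<Longrightarrow> pair_entries_le R y"
  shows "schwartz_bruhat \<rho> R \<phi>"
  using assms unfolding schwartz_bruhat_def by blast

lemma schwartz_bruhat_eq: "schwartz_bruhat \<rho> R \<phi> \<Longrightarrow> pair_entries_le \<rho> (y - z) \<Longrightarrow> \<phi> y = \<phi> z"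
  and schwartz_bruhat_supp: "schwartz_bruhat \<rho> R \<phi> \<Longrightarrow> \<phi> y \<noteq> 0 \<Longrightarrow> pair_entries_le R y"
  unfolding schwartz_bruhat_def by blast+

lemma schwartz_bruhat_act:
  fixes \<phi> :: "('a::nonarch_local_field_0, 'n::finite) mat2 \<Rightarrow> 'c::zero"
  assumes "schwartz_bruhat \<rho> R \<phi>" "k \<in> GLxGL_O"
  shows "schwartz_bruhat \<rho> R (\<lambda>y. \<phi> (act k y))"
proof (rule schwartz_bruhatI)
  fix y z :: "('a, 'n) mat2" assume "pair_entries_le \<rho> (y - z)"
  then show "\<phi> (act k y) = \<phi> (act k z)"
    using assms by (intro schwartz_bruhat_eq[OF assms(1)]) (simp add: pair_entries_le_act flip: act_diff)
next
  fix y :: "('a, 'n) mat2" assume "\<phi> (act k y) \<noteq> 0"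
  then have "pair_entries_le R (act (inv\<^bsub>GLxGL\<^esub> k) (act k y))"
    using assms by (intro pair_entries_le_act schwartz_bruhat_supp[OF assms(1)])
      (rule subgroup.m_inv_closed[OF subgroup_GLxGL_O])
  then show "pair_entries_le R y" using assms(2) by (simp only: act_inv_act GLxGL_O_carrier)
qed

lemma schwartz_bruhat_sum:
  fixes \<phi> :: "'i \<Rightarrow> ('a::nonarch_local_field_0, 'n::finite) mat2 \<Rightarrow> 'c::comm_monoid_add"
  assumes "\<And>i. i \<in> I \<Longrightarrow> schwartz_bruhat \<rho> R (\<phi> i)"
  shows "schwartz_bruhat \<rho> R (\<lambda>y. \<Sum>i\<in>I. \<phi> i y)"
proof (rule schwartz_bruhatI)
  fix y z :: "('a, 'n) mat2" assume yz: "pair_entries_le \<rho> (y - z)"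
  show "(\<Sum>i\<in>I. \<phi> i y) = (\<Sum>i\<in>I. \<phi> i z)"
    by (rule sum.cong[OF refl]) (rule schwartz_bruhat_eq[OF assms yz])
next
  fix y :: "('a, 'n) mat2" assume "(\<Sum>i\<in>I. \<phi> i y) \<noteq> 0"
  then obtain i where "i \<in> I" "\<phi> i y \<noteq> 0" by (meson sum.neutral)
  then show "pair_entries_le R y" using schwartz_bruhat_supp assms by metis
qed

lemma schwartz_bruhat_compose:
  assumes "schwartz_bruhat \<rho> R \<phi>" "g 0 = 0"
  shows "schwartz_bruhat \<rho> R (\<lambda>y. g (\<phi> y))"
  by (rule schwartz_bruhatI) (use schwartz_bruhat_eq[OF assms(1)] schwartz_bruhat_supp[OF assms(1)] assms(2)
    in metis)+

lemma finite_range_schwartz_bruhat: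
  fixes \<phi> :: "('a::nonarch_local_field_0, 'n::finite) mat2 \<Rightarrow> 'c::zero"
  assumes \<phi>: "schwartz_bruhat \<rho> R \<phi>" and \<rho>: "0 < \<rho>"
  shows "finite (range \<phi>)"
proof -
  let ?B = "{y :: ('a, 'n) mat2. pair_entries_le R y}"
  have cover: "?B \<subseteq> (\<Union>y\<in>?B. ball y \<rho>)" using \<rho> by auto
  obtain F where F: "F \<subseteq> ?B" "finite F" "?B \<subseteq> (\<Union>y\<in>F. ball y \<rho>)"
    by (rule compactE_image[OF compact_pair_entries_le _ cover]) auto
  have "\<phi> y \<in> insert 0 (\<phi> ` F)" for y
  proof (cases "\<phi> y = 0")
    case False
    then have "y \<in> ?B" using schwartz_bruhat_supp[OF \<phi>] by simp
    then obtain z where z: "z \<in> F" "dist z y < \<rho>" using F(3) by auto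
    then have "pair_entries_le \<rho> (z - y)" by (intro pair_entries_le_mono[OF pair_entries_le_dist]) simp
    then have "\<phi> z = \<phi> y" by (rule schwartz_bruhat_eq[OF \<phi>])
    then show ?thesis using z(1) by (metis image_eqI insertI2)
  qed simp
  then have "range \<phi> \<subseteq> insert 0 (\<phi> ` F)" by blast
  then show ?thesis using F(2) by (simp add: finite_subset)
qed

lemma Cc_infinity_schwartz_bruhat:
  fixes \<phi> :: "('a::nonarch_local_field_0, 'n::finite) mat2 \<Rightarrow> complex"
  assumes "\<phi> \<in> Cc_infinity"
  obtains \<rho> R where "0 < \<rho>" "1 \<le> R" "schwartz_bruhat \<rho> R \<phi>"
proof -
  let ?S = "closure {x. \<phi> x \<noteq> 0}" and ?G = "{U. open U \<and> (\<forall>x\<in>U. \<forall>y\<in>U. \<phi> x = \<phi> y)}"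
  have S: "compact ?S" using assms unfolding Cc_infinity_def mem_Collect_eq by (rule conjunct2)
  have local: "\<forall>x. \<exists>U. open U \<and> x \<in> U \<and> (\<forall>y\<in>U. \<phi> y = \<phi> x)"
    using assms unfolding Cc_infinity_def mem_Collect_eq by (rule conjunct1)
  have supp: "x \<in> ?S" if "\<phi> x \<noteq> 0" for x using that closure_subset[of "{x. \<phi> x \<noteq> 0}"] by blast
  have "x \<in> \<Union>?G" for x
  proof -
    from local[THEN spec, of x] obtain U where U: "open U" "x \<in> U" "\<forall>y\<in>U. \<phi> y = \<phi> x" by (elim exE conjE)
    have "\<forall>a\<in>U. \<forall>b\<in>U. \<phi> a = \<phi> b" using U(3) by metis
    then have "U \<in> ?G" using U(1) by blast
    then show ?thesis using U(2) by (rule UnionI)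
  qed
  then have "?S \<subseteq> \<Union>?G" by blast
  then obtain e where e: "0 < e" "\<And>x. x \<in> ?S \<Longrightarrow> \<exists>U\<in>?G. ball x e \<subseteq> U"
    using Heine_Borel_lemma[OF S, of ?G] by blast
  have near: "\<phi> x = \<phi> y" if "x \<in> ?S" "dist x y < e" for x y
  proof -
    obtain U where "U \<in> ?G" "ball x e \<subseteq> U" using e(2)[OF \<open>x \<in> ?S\<close>] by blast
    moreover have "x \<in> ball x e" "y \<in> ball x e" using e(1) \<open>dist x y < e\<close> by simp_all
    ultimately show ?thesis by blast
  qed
  have unif: "\<phi> x = \<phi> y" if "dist x y < e" for x y
    using near[of x y] near[of y x] supp[of x] supp[of y] that by (metis dist_commute)
  define \<rho> where "\<rho> = e / (4 * (real CARD('n) * real CARD('n)))"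
  have "dist y z < e" if "pair_entries_le \<rho> (y - z)" for y z :: "('a, 'n) mat2"
    using dist_le_if_pair_entries_le[OF that] e(1) by (simp add: \<rho>_def)
  then have "\<phi> y = \<phi> z" if "pair_entries_le \<rho> (y - z)" for y z using unif that by blast
  moreover obtain R where R: "\<And>x. x \<in> ?S \<Longrightarrow> dist (0, 0) x \<le> R"
    using compact_imp_bounded[OF S] unfolding bounded_any_center[where a = "(0, 0)"] by blast
  have "pair_entries_le (max R 1) y" if "\<phi> y \<noteq> 0" for y
    using R[OF supp[OF that]] pair_entries_le_dist[of y "(0, 0)"]
    by (auto simp: dist_commute zero_prod_def [symmetric] intro: pair_entries_le_mono)
  moreover have "0 < \<rho>" using e(1) by (simp add: \<rho>_def)
  ultimately show ?thesis using that[of \<rho> "max R 1"] schwartz_bruhatI by (metis max.cobounded2)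
qed

definition congruence_subgroup :: "real \<Rightarrow> ('a::nonarch_local_field_0, 'n::finite) mat2 set" where
  "congruence_subgroup r = {q. pair_entries_le r (q - (mat 1, mat 1))}"

lemma congruence_subgroup_subset: "r < 1 \<Longrightarrow> congruence_subgroup r \<subseteq> GLxGL_O"
  by (auto simp: congruence_subgroup_def pair_entries_le_def GLxGL_O_def intro: GL_O_if_near_one)

lemma subgroup_congruence_subgroup:
  assumes r: "0 \<le> r" "r < 1"
  shows "subgroup (congruence_subgroup r) (GLxGL :: ('a::nonarch_local_field_0, 'n::finite) mat2 monoid)"
proof (rule GLxGL.subgroupI)
  show sub: "congruence_subgroup r \<subseteq> (carrier GLxGL :: ('a, 'n) mat2 set)"
    using congruence_subgroup_subset[OF r(2)] GLxGL_O_carrier by blast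
  have "(mat 1, mat 1) \<in> (congruence_subgroup r :: ('a, 'n) mat2 set)"
    using r(1) by (simp add: congruence_subgroup_def pair_entries_le_def entries_le_def)
  then show "congruence_subgroup r \<noteq> ({} :: ('a, 'n) mat2 set)" by blast
  fix g h :: "('a, 'n) mat2" assume g: "g \<in> congruence_subgroup r" and h: "h \<in> congruence_subgroup r"
  have "entries_le r (A ** B - mat 1)" if "entries_le r (A - mat 1)" "entries_le r (B - mat 1)"
      for A B :: "'a^'n^'n"
  proof -
    have "entries_le (r * 1) ((A - mat 1) ** B)"
      using that GL_O_D(2)[OF GL_O_if_near_one(1)[OF that(2) r(2)]] by (intro entries_le_mult)
    then have "entries_le r ((A - mat 1) ** B + (B - mat 1))" using that(2) by (intro entries_le_add) simp_all
    then show ?thesis by (simp add: matrix_diff_rdistrib)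
  qed
  then show "g \<otimes>\<^bsub>GLxGL\<^esub> h \<in> congruence_subgroup r"
    using g h by (simp add: congruence_subgroup_def pair_entries_le_def mult_GLxGL)
  have "g \<in> carrier GLxGL" using sub g by blast
  then show "inv\<^bsub>GLxGL\<^esub> g \<in> congruence_subgroup r"
    using g GL_O_if_near_one(2)[of r "fst g"] GL_O_if_near_one(2)[of r "snd g"] r(2)
    by (simp add: congruence_subgroup_def pair_entries_le_def inv_GLxGL)
qed

lemma open_congruence_subgroup:
  assumes "0 < r"
  shows "open (congruence_subgroup r :: ('a::nonarch_local_field_0, 'n::finite) mat2 set)"
  unfolding open_dist
proof (intro ballI exI conjI allI impI)
  fix q z :: "('a, 'n) mat2" assume q: "q \<in> congruence_subgroup r" and "dist z q < r"
  then have "pair_entries_le r (z - q)" by (intro pair_entries_le_mono[OF pair_entries_le_dist]) simp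
  then have "entries_le r ((fst z - fst q) + (fst q - mat 1))"
      "entries_le r ((snd z - snd q) + (snd q - mat 1))"
    using q by (intro entries_le_add; simp add: congruence_subgroup_def pair_entries_le_def)+
  then show "z \<in> congruence_subgroup r" by (simp add: congruence_subgroup_def pair_entries_le_def)
qed (rule assms)

lemma pair_entries_le_act_congruence:
  fixes q y :: "('a::nonarch_local_field_0, 'n::finite) mat2"
  assumes q: "q \<in> congruence_subgroup r" and r: "0 \<le> r" "r < 1" and y: "pair_entries_le R y"
  shows "pair_entries_le (r * R) (act q y - y)"
proof -
  have "q \<in> GLxGL_O" using q congruence_subgroup_subset[OF r(2)] by blast
  then have qc: "q \<in> carrier GLxGL" and GL: "fst q \<in> GL_O" "snd q \<in> GL_O"
    by (auto simp: GLxGL_O_carrier GLxGL_O_def)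
  have "inv\<^bsub>GLxGL\<^esub> q \<in> congruence_subgroup r"
    using q subgroup.m_inv_closed[OF subgroup_congruence_subgroup[OF r]] by blast
  then have "entries_le r (matrix_inv (fst q) - mat 1)" "entries_le r (matrix_inv (snd q) - mat 1)"
    by (simp_all add: congruence_subgroup_def pair_entries_le_def inv_GLxGL[OF qc])
  moreover have "entries_le (r * R) (A ** Z ** B - Z)"
    if "entries_le r (A - mat 1)" "entries_le r (B - mat 1)" "entries_le 1 B" "entries_le R Z"
        for A B Z :: "'a^'n^'n"
  proof -
    have "A ** Z ** B - Z = (A - mat 1) ** Z ** B + Z ** (B - mat 1)"
      by (simp add: matrix_diff_ldistrib matrix_diff_rdistrib)
    moreover have "entries_le (r * R * 1) ((A - mat 1) ** Z ** B)" by (intro entries_le_mult that)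
    moreover have "entries_le (R * r) (Z ** (B - mat 1))" by (intro entries_le_mult that)
    ultimately show ?thesis by (simp add: entries_le_add mult.commute)
  qed
  ultimately show ?thesis
    using q y GL_O_D(3)[OF GL(1)] GL_O_D(3)[OF GL(2)]
    by (simp add: pair_entries_le_def act_def congruence_subgroup_def)
qed

lemma schwartz_bruhat_congruence_invariant:
  assumes \<phi>: "schwartz_bruhat \<rho> R \<phi>" and r: "0 \<le> r" "r < 1" "r * R \<le> \<rho>" and q: "q \<in> congruence_subgroup r"
  shows "\<phi> (act q y) = \<phi> y"
proof (cases "pair_entries_le R y")
  case True
  then show ?thesis
    using pair_entries_le_mono[OF pair_entries_le_act_congruence[OF q r(1,2)] r(3)] schwartz_bruhat_eq[OF \<phi>]
    by blast
next
  case False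
  have act: "schwartz_bruhat \<rho> R (\<lambda>y. \<phi> (act q y))"
    using \<phi> q congruence_subgroup_subset[OF r(2)] by (intro schwartz_bruhat_act) auto
  show ?thesis using False schwartz_bruhat_supp[OF \<phi>, of y] schwartz_bruhat_supp[OF act, of y] by metis
qed

section \<open>Averaging over a compact group\<close>

context group
begin

definition rcoset_reps :: "'a set \<Rightarrow> 'a set \<Rightarrow> 'a set" where
  "rcoset_reps Q K = (\<lambda>C. SOME s. s \<in> C) ` (\<lambda>x. Q #> x) ` K"

lemma some_mem_rcoset:
  assumes "subgroup Q G" "x \<in> carrier G"
  shows "(SOME s. s \<in> Q #> x) \<in> Q #> x"
  using rcos_self[OF assms(2,1)] by (rule someI)

lemma rcoset_reps_subset:
  assumes "subgroup K G" "subgroup Q G" "Q \<subseteq> K"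
  shows "rcoset_reps Q K \<subseteq> K"
proof -
  have "Q #> x \<subseteq> K" if "x \<in> K" for x
    using that assms(1,3) by (auto simp: r_coset_def subgroup.m_closed)
  then show ?thesis
    using some_mem_rcoset[OF assms(2)] subgroup.mem_carrier[OF assms(1)] unfolding rcoset_reps_def by blast
qed

lemma sum_rcoset_reps:
  fixes g :: "'a \<Rightarrow> 'c::comm_monoid_add"
  assumes K: "subgroup K G" and Q: "subgroup Q G"
  shows "(\<Sum>s\<in>rcoset_reps Q K. g s) = (\<Sum>C\<in>(\<lambda>x. Q #> x) ` K. g (SOME s. s \<in> C))"
proof -
  have "inj_on (\<lambda>C. SOME s. s \<in> C) ((\<lambda>x. Q #> x) ` K)"
  proof (rule inj_onI)
    fix C D assume C: "C \<in> (\<lambda>x. Q #> x) ` K" and D: "D \<in> (\<lambda>x. Q #> x) ` K" and eq: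
      "(SOME s. s \<in> C) = (SOME s. s \<in> D)"
    have coset: "E = Q #> (SOME s. s \<in> E)" if "E \<in> (\<lambda>x. Q #> x) ` K" for E
    proof -
      from that obtain x where "x \<in> K" "E = Q #> x" by (rule imageE)
      then show ?thesis
        using some_mem_rcoset[OF Q, of x] repr_independence[OF _ _ Q, of _ x] subgroup.mem_carrier[OF K]
        by simp
    qed
    show "C = D" using coset[OF C] coset[OF D] eq by simp
  qed
  then show ?thesis unfolding rcoset_reps_def by (subst sum.reindex) simp_all
qed

lemma sum_rcoset_reps_translate:
  fixes g :: "'a \<Rightarrow> 'c::comm_monoid_add"
  assumes K: "subgroup K G" and Q: "subgroup Q G" "Q \<subseteq> K" and k: "k \<in> K"
    and g: "\<And>q s. q \<in> Q \<Longrightarrow> s \<in> K \<Longrightarrow> g (q \<otimes> s) = g s"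
  shows "(\<Sum>s\<in>rcoset_reps Q K. g (s \<otimes> k)) = (\<Sum>s\<in>rcoset_reps Q K. g s)"
proof -
  let ?Cs = "(\<lambda>x. Q #> x) ` K"
  have Kc: "x \<in> carrier G" if "x \<in> K" for x using that subgroup.mem_carrier[OF K] by blast
  have mult: "Q #> x #> y = Q #> (x \<otimes> y)" if "x \<in> K" "y \<in> K" for x y
    using that Kc by (intro coset_mult_assoc subgroup.subset[OF Q(1)]) auto
  have rep: "g (SOME s. s \<in> Q #> x) = g x" if x: "x \<in> K" for x
    using some_mem_rcoset[OF Q(1) Kc[OF x]] g[OF _ x] by (auto simp: r_coset_def)
  have "g ((SOME s. s \<in> C) \<otimes> k) = g (SOME s. s \<in> C #> k)" if "C \<in> ?Cs" for C
  proof -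
    from that obtain x where x: "x \<in> K" "C = Q #> x" by (rule imageE)
    obtain q where q: "q \<in> Q" "(SOME s. s \<in> C) = q \<otimes> x"
      using some_mem_rcoset[OF Q(1) Kc[OF x(1)]] unfolding x(2) by (auto simp: r_coset_def)
    then have "g ((SOME s. s \<in> C) \<otimes> k) = g (q \<otimes> (x \<otimes> k))"
      using x(1) k Kc Q(2) by (simp add: m_assoc subsetD)
    then show ?thesis
      using g[OF q(1)] rep[of "x \<otimes> k"] subgroup.m_closed[OF K x(1) k] by (simp add: x mult k)
  qed
  then have "(\<Sum>s\<in>rcoset_reps Q K. g (s \<otimes> k)) = (\<Sum>C\<in>?Cs. g (SOME s. s \<in> C #> k))"
    unfolding sum_rcoset_reps[OF K Q(1)] by (rule sum.cong[OF refl])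
  also have "\<dots> = (\<Sum>C\<in>?Cs. g (SOME s. s \<in> C))"
  proof (rule sum.reindex_bij_betw[of "\<lambda>C. C #> k" ?Cs ?Cs "\<lambda>C. g (SOME s. s \<in> C)"])
    have closed: "C #> y \<in> ?Cs" if "C \<in> ?Cs" "y \<in> K" for C y
      using that mult subgroup.m_closed[OF K] by auto
    have cancel: "C #> y #> z = C" if "C \<in> ?Cs" "y \<in> K" "z \<in> K" "y \<otimes> z = \<one>" for C y z
      using that Kc mult subgroup.m_closed[OF K] by (auto simp: m_assoc)
    have ik: "inv k \<in> K" using k subgroup.m_inv_closed[OF K] by blast
    show "bij_betw (\<lambda>C. C #> k) ?Cs ?Cs"
      by (rule bij_betw_byWitness[where f' = "\<lambda>C. C #> inv k"]) (use closed cancel k ik Kc in auto)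
  qed
  also have "\<dots> = (\<Sum>s\<in>rcoset_reps Q K. g s)" unfolding sum_rcoset_reps[OF K Q(1)] ..
  finally show ?thesis .
qed

end

section \<open>Orbital integrals as weighted sums over double cosets\<close>

lemma open_if_right_invariant:
  fixes Y :: "('a::nonarch_local_field_0, 'n::finite) mat2 set"
  assumes Q: "open Q" "\<one>\<^bsub>GLxGL\<^esub> \<in> Q" and Y: "Y \<subseteq> carrier GLxGL"
    and inv: "\<And>y q. y \<in> Y \<Longrightarrow> q \<in> Q \<Longrightarrow> y \<otimes>\<^bsub>GLxGL\<^esub> q \<in> Y"
  shows "open Y"
proof (subst open_subopen, intro ballI)
  fix y assume y: "y \<in> Y"
  then have yc: "y \<in> carrier GLxGL" using Y by blast
  let ?U = "{x. inv\<^bsub>GLxGL\<^esub> y \<otimes>\<^bsub>GLxGL\<^esub> x \<otimes>\<^bsub>GLxGL\<^esub> \<one>\<^bsub>GLxGL\<^esub> \<in> Q} \<inter> carrier GLxGL"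
  have "x \<in> Y" if "x \<in> ?U" for x
  proof -
    have "inv\<^bsub>GLxGL\<^esub> y \<otimes>\<^bsub>GLxGL\<^esub> x \<in> Q" using that yc by auto
    then have "y \<otimes>\<^bsub>GLxGL\<^esub> (inv\<^bsub>GLxGL\<^esub> y \<otimes>\<^bsub>GLxGL\<^esub> x) \<in> Y" by (rule inv[OF y])
    then show ?thesis using that yc by (simp add: GLxGL.m_assoc [symmetric])
  qed
  moreover have "open ?U" using Q(1) by (rule open_GLxGL_sandwich_Int_carrier)
  moreover have "y \<in> ?U" using yc Q(2) by simp
  ultimately show "\<exists>U. open U \<and> y \<in> U \<and> U \<subseteq> Y" by blast
qed

lemma biinvariant_orbit_function:
  fixes x :: "('a::nonarch_local_field_0, 'n::finite) mat2"
  assumes T: "subgroup T GLxGL" and stabilizer: "stabilizer GLxGL act x = T"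
    and \<phi>: "\<And>k y. k \<in> GLxGL_O \<Longrightarrow> \<phi> (act k y) = \<phi> y"
  shows "double_cosets.biinvariant GLxGL T GLxGL_O (\<lambda>h. \<phi> (act (inv\<^bsub>GLxGL\<^esub> h) x))"
proof -
  interpret double_cosets GLxGL T GLxGL_O
    by (intro double_cosets.intro GLxGL.group_axioms T subgroup_GLxGL_O)
  show ?thesis
    unfolding biinvariant_def
  proof (intro ballI)
    fix h t k :: "('a, 'n) mat2"
    assume h: "h \<in> carrier GLxGL" and t: "t \<in> T" and k: "k \<in> GLxGL_O"
    have "inv\<^bsub>GLxGL\<^esub> t \<in> stabilizer GLxGL act x" unfolding stabilizer using t by blast
    then have "act (inv\<^bsub>GLxGL\<^esub> t) x = x" by (simp add: stabilizer_def)
    then have "act (inv\<^bsub>GLxGL\<^esub> (t \<otimes>\<^bsub>GLxGL\<^esub> h \<otimes>\<^bsub>GLxGL\<^esub> k)) x = act (inv\<^bsub>GLxGL\<^esub> k) (act (inv\<^bsub>GLxGL\<^esub> h) x)"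
      using h t k by (simp add: GLxGL.inv_mult_group act_mult)
    then show "\<phi> (act (inv\<^bsub>GLxGL\<^esub> (t \<otimes>\<^bsub>GLxGL\<^esub> h \<otimes>\<^bsub>GLxGL\<^esub> k)) x) = \<phi> (act (inv\<^bsub>GLxGL\<^esub> h) x)"
      using \<phi>[of "inv\<^bsub>GLxGL\<^esub> k"] k by simp
  qed
qed

locale GLxGL_compact_coset_measure = GLxGL_coset_measure T \<mu>
  for T :: "('a::nonarch_local_field_0, 'n::finite) mat2 set" and \<mu> +
  assumes T_conj: "h \<in> carrier GLxGL \<Longrightarrow> T \<inter> GLxGL.conj_set h GLxGL_O \<subseteq> GLxGL_O"
begin

lemma
  assumes h: "h \<in> carrier GLxGL"
  shows cosets_of_dcoset_in_sets: "cosets_of (dcoset h) \<in> sets \<mu>"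
    and emeasure_cosets_of_dcoset: "emeasure \<mu> (cosets_of (dcoset h)) =
        of_nat (weight h) * emeasure \<mu> (cosets_of GLxGL_O)"
proof -
  let ?N = "GLxGL_O \<inter> GLxGL.conj_set h GLxGL_O"
  have sub: "GLxGL_O \<subseteq> (carrier GLxGL :: ('a, 'n) mat2 set)" using GLxGL_O_carrier by blast
  have N: "open ?N" "subgroup ?N GLxGL" "?N \<subseteq> carrier GLxGL"
    using h sub by (auto intro!: open_Int open_GLxGL_O open_conj_set GLxGL.subgroups_Inter_pair
      subgroup_GLxGL_O
        GLxGL.subgroup_conj_set)
  note fin = finite_rcosets_compact[OF N(1,2) compact_GLxGL_O sub]
  show "cosets_of (dcoset h) \<in> sets \<mu>"
    "emeasure \<mu> (cosets_of (dcoset h)) = of_nat (weight h) * emeasure \<mu> (cosets_of GLxGL_O)"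
    using emeasure_dcoset[OF h cosets_of_open_in_sets[OF N(1,3)] fin GLxGL_unimodular[OF h] T_conj[OF h]]
    by blast+
qed

lemma emeasure_cosets_of_dcoset_finite: "h \<in> carrier GLxGL \<Longrightarrow> emeasure \<mu> (cosets_of (dcoset h)) < \<infinity>"
  using emeasure_cosets_of_GLxGL_O_finite
  by (simp add: emeasure_cosets_of_dcoset ennreal_mult_less_top of_nat_less_top)

lemma emeasure_cosets_of_GLxGL_O_nonzero: "emeasure \<mu> (cosets_of GLxGL_O) \<noteq> 0"
proof
  assume null: "emeasure \<mu> (cosets_of GLxGL_O) = 0"
  obtain S :: "('a^'n^'n) set" where S: "countable S"
    "\<And>h. invertible h \<Longrightarrow> \<exists>g\<in>S. invertible g \<and> matrix_inv g ** h \<in> GL_O"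
    using countable_GL_O_cosets[where ?'a = 'a and ?'n = 'n] by (elim exE conjE) blast
  let ?R = "(S \<times> S) \<inter> carrier GLxGL"
  have "space \<mu> \<subseteq> (\<Union>g\<in>?R. cosets_of (dcoset g))"
  proof
    fix C assume "C \<in> space \<mu>"
    then obtain h where h: "h \<in> carrier GLxGL" "C = T #>\<^bsub>GLxGL\<^esub> h" by (auto simp: space_eq RCOSETS_def)
    obtain g1 where g1: "g1 \<in> S" "invertible g1" "matrix_inv g1 ** fst h \<in> GL_O"
      using S(2)[of "fst h"] h by (auto simp: carrier_GLxGL_iff)
    obtain g2 where g2: "g2 \<in> S" "invertible g2" "matrix_inv g2 ** snd h \<in> GL_O"
      using S(2)[of "snd h"] h by (auto simp: carrier_GLxGL_iff)
    let ?g = "(g1, g2)"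
    have g: "?g \<in> carrier GLxGL" using g1 g2 by (simp add: carrier_GLxGL_iff)
    have k: "inv\<^bsub>GLxGL\<^esub> ?g \<otimes>\<^bsub>GLxGL\<^esub> h \<in> GLxGL_O" using g1 g2
      by (simp add: inv_GLxGL[OF g] mult_GLxGL GLxGL_O_def)
    have "\<one>\<^bsub>GLxGL\<^esub> \<otimes>\<^bsub>GLxGL\<^esub> ?g \<otimes>\<^bsub>GLxGL\<^esub> (inv\<^bsub>GLxGL\<^esub> ?g \<otimes>\<^bsub>GLxGL\<^esub> h) = h"
      using g h(1) by (simp add: GLxGL.m_assoc [symmetric])
    then have "h \<in> dcoset ?g" using dcosetI[OF T.one_closed k, of ?g] by simp
    then show "C \<in> (\<Union>g\<in>?R. cosets_of (dcoset g))" using g g1 g2 h(2) by (auto simp: cosets_of_def)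
  qed
  moreover have "countable ?R" using S(1) by (intro countable_Int1 countable_SIGMA)
  then have "(\<Union>g\<in>?R. cosets_of (dcoset g)) \<in> null_sets \<mu>"
    by (rule null_sets_UN') (auto intro!: null_setsI simp: cosets_of_dcoset_in_sets emeasure_cosets_of_dcoset
      null)
  ultimately have "emeasure \<mu> (space \<mu>) = 0" using null_sets_subset[of _ \<mu> "space \<mu>"]
    by (auto simp: null_setsD1)
  then show False using emeasure_space by simp
qed

lemma measure_cosets_of_GLxGL_O_nonzero: "measure \<mu> (cosets_of GLxGL_O) \<noteq> 0"
  using emeasure_cosets_of_GLxGL_O_nonzero emeasure_cosets_of_GLxGL_O_finite
  by (auto simp: measure_def enn2real_eq_0_iff)

lemma measure_cosets_of_dcoset:
  assumes "D \<in> dcosets"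
  shows "measure \<mu> (cosets_of D) = real (lift weight D) * measure \<mu> (cosets_of GLxGL_O)"
proof -
  obtain h where h: "h \<in> carrier GLxGL" "D = dcoset h" using assms by (auto simp: dcosets_def)
  let ?g = "SOME g. g \<in> D"
  have g: "?g \<in> dcoset h" unfolding h(2) using dcoset_self[OF h(1)] by (rule someI)
  then have "D = dcoset ?g" "?g \<in> carrier GLxGL"
    using dcoset_eqI[OF h(1) g] dcoset_subset_carrier[OF h(1)] h(2) by auto
  then have "emeasure \<mu> (cosets_of D) = of_nat (lift weight D) * emeasure \<mu> (cosets_of GLxGL_O)"
    using emeasure_cosets_of_dcoset[of ?g] by (simp add: lift_def)
  then show ?thesis by (simp add: measure_def enn2real_mult)
qed

context
  fixes x :: "('a, 'n) mat2"
  assumes stabilizer_eq: "stabilizer GLxGL act x = T"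
    and proper: "\<And>R. finite {D \<in> dcosets. \<exists>h\<in>D. pair_entries_le R (act (inv\<^bsub>GLxGL\<^esub> h) x)}"
begin

lemma orb_stab_fun_eq: "h \<in> carrier GLxGL \<Longrightarrow> orb_stab_fun GLxGL act (T #>\<^bsub>GLxGL\<^esub> h) x = act (inv\<^bsub>GLxGL\<^esub> h) x"
  using orb_stab_fun_GLxGL[of h x] by (simp add: stabilizer_eq)

lemma orb_stab_fun_translate:
  assumes "C \<in> space \<mu>" "g \<in> carrier GLxGL"
  shows "orb_stab_fun GLxGL act (C #>\<^bsub>GLxGL\<^esub> g) x = act (inv\<^bsub>GLxGL\<^esub> g) (orb_stab_fun GLxGL act C x)"
proof -
  obtain h where h: "h \<in> carrier GLxGL" "C = T #>\<^bsub>GLxGL\<^esub> h" using assms(1)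
    by (auto simp: space_eq RCOSETS_def)
  then have "C #>\<^bsub>GLxGL\<^esub> g = T #>\<^bsub>GLxGL\<^esub> (h \<otimes>\<^bsub>GLxGL\<^esub> g)"
    using assms(2) by (simp add: GLxGL.coset_mult_assoc T.subset)
  then show ?thesis using h assms(2) by (simp add: orb_stab_fun_eq GLxGL.inv_mult_group act_mult)
qed

lemma orbit_function_measurable:
  fixes \<phi> :: "('a, 'n) mat2 \<Rightarrow> complex"
  assumes \<phi>: "schwartz_bruhat \<rho> R \<phi>" and \<rho>: "0 < \<rho>" "1 \<le> R"
  shows "(\<lambda>C. \<phi> (orb_stab_fun GLxGL act C x)) \<in> borel_measurable \<mu>"
proof (rule borel_measurableI)
  fix B :: "complex set"
  define r where "r = min (1 / 2) (\<rho> / R)"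
  have r: "0 < r" "r < 1" "r * R \<le> \<rho>" using \<rho> by (auto simp: r_def min_def field_simps)
  note Q = subgroup_congruence_subgroup[OF less_imp_le[OF r(1)] r(2), where ?'a = 'a and ?'n = 'n]
  let ?Y = "{h \<in> carrier GLxGL. \<phi> (act (inv\<^bsub>GLxGL\<^esub> h) x) \<in> B}"
  have "open ?Y"
  proof (rule open_if_right_invariant[OF open_congruence_subgroup[OF r(1)] subgroup.one_closed[OF Q]])
    fix y q :: "('a, 'n) mat2" assume y: "y \<in> ?Y" and q: "q \<in> congruence_subgroup r"
    then have c: "y \<in> carrier GLxGL" "q \<in> carrier GLxGL" using subgroup.mem_carrier[OF Q] by auto
    have "\<phi> (act (inv\<^bsub>GLxGL\<^esub> q) (act (inv\<^bsub>GLxGL\<^esub> y) x)) = \<phi> (act (inv\<^bsub>GLxGL\<^esub> y) x)"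
      using r subgroup.m_inv_closed[OF Q q] by (intro schwartz_bruhat_congruence_invariant[OF \<phi>]) auto
    then show "y \<otimes>\<^bsub>GLxGL\<^esub> q \<in> ?Y" using y c by (simp add: GLxGL.inv_mult_group act_mult)
  qed blast
  then have "cosets_of ?Y \<in> sets \<mu>" by (rule cosets_of_open_in_sets) blast
  moreover have "(\<lambda>C. \<phi> (orb_stab_fun GLxGL act C x)) -` B \<inter> space \<mu> = cosets_of ?Y"
  proof (intro equalityI subsetI)
    fix C assume C: "C \<in> (\<lambda>C. \<phi> (orb_stab_fun GLxGL act C x)) -` B \<inter> space \<mu>"
    then obtain h where "h \<in> carrier GLxGL" "C = T #>\<^bsub>GLxGL\<^esub> h" by (auto simp: space_eq RCOSETS_def)
    then show "C \<in> cosets_of ?Y" using C by (auto simp: cosets_of_def orb_stab_fun_eq)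
  next
    fix C assume "C \<in> cosets_of ?Y"
    then show "C \<in> (\<lambda>C. \<phi> (orb_stab_fun GLxGL act C x)) -` B \<inter> space \<mu>"
      by (auto simp: cosets_of_def orb_stab_fun_eq space_eq RCOSETS_def)
  qed
  ultimately show "(\<lambda>C. \<phi> (orb_stab_fun GLxGL act C x)) -` B \<inter> space \<mu> \<in> sets \<mu>" by simp
qed

lemma orbit_function_integrable:
  fixes \<phi> :: "('a, 'n) mat2 \<Rightarrow> complex"
  assumes \<phi>: "schwartz_bruhat \<rho> R \<phi>" and \<rho>: "0 < \<rho>" "1 \<le> R"
  shows "integrable \<mu> (\<lambda>C. \<phi> (orb_stab_fun GLxGL act C x))"
proof -
  let ?\<D> = "{D \<in> dcosets. \<exists>h\<in>D. pair_entries_le R (act (inv\<^bsub>GLxGL\<^esub> h) x)}"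
  let ?A = "\<Union>D\<in>?\<D>. cosets_of D"
  obtain M where M: "\<And>y. norm (\<phi> y) \<le> M"
    using finite_imp_bounded[OF finite_range_schwartz_bruhat[OF \<phi> \<rho>(1)]] unfolding bounded_iff by auto
  have D: "cosets_of D \<in> sets \<mu>" "emeasure \<mu> (cosets_of D) < \<infinity>" if "D \<in> ?\<D>" for D
    using that cosets_of_dcoset_in_sets emeasure_cosets_of_dcoset_finite by (auto simp: dcosets_def)
  show ?thesis
  proof (rule integrableI_bounded_set)
    show "?A \<in> sets \<mu>" using proper D(1) by (intro sets.finite_UN) auto
    have "emeasure \<mu> ?A \<le> (\<Sum>D\<in>?\<D>. emeasure \<mu> (cosets_of D))"
      using proper D(1) by (intro emeasure_subadditive_finite) auto
    also have "\<dots> < \<infinity>" using D(2) by (simp add: proper)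
    finally show "emeasure \<mu> ?A < \<infinity>" .
    show "(\<lambda>C. \<phi> (orb_stab_fun GLxGL act C x)) \<in> borel_measurable \<mu>" using assms
      by (rule orbit_function_measurable)
    show "AE C in \<mu>. C \<in> ?A \<longrightarrow> norm (\<phi> (orb_stab_fun GLxGL act C x)) \<le> M" using M by simp
    show "AE C in \<mu>. C \<notin> ?A \<longrightarrow> \<phi> (orb_stab_fun GLxGL act C x) = 0"
    proof (intro AE_I2 impI)
      fix C assume C: "C \<in> space \<mu>" "C \<notin> ?A"
      obtain h where h: "h \<in> carrier GLxGL" "C = T #>\<^bsub>GLxGL\<^esub> h" using C(1)
        by (auto simp: space_eq RCOSETS_def)
      have "dcoset h \<in> dcosets" "h \<in> dcoset h" "C \<in> cosets_of (dcoset h)"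
        using h dcoset_self[OF h(1)] by (auto simp: dcosets_def cosets_of_def)
      then have "\<not> pair_entries_le R (act (inv\<^bsub>GLxGL\<^esub> h) x)" using C(2) by blast
      then show "\<phi> (orb_stab_fun GLxGL act C x) = 0"
        unfolding h(2) orb_stab_fun_eq[OF h(1)] using schwartz_bruhat_supp[OF \<phi>] by blast
    qed
  qed
qed

lemma Orb_sum_act:
  fixes \<phi> :: "('a, 'n) mat2 \<Rightarrow> complex"
  assumes \<phi>: "schwartz_bruhat \<rho> R \<phi>" "0 < \<rho>" "1 \<le> R" and S: "S \<subseteq> GLxGL_O"
  shows "Orb \<mu> (\<lambda>y. \<Sum>s\<in>S. \<phi> (act s y)) x = of_nat (card S) * Orb \<mu> \<phi> x"
proof -
  have "(LINT C|\<mu>. \<phi> (act s (orb_stab_fun GLxGL act C x))) = Orb \<mu> \<phi> x" if s: "s \<in> S" for s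
  proof -
    have sc: "s \<in> carrier GLxGL" using s S GLxGL_O_carrier by blast
    have "(LINT C|\<mu>. \<phi> (act s (orb_stab_fun GLxGL act C x))) =
        (LINT C|\<mu>. \<phi> (orb_stab_fun GLxGL act (C #>\<^bsub>GLxGL\<^esub> inv\<^bsub>GLxGL\<^esub> s) x))"
      using sc by (intro Bochner_Integration.integral_cong) (simp_all add: orb_stab_fun_translate)
    then show ?thesis
      using integral_translate[OF _ orbit_function_measurable[OF \<phi>], of "inv\<^bsub>GLxGL\<^esub> s"] sc
      by (simp add: Orb_def)
  qed
  moreover have "integrable \<mu> (\<lambda>C. \<phi> (act s (orb_stab_fun GLxGL act C x)))" if "s \<in> S" for s
    using that S by (intro orbit_function_integrable[OF schwartz_bruhat_act[OF \<phi>(1)] \<phi>(2,3)]) auto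
  ultimately show ?thesis unfolding Orb_def by (subst Bochner_Integration.integral_sum) simp_all
qed

theorem Orb_eq_weighted_sum:
  fixes \<phi> :: "('a, 'n) mat2 \<Rightarrow> complex"
  assumes \<phi>: "\<And>k y. k \<in> GLxGL_O \<Longrightarrow> \<phi> (act k y) = \<phi> y" "\<And>y. \<phi> y \<noteq> 0 \<Longrightarrow> pair_entries_le R y"
  defines "f \<equiv> lift (\<lambda>h. \<phi> (act (inv\<^bsub>GLxGL\<^esub> h) x))"
  shows "finite {D \<in> dcosets. f D \<noteq> 0}"
    and "Orb \<mu> \<phi> x =
      measure \<mu> (cosets_of GLxGL_O) *\<^sub>R (\<Sum>D | D \<in> dcosets \<and> f D \<noteq> 0. of_nat (lift weight D) * f D)"
proof -
  note bi = biinvariant_orbit_function[OF subgroup_T stabilizer_eq, of \<phi>, OF \<phi>(1)]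
  have "\<exists>h\<in>D. pair_entries_le R (act (inv\<^bsub>GLxGL\<^esub> h) x)" if D: "D \<in> dcosets" "f D \<noteq> 0" for D
  proof -
    obtain h where h: "h \<in> carrier GLxGL" "D = dcoset h" using D(1) by (auto simp: dcosets_def)
    then have "f D = \<phi> (act (inv\<^bsub>GLxGL\<^esub> h) x)" unfolding f_def h(2) by (intro lift_dcoset[OF bi])
    then show ?thesis using D(2) \<phi>(2) h dcoset_self by metis
  qed
  then have "{D \<in> dcosets. f D \<noteq> 0} \<subseteq> {D \<in> dcosets. \<exists>h\<in>D. pair_entries_le R (act (inv\<^bsub>GLxGL\<^esub> h) x)}" by blast
  then show fin: "finite {D \<in> dcosets. f D \<noteq> 0}" using proper by (rule finite_subset)
  have "Orb \<mu> \<phi> x = (\<Sum>D | D \<in> dcosets \<and> f D \<noteq> 0. measure \<mu> (cosets_of D) *\<^sub>R f D)"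
    unfolding Orb_def f_def
  proof (rule integral_biinvariant[OF _ bi])
    show "\<phi> (orb_stab_fun GLxGL act (T #>\<^bsub>GLxGL\<^esub> h) x) = \<phi> (act (inv\<^bsub>GLxGL\<^esub> h) x)" if "h \<in> carrier GLxGL"
        for h
      using that by (simp add: orb_stab_fun_eq)
  qed (use fin[unfolded f_def] cosets_of_dcoset_in_sets emeasure_cosets_of_dcoset_finite in auto)
  also have "\<dots> = measure \<mu> (cosets_of GLxGL_O) *\<^sub>R (\<Sum>D | D \<in> dcosets \<and> f D \<noteq> 0. of_nat (lift weight D) * f D)"
    unfolding scaleR_sum_right
    by (intro sum.cong) (simp_all add: measure_cosets_of_dcoset scaleR_conv_of_real mult_ac)
  finally show "Orb \<mu> \<phi> x =
      measure \<mu> (cosets_of GLxGL_O) *\<^sub>R (\<Sum>D | D \<in> dcosets \<and> f D \<noteq> 0. of_nat (lift weight D) * f D)" .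
qed

end

end

section \<open>The elliptic torus\<close>

definition elliptic_element :: "nat \<Rightarrow> ('a::nonarch_local_field_0, 'n::finite) mat2" where
  "elliptic_element k = (mat (\<pi> ^ k) ** Pi_power 1, mat 1)"

definition torus :: "('a::nonarch_local_field_0, 'n::finite) mat2 set" where
  "torus = {(e, e) | e. invertible e \<and> e \<in> cyclic_centralizer \<pi>}"

lemma torusD:
  assumes "t \<in> torus"
  shows "snd t = fst t" "invertible (fst t)" "fst t \<in> cyclic_centralizer \<pi>"
  using assms by (auto simp: torus_def)

lemma stabilizer_elliptic_element: "stabilizer GLxGL act (elliptic_element k) = torus"
  unfolding elliptic_element_def torus_def by (rule stabilizer_cyclic_mat) simp

lemma H_regular_elliptic_elliptic_element:
  "H_regular_elliptic (elliptic_element k :: ('a::nonarch_local_field_0, 'n::finite) mat2)"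
  unfolding H_regular_elliptic_def elliptic_element_def
  by (intro conjI H_regular_semisimple_cyclic_mat stabilizer_anisotropic_cyclic_mat
    irreducible_monom_minus_uniformizer)
    simp_all

lemma subgroup_torus: "subgroup torus (GLxGL :: ('a::nonarch_local_field_0, 'n::finite) mat2 monoid)"
proof
  fix x y :: "('a, 'n) mat2" assume "x \<in> torus" "y \<in> torus"
  then show "x \<otimes>\<^bsub>GLxGL\<^esub> y \<in> torus"
    by (auto simp: torus_def mult_GLxGL invertible_mult cyclic_centralizer_mult)
next
  fix x :: "('a, 'n) mat2" assume x: "x \<in> torus"
  then have "inv\<^bsub>GLxGL\<^esub> x = (matrix_inv (fst x), matrix_inv (fst x))"
    by (subst inv_GLxGL) (auto simp: carrier_GLxGL_iff torusD)
  then show "inv\<^bsub>GLxGL\<^esub> x \<in> torus"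
    using torusD[OF x] by (simp add: torus_def matrix_inv_props cyclic_centralizer_matrix_inv)
qed (auto simp: torus_def carrier_GLxGL_iff one_GLxGL invertible_mat)

global_interpretation torus: double_cosets "GLxGL :: ('a::nonarch_local_field_0, 'n::finite) mat2 monoid"
    torus GLxGL_O
  by (intro double_cosets.intro GLxGL.group_axioms subgroup_torus subgroup_GLxGL_O)

lemma torus_commute: "s \<in> torus \<Longrightarrow> t \<in> torus \<Longrightarrow> s \<otimes>\<^bsub>GLxGL\<^esub> t = t \<otimes>\<^bsub>GLxGL\<^esub> s"
  using cyclic_centralizer_commute[OF torusD(3) torusD(3), of s t] by (simp add: mult_GLxGL torusD)

lemma Pi_power_torus [simp]: "(Pi_power v, Pi_power v) \<in> torus"
  by (simp add: torus_def invertible_cyclic_mat)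

lemma Pi_power_shift_commute: "t \<in> torus \<Longrightarrow> (mat 1, Pi_power v) \<otimes>\<^bsub>GLxGL\<^esub> t = t \<otimes>\<^bsub>GLxGL\<^esub> (mat 1, Pi_power v)"
  by (simp add: mult_GLxGL torusD cyclic_mat_commute)

lemma mem_conj_set_GLxGL_O_iff:
  fixes h :: "('a::nonarch_local_field_0, 'n::finite) mat2"
  assumes "h \<in> carrier GLxGL" "x \<in> carrier GLxGL"
  shows "x \<in> GLxGL.conj_set h GLxGL_O \<longleftrightarrow>
    matrix_inv (fst h) ** fst x ** fst h \<in> GL_O \<and> matrix_inv (snd h) ** snd x ** snd h \<in> GL_O"
  using GLxGL.mem_conj_set_iff[OF assms(1) subgroup.subset[OF subgroup_GLxGL_O] assms(2)]
  by (simp add: inv_GLxGL assms(1) mult_GLxGL GLxGL_O_def)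

lemma torus_Int_conj_set_GLxGL_O:
  fixes h :: "('a::nonarch_local_field_0, 'n::finite) mat2"
  assumes h: "h \<in> carrier GLxGL"
  shows "torus \<inter> GLxGL.conj_set h GLxGL_O \<subseteq> GLxGL_O"
proof
  fix t :: "('a, 'n) mat2" assume t: "t \<in> torus \<inter> GLxGL.conj_set h GLxGL_O"
  then have tT: "t \<in> torus" by blast
  have i: "invertible (fst h)" using h by (simp add: carrier_GLxGL_iff)
  have "absval (det (matrix_inv (fst h) ** fst t ** fst h)) = 1"
    using t mem_conj_set_GLxGL_O_iff[OF h torus.T_carrier[OF tT]] by (intro absval_det_GL_O) blast
  moreover have "det (matrix_inv (fst h) ** fst t ** fst h) = det (fst t)"
    using det_matrix_inv[OF i] by (simp add: det_mul mult_ac)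
  ultimately have "fst t \<in> GL_O"
    using absval_det_cyclic_centralizer GL_O_iff_centralizer_norm torusD(3)[OF tT] by metis
  then show "t \<in> GLxGL_O" using torusD(1)[OF tT] by (simp add: GLxGL_O_def mem_Times_iff)
qed

lemma finite_torus_rcosets_conj_set:
  fixes h :: "('a::nonarch_local_field_0, 'n::finite) mat2"
  assumes h: "h \<in> carrier GLxGL"
  shows "finite ((\<lambda>t. GLxGL.conj_set h GLxGL_O #>\<^bsub>GLxGL\<^esub> t) ` (torus \<inter> GLxGL_O))"
proof (rule finite_subset)
  note K = subgroup.subset[OF subgroup_GLxGL_O, where ?'a1 = 'a and ?'n1 = 'n]
  show "finite ((\<lambda>t. GLxGL.conj_set h GLxGL_O #>\<^bsub>GLxGL\<^esub> t) ` GLxGL_O)"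
    by (rule finite_rcosets_compact[OF open_conj_set[OF open_GLxGL_O K h]
        GLxGL.subgroup_conj_set[OF h subgroup_GLxGL_O] compact_GLxGL_O K])
qed blast

section \<open>Weights of double cosets are prime powers\<close>

lemma matrix_conj_mult:
  fixes h :: "'k::field^'n^'n"
  assumes "invertible h"
  shows "matrix_inv h ** A ** h ** (matrix_inv h ** B ** h) = matrix_inv h ** (A ** B) ** h"
  by (simp add: matrix_mul_assoc [symmetric] matrix_inv_cancel assms)

lemma matrix_conj_mat:
  fixes h :: "'k::field^'n^'n"
  assumes "invertible h"
  shows "matrix_inv h ** mat a ** h = mat a"
  unfolding mat_mult_commute[symmetric] using assms
  by (simp add: matrix_mul_assoc [symmetric] matrix_inv_props)

lemma GL_O_conj_near_scalar:
  fixes h :: "'a::nonarch_local_field_0^'n^'n"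
  assumes h: "invertible h"
  obtains r where "0 < r" "\<And>a A. absval a = 1 \<Longrightarrow> entries_le r (A - mat a) \<Longrightarrow> matrix_inv h ** A ** h \<in> GL_O"
proof -
  obtain s s' where s: "1 \<le> s" "entries_le s h" and s': "1 \<le> s'" "entries_le s' (matrix_inv h)"
    using exists_entries_le by metis
  let ?r = "1 / (2 * (s * s'))"
  have "matrix_inv h ** A ** h \<in> GL_O" if a: "absval a = 1" and A: "entries_le ?r (A - mat a)" for a A
  proof -
    have a0: "a \<noteq> 0" using a by auto
    have "absval (inverse a) \<le> 1" using a by (simp add: absval_inverse)
    then have "entries_le (1 * (s' * ?r * s)) (mat (inverse a) ** (matrix_inv h ** (A - mat a) ** h))"
      using s(2) s'(2) A by (intro entries_le_mult entries_le_mat)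
    moreover have "mat (inverse a) ** (matrix_inv h ** (A - mat a) ** h) =
        mat (inverse a) ** (matrix_inv h ** A ** h) - mat 1"
      using a0 by (simp add: matrix_diff_ldistrib matrix_diff_rdistrib matrix_conj_mat h mat_mult_mat)
    moreover have "1 * (s' * ?r * s) = 1 / 2" using s(1) s'(1) by (simp add: field_simps)
    ultimately have "entries_le (1 / 2) (mat (inverse a) ** (matrix_inv h ** A ** h) - mat 1)" by (simp only:)
    then have "mat (inverse a) ** (matrix_inv h ** A ** h) \<in> GL_O" by (rule GL_O_if_near_one(1)) simp
    then have "mat a ** (mat (inverse a) ** (matrix_inv h ** A ** h)) \<in> GL_O"
      by (rule GL_O_mult[OF GL_O_mat[OF a]])
    then show ?thesis using a0 by (simp add: matrix_mul_assoc mat_mult_mat)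
  qed
  then show ?thesis using that[of ?r] s(1) s'(1) by simp
qed

lemma GLxGL_pow_matrix_poly:
  "(matrix_poly M f, matrix_poly M f) [^]\<^bsub>GLxGL\<^esub> (k :: nat) = (matrix_poly M (f ^ k), matrix_poly M (f ^ k))"
  for M :: "'k::field^'n^'n"
  by (induction k) (simp_all add: one_GLxGL mult_GLxGL matrix_poly_mult power_Suc2 del: power_Suc)

theorem torus_weight_prime_power:
  fixes h :: "('a::nonarch_local_field_0, 'n::finite) mat2"
  assumes h: "h \<in> carrier GLxGL" and p: "prime p" "absval (of_nat p :: 'a) < 1"
  shows "\<exists>k. torus.weight h = p ^ k"
  unfolding torus.weight_def
proof (rule GLxGL.rel_index_prime_power[OF _ _ GLxGL.subgroup_conj_set[OF h subgroup_GLxGL_O]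
      finite_torus_rcosets_conj_set[OF h] p(1)])
  show "subgroup (torus \<inter> GLxGL_O) (GLxGL :: ('a, 'n) mat2 monoid)"
    by (intro GLxGL.subgroups_Inter_pair subgroup_torus subgroup_GLxGL_O)
  show "x \<otimes>\<^bsub>GLxGL\<^esub> y = y \<otimes>\<^bsub>GLxGL\<^esub> x" if "x \<in> torus \<inter> GLxGL_O" "y \<in> torus \<inter> GLxGL_O" for x y :: "('a, 'n) mat2"
    using that by (intro torus_commute) auto
  fix x :: "('a, 'n) mat2" assume x: "x \<in> torus \<inter> GLxGL_O"
  then have xT: "x \<in> torus" by blast
  obtain f where f: "fst x = matrix_poly (Pi_power 1) f"
    using cyclic_centralizer_matrix_poly[OF torusD(3)[OF xT] uniformizer_nonzero] by blast
  let ?P = "\<lambda>k. matrix_poly (Pi_power 1 :: 'a^'n^'n) (f ^ k)"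
  have pow: "x [^]\<^bsub>GLxGL\<^esub> k = (?P k, ?P k)" for k :: nat
    using GLxGL_pow_matrix_poly[of "Pi_power 1 :: 'a^'n^'n" f k] f torusD(1)[OF xT] by (metis prod.collapse)
  obtain r1 where r1: "0 < r1" "\<And>a A. absval a = 1 \<Longrightarrow> entries_le r1 (A - mat a) \<Longrightarrow>
      matrix_inv (fst h) ** A ** fst h \<in> GL_O"
    using GL_O_conj_near_scalar[of "fst h"] h by (auto simp: carrier_GLxGL_iff)
  obtain r2 where r2: "0 < r2" "\<And>a A. absval a = 1 \<Longrightarrow> entries_le r2 (A - mat a) \<Longrightarrow>
      matrix_inv (snd h) ** A ** snd h \<in> GL_O"
    using GL_O_conj_near_scalar[of "snd h"] h by (auto simp: carrier_GLxGL_iff)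
  have "fst x \<in> GL_O" using x by (auto simp: GLxGL_O_def)
  then have "matrix_poly (Pi_power 1 :: 'a^'n^'n) f \<in> GL_O" unfolding f .
  then obtain s a where sa: "absval a = 1" "entries_le (min r1 r2) (?P (p ^ s) - mat a)"
    using GL_O_centralizer_power_near_scalar[OF p(2), where f = f and r = "min r1 r2"] r1(1) r2(1)
    by (metis min_less_iff_conj)
  have "x [^]\<^bsub>GLxGL\<^esub> (p ^ s) \<in> carrier GLxGL" using torus.T_carrier[OF xT] by (rule GLxGL.nat_pow_closed)
  then have "x [^]\<^bsub>GLxGL\<^esub> (p ^ s) \<in> GLxGL.conj_set h GLxGL_O"
    using r1(2)[OF sa(1) entries_le_mono[OF sa(2)]] r2(2)[OF sa(1) entries_le_mono[OF sa(2)]]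
    by (simp add: mem_conj_set_GLxGL_O_iff h pow)
  then show "\<exists>s :: nat. x [^]\<^bsub>GLxGL\<^esub> (p ^ s) \<in> GLxGL.conj_set h GLxGL_O" by blast
qed

section \<open>Double cosets of bounded weight\<close>

lemma entries_le_1_if_GL_O_quotient:
  fixes Z :: "'a::nonarch_local_field_0^'n^'n"
  assumes eps: "absval c < 1" and m: "entries_le 1 m" and eq: "m ** (mat 1 + mat c ** Z) = mat 1 + Z"
  shows "entries_le 1 Z"
proof -
  let ?G = "mat 1 - mat c ** m"
  have "entries_le (absval c * 1) (mat c ** m)" by (intro entries_le_mult entries_le_mat m order_refl)
  then have "entries_le (absval c) (?G - mat 1)" using entries_le_minus by fastforce
  then have G: "?G \<in> GL_O" using eps by (rule GL_O_if_near_one)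
  have "m ** (mat c ** Z) = mat c ** m ** Z" unfolding matrix_mul_assoc mat_mult_commute[of c m] ..
  then have "m + mat c ** m ** Z = mat 1 + Z" using eq by (simp add: matrix_add_ldistrib)
  then have "?G ** Z = m - mat 1" by (simp add: matrix_diff_rdistrib algebra_simps)
  then have "Z = matrix_inv ?G ** (m - mat 1)" using matrix_inv_cancel(1)[OF GL_O_D(1)[OF G], of Z] by simp
  moreover have "entries_le 1 (m - mat 1)" using m by (intro entries_le_diff entries_le_mat) auto
  ultimately show ?thesis using GL_O_D(3)[OF G] by (metis entries_le_mult mult_1)
qed

lemma mat_mult_Pi_power: "mat (\<pi> powi m) ** Pi_power v =
    (Pi_power (int CARD('n) * m + v) :: 'a::nonarch_local_field_0^'n^'n)"
  by (simp add: cyclic_mat_add cyclic_mat_CARD_mult)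

lemma mat_mult_conj_Pi_power:
  fixes H :: "'a::nonarch_local_field_0^'n^'n"
  shows "mat (\<pi> powi k) ** (matrix_inv H ** Pi_power v ** H) = matrix_inv H ** Pi_power (int CARD('n) * k + v) ** H"
  unfolding mat_mult_Pi_power [symmetric] matrix_mul_assoc mat_mult_commute[of _ "matrix_inv H"] ..

lemma entries_le_conj_Pi_power_shift:
  fixes H :: "'a::nonarch_local_field_0^'n^'n"
  assumes "entries_le r (matrix_inv H ** Pi_power v ** H)"
  shows "entries_le (absval (\<pi> :: 'a) powi k * r) (matrix_inv H ** Pi_power (int CARD('n) * k + v) ** H)"
  unfolding mat_mult_conj_Pi_power [symmetric]
  by (intro entries_le_mult entries_le_mat assms) (simp add: absval_power_int)

lemma GL_O_one_plus_Pi_power: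
  assumes "0 < v"
  shows "mat 1 + Pi_power v \<in> (GL_O :: ('a::nonarch_local_field_0^'n^'n) set)"
proof -
  let ?A = "mat 1 + Pi_power v :: 'a^'n^'n"
  have one: "centralizer_norm (mat 1 :: 'a^'n^'n) = 1" by (simp add: centralizer_norm_mat)
  have "centralizer_norm (Pi_power v :: 'a^'n^'n) < centralizer_norm (mat 1 :: 'a^'n^'n)"
    using assms absval_uniformizer_powi_less_iff[where k = v and l = 0 and ?'a = 'a]
    unfolding one by (simp add: centralizer_norm_Pi_power)
  then have "centralizer_norm ?A = 1"
    using cyclic_norm_add_eq[of "Pi_power v *v base_axis :: 'a^'n" base_axis] one
    by (simp add: centralizer_norm_def matrix_vector_mult_add_rdistrib)
  moreover have "?A \<in> cyclic_centralizer \<pi>"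
    by (simp add: cyclic_centralizer_def matrix_add_ldistrib matrix_add_rdistrib flip: cyclic_mat_add)
      (simp add: add.commute)
  ultimately show ?thesis by (simp add: GL_O_iff_centralizer_norm)
qed

lemma entries_le_conj_Pi_power_if_quotient_GL_O:
  fixes H :: "'a::nonarch_local_field_0^'n^'n" and i :: int
  defines "u \<equiv> \<lambda>a :: nat. mat 1 + Pi_power (int CARD('n) * int a + i) :: 'a^'n^'n"
  assumes H: "invertible H" and ab: "a < b" "invertible (u b)"
    and m: "matrix_inv H ** (u a ** matrix_inv (u b)) ** H \<in> GL_O"
  shows "entries_le (absval (\<pi> :: 'a) powi (- int a)) (matrix_inv H ** Pi_power i ** H)"
proof -
  let ?n = "int CARD('n)" and ?c = "\<pi> powi (int b - int a) :: 'a"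
  let ?Z = "matrix_inv H ** Pi_power (?n * int a + i) ** H"
  have u: "matrix_inv H ** u k ** H = mat 1 + matrix_inv H ** Pi_power (?n * int k + i) ** H" for k
    unfolding u_def by (simp add: matrix_add_ldistrib matrix_add_rdistrib matrix_inv_props H)
  have "matrix_inv H ** (u a ** matrix_inv (u b)) ** H ** (matrix_inv H ** u b ** H) =
      matrix_inv H ** u a ** H"
    unfolding matrix_conj_mult[OF H] using ab(2) by (simp add: matrix_mul_assoc [symmetric] matrix_inv_props)
  moreover have "matrix_inv H ** u b ** H = mat 1 + mat ?c ** ?Z"
    unfolding u mat_mult_conj_Pi_power by (simp add: algebra_simps)
  moreover have "absval ?c < 1"
    using ab(1) absval_uniformizer_powi_less_iff[of "int b - int a" 0, where ?'a = 'a]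
    by (simp add: absval_power_int)
  ultimately have "entries_le 1 ?Z"
    using entries_le_1_if_GL_O_quotient[OF _ GL_O_D(2)[OF m]] by (simp add: u)
  then show ?thesis
    using entries_le_conj_Pi_power_shift[of 1 H "?n * int a + i" "- int a"] by (simp add: algebra_simps)
qed

definition conj_Pi_power_le :: "real \<Rightarrow> 'a::nonarch_local_field_0^'n^'n \<Rightarrow> bool" where
  "conj_Pi_power_le r h \<longleftrightarrow> (\<forall>i<CARD('n). entries_le r (matrix_inv h ** Pi_power (int i) ** h))"

text \<open>
  For \<open>i > 0\<close>, two of the \<open>A + 2\<close> units \<open>1 + \<pi>\<^sup>a \<Pi>\<^sup>i\<close> with \<open>0 \<le> a \<le> A + 1\<close> lie in the same coset.
\<close>

theorem conj_Pi_power_le_if_weight_le: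
  fixes h :: "('a::nonarch_local_field_0, 'n::finite) mat2"
  assumes h: "h \<in> carrier GLxGL" and w: "torus.weight h \<le> Suc A"
  defines "r \<equiv> absval (\<pi> :: 'a) powi (- int A)"
  shows "conj_Pi_power_le r (fst h)" "conj_Pi_power_le r (snd h)"
proof -
  have hi: "invertible (fst h)" "invertible (snd h)" using h by (auto simp: carrier_GLxGL_iff)
  have "entries_le r (matrix_inv (fst h) ** Pi_power (int i) ** fst h) \<and>
      entries_le r (matrix_inv (snd h) ** Pi_power (int i) ** snd h)" for i
  proof (cases "i = 0")
    case True
    then show ?thesis using hi absval_uniformizer_powi_le_iff[of 0 "- int A", where ?'a = 'a]
      by (simp add: matrix_inv_props entries_le_mat r_def)
  next
    case False
    define u where "u = (\<lambda>a. mat 1 + Pi_power (int CARD('n) * int a + int i) :: 'a^'n^'n)"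
    have uG: "u a \<in> GL_O" for a unfolding u_def using False
      by (intro GL_O_one_plus_Pi_power) (simp add: add_nonneg_pos)
    have uT: "(u a, u a) \<in> torus \<inter> GLxGL_O" for a
      using uG[of a] by (simp add: torus_def GLxGL_O_def GL_O_D cyclic_centralizer_def u_def
        matrix_add_ldistrib
          matrix_add_rdistrib add.commute flip: cyclic_mat_add)
    have c: "(u a, u a) \<in> carrier GLxGL" for a using uT[of a] torus.T_carrier by blast
    obtain a b where ab: "a < b" "b \<le> Suc A"
        "(u a, u a) \<otimes>\<^bsub>GLxGL\<^esub> inv\<^bsub>GLxGL\<^esub> (u b, u b) \<in> GLxGL.conj_set h GLxGL_O"
      by (rule GLxGL.rel_index_pigeonhole[OF GLxGL.subgroup_conj_set[OF h subgroup_GLxGL_O]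
            finite_torus_rcosets_conj_set[OF h] _ uT w[unfolded torus.weight_def]])
          (use torus.T_carrier in blast)+
    then have "matrix_inv (fst h) ** (u a ** matrix_inv (u b)) ** fst h \<in> GL_O \<and>
        matrix_inv (snd h) ** (u a ** matrix_inv (u b)) ** snd h \<in> GL_O"
      using ab(3) mem_conj_set_GLxGL_O_iff[OF h GLxGL.m_closed[OF c[of a] GLxGL.inv_closed[OF c[of b]]]]
      by (simp add: inv_GLxGL c mult_GLxGL)
    then have "entries_le (absval (\<pi> :: 'a) powi (- int a)) (matrix_inv (fst h) ** Pi_power (int i)
        ** fst h) \<and>
        entries_le (absval (\<pi> :: 'a) powi (- int a)) (matrix_inv (snd h) ** Pi_power (int i) ** snd h)"
      using hi ab(1) GL_O_D(1)[OF uG[of b]] unfolding u_def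
      by (blast intro: entries_le_conj_Pi_power_if_quotient_GL_O)
    moreover have "absval (\<pi> :: 'a) powi (- int a) \<le> r"
      unfolding r_def absval_uniformizer_powi_le_iff using ab by simp
    ultimately show ?thesis using entries_le_mono by blast
  qed
  then show "conj_Pi_power_le r (fst h)" "conj_Pi_power_le r (snd h)" by (auto simp: conj_Pi_power_le_def)
qed

section \<open>Degrees of double cosets\<close>

definition det_degree :: "('a::nonarch_local_field_0, 'n::finite) mat2 \<Rightarrow> int" where
  "det_degree h = val (det (snd h)) - val (det (fst h))"

lemma val_det_mult:
  "invertible A \<Longrightarrow> invertible B \<Longrightarrow> val (det (A ** B)) =
      val (det A) + val (det (B :: 'a::nonarch_local_field_0^'n^'n))"
  by (simp add: det_mul val_mult invertible_det_nz)

lemma val_det_matrix_inv: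
  assumes "invertible A"
  shows "val (det (matrix_inv A)) = - val (det (A :: 'a::nonarch_local_field_0^'n^'n))"
  using val_det_mult[OF assms matrix_inv_props(3)[OF assms]] val_eq_0[of "1 :: 'a"] assms
  by (simp add: matrix_inv_props)

lemma val_det_GL_O: "A \<in> GL_O \<Longrightarrow> val (det A) = 0"
  by (intro val_eq_0 absval_det_GL_O)

lemma val_det_ge:
  fixes A :: "'a::nonarch_local_field_0^'n^'n"
  assumes "invertible A" "entries_le (absval (\<pi> :: 'a) powi m) A"
  shows "int CARD('n) * m \<le> val (det A)"
proof -
  have "absval (\<pi> :: 'a) powi val (det A) \<le> (absval (\<pi> :: 'a) powi m) ^ CARD('n)"
    using absval_det_le[OF assms(2)] assms(1) absval_eq_powi_val[of "det A"] by (simp add: invertible_det_nz)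
  then have "absval (\<pi> :: 'a) powi val (det A) \<le> absval (\<pi> :: 'a) powi (m * int CARD('n))"
    by (simp add: power_int_mult)
  then show ?thesis by (simp add: absval_uniformizer_powi_le_iff mult.commute)
qed

lemma det_degree_mult: "g \<in> carrier GLxGL \<Longrightarrow> h \<in> carrier GLxGL \<Longrightarrow> det_degree (g \<otimes>\<^bsub>GLxGL\<^esub> h) =
    det_degree g + det_degree h"
  by (simp add: det_degree_def mult_GLxGL carrier_GLxGL_iff val_det_mult)

lemma det_degree_torus: "t \<in> torus \<Longrightarrow> det_degree t = 0"
  by (simp add: det_degree_def torusD)

lemma det_degree_GLxGL_O: "k \<in> GLxGL_O \<Longrightarrow> det_degree k = 0"
  by (auto simp: det_degree_def GLxGL_O_def val_det_GL_O)

lemma det_degree_Pi_power_mult: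
  assumes "invertible g1" "invertible g2"
  shows "det_degree (Pi_power v1 ** g1, Pi_power v2 ** g2) = v2 - v1 + det_degree (g1, g2)"
  using assms by (simp add: det_degree_def val_det_mult invertible_cyclic_mat val_det_Pi_power)

lemma biinvariant_det_degree: "torus.biinvariant det_degree"
  unfolding torus.biinvariant_def
  by (intro ballI) (simp add: det_degree_mult det_degree_torus det_degree_GLxGL_O)

lemma biinvariant_weight: "torus.biinvariant torus.weight"
  unfolding torus.biinvariant_def
  by (intro ballI torus.weight_mult torus_commute) auto

section \<open>Finiteness modulo the torus\<close>

lemma Pi_power_integral_decomposition:
  fixes h :: "'a::nonarch_local_field_0^'n^'n"
  assumes h: "invertible h" and conj: "conj_Pi_power_le r h"
  obtains v g where "h = Pi_power v ** g" "invertible g" "entries_le 1 g" "entries_le r (matrix_inv g)"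
proof -
  obtain v where v: "entries_le 1 (Pi_power v ** h)" "entries_le r (matrix_inv (Pi_power v ** h))"
    using exists_integral_Pi_power_mult[OF h] conj unfolding conj_Pi_power_le_def by metis
  have "h = Pi_power (- v) ** (Pi_power v ** h)" by (simp add: cyclic_mat_cancel)
  then show ?thesis using v h by (intro that) (simp_all add: invertible_mult invertible_cyclic_mat)
qed

lemma dcoset_Pi_power_mult:
  fixes g1 g2 s1 s2 :: "'a::nonarch_local_field_0^'n^'n"
  assumes s: "invertible s1" "invertible s2" and k: "matrix_inv s1 ** g1 \<in> GL_O" "matrix_inv s2 ** g2 \<in> GL_O"
  shows "torus.dcoset (Pi_power v1 ** g1, Pi_power v2 ** g2) = torus.dcoset (s1, Pi_power (v2 - v1) ** s2)"
proof -
  let ?s = "(s1, Pi_power (v2 - v1) ** s2)" and ?k = "(matrix_inv s1 ** g1, matrix_inv s2 ** g2)"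
  have "?s \<in> carrier GLxGL" using s by (simp add: carrier_GLxGL_iff invertible_mult invertible_cyclic_mat)
  moreover have "?k \<in> GLxGL_O" using k by (simp add: GLxGL_O_def)
  then have "(Pi_power v1, Pi_power v1) \<otimes>\<^bsub>GLxGL\<^esub> ?s \<otimes>\<^bsub>GLxGL\<^esub> ?k \<in> torus.dcoset ?s"
    by (intro torus.dcosetI Pi_power_torus)
  moreover have "Pi_power v2 = (Pi_power v1 ** Pi_power (v2 - v1) :: 'a^'n^'n)" by (simp flip: cyclic_mat_add)
  then have "(Pi_power v1, Pi_power v1) \<otimes>\<^bsub>GLxGL\<^esub> ?s \<otimes>\<^bsub>GLxGL\<^esub> ?k = (Pi_power v1 ** g1, Pi_power v2 ** g2)"
    using s by (simp add: mult_GLxGL matrix_mul_assoc [symmetric] matrix_inv_cancel)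
  ultimately show ?thesis by (metis torus.dcoset_eqI)
qed

lemma finite_dcosets_of_degree:
  "finite (torus.dcoset ` {h :: ('a::nonarch_local_field_0, 'n::finite) mat2. h \<in> carrier GLxGL \<and>
    conj_Pi_power_le r (fst h) \<and> conj_Pi_power_le r (snd h) \<and> det_degree h = d})" (is "finite (_ ` ?H)")
proof -
  obtain S :: "('a^'n^'n) set" where S: "finite S" "\<And>g. invertible g \<Longrightarrow> entries_le (max r 1) g \<Longrightarrow>
      entries_le (max r 1) (matrix_inv g) \<Longrightarrow> \<exists>s\<in>S. invertible s \<and> matrix_inv s ** g \<in> GL_O"
    using finite_GL_O_cosets[of "max r 1", where ?'a = 'a and ?'n = 'n] by blast
  have rep: "\<exists>s\<in>S. invertible s \<and> matrix_inv s ** g \<in> GL_O \<and> val (det g) = val (det s)"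
    if g: "invertible g" "entries_le 1 g" "entries_le r (matrix_inv g)" for g
  proof -
    obtain s where s: "s \<in> S" "invertible s" "matrix_inv s ** g \<in> GL_O"
      using S(2)[OF g(1) entries_le_mono[OF g(2)] entries_le_mono[OF g(3)]] by auto
    then show ?thesis using val_det_GL_O[OF s(3)] g(1)
      by (auto simp: val_det_mult val_det_matrix_inv matrix_inv_props)
  qed
  let ?F = "\<lambda>(s1, s2). torus.dcoset (s1, Pi_power (d - det_degree (s1, s2)) ** s2)"
  have "torus.dcoset h \<in> ?F ` (S \<times> S)" if h: "h \<in> ?H" for h
  proof -
    have hi: "invertible (fst h)" "invertible (snd h)" using h by (auto simp: carrier_GLxGL_iff)
    obtain v1 g1 where g1: "fst h = Pi_power v1 ** g1" "invertible g1" "entries_le 1 g1"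
        "entries_le r (matrix_inv g1)"
      using Pi_power_integral_decomposition[OF hi(1)] h by blast
    obtain v2 g2 where g2: "snd h = Pi_power v2 ** g2" "invertible g2" "entries_le 1 g2"
        "entries_le r (matrix_inv g2)"
      using Pi_power_integral_decomposition[OF hi(2)] h by blast
    obtain s1 where s1: "s1 \<in> S" "invertible s1" "matrix_inv s1 ** g1 \<in> GL_O" "val (det g1) = val (det s1)"
      using rep[OF g1(2-4)] by blast
    obtain s2 where s2: "s2 \<in> S" "invertible s2" "matrix_inv s2 ** g2 \<in> GL_O" "val (det g2) = val (det s2)"
      using rep[OF g2(2-4)] by blast
    have nf: "h = (Pi_power v1 ** g1, Pi_power v2 ** g2)" using g1(1) g2(1) by (simp add: prod_eq_iff)
    then have "d = v2 - v1 + det_degree (s1, s2)"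
      using h det_degree_Pi_power_mult[OF g1(2) g2(2)] s1(4) s2(4) by (simp add: det_degree_def)
    then have "torus.dcoset h = ?F (s1, s2)"
      unfolding nf using dcoset_Pi_power_mult[OF s1(2) s2(2) s1(3) s2(3), of v1 v2] by simp
    then show ?thesis using s1(1) s2(1) by blast
  qed
  then have "torus.dcoset ` ?H \<subseteq> ?F ` (S \<times> S)" by blast
  then show ?thesis by (rule finite_subset) (use S(1) in simp)
qed

lemma finite_level:
  "finite {D \<in> torus.dcosets. torus.lift torus.weight D \<le> Suc A \<and>
    torus.lift (det_degree :: ('a::nonarch_local_field_0, 'n::finite) mat2 \<Rightarrow> int) D = d}" (is "finite ?L")
proof (rule finite_subset[OF _ finite_dcosets_of_degree])
  show "?L \<subseteq> torus.dcoset ` {h :: ('a, 'n) mat2. h \<in> carrier GLxGL \<and>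
      conj_Pi_power_le (absval (\<pi> :: 'a) powi (- int A)) (fst h) \<and>
      conj_Pi_power_le (absval (\<pi> :: 'a) powi (- int A)) (snd h) \<and> det_degree h = d}"
  proof
    fix D assume D: "D \<in> ?L"
    then obtain h where h: "h \<in> carrier GLxGL" "D = torus.dcoset h" by (auto simp: torus.dcosets_def)
    then have "torus.weight h \<le> Suc A" "det_degree h = d"
      using D torus.lift_dcoset[OF biinvariant_weight h(1)] torus.lift_dcoset[OF biinvariant_det_degree h(1)]
      by auto
    then show "D \<in> torus.dcoset ` {h. h \<in> carrier GLxGL \<and>
        conj_Pi_power_le (absval (\<pi> :: 'a) powi (- int A)) (fst h) \<and>
      conj_Pi_power_le (absval (\<pi> :: 'a) powi (- int A)) (snd h) \<and> det_degree h = d}"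
      unfolding h(2) using h(1) conj_Pi_power_le_if_weight_le by blast
  qed
qed

lemma dcoset_eq_dcoset_one:
  fixes h :: "('a::nonarch_local_field_0, 'n::finite) mat2"
  assumes h: "h \<in> carrier GLxGL" "torus.weight h = 1" "det_degree h = 0"
  shows "torus.dcoset h = torus.dcoset \<one>\<^bsub>GLxGL\<^esub>"
proof -
  have hi: "invertible (fst h)" "invertible (snd h)" using h(1) by (auto simp: carrier_GLxGL_iff)
  have w: "torus.weight h \<le> Suc 0" using h(2) by simp
  note conj = conj_Pi_power_le_if_weight_le[OF h(1) w, simplified]
  obtain v1 g1 where g1: "fst h = Pi_power v1 ** g1" "invertible g1" "entries_le 1 g1"
      "entries_le 1 (matrix_inv g1)"
    using Pi_power_integral_decomposition[OF hi(1) conj(1)] by blast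
  obtain v2 g2 where g2: "snd h = Pi_power v2 ** g2" "invertible g2" "entries_le 1 g2"
      "entries_le 1 (matrix_inv g2)"
    using Pi_power_integral_decomposition[OF hi(2) conj(2)] by blast
  have G: "g1 \<in> GL_O" "g2 \<in> GL_O" using g1 g2 by (auto simp: GL_O_def)
  have nf: "h = (Pi_power v1 ** g1, Pi_power v2 ** g2)" using g1(1) g2(1) by (simp add: prod_eq_iff)
  have "v2 = v1"
    using h(3) det_degree_Pi_power_mult[OF g1(2) g2(2), of v1 v2] G unfolding nf
    by (simp add: det_degree_def val_det_GL_O)
  then show ?thesis unfolding nf
    using dcoset_Pi_power_mult[of "mat 1" "mat 1" g1 g2 v1 v2] G
    by (simp add: one_GLxGL matrix_inv_mat_1 invertible_mat)
qed

section \<open>The orbit of an elliptic element\<close>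

lemma act_inv_elliptic_element:
  fixes h :: "('a::nonarch_local_field_0, 'n::finite) mat2"
  assumes "h \<in> carrier GLxGL"
  shows "act (inv\<^bsub>GLxGL\<^esub> h) (elliptic_element k) =
    (matrix_inv (fst h) ** Pi_power (int CARD('n) * int k + 1) ** snd h, matrix_inv (snd h) ** fst h)"
proof -
  have "mat (\<pi> ^ k) ** Pi_power 1 = (Pi_power (int CARD('n) * int k + 1) :: 'a^'n^'n)"
    using mat_mult_Pi_power[of "int k" 1, where ?'a = 'a and ?'n = 'n] by simp
  then show ?thesis using assms by (simp add: act_def inv_GLxGL elliptic_element_def carrier_GLxGL_iff
      matrix_inv_matrix_inv)
qed

lemma entries_le_Pi_power_sandwich:
  fixes h1 h2 :: "'a::nonarch_local_field_0^'n^'n"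
  assumes h: "invertible h1" "invertible h2"
    and conj: "conj_Pi_power_le (absval (\<pi> :: 'a) powi (- int A)) h1"
        "conj_Pi_power_le (absval (\<pi> :: 'a) powi (- int A)) h2"
    and q: "int CARD('n) * (q + 2 * int A) \<le> v + det_degree (h1, h2)"
  shows "entries_le (absval (\<pi> :: 'a) powi q) (matrix_inv h1 ** Pi_power v ** h2)"
proof -
  obtain v1 g1 where g1: "h1 = Pi_power v1 ** g1" "invertible g1" "entries_le 1 g1"
      "entries_le (absval (\<pi> :: 'a) powi (- int A)) (matrix_inv g1)"
    using Pi_power_integral_decomposition[OF h(1) conj(1)] by blast
  obtain v2 g2 where g2: "h2 = Pi_power v2 ** g2" "invertible g2" "entries_le 1 g2"
      "entries_le (absval (\<pi> :: 'a) powi (- int A)) (matrix_inv g2)"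
    using Pi_power_integral_decomposition[OF h(2) conj(2)] by blast
  have "0 \<le> val (det g1)" using val_det_ge[of g1 0] g1 by simp
  moreover have "val (det g2) \<le> int CARD('n) * int A"
    using val_det_ge[of "matrix_inv g2" "- int A"] g2 by (simp add: matrix_inv_props val_det_matrix_inv)
  moreover have "det_degree (h1, h2) = v2 - v1 + val (det g2) - val (det g1)"
    unfolding g1(1) g2(1) using det_degree_Pi_power_mult[OF g1(2) g2(2)] by (simp add: det_degree_def)
  ultimately have "int CARD('n) * (q + int A) \<le> v + v2 - v1" using q by (simp add: algebra_simps)
  then have "entries_le (absval (\<pi> :: 'a) powi (- int A) * absval (\<pi> :: 'a) powi (q + int A)
      * 1) (matrix_inv g1 ** Pi_power (v + v2 - v1) ** g2)"
    by (intro entries_le_mult g1(4) g2(3) entries_le_Pi_power)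
  moreover have "absval (\<pi> :: 'a) powi (- int A) * absval (\<pi> :: 'a) powi (q + int A) =
      absval (\<pi> :: 'a) powi q"
    by (simp flip: power_int_add)
  moreover have "matrix_inv h1 ** Pi_power v ** h2 = matrix_inv g1 ** Pi_power (v + v2 - v1) ** g2"
  proof -
    have "Pi_power (v + v2 - v1) = (Pi_power (- v1) ** Pi_power v ** Pi_power v2 :: 'a^'n^'n)"
      by (simp flip: cyclic_mat_add) (simp add: algebra_simps)
    then show ?thesis unfolding g1(1) g2(1)
      using g1(2) by (simp add: matrix_inv_mult invertible_cyclic_mat matrix_inv_cyclic_mat matrix_mul_assoc)
  qed
  ultimately show ?thesis by simp
qed

lemma entries_le_act_elliptic_element:
  fixes h :: "('a::nonarch_local_field_0, 'n::finite) mat2"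
  assumes h: "h \<in> carrier GLxGL" "torus.weight h \<le> Suc A"
  defines "y \<equiv> \<lambda>k. act (inv\<^bsub>GLxGL\<^esub> h) (elliptic_element k)"
  shows "int CARD('n) * (q + 2 * int A) \<le> int CARD('n) * int k + 1 + det_degree h \<Longrightarrow>
      entries_le (absval (\<pi> :: 'a) powi q) (fst (y k))"
    and "int CARD('n) * (q + 2 * int A) \<le> - det_degree h \<Longrightarrow> entries_le (absval (\<pi> :: 'a) powi q) (snd (y k))"
proof -
  have hi: "invertible (fst h)" "invertible (snd h)" using h(1) by (auto simp: carrier_GLxGL_iff)
  note conj = conj_Pi_power_le_if_weight_le[OF h]
  show "entries_le (absval (\<pi> :: 'a) powi q) (fst (y k))"
    if "int CARD('n) * (q + 2 * int A) \<le> int CARD('n) * int k + 1 + det_degree h"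
    using entries_le_Pi_power_sandwich[OF hi conj] that by (simp add: y_def act_inv_elliptic_element h(1))
  show "entries_le (absval (\<pi> :: 'a) powi q) (snd (y k))" if "int CARD('n) * (q + 2 * int A) \<le> - det_degree h"
    using entries_le_Pi_power_sandwich[OF hi(2,1) conj(2,1), of q 0] that
    by (simp add: y_def act_inv_elliptic_element h(1) det_degree_def)
qed

lemma conj_Pi_power_le_if_entries_le:
  fixes h :: "'a::nonarch_local_field_0^'n^'n"
  assumes h: "invertible h"
    and c: "entries_le (absval (\<pi> :: 'a) powi (- int c)) (matrix_inv h ** Pi_power 1 ** h)"
  shows "conj_Pi_power_le (absval (\<pi> :: 'a) powi (- int (c * CARD('n)))) h"
  unfolding conj_Pi_power_le_def
proof (intro allI impI)
  fix i assume i: "i < CARD('n)"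
  have "entries_le (absval (\<pi> :: 'a) powi (- int (c * i))) (matrix_inv h ** Pi_power (int i) ** h)"
  proof (induction i)
    case 0
    show ?case using h by (simp add: matrix_inv_props entries_le_mat)
  next
    case (Suc i)
    have "matrix_inv h ** Pi_power (int (Suc i)) ** h =
        matrix_inv h ** Pi_power (int i) ** h ** (matrix_inv h ** Pi_power 1 ** h)"
      unfolding matrix_conj_mult[OF h] by (simp add: add.commute flip: cyclic_mat_add)
    moreover have "absval (\<pi> :: 'a) powi (- int (c * Suc i)) =
        absval (\<pi> :: 'a) powi (- int (c * i)) * absval (\<pi> :: 'a) powi (- int c)"
      by (simp add: algebra_simps flip: power_int_add)
    ultimately show ?case using entries_le_mult[OF Suc c] by simp
  qed
  then show "entries_le (absval (\<pi> :: 'a) powi (- int (c * CARD('n)))) (matrix_inv h ** Pi_power (int i)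
      ** h)"
    by (rule entries_le_mono) (use i in \<open>simp add: absval_uniformizer_powi_le_iff mult_left_mono\<close>)
qed

lemma conj_Pi_power_le_if_pair_entries_le:
  fixes h :: "('a::nonarch_local_field_0, 'n::finite) mat2" and k m :: nat
  assumes h: "h \<in> carrier GLxGL"
    and m: "pair_entries_le (absval (\<pi> :: 'a) powi (- int m)) (act (inv\<^bsub>GLxGL\<^esub> h) (elliptic_element k))"
  defines "r \<equiv> absval (\<pi> :: 'a) powi (- int ((2 * m + k) * CARD('n)))"
  shows "conj_Pi_power_le r (fst h)" "conj_Pi_power_le r (snd h)"
    and "- int CARD('n) * int m \<le> int CARD('n) * int k + 1 + det_degree h"
      "- int CARD('n) * int m \<le> - det_degree h"
proof -
  let ?N = "int CARD('n) * int k + 1"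
  have hi: "invertible (fst h)" "invertible (snd h)" using h by (auto simp: carrier_GLxGL_iff)
  have x: "entries_le (absval (\<pi> :: 'a) powi (- int m)) (matrix_inv (fst h) ** Pi_power ?N ** snd h)"
    and y: "entries_le (absval (\<pi> :: 'a) powi (- int m)) (matrix_inv (snd h) ** fst h)"
    using m unfolding pair_entries_le_def act_inv_elliptic_element[OF h] by auto
  have conj: "conj_Pi_power_le r g" if g: "invertible g"
    and sq: "entries_le (absval (\<pi> :: 'a) powi (- int m) * absval (\<pi> :: 'a) powi (- int m))
      (matrix_inv g ** Pi_power ?N ** g)" for g :: "'a^'n^'n"
  proof -
    have "entries_le (absval (\<pi> :: 'a) powi (- int (2 * m + k))) (matrix_inv g ** Pi_power 1 ** g)"
      using entries_le_conj_Pi_power_shift[OF sq, of "- int k"] by (simp add: algebra_simps flip: power_int_add)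
    then show ?thesis unfolding r_def by (rule conj_Pi_power_le_if_entries_le[OF g])
  qed
  have "matrix_inv (fst h) ** Pi_power ?N ** snd h ** (matrix_inv (snd h) ** fst h) =
      matrix_inv (fst h) ** Pi_power ?N ** fst h"
    using hi by (simp add: matrix_mul_assoc [symmetric] matrix_inv_cancel)
  then show "conj_Pi_power_le r (fst h)" using entries_le_mult[OF x y] hi(1) by (intro conj) simp_all
  have "matrix_inv (snd h) ** fst h ** (matrix_inv (fst h) ** Pi_power ?N ** snd h) =
      matrix_inv (snd h) ** Pi_power ?N ** snd h"
    using hi by (simp add: matrix_mul_assoc [symmetric] matrix_inv_cancel)
  then show "conj_Pi_power_le r (snd h)" using entries_le_mult[OF y x] hi(2) by (intro conj) simp_all
  show "- int CARD('n) * int m \<le> ?N + det_degree h"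
    using val_det_ge[OF _ x] hi
    by (simp add: invertible_mult invertible_cyclic_mat matrix_inv_props val_det_mult val_det_matrix_inv
      val_det_Pi_power det_degree_def)
  show "- int CARD('n) * int m \<le> - det_degree h"
    using val_det_ge[OF _ y] hi by (simp add: invertible_mult matrix_inv_props val_det_mult val_det_matrix_inv
      det_degree_def)
qed

theorem finite_dcosets_pair_entries_le:
  "finite {D \<in> torus.dcosets. \<exists>h\<in>D. pair_entries_le R
    (act (inv\<^bsub>GLxGL\<^esub> h) (elliptic_element k :: ('a::nonarch_local_field_0, 'n::finite) mat2))}"
proof -
  have "1 < inverse (absval (\<pi> :: 'a))" by (simp add: one_less_inverse)
  then obtain m :: nat where "R < inverse (absval (\<pi> :: 'a)) ^ m" using real_arch_pow by blast
  then have m: "R \<le> absval (\<pi> :: 'a) powi (- int m)" by (simp add: power_int_minus power_inverse)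
  define r where "r = absval (\<pi> :: 'a) powi (- int ((2 * m + k) * CARD('n)))"
  let ?H = "\<lambda>d. {h :: ('a, 'n) mat2. h \<in> carrier GLxGL \<and> conj_Pi_power_le r (fst h) \<and>
      conj_Pi_power_le r (snd h) \<and> det_degree h = d}"
  let ?I = "{- int CARD('n) * int m - int CARD('n) * int k - 1 .. int CARD('n) * int m}"
  have "{D \<in> torus.dcosets. \<exists>h\<in>D. pair_entries_le R
      (act (inv\<^bsub>GLxGL\<^esub> h) (elliptic_element k :: ('a, 'n) mat2))} \<subseteq>
    (\<Union>d\<in>?I. torus.dcoset ` ?H d)"
  proof
    fix D :: "('a, 'n) mat2 set"
    assume D: "D \<in> {D \<in> torus.dcosets. \<exists>h\<in>D. pair_entries_le R (act (inv\<^bsub>GLxGL\<^esub> h) (elliptic_element k))}"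
    then obtain h where hD: "h \<in> D" and hR: "pair_entries_le R (act (inv\<^bsub>GLxGL\<^esub> h) (elliptic_element k))"
      by blast
    obtain g where g: "g \<in> carrier GLxGL" "D = torus.dcoset g" using D by (auto simp: torus.dcosets_def)
    have h: "h \<in> carrier GLxGL" "D = torus.dcoset h"
      using hD g torus.dcoset_subset_carrier[OF g(1)] torus.dcoset_eqI[OF g(1)] by auto
    note b = conj_Pi_power_le_if_pair_entries_le[OF h(1) pair_entries_le_mono[OF hR m], folded r_def]
    have "h \<in> ?H (det_degree h)" "det_degree h \<in> ?I" using h(1) b by auto
    then show "D \<in> (\<Union>d\<in>?I. torus.dcoset ` ?H d)" using h(2) by blast
  qed
  then show ?thesis by (rule finite_subset) (intro finite_UN_I finite_dcosets_of_degree
      finite_atLeastAtMost_int)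
qed

section \<open>Level sums\<close>

lemma sum_shifted_interval:
  fixes F G :: "int \<Rightarrow> 'b::comm_ring_1"
  assumes lu: "l \<le> c" "c \<le> u"
    and above: "\<And>d. c < d \<Longrightarrow> G d = F d"
    and middle: "\<And>d. c - int n < d \<Longrightarrow> d \<le> c \<Longrightarrow> G d = a"
    and below: "\<And>d. d \<le> c - int n \<Longrightarrow> G d = F (d + int n)"
  shows "sum G {l - int n<..u} = sum F {l<..u} + of_nat n * a"
proof -
  have split: "sum H {a<..b} = sum H {a<..m} + sum H {m<..b}" if "a \<le> m" "m \<le> b" for H :: "int \<Rightarrow> 'b" and a m b
  proof -
    have "{a<..b} = {a<..m} \<union> {m<..b}" using that by auto
    then show ?thesis by (simp only:) (rule sum.union_disjoint, auto)
  qed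
  have "sum G {l - int n<..u} = sum G {l - int n<..c - int n} + (sum G {c - int n<..c} + sum G {c<..u})"
    using lu split[of "l - int n" "c - int n" u G] split[of "c - int n" c u G] by simp
  also have "sum G {l - int n<..c - int n} = sum F {l<..c}"
    by (rule sum.reindex_bij_witness[of _ "\<lambda>d. d - int n" "\<lambda>d. d + int n"]) (auto simp: below)
  also have "sum G {c - int n<..c} = of_nat n * a" using middle by simp
  also have "sum G {c<..u} = sum F {c<..u}" using above by simp
  finally show ?thesis using split[OF lu, of F] by simp
qed

lemmas lift_weight_dcoset = torus.lift_dcoset[OF biinvariant_weight]
lemmas lift_det_degree_dcoset = torus.lift_dcoset[OF biinvariant_det_degree]

definition level :: "nat \<Rightarrow> int \<Rightarrow> ('a::nonarch_local_field_0, 'n::finite) mat2 set set" where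
  "level A d = {D \<in> torus.dcosets. torus.lift torus.weight D \<le> Suc A \<and> torus.lift det_degree D = d}"

lemma dcoset_in_level_iff:
  "h \<in> carrier GLxGL \<Longrightarrow> torus.dcoset h \<in> level A d \<longleftrightarrow> torus.weight h \<le> Suc A \<and> det_degree h = d"
  by (simp add: level_def torus.dcosets_def lift_weight_dcoset lift_det_degree_dcoset)

lemma level_cases:
  assumes "D \<in> level A d"
  obtains h where "D = torus.dcoset h" "h \<in> carrier GLxGL" "torus.weight h \<le> Suc A" "det_degree h = d"
proof -
  obtain h where "D = torus.dcoset h" "h \<in> carrier GLxGL" using assms
    by (auto simp: level_def torus.dcosets_def)
  then show ?thesis using assms that dcoset_in_level_iff by blast
qed

definition shift :: "int \<Rightarrow> ('a::nonarch_local_field_0, 'n::finite) mat2 set \<Rightarrow> ('a, 'n) mat2 set" where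
  "shift j = torus.lift (\<lambda>h. torus.dcoset ((mat 1, Pi_power j) \<otimes>\<^bsub>GLxGL\<^esub> h))"

lemma Pi_power_shift_carrier [simp]: "(mat 1, Pi_power j) \<in> carrier GLxGL"
  by (simp add: carrier_GLxGL_iff invertible_mat invertible_cyclic_mat)

lemma shift_dcoset:
  assumes "h \<in> carrier GLxGL"
  shows "shift j (torus.dcoset h) = torus.dcoset ((mat 1, Pi_power j) \<otimes>\<^bsub>GLxGL\<^esub> h)"
  unfolding shift_def
  by (rule torus.lift_dcoset[OF torus.biinvariant_dcoset_translate[OF Pi_power_shift_carrier
    Pi_power_shift_commute] assms])

lemma weight_Pi_power_shift:
  assumes "h \<in> carrier GLxGL"
  shows "torus.weight ((mat 1, Pi_power j) \<otimes>\<^bsub>GLxGL\<^esub> h) = torus.weight h"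
  using torus.weight_mult[OF Pi_power_shift_carrier Pi_power_shift_commute assms torus.K.one_closed, of j]
    assms by simp

lemma det_degree_Pi_power_shift:
  assumes "h \<in> carrier GLxGL"
  shows "det_degree ((mat 1, Pi_power j) \<otimes>\<^bsub>GLxGL\<^esub> h) = det_degree h + j"
  unfolding det_degree_mult[OF Pi_power_shift_carrier assms]
  by (simp add: det_degree_def val_det_Pi_power val_eq_0)

lemma shift_in_level: "D \<in> level A d \<Longrightarrow> shift j D \<in> level A (d + j)"
  by (elim level_cases) (simp add: shift_dcoset dcoset_in_level_iff weight_Pi_power_shift
    det_degree_Pi_power_shift)

lemma lift_weight_shift: "D \<in> level A d \<Longrightarrow> torus.lift torus.weight (shift j D) = torus.lift torus.weight D"
  by (elim level_cases) (simp add: shift_dcoset lift_weight_dcoset weight_Pi_power_shift)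

lemma shift_minus_shift:
  assumes "D \<in> level A d" "i + j = 0"
  shows "shift i (shift j D) = D"
proof -
  obtain h where h: "D = torus.dcoset h" "h \<in> carrier GLxGL" using assms(1) by (elim level_cases)
  have "(mat 1, Pi_power i) \<otimes>\<^bsub>GLxGL\<^esub> ((mat 1, Pi_power j) \<otimes>\<^bsub>GLxGL\<^esub> h) = h"
    unfolding mult_GLxGL using assms(2) by (simp add: matrix_mul_assoc flip: cyclic_mat_add)
  then show ?thesis using h by (simp add: shift_dcoset)
qed

lemma bij_betw_shift: "bij_betw (shift j) (level A d) (level A (d + j))"
proof (rule bij_betw_byWitness[where f' = "shift (- j)"])
  show "shift (- j) ` level A (d + j) \<subseteq> level A d"
    using shift_in_level[of _ A "d + j" "- j"] by fastforce
qed (auto simp: shift_minus_shift intro: shift_in_level)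

definition level_sum ::
  "nat \<Rightarrow> (('a::nonarch_local_field_0, 'n::finite) mat2 set \<Rightarrow> int) \<Rightarrow> int \<Rightarrow> int" where
  "level_sum A \<Phi> d = (\<Sum>D\<in>level A d. int (torus.lift torus.weight D) * \<Phi> D)"

lemma level_sum_cong: "(\<And>D. D \<in> level A d \<Longrightarrow> \<Phi> D = \<Psi> D) \<Longrightarrow> level_sum A \<Phi> d = level_sum A \<Psi> d"
  unfolding level_sum_def by (intro sum.cong) auto

lemma level_sum_shift: "level_sum A (\<lambda>D. \<Phi> (shift j D)) d = level_sum A \<Phi> (d + j)"
  unfolding level_sum_def
  by (subst sum.reindex_bij_betw[OF bij_betw_shift, symmetric]) (simp add: lift_weight_shift)

lemma level_sum_const:
  "level_sum A (\<lambda>_ :: ('a::nonarch_local_field_0, 'n::finite) mat2 set. a) d =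
      a * level_sum A (\<lambda>_ :: ('a, 'n) mat2 set. 1) 0"
proof -
  have "level_sum A (\<lambda>_ :: ('a, 'n) mat2 set. a) d = a * level_sum A (\<lambda>_ :: ('a, 'n) mat2 set. 1) d"
    by (simp add: level_sum_def sum_distrib_left mult.commute)
  then show ?thesis using level_sum_shift[of A "\<lambda>_ :: ('a, 'n) mat2 set. 1" "- d" d] by simp
qed

lemma sum_eq_sum_level_sum:
  assumes fin: "finite {D \<in> torus.dcosets. \<Phi> D \<noteq> 0}" and I: "finite I" "\<And>D. D \<in> torus.dcosets \<Longrightarrow> \<Phi> D \<noteq> 0 \<Longrightarrow>
      torus.lift det_degree D \<in> I"
  shows "(\<Sum>D | D \<in> torus.dcosets \<and> \<Phi> D \<noteq> 0 \<and> torus.lift torus.weight D \<le> Suc A.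
      int (torus.lift torus.weight D) * \<Phi> D) =
    (\<Sum>d\<in>I. level_sum A \<Phi> d)"
proof -
  let ?S = "{D \<in> torus.dcosets. \<Phi> D \<noteq> 0 \<and> torus.lift torus.weight D \<le> Suc A}"
    and ?f = "\<lambda>D. int (torus.lift torus.weight D) * \<Phi> D"
  have "finite ?S" by (rule finite_subset[OF _ fin]) blast
  moreover have "torus.lift det_degree ` ?S \<subseteq> I" using I(2) by blast
  ultimately have "sum ?f ?S = (\<Sum>d\<in>I. sum ?f {D \<in> ?S. torus.lift det_degree D = d})"
    using I(1) by (intro sum.group [symmetric])
  also have "\<dots> = (\<Sum>d\<in>I. level_sum A \<Phi> d)"
    unfolding level_sum_def
    by (intro sum.cong refl sum.mono_neutral_left) (auto simp: level_def finite_level)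
  finally show ?thesis .
qed

lemma not_prime_dvd_level_sum_1:
  assumes p: "prime p" "absval (of_nat p :: 'a::nonarch_local_field_0) < 1"
  shows "\<not> int p dvd level_sum A (\<lambda>_ :: ('a, 'n::finite) mat2 set. 1) 0"
proof -
  let ?L = "level A 0 :: ('a, 'n) mat2 set set" and ?D1 = "torus.dcoset \<one>\<^bsub>GLxGL\<^esub> :: ('a, 'n) mat2 set"
  let ?w = "\<lambda>D :: ('a, 'n) mat2 set. int (torus.lift torus.weight D)"
  have one: "torus.weight (\<one>\<^bsub>GLxGL\<^esub> :: ('a, 'n) mat2) = 1" "det_degree (\<one>\<^bsub>GLxGL\<^esub> :: ('a, 'n) mat2) = 0"
    using torus.weight_one by (simp_all add: one_GLxGL det_degree_def)
  have D1: "?D1 \<in> ?L" "?w ?D1 = 1" using one by (simp_all add: dcoset_in_level_iff lift_weight_dcoset)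
  have "int p dvd (\<Sum>D\<in>?L - {?D1}. ?w D)"
  proof (rule dvd_sum)
    fix D assume D: "D \<in> ?L - {?D1}"
    then obtain h where h: "D = torus.dcoset h" "h \<in> carrier GLxGL" "det_degree h = 0"
      by (elim DiffE level_cases)
    obtain i where i: "torus.weight h = p ^ i" using torus_weight_prime_power[OF h(2) p] by blast
    have "i \<noteq> 0" using D h i dcoset_eq_dcoset_one[OF h(2) _ h(3)] by (cases i) auto
    then show "int p dvd ?w D" using i h by (simp add: lift_weight_dcoset)
  qed
  moreover have "level_sum A (\<lambda>_ :: ('a, 'n) mat2 set. 1) 0 = 1 + (\<Sum>D\<in>?L - {?D1}. ?w D)"
    unfolding level_sum_def using sum.remove[OF finite_level[folded level_def] D1(1), of ?w] D1(2) by simp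
  ultimately have "int p dvd level_sum A (\<lambda>_ :: ('a, 'n) mat2 set. 1) 0 \<longleftrightarrow> int p dvd 1"
    by (simp only: dvd_add_left_iff)
  then show ?thesis using prime_gt_1_nat[OF p(1)] by simp
qed

section \<open>Comparing consecutive elliptic elements\<close>

definition orbit_value :: "(('a::nonarch_local_field_0, 'n::finite) mat2 \<Rightarrow> 'c) \<Rightarrow> nat \<Rightarrow> ('a, 'n) mat2 set \<Rightarrow> 'c"
    where
  "orbit_value \<psi> k = torus.lift (\<lambda>h. \<psi> (act (inv\<^bsub>GLxGL\<^esub> h) (elliptic_element k)))"

lemma orbit_value_dcoset:
  assumes "\<And>k y. k \<in> GLxGL_O \<Longrightarrow> \<psi> (act k y) = \<psi> y" "h \<in> carrier GLxGL"
  shows "orbit_value \<psi> k (torus.dcoset h) = \<psi> (act (inv\<^bsub>GLxGL\<^esub> h) (elliptic_element k))"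
  unfolding orbit_value_def
  by (rule torus.lift_dcoset[OF biinvariant_orbit_function[OF subgroup_torus stabilizer_elliptic_element
    assms(1)] assms(2)])

lemma finite_orbit_value_nonzero:
  fixes \<psi> :: "('a::nonarch_local_field_0, 'n::finite) mat2 \<Rightarrow> 'c::zero"
  assumes "schwartz_bruhat \<rho> R \<psi>" "\<And>k y. k \<in> GLxGL_O \<Longrightarrow> \<psi> (act k y) = \<psi> y"
  shows "finite {D \<in> torus.dcosets. orbit_value \<psi> k D \<noteq> 0}"
proof (rule finite_subset[OF _ finite_dcosets_pair_entries_le])
  show "{D \<in> torus.dcosets. orbit_value \<psi> k D \<noteq> 0} \<subseteq>
    {D \<in> torus.dcosets. \<exists>h\<in>D. pair_entries_le R (act (inv\<^bsub>GLxGL\<^esub> h) (elliptic_element k :: ('a, 'n) mat2))}"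
  proof
    fix D assume D: "D \<in> {D \<in> torus.dcosets. orbit_value \<psi> k D \<noteq> 0}"
    then obtain h where h: "h \<in> carrier GLxGL" "D = torus.dcoset h" by (auto simp: torus.dcosets_def)
    then have "\<psi> (act (inv\<^bsub>GLxGL\<^esub> h) (elliptic_element k)) \<noteq> 0"
      using D orbit_value_dcoset[of \<psi>, OF assms(2) h(1)] by simp
    then show "D \<in> {D \<in> torus.dcosets. \<exists>h\<in>D. pair_entries_le R (act (inv\<^bsub>GLxGL\<^esub> h) (elliptic_element k))}"
      using D schwartz_bruhat_supp[OF assms(1)] torus.dcoset_self[OF h(1)] h(2) by blast
  qed
qed

definition weighted_sum :: "(('a::nonarch_local_field_0, 'n::finite) mat2 \<Rightarrow> 'c::semiring_1) \<Rightarrow> nat \<Rightarrow> 'c" where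
  "weighted_sum \<psi> k =
    (\<Sum>D | D \<in> torus.dcosets \<and> orbit_value \<psi> k D \<noteq> 0. of_nat (torus.lift torus.weight D) * orbit_value \<psi> k D)"

context
  fixes \<psi> :: "('a::nonarch_local_field_0, 'n::finite) mat2 \<Rightarrow> int" and \<rho> R :: real
  assumes K_invariant: "\<And>k y. k \<in> GLxGL_O \<Longrightarrow> \<psi> (act k y) = \<psi> y"
    and schwartz_bruhat: "schwartz_bruhat \<rho> R \<psi>" and \<rho>_pos: "0 < \<rho>"
begin

lemma value_dcoset:
  "h \<in> carrier GLxGL \<Longrightarrow> orbit_value \<psi> k (torus.dcoset h) = \<psi> (act (inv\<^bsub>GLxGL\<^esub> h) (elliptic_element k))"
  by (intro orbit_value_dcoset K_invariant)

lemma
  shows eq_if_fst_small: "entries_le \<rho> x \<Longrightarrow> \<psi> (x, y) = \<psi> (0, y)"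
    and eq_if_snd_small: "entries_le \<rho> y \<Longrightarrow> \<psi> (x, y) = \<psi> (x, 0)"
  using \<rho>_pos by (auto intro!: schwartz_bruhat_eq[OF schwartz_bruhat] simp: pair_entries_le_def
    entries_le_def)

context
  fixes q :: int and A :: nat and c :: int
  assumes q: "absval (\<pi> :: 'a) powi q \<le> \<rho>"
  defines "c \<equiv> int CARD('n) * (q + 2 * int A)"
begin

lemma
  fixes h :: "('a, 'n) mat2"
  assumes h: "h \<in> carrier GLxGL" "torus.weight h \<le> Suc A"
  shows value_if_degree_large: "c \<le> int CARD('n) * int k + 1 + det_degree h \<Longrightarrow>
      \<psi> (act (inv\<^bsub>GLxGL\<^esub> h) (elliptic_element k)) = \<psi> (0, matrix_inv (snd h) ** fst h)"
    and value_if_degree_small: "c \<le> - det_degree h \<Longrightarrow>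
      \<psi> (act (inv\<^bsub>GLxGL\<^esub> h) (elliptic_element k)) =
          \<psi> (matrix_inv (fst h) ** Pi_power (int CARD('n) * int k + 1) ** snd h, 0)"
    and base_value_if_degree_small: "c \<le> - det_degree h \<Longrightarrow> \<psi> (0, matrix_inv (snd h) ** fst h) = \<psi> (0, 0)"
  using entries_le_act_elliptic_element[OF h, of q k, folded c_def] q
  unfolding act_inv_elliptic_element[OF h(1)] fst_conv snd_conv
  by (blast intro: eq_if_fst_small eq_if_snd_small entries_le_mono)+

lemma level_sum_orbit_value_eq:
  assumes "c \<le> int CARD('n) * int k + 1 + d" "c \<le> int CARD('n) * int k' + 1 + d"
  shows "level_sum A (orbit_value \<psi> k) d = level_sum A (orbit_value \<psi> k') d"
proof (rule level_sum_cong)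
  fix D :: "('a, 'n) mat2 set" assume "D \<in> level A d"
  then obtain h where h: "D = torus.dcoset h" "h \<in> carrier GLxGL" "torus.weight h \<le> Suc A" "det_degree h = d"
    by (rule level_cases)
  show "orbit_value \<psi> k D = orbit_value \<psi> k' D"
    using assms h by (simp add: value_dcoset value_if_degree_large)
qed

lemma level_sum_orbit_value_const:
  assumes "c \<le> int CARD('n) * int k + 1 + d" "c \<le> - d"
  shows "level_sum A (orbit_value \<psi> k) d = \<psi> (0, 0) * level_sum A (\<lambda>_ :: ('a, 'n) mat2 set. 1) 0"
  unfolding level_sum_const[of A "\<psi> (0, 0)" d, symmetric]
proof (rule level_sum_cong)
  fix D :: "('a, 'n) mat2 set" assume "D \<in> level A d"
  then obtain h where h: "D = torus.dcoset h" "h \<in> carrier GLxGL" "torus.weight h \<le> Suc A" "det_degree h = d"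
    by (rule level_cases)
  show "orbit_value \<psi> k D = \<psi> (0, 0)"
    using assms h by (simp add: value_dcoset value_if_degree_large base_value_if_degree_small)
qed

lemma level_sum_orbit_value_Suc:
  assumes "c \<le> - d - int CARD('n)"
  shows "level_sum A (orbit_value \<psi> (Suc k)) d = level_sum A (orbit_value \<psi> k) (d + int CARD('n))"
  unfolding level_sum_shift [symmetric]
proof (rule level_sum_cong)
  fix D :: "('a, 'n) mat2 set" assume "D \<in> level A d"
  then obtain h where h: "D = torus.dcoset h" "h \<in> carrier GLxGL" "torus.weight h \<le> Suc A" "det_degree h = d"
    by (rule level_cases)
  let ?n = "int CARD('n)" and ?g = "(mat 1, Pi_power (int CARD('n))) \<otimes>\<^bsub>GLxGL\<^esub> h"
  have g: "?g \<in> carrier GLxGL" "torus.weight ?g \<le> Suc A" "det_degree ?g = d + ?n"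
    using h by (simp_all add: weight_Pi_power_shift det_degree_Pi_power_shift)
  have "Pi_power (?n * int (Suc k) + 1) = (Pi_power (?n * int k + 1) ** Pi_power ?n :: 'a^'n^'n)"
    by (simp add: algebra_simps flip: cyclic_mat_add)
  then have "matrix_inv (fst ?g) ** Pi_power (?n * int k + 1) ** snd ?g =
      matrix_inv (fst h) ** Pi_power (?n * int (Suc k) + 1) ** snd h"
    by (simp only: mult_GLxGL fst_conv snd_conv matrix_mul_lid matrix_mul_assoc)
  then show "orbit_value \<psi> (Suc k) D = orbit_value \<psi> k (shift ?n D)"
    using assms h g unfolding h(1) shift_dcoset[OF h(2)] value_dcoset[OF h(2)] value_dcoset[OF g(1)]
    by (simp add: value_if_degree_small del: of_nat_Suc)
qed

end

definition bounded_sum :: "nat \<Rightarrow> nat \<Rightarrow> int" where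
  "bounded_sum A k = (\<Sum>D | D \<in> torus.dcosets \<and> orbit_value \<psi> k D \<noteq> 0 \<and> torus.lift torus.weight D \<le> Suc A.
    int (torus.lift torus.weight D) * orbit_value \<psi> k D)"

theorem bounded_sum_difference:
  "\<exists>k. bounded_sum A (Suc k) =
      bounded_sum A k + int CARD('n) * (\<psi> (0, 0) * level_sum A (\<lambda>_ :: ('a, 'n) mat2 set. 1) 0)"
proof -
  let ?n = "int CARD('n)"
  obtain q0 :: nat where "absval (\<pi> :: 'a) ^ q0 < \<rho>"
    using real_arch_pow_inv[OF \<rho>_pos] absval_uniformizer_less_1 by blast
  then have q: "absval (\<pi> :: 'a) powi int q0 \<le> \<rho>" by simp
  define c where "c = ?n * (int q0 + 2 * int A)"
  define k where "k = nat (2 * c)"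
  have c0: "0 \<le> c" unfolding c_def by simp
  then have big: "2 * c \<le> ?n * int k" using mult_right_mono[of 1 ?n "2 * c"] by (simp add: k_def Suc_le_eq)
  note fin = finite_orbit_value_nonzero[OF schwartz_bruhat K_invariant]
  let ?S = "\<lambda>k. {D \<in> torus.dcosets. orbit_value \<psi> k D \<noteq> 0}"
  define M where "M = Max ((\<lambda>D. \<bar>torus.lift det_degree D\<bar>) ` (?S k \<union> ?S (Suc k)))"
  have M: "\<bar>torus.lift det_degree D\<bar> \<le> M" if "D \<in> ?S k \<union> ?S (Suc k)" for D
    unfolding M_def using fin that by (intro Max_ge finite_imageI imageI finite_UnI)
  define u where "u = max c (M + 1)"
  have degree: "torus.lift det_degree D \<in> {- u<..u}" "torus.lift det_degree D \<in> {- u - ?n<..u}"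
    if "D \<in> ?S k \<union> ?S (Suc k)" for D
    using M[OF that] by (auto simp: u_def)
  have "bounded_sum A (Suc k) = (\<Sum>d\<in>{- u - ?n<..u}. level_sum A (orbit_value \<psi> (Suc k)) d)"
    unfolding bounded_sum_def by (intro sum_eq_sum_level_sum fin finite_greaterThanAtMost_int
      degree(2)) simp_all
  also have "\<dots> = (\<Sum>d\<in>{- u<..u}. level_sum A (orbit_value \<psi> k) d) + ?n
      * (\<psi> (0, 0) * level_sum A (\<lambda>_ :: ('a, 'n) mat2 set. 1) 0)"
  proof (rule sum_shifted_interval[where c = "- c", unfolded of_nat_id])
    have Suc: "?n * int (Suc k) = ?n * int k + ?n" by (simp add: algebra_simps)
    show "level_sum A (orbit_value \<psi> (Suc k)) d = level_sum A (orbit_value \<psi> k) d" if "- c < d" for d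
      using that big by (intro level_sum_orbit_value_eq[OF q, of A]) (simp_all add: Suc
        del: of_nat_Suc flip: c_def)
    show "level_sum A (orbit_value \<psi> (Suc k)) d = \<psi> (0, 0) * level_sum A (\<lambda>_ :: ('a, 'n) mat2 set. 1) 0"
      if "- c - ?n < d" "d \<le> - c" for d
      using that big by (intro level_sum_orbit_value_const[OF q, of A]) (simp_all add: Suc
        del: of_nat_Suc flip: c_def)
    show "level_sum A (orbit_value \<psi> (Suc k)) d = level_sum A (orbit_value \<psi> k) (d + ?n)" if "d \<le> - c - ?n"
        for d
      using that by (intro level_sum_orbit_value_Suc[OF q, of A]) (simp flip: c_def)
  qed (use c0 in \<open>simp_all add: u_def\<close>)
  also have "(\<Sum>d\<in>{- u<..u}. level_sum A (orbit_value \<psi> k) d) = bounded_sum A k"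
    unfolding bounded_sum_def
    by (intro sum_eq_sum_level_sum[symmetric] fin finite_greaterThanAtMost_int degree(1)) simp_all
  finally show ?thesis by blast
qed

lemma dvd_weighted_sum_diff_bounded_sum:
  assumes p: "prime p" "absval (of_nat p :: 'a) < 1" and A: "Suc A = p ^ v"
  shows "int (p ^ Suc v) dvd
    weighted_sum \<psi> k - bounded_sum A k"
proof -
  let ?S = "{D \<in> torus.dcosets. orbit_value \<psi> k D \<noteq> 0}"
    and ?f = "\<lambda>D. int (torus.lift torus.weight D) * orbit_value \<psi> k D"
  let ?B = "{D \<in> torus.dcosets. orbit_value \<psi> k D \<noteq> 0 \<and> torus.lift torus.weight D \<le> Suc A}"
  have "weighted_sum \<psi> k - bounded_sum A k = sum ?f (?S - ?B)"
    unfolding weighted_sum_def bounded_sum_def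
      using finite_orbit_value_nonzero[OF schwartz_bruhat K_invariant]
    by (intro sum_diff [symmetric]) auto
  moreover have "int (p ^ Suc v) dvd ?f D" if D: "D \<in> ?S - ?B" for D
  proof -
    obtain h where h: "h \<in> carrier GLxGL" "D = torus.dcoset h" using D by (auto simp: torus.dcosets_def)
    obtain i where i: "torus.weight h = p ^ i" using torus_weight_prime_power[OF h(1) p] by blast
    have "p ^ v < p ^ i" using D h i A by (auto simp: lift_weight_dcoset)
    then have "Suc v \<le> i" using prime_gt_1_nat[OF p(1)] by (simp add: Suc_le_eq)
    then have "p ^ Suc v dvd torus.lift torus.weight D" using h i
      by (simp only: lift_weight_dcoset le_imp_power_dvd)
    then show ?thesis by (intro dvd_mult2) (simp only: of_nat_dvd_iff)
  qed
  ultimately show ?thesis by (simp only: dvd_sum)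
qed

theorem exists_weighted_sum_nonzero:
  assumes "\<psi> (0, 0) \<noteq> 0"
  shows "\<exists>k. weighted_sum \<psi> k \<noteq> 0"
proof (rule ccontr)
  assume "\<not> ?thesis"
  then have zero: "weighted_sum \<psi> k = 0" for k
    by blast
  obtain p where p: "prime p" "absval (of_nat p :: 'a) < 1" using exists_residue_prime by blast
  let ?a = "int CARD('n) * \<psi> (0, 0)"
  define v where "v = nat \<bar>?a\<bar>"
  have p1: "1 < p" using p(1) by (rule prime_gt_1_nat)
  obtain A where A: "Suc A = p ^ v" using p1 by (metis Suc_pred zero_less_power less_trans zero_less_one)
  let ?W = "level_sum A (\<lambda>_ :: ('a, 'n) mat2 set. 1) 0"
  obtain k where k: "bounded_sum A (Suc k) = bounded_sum A k + int CARD('n) * (\<psi> (0, 0) * ?W)"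
    using bounded_sum_difference by blast
  have "int (p ^ Suc v) dvd bounded_sum A i" for i
    using dvd_weighted_sum_diff_bounded_sum[OF p A, of i] unfolding zero by simp
  then have "int (p ^ Suc v) dvd bounded_sum A (Suc k) - bounded_sum A k" by (intro dvd_diff)
  then have "int p ^ Suc v dvd ?a * ?W" unfolding k by (simp add: mult.assoc)
  moreover have "coprime (int p ^ Suc v) ?W"
    using p(1) not_prime_dvd_level_sum_1[OF p, of A, where ?'n = 'n]
    by (intro coprime_power_left_iff[THEN iffD2] disjI1) (auto intro!: prime_imp_coprime)
  ultimately have "int p ^ Suc v dvd ?a" by (simp only: coprime_dvd_mult_left_iff)
  then have "int (p ^ Suc v) \<le> \<bar>?a\<bar>" using assms dvd_imp_le_int[of ?a "int p ^ Suc v"] by simp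
  moreover have "Suc v < p ^ Suc v" using p1 by (intro power_gt_expt) simp
  ultimately show False unfolding v_def by linarith
qed

end

section \<open>Nonvanishing orbital integrals\<close>

lemma integral_rational_functional:
  assumes S: "finite S" and u: "u \<noteq> (0 :: complex)"
  obtains l :: "complex \<Rightarrow> rat" where "Modules.additive l" "l ` S \<subseteq> \<int>" "l u \<noteq> 0"
proof -
  interpret V: vector_space_pair "\<lambda>(q :: rat) (z :: complex). of_rat q * z" "(*) :: rat \<Rightarrow> rat \<Rightarrow> rat"
    by unfold_locales (auto simp: algebra_simps of_rat_add of_rat_mult)
  have "V.vs1.independent {u}" using u by (simp add: V.vs1.dependent_single)
  then obtain l where l: "Vector_Spaces.linear (\<lambda>(q :: rat) (z :: complex). of_rat q * z) (*) l" "l u = 1"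
    using V.linear_independent_extend[of "{u}" "\<lambda>_. 1"] by auto
  then interpret L: Vector_Spaces.linear "\<lambda>(q :: rat) (z :: complex). of_rat q * z" "(*)" l by simp
  define d where "d = (\<Prod>z\<in>S. snd (quotient_of (l z)))"
  have d: "d \<noteq> 0"
    using S less_imp_neq[OF quotient_of_denom_pos', symmetric] by (simp add: d_def)
  have "of_int d * l z \<in> \<int>" if z: "z \<in> S" for z
  proof -
    obtain a b where ab: "quotient_of (l z) = (a, b)" by fastforce
    have "b dvd d" using dvd_prodI[OF S z, of "\<lambda>z. snd (quotient_of (l z))"] ab by (simp add: d_def)
    then obtain e where "d = b * e" by blast
    moreover have "l z = of_int a / of_int b" "b \<noteq> 0"
      using quotient_of_div[OF ab] quotient_of_denom_pos[OF ab] by auto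
    ultimately have "of_int d * l z = of_int (e * a)" by simp
    then show ?thesis by (simp only: Ints_of_int)
  qed
  moreover have "Modules.additive (\<lambda>z. of_int d * l z)" by standard (simp add: L.add algebra_simps)
  ultimately show ?thesis using that[of "\<lambda>z. of_int d * l z"] l(2) d by auto
qed

lemma additive_of_nat_mult:
  fixes l :: "'b::ring_1 \<Rightarrow> 'c::ring_1"
  assumes "Modules.additive l"
  shows "l (of_nat m * x) = of_nat m * l x"
  by (induction m) (simp_all add: Modules.additive.zero[OF assms] Modules.additive.add[OF assms]
    algebra_simps)

lemma torus_coset_measure: "invariant_coset_measure torus \<mu> \<Longrightarrow> GLxGL_compact_coset_measure torus \<mu>"
  by unfold_locales (use subgroup_torus torus_Int_conj_set_GLxGL_O in auto)

lemma additive_weighted_sum: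
  fixes \<phi> :: "('a::nonarch_local_field_0, 'n::finite) mat2 \<Rightarrow> 'b::ring_1" and \<psi> :: "('a, 'n) mat2 \<Rightarrow> int"
    and l :: "'b \<Rightarrow> 'c::ring_char_0"
  assumes l: "Modules.additive l" and \<psi>: "\<And>y. of_int (\<psi> y) = l (\<phi> y)"
    and \<phi>: "schwartz_bruhat \<rho> R \<phi>" "\<And>k y. k \<in> GLxGL_O \<Longrightarrow> \<phi> (act k y) = \<phi> y"
  shows "l (weighted_sum \<phi> k) = of_int (weighted_sum \<psi> k)"
proof -
  have value_eq: "of_int (orbit_value \<psi> k D) = l (orbit_value \<phi> k D)" for D
    unfolding orbit_value_def torus.lift_def \<psi> ..
  have "orbit_value \<psi> k D = 0" if "orbit_value \<phi> k D = 0" for D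
    using value_eq[of D] unfolding that Modules.additive.zero[OF l] by simp
  moreover have "finite {D \<in> torus.dcosets. orbit_value \<phi> k D \<noteq> 0}"
    by (intro finite_orbit_value_nonzero[OF \<phi>(1)] \<phi>(2))
  ultimately have "weighted_sum \<psi> k =
      (\<Sum>D | D \<in> torus.dcosets \<and> orbit_value \<phi> k D \<noteq> 0. int (torus.lift torus.weight D) * orbit_value \<psi> k D)"
    unfolding weighted_sum_def by (intro sum.mono_neutral_left) auto
  then show ?thesis
    by (simp add: weighted_sum_def[of \<phi>] Modules.additive.sum[OF l] additive_of_nat_mult[OF l] flip: value_eq)
qed

lemma Orb_elliptic_element:
  fixes \<phi> :: "('a::nonarch_local_field_0, 'n::finite) mat2 \<Rightarrow> complex"
  assumes \<mu>: "invariant_coset_measure torus \<mu>"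
    and \<phi>: "schwartz_bruhat \<rho> R \<phi>" "\<And>k y. k \<in> GLxGL_O \<Longrightarrow> \<phi> (act k y) = \<phi> y"
  shows "Orb \<mu> \<phi> (elliptic_element k) = 0 \<longleftrightarrow> weighted_sum \<phi> k = 0"
proof -
  interpret GLxGL_compact_coset_measure torus \<mu> using \<mu> by (rule torus_coset_measure)
  show ?thesis
    using Orb_eq_weighted_sum(2)[of "elliptic_element k" \<phi>, OF stabilizer_elliptic_element
        finite_dcosets_pair_entries_le \<phi>(2) schwartz_bruhat_supp[OF \<phi>(1)]]
      measure_cosets_of_GLxGL_O_nonzero by (simp add: weighted_sum_def orbit_value_def)
qed

theorem exists_Orb_nonzero_if_invariant:
  fixes \<phi> :: "('a::nonarch_local_field_0, 'n::finite) mat2 \<Rightarrow> complex"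
  assumes K: "\<And>k y. k \<in> GLxGL_O \<Longrightarrow> \<phi> (act k y) = \<phi> y"
    and \<phi>: "schwartz_bruhat \<rho> R \<phi>" "0 < \<rho>" "\<phi> (0, 0) \<noteq> 0"
  shows "\<exists>k. \<forall>\<mu>. invariant_coset_measure torus \<mu> \<longrightarrow> Orb \<mu> \<phi> (elliptic_element k) \<noteq> 0"
proof -
  obtain l where l: "Modules.additive l" "l ` range \<phi> \<subseteq> \<int>" "l (\<phi> (0, 0)) \<noteq> (0 :: rat)"
    by (rule integral_rational_functional[OF finite_range_schwartz_bruhat[OF \<phi>(1,2)] \<phi>(3)])
  note zero = Modules.additive.zero[OF l(1)]
  define \<psi> where "\<psi> = (\<lambda>y. \<lfloor>l (\<phi> y)\<rfloor>)"
  have \<psi>: "of_int (\<psi> y) = l (\<phi> y)" for y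
  proof -
    have "l (\<phi> y) \<in> \<int>" using l(2) by blast
    then show ?thesis by (auto simp: \<psi>_def elim: Ints_cases)
  qed
  have "\<psi> (act k y) = \<psi> y" if "k \<in> GLxGL_O" for k y unfolding \<psi>_def K[OF that] ..
  moreover have "schwartz_bruhat \<rho> R \<psi>"
    unfolding \<psi>_def by (rule schwartz_bruhat_compose[OF \<phi>(1)]) (simp add: zero)
  moreover have "\<psi> (0, 0) \<noteq> 0" using \<psi>[of "(0, 0)"] l(3) by auto
  ultimately obtain k where k: "weighted_sum \<psi> k \<noteq> 0"
    using exists_weighted_sum_nonzero[of \<psi>, OF _ _ \<phi>(2)] by blast
  have "weighted_sum \<phi> k \<noteq> 0"
  proof
    assume "weighted_sum \<phi> k = 0"
    then have "of_int (weighted_sum \<psi> k) = (0 :: rat)"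
      using additive_weighted_sum[OF l(1) \<psi> \<phi>(1) K, of k] zero by simp
    then show False using k by (simp only: of_int_eq_0_iff)
  qed
  then have "Orb \<mu> \<phi> (elliptic_element k) \<noteq> 0" if "invariant_coset_measure torus \<mu>" for \<mu>
    using Orb_elliptic_element[OF that \<phi>(1) K] by blast
  then show ?thesis by blast
qed

lemma exists_averaging_set:
  fixes \<phi> :: "('a::nonarch_local_field_0, 'n::finite) mat2 \<Rightarrow> 'c::comm_monoid_add"
  assumes \<phi>: "schwartz_bruhat \<rho> R \<phi>" "0 < \<rho>" "1 \<le> R"
  obtains S where "finite S" "S \<noteq> {}" "S \<subseteq> GLxGL_O"
    "\<And>k y. k \<in> GLxGL_O \<Longrightarrow> (\<Sum>s\<in>S. \<phi> (act s (act k y))) = (\<Sum>s\<in>S. \<phi> (act s y))"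
proof -
  define r where "r = min (1 / 2) (\<rho> / R)"
  have r: "0 < r" "r < 1" "r * R \<le> \<rho>" using \<phi>(2,3) by (auto simp: r_def min_def field_simps)
  let ?Q = "congruence_subgroup r :: ('a, 'n) mat2 set" and ?K = "GLxGL_O :: ('a, 'n) mat2 set"
  let ?S = "GLxGL.rcoset_reps ?Q ?K"
  note Q = subgroup_congruence_subgroup[OF less_imp_le[OF r(1)] r(2), where ?'a = 'a and ?'n = 'n]
  have S: "?S \<subseteq> ?K" by (rule GLxGL.rcoset_reps_subset[OF subgroup_GLxGL_O Q
      congruence_subgroup_subset[OF r(2)]])
  have "finite ((\<lambda>x. ?Q #>\<^bsub>GLxGL\<^esub> x) ` ?K)"
    by (rule finite_rcosets_compact[OF open_congruence_subgroup[OF r(1)] Q compact_GLxGL_O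
      subgroup.subset[OF subgroup_GLxGL_O]])
  then have "finite ?S" unfolding GLxGL.rcoset_reps_def by (rule finite_imageI)
  moreover have "?S \<noteq> {}" using subgroup.one_closed[OF subgroup_GLxGL_O] unfolding GLxGL.rcoset_reps_def
    by blast
  moreover have "(\<Sum>s\<in>?S. \<phi> (act s (act k y))) = (\<Sum>s\<in>?S. \<phi> (act s y))" if k: "k \<in> ?K" for k y
  proof -
    have "(\<Sum>s\<in>?S. \<phi> (act s (act k y))) = (\<Sum>s\<in>?S. \<phi> (act (s \<otimes>\<^bsub>GLxGL\<^esub> k) y))"
      using S k GLxGL_O_carrier by (intro sum.cong) (auto simp: act_mult)
    also have "\<dots> = (\<Sum>s\<in>?S. \<phi> (act s y))"
    proof (rule GLxGL.sum_rcoset_reps_translate[OF subgroup_GLxGL_O Q congruence_subgroup_subset[OF r(2)] k])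
      fix q s :: "('a, 'n) mat2" assume q: "q \<in> ?Q" and s: "s \<in> ?K"
      have "act (q \<otimes>\<^bsub>GLxGL\<^esub> s) y = act q (act s y)"
        by (rule act_mult[OF subgroup.mem_carrier[OF Q q] GLxGL_O_carrier[OF s]])
      then show "\<phi> (act (q \<otimes>\<^bsub>GLxGL\<^esub> s) y) = \<phi> (act s y)"
        using schwartz_bruhat_congruence_invariant[OF \<phi>(1) less_imp_le[OF r(1)] r(2,3) q] by simp
    qed
    finally show ?thesis .
  qed
  ultimately show ?thesis using that S by blast
qed

theorem theoremA5:
  fixes \<phi> :: "('a::nonarch_local_field_0, 'n::finite) mat2 \<Rightarrow> complex"
    and \<mu> :: "('a, 'n) mat2 \<Rightarrow> ('a, 'n) mat2 set measure"
  assumes "\<And>x. H_regular_semisimple x \<Longrightarrow>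
      invariant_coset_measure (stabilizer GLxGL act x) (\<mu> x)"
    and "\<phi> \<in> Cc_infinity"
    and "\<phi> (0, 0) \<noteq> 0"
  shows "\<exists>x. H_regular_elliptic x \<and> Orb (\<mu> x) \<phi> x \<noteq> 0"
proof -
  obtain \<rho> R where \<phi>: "0 < \<rho>" "1 \<le> R" "schwartz_bruhat \<rho> R \<phi>"
    using assms(2) by (rule Cc_infinity_schwartz_bruhat)
  obtain S where S: "finite S" "S \<noteq> {}" "S \<subseteq> GLxGL_O"
    and invariant: "\<And>k y. k \<in> GLxGL_O \<Longrightarrow> (\<Sum>s\<in>S. \<phi> (act s (act k y))) = (\<Sum>s\<in>S. \<phi> (act s y))"
    using exists_averaging_set[OF \<phi>(3,1,2)] by blast
  let ?f = "\<lambda>y. \<Sum>s\<in>S. \<phi> (act s y)"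
  have "schwartz_bruhat \<rho> R ?f" using S(3) by (intro schwartz_bruhat_sum schwartz_bruhat_act \<phi>(3)) blast
  moreover have "?f (0, 0) \<noteq> 0" using S assms(3) by (simp add: act_0)
  ultimately obtain k where k: "\<And>\<mu>. invariant_coset_measure torus \<mu> \<Longrightarrow> Orb \<mu> ?f (elliptic_element k) \<noteq> 0"
    using exists_Orb_nonzero_if_invariant[of ?f, OF invariant _ \<phi>(1)] by blast
  let ?x = "elliptic_element k :: ('a, 'n) mat2"
  have elliptic: "H_regular_elliptic ?x" by (rule H_regular_elliptic_elliptic_element)
  then have \<mu>: "invariant_coset_measure torus (\<mu> ?x)"
    using assms(1)[of ?x] by (simp add: H_regular_elliptic_def stabilizer_elliptic_element)
  then interpret GLxGL_compact_coset_measure torus "\<mu> ?x" by (rule torus_coset_measure)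
  have "Orb (\<mu> ?x) ?f ?x = of_nat (card S) * Orb (\<mu> ?x) \<phi> ?x"
    by (rule Orb_sum_act[OF stabilizer_elliptic_element finite_dcosets_pair_entries_le \<phi>(3,1,2) S(3)])
  then show ?thesis using elliptic k[OF \<mu>] by (intro exI[of _ ?x]) auto
qed

end
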